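(* Let $k\geq2$ be an integer and $s\geq0$. On $X^s_{\mathrm{sym}}$ the unstable spectrum is $$\sigma(\mathscr{L}_k)\cap\{\operatorname{Re}z>0\}=\{\lambda_{k,n}:1\leq n<k\}.$$ Each $\lambda_{k,n}$ is algebraically simple within its transverse block. The leading space $\mathcal{E}_k$ is finite-dimensional, $\gamma_k>0$, and the Riesz projection $P_k$ associated with the spectral point $\Lambda_k$ is bounded on every $X^s_{\mathrm{sym}}$. Its range and the action of $\mathscr{L}_k$ on it are $$\operatorname{Ran}P_k=\mathcal{E}_k,\qquad \mathscr{L}_kP_k=\Lambda_kP_k,\qquad \dim_{\mathbb{C}}\mathcal{E}_k=\#\{n\in\{1,\ldots,k-1\}:\lambda_{k,n}=\Lambda_k\}.$$ More precisely, $$\sigma\bigl(\mathscr{L}_k|_{(I-P_k)X^s_{\mathrm{sym}}}\bigr)\subset\{z\in\mathbb{C}:\operatorname{Re}z\leq\Lambda_{k,2}\}.$$ For every $\eta>0$ there is a constant $C_{s,\eta}$ such that $$\|e^{t\mathscr{L}_k}(I-P_k)\|_{X^s_{\mathrm{sym}}\to X^s_{\mathrm{sym}}}\leq C_{s,\eta}e^{(\Lambda_{k,2}+\eta)t},\qquad t\geq0.$$ In particular, there is a constant $C_s$ such that $$\|e^{t\mathscr{L}_k}\|_{X^s_{\mathrm{sym}}\to X^s_{\mathrm{sym}}}\leq C_se^{\Lambda_kt},\qquad t\geq0.$$ The spectral point $\Lambda_k$ is algebraically simple on the full symmetry class $X^s_{\mathrm{sym}}$ if and only if exactly one integer $n_\ast\in\{1,\dots,k-1\}$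 attains the maximum $\Lambda_k=\max_{1\leq n<k}\lambda_{k,n}$. In that case $\mathcal{E}_k$ is one-dimensional in the real symmetry class, and the real eigenfunction $(\omega_{k,n_\ast},F_{k,n_\ast})$ is a fastest-growing eigenfunction in this symmetry class.
   Context: On $\mathbb{T}^2=(\mathbb{R}/2\pi\mathbb{Z})^2$, for $s\geq0$ let $X^s=H^{s-1}_0(\mathbb{T}^2;\mathbb{C})\times H^s(\mathbb{T}^2;\mathbb{C})\ni(\omega,F)$ (subscript $0$: mean zero), and let $$\mathscr{L}_k=-k\cos(kx_1)\,\partial_{x_2}\begin{pmatrix}0 & A_k \\ B_k & 0\end{pmatrix},\qquad A_k=I-(1+k^2)(1-\Delta)^{-1},\quad B_k=-(1+k^2)\Delta^{-1},$$ a bounded operator on each $X^s$. Symmetry class: $X^s_{\mathrm{sym}}$ is the closed $\mathscr{L}_k$-invariant subspace of $(\omega,F)\in X^s$ that are $2\pi/k$-periodic in $x_1$ and satisfy $\omega(\pi/k-x_1,x_2)=-\omega(x_1,x_2)$, $F(\pi/k-x_1,x_2)=F(x_1,x_2)$, $\omega(x_1,-x_2)=-\omega(x_1,x_2)$, $F(x_1,-x_2)=F(x_1,x_2)$. Its transverse block of frequency $n\geq1$ consists of its elements of the form $\omega=h(x_1)\sin(nx_2)$, $F=f(x_1)\cos(nx_2)$. Within it, the cosine chain is the invariant subspace with $f\in\overline{\operatorname{span}}\{\cos(2jkx_1):j\geq0\}$, $h\in\overline{\operatorname{span}}\{\cos((2j+1)kx_1):j\geq0\}$. For $1\leq n<k$,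 $\lambda_{k,n}$ denotes the unique positive eigenvalue of $\mathscr{L}_k$ on the cosine chain of frequency $n$. Real eigenfunction: let $A_{k,n},B_{k,n}$ be the Fourier multipliers in $x_1$ with symbols $\frac{m^2+n^2-k^2}{m^2+n^2+1}$ and $\frac{1+k^2}{m^2+n^2}$ ($m\in\mathbb{Z}$), $C_k$ multiplication by $\cos(kx_1)$, $D_{k,n}=C_kB_{k,n}C_k$, $K_{k,n}=D_{k,n}^{1/2}A_{k,n}D_{k,n}^{1/2}$ on $L^2(\mathbb{R}/2\pi\mathbb{Z})$. Let $-\nu_{k,n}$ be the unique negative eigenvalue of the restriction of $K_{k,n}$ to $\overline{\operatorname{span}}\{\cos(2jkx_1):j\geq0\}$, with real eigenfunction $g_{k,n}$, and $f_{k,n}=D_{k,n}^{1/2}g_{k,n}$. Then $\lambda_{k,n}=nk\sqrt{\nu_{k,n}}$ and $$F_{k,n}=f_{k,n}(x_1)\cos(nx_2),\qquad \omega_{k,n}=\frac{nk}{\lambda_{k,n}}C_kA_{k,n}f_{k,n}(x_1)\sin(nx_2).$$ Leading rate and gap: $\Lambda_k=\max_{1\leq n<k}\lambda_{k,n}$; $\mathcal{E}_k$ is the direct sum of the eigenspaces (in $X^s_{\mathrm{sym}}$) of the branches $n$ attaining $\Lambda_k$; $\Lambda_{k,2}=\max(\{\lambda_{k,n}:\lambda_{k,n}<\Lambda_k\}\cup\{0\})$; $\gamma_k=\Lambda_k-\Lambda_{k,2}$. The Riesz projection is $P_k=\frac{1}{2\pi\mathrm{i}}\int_{|z-\Lambda_k|=r}(z-\mathscr{L}_k)^{-1}dz$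 on $X^s_{\mathrm{sym}}$, with $r>0$ so small that the closed disk $|z-\Lambda_k|\leq r$ contains no other spectral point. *)

theory Defs
  imports "HOL-Complex_Analysis.Complex_Analysis" "HOL-Library.Function_Algebras"
begin

section \<open>Complex vector spaces\<close>

class complex_vs = ab_group_add +
  fixes scaleC :: "complex \<Rightarrow> 'a \<Rightarrow> 'a"  (infixr "*\<^sub>C" 75)
  assumes scaleC_add_right: "c *\<^sub>C (x + y) = c *\<^sub>C x + c *\<^sub>C y"
    and scaleC_add_left: "(c + d) *\<^sub>C x = c *\<^sub>C x + d *\<^sub>C x"
    and scaleC_scaleC: "c *\<^sub>C d *\<^sub>C x = (c * d) *\<^sub>C x"
    and scaleC_one: "1 *\<^sub>C x = x"

instantiation complex :: complex_vs
begin
definition "c *\<^sub>C (x::complex) = c * x"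
instance by standard (simp_all add: scaleC_complex_def algebra_simps)
end

instantiation "fun" :: (type, complex_vs) complex_vs
begin
definition "c *\<^sub>C u = (\<lambda>i. c *\<^sub>C u i)"
instance
  by standard (simp_all add: scaleC_fun_def fun_eq_iff scaleC_add_right scaleC_add_left
      scaleC_scaleC scaleC_one)
end

instantiation prod :: (complex_vs, complex_vs) complex_vs
begin
definition "c *\<^sub>C p = (c *\<^sub>C fst p, c *\<^sub>C snd p)"
instance
  by standard (simp_all add: scaleC_prod_def prod_eq_iff scaleC_add_right scaleC_add_left
      scaleC_scaleC scaleC_one)
end

lemma vector_space_scaleC: "vector_space (scaleC :: complex \<Rightarrow> 'a::complex_vs \<Rightarrow> 'a)"
  by unfold_locales (simp_all add: scaleC_add_right scaleC_add_left scaleC_scaleC scaleC_one)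

lemma vector_space_scaleC_real:
  "vector_space (\<lambda>r::real. scaleC (complex_of_real r) :: 'a::complex_vs \<Rightarrow> 'a)"
  by unfold_locales (simp_all add: scaleC_add_right scaleC_add_left scaleC_scaleC scaleC_one)

abbreviation cspan :: "'a::complex_vs set \<Rightarrow> 'a set"
  where "cspan \<equiv> module.span scaleC"

abbreviation cdim :: "'a::complex_vs set \<Rightarrow> nat"
  where "cdim \<equiv> vector_space.dim scaleC"

abbreviation rdim :: "'a::complex_vs set \<Rightarrow> nat"
  where "rdim \<equiv> vector_space.dim (\<lambda>r::real. scaleC (complex_of_real r))"

section \<open>Bounded operators, spectrum, Riesz projections\<close>

text \<open>A normed space is given by a linear subspace \<open>V\<close> of the ambient type together with a norm
  \<open>N\<close> on it; an operator on it is a function whose values off \<open>V\<close> are irrelevant.\<close>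

definition linear_on :: "'a::complex_vs set \<Rightarrow> ('a \<Rightarrow> 'b::complex_vs) \<Rightarrow> bool" where
  "linear_on V T \<longleftrightarrow>
     (\<forall>u\<in>V. \<forall>v\<in>V. T (u + v) = T u + T v) \<and> (\<forall>c. \<forall>u\<in>V. T (c *\<^sub>C u) = c *\<^sub>C T u)"

definition bounded_op :: "('a::complex_vs \<Rightarrow> real) \<Rightarrow> 'a set \<Rightarrow> ('a \<Rightarrow> 'a) \<Rightarrow> bool" where
  "bounded_op N V T \<longleftrightarrow>
     (\<forall>u\<in>V. T u \<in> V) \<and> linear_on V T \<and> (\<exists>C. \<forall>u\<in>V. N (T u) \<le> C * N u)"

definition dual_space :: "('a::complex_vs \<Rightarrow> real) \<Rightarrow> 'a set \<Rightarrow> ('a \<Rightarrow> complex) set" where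
  "dual_space N V = {\<phi>. linear_on V \<phi> \<and> (\<exists>C. \<forall>u\<in>V. cmod (\<phi> u) \<le> C * N u)}"

definition closed_span :: "('a::complex_vs \<Rightarrow> real) \<Rightarrow> 'a set \<Rightarrow> 'a set \<Rightarrow> 'a set" where
  "closed_span N V S = {u\<in>V. \<forall>e>0. \<exists>v\<in>cspan S. N (u - v) < e}"

definition eigenspace :: "'a::complex_vs set \<Rightarrow> ('a \<Rightarrow> 'a) \<Rightarrow> complex \<Rightarrow> 'a set" where
  "eigenspace V T z = {u\<in>V. T u = z *\<^sub>C u}"

definition eigenvalue :: "'a::complex_vs set \<Rightarrow> ('a \<Rightarrow> 'a) \<Rightarrow> complex \<Rightarrow> bool" where
  "eigenvalue V T z \<longleftrightarrow> (\<exists>u\<in>eigenspace V T z. u \<noteq> 0)"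

definition resolvent :: "'a::complex_vs set \<Rightarrow> ('a \<Rightarrow> 'a) \<Rightarrow> complex \<Rightarrow> 'a \<Rightarrow> 'a" where
  "resolvent V T z = inv_into V (\<lambda>u. z *\<^sub>C u - T u)"

definition spectrum :: "('a::complex_vs \<Rightarrow> real) \<Rightarrow> 'a set \<Rightarrow> ('a \<Rightarrow> 'a) \<Rightarrow> complex set" where
  "spectrum N V T =
     - {z. bij_betw (\<lambda>u. z *\<^sub>C u - T u) V V \<and> bounded_op N V (resolvent V T z)}"

definition isolating_radius ::
  "('a::complex_vs \<Rightarrow> real) \<Rightarrow> 'a set \<Rightarrow> ('a \<Rightarrow> 'a) \<Rightarrow> complex \<Rightarrow> real \<Rightarrow> bool" where
  "isolating_radius N V T z0 r \<longleftrightarrow> r > 0 \<and> spectrum N V T \<inter> cball z0 r = {z0}"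

text \<open>The integral \<open>1/(2\<pi>\<i>) \<integral> (z - T)\<^sup>-\<^sup>1 u dz\<close> over the circle of radius \<open>r\<close> about \<open>z0\<close> is the
  vector \<open>v \<in> V\<close> whose image under every bounded functional \<open>\<phi>\<close> is the corresponding scalar
  integral. It is required for every isolating radius \<open>r\<close>, so the projection carries no \<open>r\<close>;
  the definition is meaningful only if there is one.\<close>

definition riesz_projection ::
  "('a::complex_vs \<Rightarrow> real) \<Rightarrow> 'a set \<Rightarrow> ('a \<Rightarrow> 'a) \<Rightarrow> complex \<Rightarrow> 'a \<Rightarrow> 'a" where
  "riesz_projection N V T z0 u =
     (THE v. v \<in> V \<and>
        (\<forall>r. isolating_radius N V T z0 r \<longrightarrow>
          (\<forall>\<phi>\<in>dual_space N V.
            ((\<lambda>z. \<phi> (resolvent V T z u)) has_contour_integral (2 * of_real pi * \<i> * \<phi> v))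
              (circlepath z0 r))))"

definition algebraically_simple ::
  "('a::complex_vs \<Rightarrow> real) \<Rightarrow> 'a set \<Rightarrow> ('a \<Rightarrow> 'a) \<Rightarrow> complex \<Rightarrow> bool" where
  "algebraically_simple N V T z0 \<longleftrightarrow>
     (\<exists>r. isolating_radius N V T z0 r) \<and> cdim (riesz_projection N V T z0 ` V) = 1"

text \<open>\<open>e\<^sup>t\<^sup>T u\<close>, the \<open>N\<close>-limit of the exponential series.\<close>

definition op_exp ::
  "('a::complex_vs \<Rightarrow> real) \<Rightarrow> 'a set \<Rightarrow> ('a \<Rightarrow> 'a) \<Rightarrow> real \<Rightarrow> 'a \<Rightarrow> 'a" where
  "op_exp N V T t u =
     (THE v. v \<in> V \<and>
        (\<lambda>M. N ((\<Sum>j<M. complex_of_real (t ^ j / fact j) *\<^sub>C (T ^^ j) u) - v)) \<longlonglongrightarrow> 0)"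

section \<open>Periodic distributions and Sobolev spaces\<close>

text \<open>A distribution on the torus (in one or two variables) is represented by its family of
  Fourier coefficients: \<open>c\<close> stands for \<open>\<Sum>m. c m exp (\<i> m x)\<close>, respectively
  \<open>c\<close> for \<open>\<Sum>m1 m2. c (m1, m2) exp (\<i> (m1 x1 + m2 x2))\<close>. This covers the negative
  Sobolev order \<open>s - 1\<close> for \<open>s < 1\<close>.\<close>

type_synonym dist1 = "int \<Rightarrow> complex"
type_synonym dist2 = "int \<times> int \<Rightarrow> complex"
type_synonym state = "dist2 \<times> dist2"

definition fourier :: "(real \<Rightarrow> real) \<Rightarrow> dist1" where
  "fourier \<phi> m =
     integral {0..2*pi} (\<lambda>x. complex_of_real (\<phi> x) * cis (- (of_int m * x))) / of_real (2*pi)"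

definition tensor :: "dist1 \<Rightarrow> dist1 \<Rightarrow> dist2"  (infix "\<otimes>\<^sub>D" 70) where
  "(h \<otimes>\<^sub>D g) = (\<lambda>(m1, m2). h m1 * g m2)"

definition sobolev1 :: "real \<Rightarrow> dist1 set" where
  "sobolev1 \<sigma> = {c. (\<lambda>m. (1 + (of_int m)\<^sup>2) powr \<sigma> * (cmod (c m))\<^sup>2) summable_on UNIV}"

definition norm1 :: "real \<Rightarrow> dist1 \<Rightarrow> real" where
  "norm1 \<sigma> c = sqrt (\<Sum>\<^sub>\<infinity>m. (1 + (of_int m)\<^sup>2) powr \<sigma> * (cmod (c m))\<^sup>2)"

definition msq :: "int \<times> int \<Rightarrow> real" where
  "msq m = (of_int (fst m))\<^sup>2 + (of_int (snd m))\<^sup>2"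

definition sobolev2 :: "real \<Rightarrow> dist2 set" where
  "sobolev2 \<sigma> = {c. (\<lambda>m. (1 + msq m) powr \<sigma> * (cmod (c m))\<^sup>2) summable_on UNIV}"

definition norm2 :: "real \<Rightarrow> dist2 \<Rightarrow> real" where
  "norm2 \<sigma> c = sqrt (\<Sum>\<^sub>\<infinity>m. (1 + msq m) powr \<sigma> * (cmod (c m))\<^sup>2)"

definition Xs :: "real \<Rightarrow> state set" where
  "Xs s = {(\<omega>, F). \<omega> \<in> sobolev2 (s - 1) \<and> \<omega> (0, 0) = 0 \<and> F \<in> sobolev2 s}"

definition Xnorm :: "real \<Rightarrow> state \<Rightarrow> real" where
  "Xnorm s = (\<lambda>(\<omega>, F). sqrt ((norm2 (s - 1) \<omega>)\<^sup>2 + (norm2 s F)\<^sup>2))"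

section \<open>The operator\<close>

definition multiplier :: "('i \<Rightarrow> complex) \<Rightarrow> ('i \<Rightarrow> complex) \<Rightarrow> 'i \<Rightarrow> complex" where
  "multiplier p c = (\<lambda>m. p m * c m)"

definition d2 :: "dist2 \<Rightarrow> dist2" where
  "d2 = multiplier (\<lambda>m. \<i> * of_int (snd m))"

text \<open>Multiplication by \<open>cos (k x1) = (exp (\<i> k x1) + exp (- \<i> k x1)) / 2\<close>.\<close>

definition cos_mult2 :: "nat \<Rightarrow> dist2 \<Rightarrow> dist2" where
  "cos_mult2 k c = (\<lambda>(m1, m2). (c (m1 - int k, m2) + c (m1 + int k, m2)) / 2)"

definition A_op :: "nat \<Rightarrow> dist2 \<Rightarrow> dist2" where
  "A_op k = multiplier (\<lambda>m. of_real (1 - (1 + (real k)\<^sup>2) / (1 + msq m)))"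

text \<open>The Laplacian has symbol \<open>- msq\<close>; its inverse acts on mean-zero distributions, and at
  \<open>m = (0, 0)\<close> the symbol below is \<open>0\<close> by the convention \<open>x / 0 = 0\<close>.\<close>

definition B_op :: "nat \<Rightarrow> dist2 \<Rightarrow> dist2" where
  "B_op k = multiplier (\<lambda>m. of_real ((1 + (real k)\<^sup>2) / msq m))"

definition L_op :: "nat \<Rightarrow> state \<Rightarrow> state" where
  "L_op k = (\<lambda>(\<omega>, F).
     (- of_nat k *\<^sub>C cos_mult2 k (d2 (A_op k F)), - of_nat k *\<^sub>C cos_mult2 k (d2 (B_op k \<omega>))))"

section \<open>Symmetry class, transverse blocks and cosine chains\<close>

text \<open>Fourier coefficients of \<open>u (x1 + a, x2)\<close>, \<open>u (a - x1, x2)\<close> and \<open>u (x1, - x2)\<close>.\<close>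

definition translate1 :: "real \<Rightarrow> dist2 \<Rightarrow> dist2" where
  "translate1 a u = (\<lambda>(m1, m2). cis (of_int m1 * a) * u (m1, m2))"

definition reflect1 :: "real \<Rightarrow> dist2 \<Rightarrow> dist2" where
  "reflect1 a u = (\<lambda>(m1, m2). cis (- (of_int m1 * a)) * u (- m1, m2))"

definition reflect2 :: "dist2 \<Rightarrow> dist2" where
  "reflect2 u = (\<lambda>(m1, m2). u (m1, - m2))"

definition Xsym :: "real \<Rightarrow> nat \<Rightarrow> state set" where
  "Xsym s k = {(\<omega>, F). (\<omega>, F) \<in> Xs s
     \<and> translate1 (2 * pi / real k) \<omega> = \<omega> \<and> translate1 (2 * pi / real k) F = F
     \<and> reflect1 (pi / real k) \<omega> = - \<omega> \<and> reflect1 (pi / real k) F = F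
     \<and> reflect2 \<omega> = - \<omega> \<and> reflect2 F = F}"

definition block :: "real \<Rightarrow> nat \<Rightarrow> nat \<Rightarrow> state set" where
  "block s k n = {u \<in> Xsym s k. \<exists>h f.
     u = (h \<otimes>\<^sub>D fourier (\<lambda>x. sin (real n * x)), f \<otimes>\<^sub>D fourier (\<lambda>x. cos (real n * x)))}"

definition cos_even :: "nat \<Rightarrow> dist1 set" where
  "cos_even k = {fourier (\<lambda>x. cos (real (2 * j * k) * x)) | j. True}"

definition cos_odd :: "nat \<Rightarrow> dist1 set" where
  "cos_odd k = {fourier (\<lambda>x. cos (real ((2 * j + 1) * k) * x)) | j. True}"

definition cosine_chain :: "real \<Rightarrow> nat \<Rightarrow> nat \<Rightarrow> state set" where
  "cosine_chain s k n = {u \<in> block s k n. \<exists>h f.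
     u = (h \<otimes>\<^sub>D fourier (\<lambda>x. sin (real n * x)), f \<otimes>\<^sub>D fourier (\<lambda>x. cos (real n * x)))
     \<and> f \<in> closed_span (norm1 s) (sobolev1 s) (cos_even k)
     \<and> h \<in> closed_span (norm1 (s - 1)) (sobolev1 (s - 1)) (cos_odd k)}"

text \<open>The chain depends on \<open>s\<close>, its positive eigenvalue does not.\<close>

definition lam :: "nat \<Rightarrow> nat \<Rightarrow> real" where
  "lam k n = (THE l. \<forall>s\<ge>0.
     {x::real. x > 0 \<and> eigenvalue (cosine_chain s k n) (L_op k) (of_real x)} = {l})"

section \<open>The real eigenfunctions\<close>

definition L2 :: "dist1 set" where
  "L2 = {c. (\<lambda>m. (cmod (c m))\<^sup>2) summable_on UNIV}"

definition L2_norm :: "dist1 \<Rightarrow> real" where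
  "L2_norm c = sqrt (\<Sum>\<^sub>\<infinity>m. (cmod (c m))\<^sup>2)"

definition L2_inner :: "dist1 \<Rightarrow> dist1 \<Rightarrow> complex" where
  "L2_inner c d = (\<Sum>\<^sub>\<infinity>m. c m * cnj (d m))"

definition positive_op :: "(dist1 \<Rightarrow> dist1) \<Rightarrow> bool" where
  "positive_op T \<longleftrightarrow> bounded_op L2_norm L2 T
     \<and> (\<forall>c\<in>L2. \<forall>d\<in>L2. L2_inner (T c) d = L2_inner c (T d))
     \<and> (\<forall>c\<in>L2. Re (L2_inner (T c) c) \<ge> 0)"

text \<open>The positive square root; the value off \<open>L2\<close> is fixed for uniqueness as a HOL function.\<close>

definition sqrt_op :: "(dist1 \<Rightarrow> dist1) \<Rightarrow> dist1 \<Rightarrow> dist1" where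
  "sqrt_op T = (THE S. positive_op S \<and> (\<forall>c\<in>L2. S (S c) = T c) \<and> (\<forall>c. c \<notin> L2 \<longrightarrow> S c = 0))"

definition cos_mult1 :: "nat \<Rightarrow> dist1 \<Rightarrow> dist1" where
  "cos_mult1 k c = (\<lambda>m. (c (m - int k) + c (m + int k)) / 2)"

definition A1 :: "nat \<Rightarrow> nat \<Rightarrow> dist1 \<Rightarrow> dist1" where
  "A1 k n = multiplier (\<lambda>m. of_real
     (((of_int m)\<^sup>2 + (real n)\<^sup>2 - (real k)\<^sup>2) / ((of_int m)\<^sup>2 + (real n)\<^sup>2 + 1)))"

definition B1 :: "nat \<Rightarrow> nat \<Rightarrow> dist1 \<Rightarrow> dist1" where
  "B1 k n = multiplier (\<lambda>m. of_real ((1 + (real k)\<^sup>2) / ((of_int m)\<^sup>2 + (real n)\<^sup>2)))"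

definition D1 :: "nat \<Rightarrow> nat \<Rightarrow> dist1 \<Rightarrow> dist1" where
  "D1 k n = cos_mult1 k \<circ> B1 k n \<circ> cos_mult1 k"

definition K1 :: "nat \<Rightarrow> nat \<Rightarrow> dist1 \<Rightarrow> dist1" where
  "K1 k n = sqrt_op (D1 k n) \<circ> A1 k n \<circ> sqrt_op (D1 k n)"

definition L2_even :: "nat \<Rightarrow> dist1 set" where
  "L2_even k = closed_span L2_norm L2 (cos_even k)"

definition nu :: "nat \<Rightarrow> nat \<Rightarrow> real" where
  "nu k n = (THE \<nu>. \<nu> > 0 \<and> eigenvalue (L2_even k) (K1 k n) (of_real (- \<nu>)))"

text \<open>A distribution is real iff its coefficients are Hermitian.\<close>

definition real_dist1 :: "dist1 set" where
  "real_dist1 = {c. \<forall>m. c (- m) = cnj (c m)}"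

definition real_states :: "state set" where
  "real_states = {(\<omega>, F). \<forall>m1 m2.
     \<omega> (- m1, - m2) = cnj (\<omega> (m1, m2)) \<and> F (- m1, - m2) = cnj (F (m1, m2))}"

text \<open>The admissible \<open>g\<close>; they are unique only up to a nonzero real factor.\<close>

definition ground_state :: "nat \<Rightarrow> nat \<Rightarrow> dist1 \<Rightarrow> bool" where
  "ground_state k n g \<longleftrightarrow>
     g \<in> eigenspace (L2_even k) (K1 k n) (of_real (- nu k n)) \<and> g \<noteq> 0 \<and> g \<in> real_dist1"

definition real_eigenfunction :: "nat \<Rightarrow> nat \<Rightarrow> dist1 \<Rightarrow> state" where
  "real_eigenfunction k n g =
     (let f = sqrt_op (D1 k n) g in
      ((of_real (real n * real k / lam k n) *\<^sub>C cos_mult1 k (A1 k n f))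
          \<otimes>\<^sub>D fourier (\<lambda>x. sin (real n * x)),
       f \<otimes>\<^sub>D fourier (\<lambda>x. cos (real n * x))))"

section \<open>Leading rate, gap and leading space\<close>

definition Lam :: "nat \<Rightarrow> real" where
  "Lam k = Max (lam k ` {1..<k})"

definition Lam2 :: "nat \<Rightarrow> real" where
  "Lam2 k = Max ({l \<in> lam k ` {1..<k}. l < Lam k} \<union> {0})"

definition gap :: "nat \<Rightarrow> real" where
  "gap k = Lam k - Lam2 k"

text \<open>The sum is direct since distinct blocks have disjoint Fourier supports.\<close>

definition leading_space :: "real \<Rightarrow> nat \<Rightarrow> state set" where
  "leading_space s k =
     cspan (\<Union>n\<in>{n\<in>{1..<k}. lam k n = Lam k}.
              eigenspace (block s k n) (L_op k) (of_real (lam k n)))"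

abbreviation P_op :: "real \<Rightarrow> nat \<Rightarrow> state \<Rightarrow> state" where
  "P_op s k \<equiv> riesz_projection (Xnorm s) (Xsym s k) (L_op k) (of_real (Lam k))"

definition fastest_growing_eigenfunction ::
  "'a::complex_vs set \<Rightarrow> ('a \<Rightarrow> 'a) \<Rightarrow> complex \<Rightarrow> 'a \<Rightarrow> bool" where
  "fastest_growing_eigenfunction V T z u \<longleftrightarrow>
     u \<in> eigenspace V T z \<and> u \<noteq> 0 \<and> (\<forall>w. eigenvalue V T w \<longrightarrow> Re w \<le> Re z)"

end

theory Submission
  imports Defs
begin

text \<open>In a transverse block with \<open>1 \<le> n < k\<close> the growing modes of the cosine chain solve a three-term
  recursion, and a positive solution (up to a periodic pattern of signs) is found by a connectedness
  argument in the growth rate. The operator conserves the indefinite form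
  \<open>\<langle>B \<omega>, \<omega>\<rangle> + \<langle>A F, F\<rangle>\<close>. Within the symmetry class its restriction to the frequencies with
  \<open>0 < |m2| < k\<close> has exactly one negative direction for each \<open>n = |m2|\<close>, so it is nonnegative on the common
  kernel \<open>V\<close> of the functionals dual to the modes of rates \<open>\<lambda>\<close> and \<open>- \<lambda>\<close>. There it controls the finitely many
  of these frequencies where \<open>A < 0\<close>, and adding a large multiple of it to a positive form with slowly varying
  weights gives an equivalent norm on \<open>V\<close> for which the operator is dissipative up to any given
  \<open>\<epsilon> > 0\<close>. Hence \<open>V\<close> contributes no spectrum in \<open>Re z > 0\<close> and no growth faster than \<open>exp (\<epsilon> t)\<close>,
  and all unstable spectrum comes from the finite-dimensional span of the modes. A ground state \<open>g\<close> of
  \<open>D\<^sup>1\<^sup>/\<^sup>2 A D\<^sup>1\<^sup>/\<^sup>2\<close> with eigenvalue \<open>- \<nu>\<close> yields \<open>f = D\<^sup>1\<^sup>/\<^sup>2 g\<close> with \<open>D A f = - \<nu> f\<close>, that is, an eigenvector of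
  the block with positive eigenvalue \<open>n k sqrt \<nu>\<close>, which must be the mode.\<close>

section \<open>Operators on complete normed subspaces\<close>

text \<open>At order \<open>s = 0\<close> the conserved form is comparable with the norm at high
  frequencies. For \<open>s > 0\<close> it needs additional weights growing with \<open>msq\<close>,
  which do not commute with multiplication by cos (k x1); the error has relative size k / |m| and is
  small only far out. Replacing \<open>1 + msq\<close> by \<open>R + msq\<close> makes it small
  everywhere except at the finitely many frequencies coupled to A < 0, and those are left to the
  conserved form. The zero of A at m1 = 0, |m2| = k belongs to neither regime and gets a small
  weight of its own. Both rates must be split off because a growing mode is a null vector of the
  form: only with its decaying partner does it span the negative direction. The equivalent norm
  depends on \<epsilon>, hence the loss \<open>\<eta>\<close> next to \<open>Lam2 k\<close>, which
  can be 0, and no loss next to \<open>Lam k > 0\<close>. The Riesz integral is evaluated, not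
  estimated: the resolvent is an explicit simple pole plus a part regular at \<open>Lam k\<close>.
  The modes decay faster than every power, so one family serves all orders \<open>s\<close>.\<close>

interpretation cvs: vector_space "scaleC :: complex \<Rightarrow> 'a::complex_vs \<Rightarrow> 'a"
  by (rule vector_space_scaleC)

text \<open>Completeness is stated for absolutely convergent series, the form in which Neumann and
  exponential series use it. The field \<open>separating\<close> stands in for the Hahn-Banach
  theorem; in the concrete spaces the Fourier coefficients separate points.\<close>

locale nspace =
  fixes V :: "'a::complex_vs set" and N :: "'a \<Rightarrow> real"
  assumes subspace: "cvs.subspace V"
    and N_nonneg: "u \<in> V \<Longrightarrow> 0 \<le> N u"
    and N_scale: "u \<in> V \<Longrightarrow> N (c *\<^sub>C u) = cmod c * N u"
    and N_triangle: "u \<in> V \<Longrightarrow> v \<in> V \<Longrightarrow> N (u + v) \<le> N u + N v"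
    and complete: "(\<And>j. x j \<in> V) \<Longrightarrow> summable (\<lambda>j. N (x j)) \<Longrightarrow>
      \<exists>v\<in>V. (\<lambda>M. N ((\<Sum>j<M. x j) - v)) \<longlonglongrightarrow> 0"
    and separating: "u \<in> V \<Longrightarrow> u \<noteq> 0 \<Longrightarrow> \<exists>\<phi>\<in>dual_space N V. \<phi> u \<noteq> 0"
begin

lemma V_0 [simp]: "0 \<in> V"
  and V_add [simp]: "u \<in> V \<Longrightarrow> v \<in> V \<Longrightarrow> u + v \<in> V"
  and V_scale [simp]: "u \<in> V \<Longrightarrow> c *\<^sub>C u \<in> V"
  and V_diff [simp]: "u \<in> V \<Longrightarrow> v \<in> V \<Longrightarrow> u - v \<in> V"
  and V_minus [simp]: "u \<in> V \<Longrightarrow> - u \<in> V"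
  using subspace by (auto simp: cvs.subspace_0 cvs.subspace_add cvs.subspace_scale
      cvs.subspace_diff cvs.subspace_neg)

lemma V_sum [simp]: "(\<And>j. j \<in> J \<Longrightarrow> x j \<in> V) \<Longrightarrow> sum x J \<in> V"
  using cvs.subspace_sum[OF subspace] by blast

lemma N_0 [simp]: "N 0 = 0"
  using N_scale[of 0 0] by simp

lemma N_minus: "u \<in> V \<Longrightarrow> N (- u) = N u"
  using N_scale[of u "-1"] by simp

lemma N_diff: "u \<in> V \<Longrightarrow> v \<in> V \<Longrightarrow> N (u - v) \<le> N u + N v"
  using N_triangle[of u "- v"] by (simp add: N_minus)

lemma N_commute: "u \<in> V \<Longrightarrow> v \<in> V \<Longrightarrow> N (u - v) = N (v - u)"
  using N_minus[of "u - v"] by simp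

lemma N_sum: "(\<And>j. j \<in> J \<Longrightarrow> x j \<in> V) \<Longrightarrow> N (sum x J) \<le> (\<Sum>j\<in>J. N (x j))"
proof (induction J rule: infinite_finite_induct)
  case (insert a J)
  then show ?case using N_triangle[of "x a" "sum x J"] by force
qed auto

lemma N_zero_iff: "u \<in> V \<Longrightarrow> N u = 0 \<longleftrightarrow> u = 0"
proof
  assume u: "u \<in> V" and z: "N u = 0"
  show "u = 0"
  proof (rule ccontr)
    assume "u \<noteq> 0"
    then obtain \<phi> C where "\<phi> u \<noteq> 0" "\<forall>u\<in>V. cmod (\<phi> u) \<le> C * N u"
      using separating[OF u] by (auto simp: dual_space_def)
    then show False using u z by force
  qed
qed simp

lemma lim_unique:
  assumes "\<And>M. x M \<in> V" "v \<in> V" "w \<in> V"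
    and "(\<lambda>M. N (x M - v)) \<longlonglongrightarrow> 0" "(\<lambda>M. N (x M - w)) \<longlonglongrightarrow> 0"
  shows "v = w"
proof -
  have "N (v - w) \<le> N (x M - v) + N (x M - w)" for M
    using N_triangle[of "v - x M" "x M - w"] assms(1-3) by (simp add: N_commute)
  moreover have "(\<lambda>M. N (x M - v) + N (x M - w)) \<longlonglongrightarrow> 0"
    using tendsto_add[OF assms(4,5)] by simp
  ultimately have "N (v - w) \<le> 0"
    by (intro tendsto_lowerbound[of _ 0 sequentially]) auto
  then have "v - w = 0" using N_zero_iff[of "v - w"] N_nonneg[of "v - w"] assms by auto
  then show ?thesis by simp
qed

lemma N_lim_le:
  assumes "\<And>M. x M \<in> V" "v \<in> V" "(\<lambda>M. N (x M - v)) \<longlonglongrightarrow> 0"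
    and "\<And>M. N (x M) \<le> B M" "B \<longlonglongrightarrow> b"
  shows "N v \<le> b"
proof -
  have "N v \<le> B M + N (x M - v)" for M
    using N_diff[of "x M" "x M - v"] assms(1,2) assms(4)[of M] by simp
  moreover have "(\<lambda>M. B M + N (x M - v)) \<longlonglongrightarrow> b + 0"
    using tendsto_add[OF assms(5,3)] .
  ultimately show ?thesis by (intro tendsto_lowerbound[of _ "b" sequentially]) auto
qed

lemma dual_tendsto:
  assumes "\<phi> \<in> dual_space N V" "\<And>M. x M \<in> V" "v \<in> V" "(\<lambda>M. N (x M - v)) \<longlonglongrightarrow> 0"
  shows "(\<lambda>M. \<phi> (x M)) \<longlonglongrightarrow> \<phi> v"
proof -
  obtain C where C: "\<forall>u\<in>V. cmod (\<phi> u) \<le> C * N u" and lin: "linear_on V \<phi>"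
    using assms(1) by (auto simp: dual_space_def)
  have "\<phi> (x M - v) = \<phi> (x M) - \<phi> v" for M
    using lin assms(2)[of M] assms(3) unfolding linear_on_def
    by (metis V_diff add_diff_cancel_right' diff_add_cancel)
  then have "cmod (\<phi> (x M) - \<phi> v) \<le> C * N (x M - v)" for M
    using C assms(2)[of M] assms(3) by (metis V_diff)
  moreover have "(\<lambda>M. C * N (x M - v)) \<longlonglongrightarrow> 0" using tendsto_mult[OF tendsto_const assms(4)] by simp
  ultimately have "(\<lambda>M. \<phi> (x M) - \<phi> v) \<longlonglongrightarrow> 0"
    using Lim_null_comparison[of "\<lambda>M. \<phi> (x M) - \<phi> v" "\<lambda>M. C * N (x M - v)" sequentially]
    by simp
  then show ?thesis using Lim_null by blast
qed

end

lemma linear_on_diff: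
  assumes "linear_on V T" "cvs.subspace V" "u \<in> V" "v \<in> V"
  shows "T (u - v) = T u - T v"
  using assms unfolding linear_on_def
  by (metis add_diff_cancel_right' cvs.subspace_diff diff_add_cancel)

lemma linear_on_0: "linear_on V T \<Longrightarrow> cvs.subspace V \<Longrightarrow> T 0 = 0"
  using linear_on_diff[of V T 0 0] cvs.subspace_0[of V] by simp

lemma linear_on_sum:
  assumes "linear_on V T" "cvs.subspace V" "\<And>j. j \<in> J \<Longrightarrow> x j \<in> V"
  shows "T (sum x J) = (\<Sum>j\<in>J. T (x j))"
  using assms(3)
proof (induction J rule: infinite_finite_induct)
  case (insert a J)
  then have "sum x J \<in> V" using cvs.subspace_sum[OF assms(2)] by blast
  then show ?case using insert assms(1) by (simp add: linear_on_def)
qed (use assms linear_on_0 in auto)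

definition ker_on :: "'a set \<Rightarrow> ('a \<Rightarrow> complex) set \<Rightarrow> 'a set" where
  "ker_on V \<Phi> = {u\<in>V. \<forall>\<phi>\<in>\<Phi>. \<phi> u = 0}"

text \<open>A limit stays in the kernel since bounded functionals are continuous. The symmetry
  class, the transverse blocks and the complements of eigenvectors are all such kernels, and this is
  where their completeness comes from.\<close>

lemma (in nspace) nspace_ker:
  assumes \<Phi>: "\<Phi> \<subseteq> dual_space N V"
  shows "nspace (ker_on V \<Phi>) N"
proof
  have lin: "linear_on V \<phi>" if "\<phi> \<in> \<Phi>" for \<phi>
    using that \<Phi> by (auto simp: dual_space_def)
  then have lin': "\<And>\<phi> u v. \<phi> \<in> \<Phi> \<Longrightarrow> u \<in> V \<Longrightarrow> v \<in> V \<Longrightarrow> \<phi> (u + v) = \<phi> u + \<phi> v"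
    "\<And>\<phi> u c. \<phi> \<in> \<Phi> \<Longrightarrow> u \<in> V \<Longrightarrow> \<phi> (c *\<^sub>C u) = c * \<phi> u"
    "\<And>\<phi>. \<phi> \<in> \<Phi> \<Longrightarrow> \<phi> 0 = 0"
    using lin linear_on_0[OF lin subspace] by (auto simp: linear_on_def scaleC_complex_def)
  show "cvs.subspace (ker_on V \<Phi>)"
  proof (rule cvs.subspaceI)
    show "0 \<in> ker_on V \<Phi>" using lin'(3) by (simp add: ker_on_def)
    show "u + v \<in> ker_on V \<Phi>" if "u \<in> ker_on V \<Phi>" "v \<in> ker_on V \<Phi>" for u v
      using that by (auto simp: ker_on_def lin'(1)[of _ u v])
    show "c *\<^sub>C u \<in> ker_on V \<Phi>" if "u \<in> ker_on V \<Phi>" for c u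
      using that by (auto simp: ker_on_def lin'(2)[of _ u c])
  qed
  fix x :: "nat \<Rightarrow> 'a" assume x: "\<And>j. x j \<in> ker_on V \<Phi>" "summable (\<lambda>j. N (x j))"
  then obtain v where v: "v \<in> V" "(\<lambda>M. N ((\<Sum>j<M. x j) - v)) \<longlonglongrightarrow> 0"
    using complete[of x] by (auto simp: ker_on_def)
  have "\<phi> v = 0" if "\<phi> \<in> \<Phi>" for \<phi>
  proof -
    have lim: "(\<lambda>M. \<phi> (\<Sum>j<M. x j)) \<longlonglongrightarrow> \<phi> v"
      using that \<Phi> x v by (intro dual_tendsto) (auto simp: ker_on_def)
    have x0: "x j \<in> V" "\<phi> (x j) = 0" for j
      using x(1)[of j] that by (auto simp: ker_on_def)
    have "\<phi> (\<Sum>j<M. x j) = 0" for M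
      using linear_on_sum[OF lin[OF that] subspace, of "{..<M}" x] x0 by simp
    with lim show ?thesis by (simp add: LIMSEQ_const_iff)
  qed
  then show "\<exists>v\<in>ker_on V \<Phi>. (\<lambda>M. N ((\<Sum>j<M. x j) - v)) \<longlonglongrightarrow> 0"
    using v by (auto simp: ker_on_def)
next
  fix u assume "u \<in> ker_on V \<Phi>" "u \<noteq> 0"
  then obtain \<phi> where "\<phi> \<in> dual_space N V" "\<phi> u \<noteq> 0" using separating by (auto simp: ker_on_def)
  then show "\<exists>\<phi>\<in>dual_space N (ker_on V \<Phi>). \<phi> u \<noteq> 0"
    by (intro bexI[of _ \<phi>]) (auto simp: dual_space_def linear_on_def ker_on_def)
qed (auto simp: ker_on_def N_nonneg N_scale N_triangle)

subsection \<open>Regular points\<close>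

definition regular :: "('a::complex_vs \<Rightarrow> real) \<Rightarrow> 'a set \<Rightarrow> ('a \<Rightarrow> 'a) \<Rightarrow> complex \<Rightarrow> bool" where
  "regular N V T z \<longleftrightarrow>
    bij_betw (\<lambda>u. z *\<^sub>C u - T u) V V \<and> bounded_op N V (resolvent V T z)"

lemma spectrum_regular: "z \<in> spectrum N V T \<longleftrightarrow> \<not> regular N V T z"
  by (simp add: spectrum_def regular_def)

locale operator = nspace V N for V :: "'a::complex_vs set" and N +
  fixes T :: "'a \<Rightarrow> 'a"
  assumes bounded: "bounded_op N V T"
begin

lemma T_V [simp]: "u \<in> V \<Longrightarrow> T u \<in> V"
  and T_lin: "linear_on V T"
  using bounded by (auto simp: bounded_op_def)

lemma T_add: "u \<in> V \<Longrightarrow> v \<in> V \<Longrightarrow> T (u + v) = T u + T v"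
  and T_scale: "u \<in> V \<Longrightarrow> T (c *\<^sub>C u) = c *\<^sub>C T u"
  using T_lin by (auto simp: linear_on_def)

lemmas T_diff = linear_on_diff[OF T_lin subspace]
lemmas T_sum = linear_on_sum[OF T_lin subspace]
lemmas T_0 = linear_on_0[OF T_lin subspace]

lemma T_bound: "\<exists>C>0. \<forall>u\<in>V. N (T u) \<le> C * N u"
proof -
  obtain C where "\<forall>u\<in>V. N (T u) \<le> C * N u" using bounded by (auto simp: bounded_op_def)
  moreover have "C * N u \<le> (\<bar>C\<bar> + 1) * N u" if "u \<in> V" for u
    using N_nonneg[OF that] by (intro mult_right_mono) auto
  ultimately show ?thesis by (intro exI[of _ "\<bar>C\<bar> + 1"]) force
qed

lemma funpow_V [simp]: "u \<in> V \<Longrightarrow> (T ^^ j) u \<in> V"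
  by (induction j) auto

lemma funpow_add_distrib: "u \<in> V \<Longrightarrow> v \<in> V \<Longrightarrow> (T ^^ j) (u + v) = (T ^^ j) u + (T ^^ j) v"
  by (induction j) (auto simp: T_add)

lemma funpow_bound:
  assumes "C \<ge> 0" "\<forall>u\<in>V. N (T u) \<le> C * N u" "u \<in> V"
  shows "N ((T ^^ j) u) \<le> C ^ j * N u"
proof (induction j)
  case (Suc j)
  have "N ((T ^^ Suc j) u) \<le> C * N ((T ^^ j) u)" using assms by simp
  also have "\<dots> \<le> C * (C ^ j * N u)" using Suc assms(1) mult_left_mono by blast
  finally show ?case by simp
qed simp

lemma shift_linear:
  assumes "u \<in> V" "v \<in> V"
  shows "z *\<^sub>C (u + c *\<^sub>C v) - T (u + c *\<^sub>C v) = (z *\<^sub>C u - T u) + c *\<^sub>C (z *\<^sub>C v - T v)"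
proof -
  have "z *\<^sub>C c *\<^sub>C v = c *\<^sub>C z *\<^sub>C v" by (simp add: scaleC_scaleC mult.commute[of z c])
  then show ?thesis
    using assms by (simp add: T_add T_scale scaleC_add_right cvs.scale_right_diff_distrib)
qed

text \<open>The lower bound does double duty: it gives injectivity and the norm bound of the
  inverse, so that only surjectivity has to be supplied.\<close>

lemma regularI:
  assumes surj: "\<And>w. w \<in> V \<Longrightarrow> \<exists>u\<in>V. z *\<^sub>C u - T u = w"
    and bd: "\<And>u. u \<in> V \<Longrightarrow> N u \<le> C * N (z *\<^sub>C u - T u)"
  shows "regular N V T z"
proof -
  let ?S = "\<lambda>u. z *\<^sub>C u - T u"
  have inj: "inj_on ?S V"
  proof (rule inj_onI)
    fix u v assume uv: "u \<in> V" "v \<in> V" and eq: "?S u = ?S v"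
    have "?S (u - v) = ?S u - ?S v" using uv by (simp add: T_diff cvs.scale_right_diff_distrib)
    then have "N (u - v) \<le> 0" using bd[of "u - v"] uv eq by simp
    then show "u = v" using N_zero_iff[of "u - v"] N_nonneg[of "u - v"] uv by simp
  qed
  have "?S ` V = V" using surj by force
  with inj have bij: "bij_betw ?S V V" by (simp add: bij_betw_def)
  have r: "resolvent V T z w \<in> V \<and> ?S (resolvent V T z w) = w" if "w \<in> V" for w
    using \<open>?S ` V = V\<close> that unfolding resolvent_def
    by (metis (no_types, lifting) f_inv_into_f inv_into_into)
  have r': "resolvent V T z w = u" if "u \<in> V" "?S u = w" for u w
    using inv_into_f_f[OF inj that(1)] that(2) by (simp add: resolvent_def)
  have "linear_on V (resolvent V T z)"
    unfolding linear_on_def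
  proof (intro conjI ballI allI)
    fix u v c assume u: "u \<in> V"
    show "resolvent V T z (c *\<^sub>C u) = c *\<^sub>C resolvent V T z u"
    proof (rule r')
      have "?S (c *\<^sub>C resolvent V T z u) = c *\<^sub>C ?S (resolvent V T z u)"
        using r[OF u] shift_linear[of 0 "resolvent V T z u" z c] by (simp add: T_0)
      then show "?S (c *\<^sub>C resolvent V T z u) = c *\<^sub>C u" using r[OF u] by simp
    qed (use r u in auto)
    assume v: "v \<in> V"
    show "resolvent V T z (u + v) = resolvent V T z u + resolvent V T z v"
    proof (rule r')
      have "?S (resolvent V T z u + resolvent V T z v) =
        ?S (resolvent V T z u) + ?S (resolvent V T z v)"
        using r[OF u] r[OF v] shift_linear[of "resolvent V T z u" "resolvent V T z v" z 1] by simp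
      then show "?S (resolvent V T z u + resolvent V T z v) = u + v" using r[OF u] r[OF v] by simp
    qed (use r u v in auto)
  qed
  then have "bounded_op N V (resolvent V T z)"
    unfolding bounded_op_def using r bd by metis
  with bij show ?thesis by (simp add: regular_def)
qed

lemma regularE:
  assumes "regular N V T z"
  obtains C where "C > 0" "\<And>u. u \<in> V \<Longrightarrow> N u \<le> C * N (z *\<^sub>C u - T u)"
    "\<And>w. w \<in> V \<Longrightarrow> resolvent V T z w \<in> V"
    "\<And>w. w \<in> V \<Longrightarrow> z *\<^sub>C resolvent V T z w - T (resolvent V T z w) = w"
    "\<And>u. u \<in> V \<Longrightarrow> resolvent V T z (z *\<^sub>C u - T u) = u"
proof -
  let ?S = "\<lambda>u. z *\<^sub>C u - T u"
  have bij: "bij_betw ?S V V" and bd: "bounded_op N V (resolvent V T z)"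
    using assms by (auto simp: regular_def)
  interpret R: operator V N "resolvent V T z" by unfold_locales (rule bd)
  obtain C where C: "C > 0" "\<forall>u\<in>V. N (resolvent V T z u) \<le> C * N u" using R.T_bound by blast
  have inv: "resolvent V T z (?S u) = u" if "u \<in> V" for u
    using that bij inv_into_f_f[of ?S V u] by (simp add: resolvent_def bij_betw_def)
  have inv': "?S (resolvent V T z w) = w" if "w \<in> V" for w
    using that bij unfolding resolvent_def bij_betw_def
    by (metis (no_types, lifting) f_inv_into_f)
  have "N u \<le> C * N (?S u)" if "u \<in> V" for u
    using C(2)[rule_format, of "?S u"] inv[OF that] that by simp
  then show ?thesis using that[OF C(1) _ R.T_V inv' inv] by blast
qed

lemma resolvent_eqI:
  assumes "regular N V T z" "u \<in> V" "z *\<^sub>C u - T u = w"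
  shows "resolvent V T z w = u"
  using regularE[OF assms(1)] assms(2,3) by metis

lemma eigenvalue_not_regular:
  assumes "eigenvalue V T z"
  shows "\<not> regular N V T z"
proof
  assume reg: "regular N V T z"
  obtain u where u: "u \<in> V" "T u = z *\<^sub>C u" "u \<noteq> 0"
    using assms by (auto simp: eigenvalue_def eigenspace_def)
  then have "resolvent V T z 0 = u" by (intro resolvent_eqI[OF reg]) auto
  moreover have "resolvent V T z 0 = 0" using T_0 by (intro resolvent_eqI[OF reg]) auto
  ultimately show False using u by simp
qed

text \<open>Only the orbit of the given vector has to be summable. That is what a contraction for an
  equivalent norm provides, even when its bound with respect to \<open>N\<close> exceeds 1.\<close>

lemma neumann:
  assumes w: "w \<in> V" and sm: "summable (\<lambda>j. N ((T ^^ j) w))"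
  shows "\<exists>u\<in>V. u - T u = w"
proof -
  obtain v where v: "v \<in> V" "(\<lambda>M. N ((\<Sum>j<M. (T ^^ j) w) - v)) \<longlonglongrightarrow> 0"
    using complete[OF _ sm] w by auto
  define s where "s M = (\<Sum>j<M. (T ^^ j) w)" for M
  have s: "s M \<in> V" for M using w by (simp add: s_def)
  obtain C where C: "C > 0" "\<forall>u\<in>V. N (T u) \<le> C * N u" using T_bound by blast
  have tel: "s M - T (s M) = w - (T ^^ M) w" for M
  proof (induction M)
    case (Suc M)
    have "s (Suc M) = s M + (T ^^ M) w" by (simp add: s_def)
    moreover from this have "T (s (Suc M)) = T (s M) + (T ^^ Suc M) w"
      using s w by (simp add: T_add)
    ultimately show ?case using Suc by (simp add: algebra_simps)
  qed (simp add: s_def T_0)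
  have eq: "w - (v - T v) = (T ^^ M) w + (s M - v) - T (s M - v)" for M
    using tel[of M] v s by (simp add: T_diff algebra_simps)
  have "N (w - (v - T v)) \<le> N ((T ^^ M) w) + N (s M - v) + C * N (s M - v)" for M
    unfolding eq[of M] using N_diff[of "(T ^^ M) w + (s M - v)" "T (s M - v)"] N_triangle[of "(T ^^ M) w" "s M - v"]
      C(2)[rule_format, of "s M - v"] w v(1) s[of M] by auto
  moreover have "(\<lambda>M. N ((T ^^ M) w) + N (s M - v) + C * N (s M - v)) \<longlonglongrightarrow> 0 + 0 + C * 0"
    using v(2) summable_LIMSEQ_zero[OF sm] unfolding s_def by (intro tendsto_intros)
  ultimately have "N (w - (v - T v)) \<le> 0"
    by (intro tendsto_lowerbound[of _ 0 sequentially]) auto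
  then have "w - (v - T v) = 0"
    using N_zero_iff[of "w - (v - T v)"] N_nonneg[of "w - (v - T v)"] w v by auto
  then show ?thesis using v(1) by auto
qed

text \<open>The resolvent identity turns the difference quotient into minus \<open>\<phi>\<close> of
  a product of two resolvents; passing to the limit takes a bound for the resolvents that is uniform
  near \<open>z\<close>.\<close>

lemma resolvent_dual_differentiable:
  assumes \<phi>: "\<phi> \<in> dual_space N V" and w: "w \<in> V" and op: "open S"
    and reg: "\<And>z. z \<in> S \<Longrightarrow> regular N V T z"
  shows "(\<lambda>z. \<phi> (resolvent V T z w)) holomorphic_on S"
  unfolding holomorphic_on_def
proof
  fix z assume z: "z \<in> S"
  define R where "R = resolvent V T"
  obtain K where K: "K > 0" "\<And>u. u \<in> V \<Longrightarrow> N u \<le> K * N (z *\<^sub>C u - T u)"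
    using regularE[OF reg[OF z]] by metis
  have R_V: "R y x \<in> V" and R_eq: "y *\<^sub>C R y x - T (R y x) = x" if "y \<in> S" "x \<in> V" for x y
    using regularE[OF reg[OF that(1)]] that unfolding R_def by metis+
  obtain e where e: "e > 0" "ball z e \<subseteq> S" using op z openE by blast
  obtain C0 where C0: "\<forall>u\<in>V. cmod (\<phi> u) \<le> C0 * N u" and lin: "linear_on V \<phi>"
    using \<phi> by (auto simp: dual_space_def)
  define C where "C = \<bar>C0\<bar>"
  have C: "cmod (\<phi> u) \<le> C * N u" if "u \<in> V" for u
    using C0[rule_format, OF that] mult_right_mono[OF abs_ge_self N_nonneg[OF that], of C0]
    by (simp add: C_def)
  \<comment> \<open>Within this radius the perturbation \<open>z - y\<close> costs at most half of
    the lower bound at \<open>z\<close>, so the resolvents at \<open>y\<close> are bounded by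
    \<open>2 * K\<close>; the minimum with \<open>e\<close> keeps \<open>y\<close> in
    \<open>S\<close>.\<close>
  define d where "d = min e (1 / (2 * K))"
  have d: "d > 0" using e K by (simp add: d_def)
  have bound: "N (R y x) \<le> 2 * K * N x" if "y \<in> ball z d" "x \<in> V" for x y
  proof -
    have y: "y \<in> S" using that e by (auto simp: d_def)
    let ?v = "R y x"
    have v: "?v \<in> V" using R_V y that by blast
    have "z *\<^sub>C ?v - T ?v = x + (z - y) *\<^sub>C ?v"
      using R_eq[OF y that(2)] by (simp add: cvs.scale_left_diff_distrib algebra_simps)
    then have "N ?v \<le> K * (N x + cmod (z - y) * N ?v)"
      using K(2)[OF v] N_triangle[of x "(z - y) *\<^sub>C ?v"] v that(2) K(1)
      by (smt (verit) N_scale V_scale mult_left_mono)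
    moreover have "K * cmod (z - y) \<le> 1 / 2"
    proof -
      have "cmod (z - y) \<le> 1 / (2 * K)" using that by (simp add: d_def dist_norm)
      then have "K * cmod (z - y) \<le> K * (1 / (2 * K))" using K(1) by (intro mult_left_mono) auto
      then show ?thesis using K(1) by simp
    qed
    then have "K * cmod (z - y) * N ?v \<le> 1 / 2 * N ?v" by (intro mult_right_mono N_nonneg v)
    ultimately show ?thesis by (simp add: algebra_simps)
  qed
  \<comment> \<open>The resolvent identity, obtained by checking that the candidate
    \<open>?u\<close> solves the equation at \<open>y\<close>.\<close>
  have diff: "R y x - R z x = (z - y) *\<^sub>C R y (R z x)" if "y \<in> S" "x \<in> V" for x y
  proof -
    have v: "R y x \<in> V" "R z x \<in> V" "R y (R z x) \<in> V" using R_V that z by auto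
    let ?u = "R z x + (z - y) *\<^sub>C R y (R z x)"
    have "y *\<^sub>C ?u - T ?u = y *\<^sub>C R z x - T (R z x) + (z - y) *\<^sub>C (y *\<^sub>C R y (R z x) - T (R y (R z x)))"
      using shift_linear v by simp
    also have "\<dots> = y *\<^sub>C R z x - T (R z x) + (z - y) *\<^sub>C R z x" using R_eq[OF that(1) v(2)] by simp
    also have "\<dots> = z *\<^sub>C R z x - T (R z x)" by (simp add: cvs.scale_left_diff_distrib)
    also have "\<dots> = x" using R_eq[OF z that(2)] .
    finally have "R y x = ?u"
      using resolvent_eqI[OF reg[OF that(1)], of ?u x] v unfolding R_def by simp
    then show ?thesis by simp
  qed
  have \<phi>d: "\<phi> (u - v) = \<phi> u - \<phi> v" if "u \<in> V" "v \<in> V" for u v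
    using linear_on_diff[OF lin subspace that] .
  have \<phi>s: "\<phi> (c *\<^sub>C u) = c * \<phi> u" if "u \<in> V" for c u
    using lin that by (simp add: linear_on_def scaleC_complex_def)
  let ?x = "R z w"
  have x: "?x \<in> V" "R z ?x \<in> V" using R_V z w by auto
  have cont: "((\<lambda>y. \<phi> (R y ?x)) \<longlongrightarrow> \<phi> (R z ?x)) (at z)"
  proof (rule LIM_zero_cancel)
    show "((\<lambda>y. \<phi> (R y ?x) - \<phi> (R z ?x)) \<longlongrightarrow> 0) (at z)"
    proof (rule Lim_null_comparison)
      show "((\<lambda>y. C * (cmod (z - y) * (2 * K * N (R z ?x)))) \<longlongrightarrow> 0) (at z)"
        by (rule tendsto_eq_intros refl | simp)+
      show "\<forall>\<^sub>F y in at z. cmod (\<phi> (R y ?x) - \<phi> (R z ?x)) \<le> C * (cmod (z - y) * (2 * K * N (R z ?x)))"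
        unfolding eventually_at
      proof (intro exI[of _ d] conjI ballI impI)
        fix y assume "y \<in> UNIV" "y \<noteq> z \<and> dist y z < d"
        then have y: "y \<in> ball z d" "y \<in> S" using e by (auto simp: d_def dist_commute)
        have v: "R y (R z ?x) \<in> V" "R y ?x \<in> V" using R_V y x by auto
        have "\<phi> (R y ?x) - \<phi> (R z ?x) = \<phi> ((z - y) *\<^sub>C R y (R z ?x))"
          using \<phi>d[of "R y ?x" "R z ?x"] diff[OF y(2) x(1)] v x by simp
        then have "cmod (\<phi> (R y ?x) - \<phi> (R z ?x)) \<le> C * (cmod (z - y) * N (R y (R z ?x)))"
          using C[of "(z - y) *\<^sub>C R y (R z ?x)"] v by (simp add: N_scale)
        also have "\<dots> \<le> C * (cmod (z - y) * (2 * K * N (R z ?x)))"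
          using bound[OF y(1) x(2)] by (intro mult_left_mono) (auto simp: C_def)
        finally show "cmod (\<phi> (R y ?x) - \<phi> (R z ?x)) \<le> C * (cmod (z - y) * (2 * K * N (R z ?x)))" .
      qed (use d in auto)
    qed
  qed
  have "((\<lambda>y. (\<phi> (R y w) - \<phi> (R z w)) / (y - z)) \<longlongrightarrow> - \<phi> (R z ?x)) (at z)"
  proof (rule Lim_transform_within[OF tendsto_minus[OF cont]])
    show "0 < d" by (rule d)
    fix y assume "y \<in> UNIV" "0 < dist y z" "dist y z < d"
    then have y: "y \<in> S" "y \<noteq> z" using e by (auto simp: d_def dist_commute)
    have v: "R y ?x \<in> V" "R y w \<in> V" using R_V y x w by auto
    have "\<phi> (R y w) - \<phi> (R z w) = (z - y) * \<phi> (R y ?x)"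
      using \<phi>d[of "R y w" "R z w"] diff[OF y(1) w] v x \<phi>s by simp
    then show "- \<phi> (R y ?x) = (\<phi> (R y w) - \<phi> (R z w)) / (y - z)"
      using y(2) by (simp add: field_simps)
  qed
  then have "((\<lambda>y. \<phi> (R y w)) has_field_derivative - \<phi> (R z ?x)) (at z)"
    by (simp only: has_field_derivative_iff)
  then have "((\<lambda>y. \<phi> (R y w)) has_field_derivative - \<phi> (R z ?x)) (at z within S)"
    by (rule has_field_derivative_at_within)
  then show "(\<lambda>z. \<phi> (resolvent V T z w)) field_differentiable (at z within S)"
    unfolding R_def field_differentiable_def by (rule exI)
qed

end

context operator
begin

text \<open>Solving the equation at \<open>y\<close> amounts to inverting \<open>1 - S\<close>,
  where \<open>S\<close> is \<open>z - y\<close> times the resolvent at \<open>z\<close>, a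
  contraction with factor 1/2 for \<open>y\<close> in the ball. Openness allows the resolvent to be
  treated as a holomorphic function.\<close>

lemma regular_open: "open {z. regular N V T z}"
  unfolding open_contains_ball
proof
  fix z assume "z \<in> {z. regular N V T z}"
  then have reg: "regular N V T z" by simp
  obtain K where K: "K > 0" "\<And>u. u \<in> V \<Longrightarrow> N u \<le> K * N (z *\<^sub>C u - T u)"
    and R_V: "\<And>w. w \<in> V \<Longrightarrow> resolvent V T z w \<in> V"
    and R_eq: "\<And>w. w \<in> V \<Longrightarrow> z *\<^sub>C resolvent V T z w - T (resolvent V T z w) = w"
    using regularE[OF reg] by metis
  define d where "d = 1 / (2 * K)"
  have "regular N V T y" if y: "y \<in> ball z d" for y
  proof (rule regularI[where C = "2 * K"])
    have c: "K * cmod (z - y) \<le> 1 / 2"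
    proof -
      have "cmod (z - y) \<le> 1 / (2 * K)" using y by (simp add: d_def dist_norm)
      then have "K * cmod (z - y) \<le> K * (1 / (2 * K))" using K(1) by (intro mult_left_mono) auto
      then show ?thesis using K(1) by simp
    qed
    have eq: "z *\<^sub>C u - T u = (y *\<^sub>C u - T u) + (z - y) *\<^sub>C u" for u
      by (simp add: cvs.scale_left_diff_distrib)
    fix u assume u: "u \<in> V"
    have "N u \<le> K * (N (y *\<^sub>C u - T u) + cmod (z - y) * N u)"
      using K(2)[OF u] N_triangle[of "y *\<^sub>C u - T u" "(z - y) *\<^sub>C u"] u K(1) N_scale[OF u]
      unfolding eq by (smt (verit) T_V V_diff V_scale mult_left_mono)
    moreover have "K * cmod (z - y) * N u \<le> 1 / 2 * N u" using c by (intro mult_right_mono N_nonneg u)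
    ultimately show "N u \<le> 2 * K * N (y *\<^sub>C u - T u)" by (simp add: algebra_simps)
  next
    fix w assume w: "w \<in> V"
    let ?R = "resolvent V T z"
    define S where "S u = (z - y) *\<^sub>C ?R u" for u
    have "K * cmod (z - y) \<le> 1 / 2"
    proof -
      have "cmod (z - y) \<le> 1 / (2 * K)" using y by (simp add: d_def dist_norm)
      then have "K * cmod (z - y) \<le> K * (1 / (2 * K))" using K(1) by (intro mult_left_mono) auto
      then show ?thesis using K(1) by simp
    qed
    moreover have RN: "N (?R u) \<le> K * N u" if "u \<in> V" for u
      using K(2)[OF R_V[OF that]] R_eq[OF that] by simp
    ultimately have SN: "N (S u) \<le> 1 / 2 * N u" if "u \<in> V" for u
    proof -
      have "N (S u) \<le> cmod (z - y) * (K * N u)"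
        using RN[OF that] N_scale[OF R_V[OF that]] by (simp add: S_def mult_left_mono)
      also have "\<dots> = K * cmod (z - y) * N u" by simp
      also have "\<dots> \<le> 1 / 2 * N u" using \<open>K * cmod (z - y) \<le> 1 / 2\<close> by (intro mult_right_mono N_nonneg that)
      finally show ?thesis .
    qed
    have "bounded_op N V ?R" using reg by (simp add: regular_def)
    then have "linear_on V ?R" by (simp add: bounded_op_def)
    then have "linear_on V S"
      by (simp add: linear_on_def S_def scaleC_add_right scaleC_scaleC mult.commute)
    moreover have "\<forall>u\<in>V. S u \<in> V" using R_V by (simp add: S_def)
    ultimately have "bounded_op N V S" using SN unfolding bounded_op_def by blast
    then interpret S: operator V N S by unfold_locales
    have "summable (\<lambda>j. N ((S ^^ j) (?R w)))"
    proof (rule summable_comparison_test)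
      show "summable (\<lambda>j. (1 / 2) ^ j * N (?R w))" by (intro summable_mult2 summable_geometric) auto
      show "\<exists>M. \<forall>j\<ge>M. norm (N ((S ^^ j) (?R w))) \<le> (1 / 2) ^ j * N (?R w)"
        using S.funpow_bound[of "1/2" "?R w"] SN R_V[OF w] N_nonneg S.funpow_V by auto
    qed
    then obtain u where u: "u \<in> V" "u - S u = ?R w" using S.neumann R_V[OF w] by blast
    have "u = ?R w + (z - y) *\<^sub>C ?R u" using u(2) by (simp add: S_def algebra_simps)
    then have "z *\<^sub>C u - T u = (z *\<^sub>C ?R w - T (?R w)) + (z - y) *\<^sub>C (z *\<^sub>C ?R u - T (?R u))"
      using shift_linear[of "?R w" "?R u" z "z - y"] R_V w u by simp
    then have "z *\<^sub>C u - T u = w + (z - y) *\<^sub>C u" using R_eq w u by simp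
    then have "y *\<^sub>C u - T u = w" by (simp add: cvs.scale_left_diff_distrib algebra_simps)
    then show "\<exists>u\<in>V. y *\<^sub>C u - T u = w" using u(1) by blast
  qed
  then show "\<exists>e>0. ball z e \<subseteq> {z. regular N V T z}"
    using K(1) by (intro exI[of _ d]) (auto simp: d_def)
qed

subsection \<open>The exponential\<close>

abbreviation exp_partial :: "real \<Rightarrow> 'a \<Rightarrow> nat \<Rightarrow> 'a" where
  "exp_partial t u M \<equiv> (\<Sum>j<M. complex_of_real (t ^ j / fact j) *\<^sub>C (T ^^ j) u)"

lemma op_exp_unique:
  assumes "u \<in> V" "v \<in> V" "(\<lambda>M. N (exp_partial t u M - v)) \<longlonglongrightarrow> 0"
  shows "op_exp N V T t u = v"
  unfolding op_exp_def
proof (rule the_equality)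
  fix w assume "w \<in> V \<and> (\<lambda>M. N (exp_partial t u M - w)) \<longlonglongrightarrow> 0"
  then show "w = v" using lim_unique[of "exp_partial t u" w v] assms by auto
qed (use assms in auto)

lemma op_exp_lim:
  assumes u: "u \<in> V"
  shows "op_exp N V T t u \<in> V" "(\<lambda>M. N (exp_partial t u M - op_exp N V T t u)) \<longlonglongrightarrow> 0"
proof -
  obtain C where C: "C > 0" "\<forall>u\<in>V. N (T u) \<le> C * N u" using T_bound by blast
  have "summable (\<lambda>j. N (complex_of_real (t ^ j / fact j) *\<^sub>C (T ^^ j) u))"
  proof (rule summable_comparison_test)
    show "summable (\<lambda>j. inverse (fact j) * (\<bar>t\<bar> * C) ^ j * N u)"
      by (intro summable_mult2 summable_exp)
    have "N (complex_of_real (t ^ j / fact j) *\<^sub>C (T ^^ j) u) \<le> inverse (fact j) * (\<bar>t\<bar> * C) ^ j * N u" for j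
    proof -
      have "cmod (complex_of_real (t ^ j / fact j)) = \<bar>t\<bar> ^ j / fact j"
        by (simp add: norm_divide norm_power power_abs)
      then have "N (complex_of_real (t ^ j / fact j) *\<^sub>C (T ^^ j) u) = \<bar>t\<bar> ^ j / fact j * N ((T ^^ j) u)"
        using N_scale[of "(T ^^ j) u"] u by simp
      also have "\<dots> \<le> \<bar>t\<bar> ^ j / fact j * (C ^ j * N u)"
        using funpow_bound[of C u j] C u by (intro mult_left_mono) auto
      finally show ?thesis by (simp add: field_simps)
    qed
    then show "\<exists>M. \<forall>j\<ge>M. norm (N (complex_of_real (t ^ j / fact j) *\<^sub>C (T ^^ j) u))
        \<le> inverse (fact j) * (\<bar>t\<bar> * C) ^ j * N u"
      using N_nonneg u by auto
  qed
  then obtain v where "v \<in> V" "(\<lambda>M. N (exp_partial t u M - v)) \<longlonglongrightarrow> 0"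
    using complete[of "\<lambda>j. complex_of_real (t ^ j / fact j) *\<^sub>C (T ^^ j) u"] u by auto
  with op_exp_unique[OF u this]
  show "op_exp N V T t u \<in> V" "(\<lambda>M. N (exp_partial t u M - op_exp N V T t u)) \<longlonglongrightarrow> 0"
    by auto
qed

lemma op_exp_add:
  assumes u: "u \<in> V" and v: "v \<in> V"
  shows "op_exp N V T t (u + v) = op_exp N V T t u + op_exp N V T t v"
proof (rule op_exp_unique)
  let ?a = "op_exp N V T t u" and ?b = "op_exp N V T t v"
  have eq: "exp_partial t (u + v) M - (?a + ?b) = (exp_partial t u M - ?a) + (exp_partial t v M - ?b)" for M
    using u v by (simp add: funpow_add_distrib scaleC_add_right sum.distrib)
  show "(\<lambda>M. N (exp_partial t (u + v) M - (?a + ?b))) \<longlonglongrightarrow> 0"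
  proof (rule Lim_null_comparison)
    show "\<forall>\<^sub>F M in sequentially. norm (N (exp_partial t (u + v) M - (?a + ?b)))
      \<le> N (exp_partial t u M - ?a) + N (exp_partial t v M - ?b)"
      unfolding eq using u v op_exp_lim(1) N_triangle N_nonneg by (intro always_eventually) auto
    show "(\<lambda>M. N (exp_partial t u M - ?a) + N (exp_partial t v M - ?b)) \<longlonglongrightarrow> 0"
      using tendsto_add[OF op_exp_lim(2)[OF u, of t] op_exp_lim(2)[OF v, of t]] by simp
  qed
qed (use u v op_exp_lim(1) in auto)

lemma funpow_eigen:
  assumes "e \<in> V" "T e = \<mu> *\<^sub>C e"
  shows "(T ^^ j) e = \<mu> ^ j *\<^sub>C e"
proof (induction j)
  case (Suc j)
  have "(T ^^ Suc j) e = \<mu> ^ j *\<^sub>C \<mu> *\<^sub>C e" using Suc assms by (simp add: T_scale)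
  then show ?case by (simp add: scaleC_scaleC mult.commute[of \<mu>])
qed simp

lemma op_exp_eigen:
  assumes e: "e \<in> V" "T e = \<mu> *\<^sub>C e"
  shows "op_exp N V T t (c *\<^sub>C e) = (exp (of_real t * \<mu>) * c) *\<^sub>C e"
proof (rule op_exp_unique)
  have e': "T (c *\<^sub>C e) = \<mu> *\<^sub>C (c *\<^sub>C e)" using e by (simp add: T_scale scaleC_scaleC mult.commute)
  define p where "p M = (\<Sum>j<M. (of_real t * \<mu>) ^ j /\<^sub>R fact j)" for M
  have "complex_of_real (t ^ j / fact j) *\<^sub>C (T ^^ j) (c *\<^sub>C e) = ((of_real t * \<mu>) ^ j /\<^sub>R fact j * c) *\<^sub>C e" for j
    using funpow_eigen[OF _ e'] e by (simp add: scaleC_scaleC power_mult_distrib scaleR_conv_of_real field_simps)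
  then have "exp_partial t (c *\<^sub>C e) M = (p M * c) *\<^sub>C e" for M
    by (simp add: p_def sum_distrib_right flip: cvs.scale_sum_left)
  then have "exp_partial t (c *\<^sub>C e) M - (exp (of_real t * \<mu>) * c) *\<^sub>C e = ((p M - exp (of_real t * \<mu>)) * c) *\<^sub>C e" for M
    by (simp add: cvs.scale_left_diff_distrib left_diff_distrib)
  moreover have "(\<lambda>M. cmod ((p M - exp (of_real t * \<mu>)) * c) * N e) \<longlonglongrightarrow> cmod (0 * c) * N e"
  proof (intro tendsto_intros LIM_zero)
    show "p \<longlonglongrightarrow> exp (of_real t * \<mu>)"
      using exp_converges[of "of_real t * \<mu>"] unfolding sums_def p_def .
  qed
  ultimately show "(\<lambda>M. N (exp_partial t (c *\<^sub>C e) M - (exp (of_real t * \<mu>) * c) *\<^sub>C e)) \<longlonglongrightarrow> 0"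
    using e by (simp add: N_scale)
qed (use e in auto)

text \<open>Exposes the Euler steps as a polynomial in \<open>T\<close>, to be compared with the
  exponential series coefficient by coefficient.\<close>

lemma euler_step_binomial:
  fixes h :: real
  assumes u: "u \<in> V"
  shows "((\<lambda>u. u + of_real h *\<^sub>C T u) ^^ M) u = (\<Sum>j\<le>M. of_real ((M choose j) * h ^ j) *\<^sub>C (T ^^ j) u)"
proof (induction M)
  case (Suc M)
  let ?x = "\<lambda>M j. complex_of_real ((M choose j) * h ^ j) *\<^sub>C (T ^^ j) u"
  have "complex_of_real h *\<^sub>C T (\<Sum>j\<le>M. ?x M j) = (\<Sum>j\<le>M. of_real ((M choose j) * h ^ Suc j) *\<^sub>C (T ^^ Suc j) u)"
    using u by (simp add: T_sum T_scale cvs.scale_sum_right scaleC_scaleC mult_ac)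
  moreover have "(\<Sum>j\<le>M. ?x M j) = u + (\<Sum>j\<le>M. ?x M (Suc j))"
  proof -
    have "(\<Sum>j\<le>M. ?x M j) = (\<Sum>j\<le>Suc M. ?x M j)" by (simp add: binomial_eq_0)
    also have "\<dots> = u + (\<Sum>j\<le>M. ?x M (Suc j))" by (subst sum.atMost_Suc_shift) simp
    finally show ?thesis .
  qed
  moreover have "(\<Sum>j\<le>Suc M. ?x (Suc M) j) = u + (\<Sum>j\<le>M. ?x (Suc M) (Suc j))"
    by (subst sum.atMost_Suc_shift) simp
  moreover have "?x (Suc M) (Suc j) = ?x M (Suc j) + of_real ((M choose j) * h ^ Suc j) *\<^sub>C (T ^^ Suc j) u" for j
    by (simp add: distrib_right scaleC_add_left)
  then have "(\<Sum>j\<le>M. ?x (Suc M) (Suc j))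
      = (\<Sum>j\<le>M. ?x M (Suc j)) + (\<Sum>j\<le>M. of_real ((M choose j) * h ^ Suc j) *\<^sub>C (T ^^ Suc j) u)"
    by (simp only: sum.distrib)
  moreover have "((\<lambda>u. u + of_real h *\<^sub>C T u) ^^ Suc M) u = (\<Sum>j\<le>M. ?x M j) + of_real h *\<^sub>C T (\<Sum>j\<le>M. ?x M j)"
    using Suc by simp
  ultimately show ?case by (simp only: add.assoc)
qed simp

text \<open>Through this limit a bound for one Euler step passes to the exponential. The
  coefficients of the exponential series exceed those of the binomial expansion, so the difference
  is dominated by the same difference with the number \<open>C\<close> in place of \<open>T\<close>,
  where both sides tend to \<open>exp (t * C)\<close>.\<close>

lemma op_exp_euler:
  assumes u: "u \<in> V" and t: "t \<ge> 0"
  shows "(\<lambda>M. N (((\<lambda>u. u + of_real (t / real M) *\<^sub>C T u) ^^ M) u - op_exp N V T t u)) \<longlonglongrightarrow> 0"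
proof -
  obtain C where C: "C > 0" "\<forall>u\<in>V. N (T u) \<le> C * N u" using T_bound by blast
  define E where "E M = ((\<lambda>u. u + complex_of_real (t / real M) *\<^sub>C T u) ^^ M) u" for M
  let ?E = E
  have eb: "E M = (\<Sum>j\<le>M. of_real ((M choose j) * (t / real M) ^ j) *\<^sub>C (T ^^ j) u)" for M
    unfolding E_def by (rule euler_step_binomial[OF u])
  have E_V: "?E M \<in> V" for M unfolding eb using u by simp
  let ?s = "\<lambda>M::nat. (\<Sum>j\<le>M. (t * C) ^ j / fact j) - (1 + t * C / real M) ^ M"
  have bd: "N (?E M - exp_partial t u (Suc M)) \<le> ?s M * N u" for M
  proof (cases "M = 0")
    case False
    let ?c = "\<lambda>j. t ^ j / fact j - (M choose j) * (t / real M) ^ j"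
    \<comment> \<open>This amounts to (M choose j) * j! <= M ^ j.\<close>
    have c: "0 \<le> ?c j" for j
    proof -
      have "real ((M choose j) * fact j) \<le> real (M ^ j)"
        using binomial_fact_pow of_nat_le_iff by blast
      then have "real (M choose j) * fact j \<le> real M ^ j" by simp
      then have "real (M choose j) / real M ^ j \<le> 1 / fact j" using False by (simp add: field_simps)
      then have "t ^ j * (real (M choose j) / real M ^ j) \<le> t ^ j * (1 / fact j)"
        using t by (intro mult_left_mono) auto
      then show ?thesis by (simp add: power_divide mult.commute)
    qed
    have "exp_partial t u (Suc M) - ?E M = (\<Sum>j\<le>M. of_real (?c j) *\<^sub>C (T ^^ j) u)"
      by (simp only: eb lessThan_Suc_atMost of_real_diff
          cvs.scale_left_diff_distrib sum_subtractf)
    then have "N (?E M - exp_partial t u (Suc M)) = N (\<Sum>j\<le>M. of_real (?c j) *\<^sub>C (T ^^ j) u)"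
      using N_commute[of "?E M" "exp_partial t u (Suc M)"] E_V u by simp
    also have "\<dots> \<le> (\<Sum>j\<le>M. N (of_real (?c j) *\<^sub>C (T ^^ j) u))"
      using u by (intro N_sum) auto
    also have "\<dots> \<le> (\<Sum>j\<le>M. ?c j * (C ^ j * N u))"
    proof (rule sum_mono)
      fix j
      have "N (of_real (?c j) *\<^sub>C (T ^^ j) u) = ?c j * N ((T ^^ j) u)"
        using N_scale[of "(T ^^ j) u" "of_real (?c j)"] c[of j] u
        by (metis abs_of_nonneg funpow_V norm_of_real)
      also have "\<dots> \<le> ?c j * (C ^ j * N u)"
        using funpow_bound[of C u j] C u c[of j] by (intro mult_left_mono) auto
      finally show "N (of_real (?c j) *\<^sub>C (T ^^ j) u) \<le> ?c j * (C ^ j * N u)" .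
    qed
    also have "\<dots> = ((\<Sum>j\<le>M. (t * C) ^ j / fact j) - (\<Sum>j\<le>M. (M choose j) * (t * C / real M) ^ j)) * N u"
    proof -
      have "?c j * (C ^ j * N u) = ((t * C) ^ j / fact j - (M choose j) * (t * C / real M) ^ j) * N u" for j
        by (simp add: power_mult_distrib power_divide algebra_simps)
      then show ?thesis by (simp only: sum_distrib_right[symmetric] sum_subtractf)
    qed
    also have "(\<Sum>j\<le>M. (M choose j) * (t * C / real M) ^ j) = (t * C / real M + 1) ^ M"
      by (subst binomial_ring) simp
    finally show ?thesis by (simp add: add.commute)
  qed (simp add: E_def)
  have "(\<lambda>M. \<Sum>j\<le>M. (t * C) ^ j / fact j) \<longlonglongrightarrow> exp (t * C)"
    using exp_converges[of "t * C"] unfolding sums_def_le by (simp add: divide_inverse mult.commute)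
  then have "(\<lambda>M. ?s M * N u + N (exp_partial t u (Suc M) - op_exp N V T t u))
      \<longlonglongrightarrow> (exp (t * C) - exp (t * C)) * N u + 0"
    by (intro tendsto_intros tendsto_exp_limit_sequentially LIMSEQ_Suc[OF op_exp_lim(2)[OF u]])
  then have lim: "(\<lambda>M. ?s M * N u + N (exp_partial t u (Suc M) - op_exp N V T t u)) \<longlonglongrightarrow> 0" by simp
  show ?thesis
    unfolding E_def[symmetric]
  proof (rule Lim_null_comparison[OF _ lim])
    have "N (?E M - op_exp N V T t u) \<le> ?s M * N u + N (exp_partial t u (Suc M) - op_exp N V T t u)" for M
      using N_triangle[of "?E M - exp_partial t u (Suc M)" "exp_partial t u (Suc M) - op_exp N V T t u"]
        bd[of M] E_V u op_exp_lim(1)[OF u] by auto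
    then show "\<forall>\<^sub>F M in sequentially. norm (N (?E M - op_exp N V T t u))
        \<le> ?s M * N u + N (exp_partial t u (Suc M) - op_exp N V T t u)"
      using N_nonneg E_V op_exp_lim(1)[OF u] by (intro always_eventually) auto
  qed
qed

end

subsection \<open>Dissipative operators\<close>

text \<open>\<open>g\<close> plays the real part of a Hermitian inner product whose norm is
  equivalent to \<open>N\<close>. Real bilinearity and invariance under \<open>\<i>\<close> are what
  forms with real weights offer. \<open>g_diss\<close> says that this norm grows at most like exp
  (\<epsilon> t).\<close>

locale dissipative = operator V N T for V :: "'a::complex_vs set" and N T +
  fixes g :: "'a \<Rightarrow> 'a \<Rightarrow> real" and m K \<epsilon> :: real
  assumes g_add: "u \<in> V \<Longrightarrow> v \<in> V \<Longrightarrow> w \<in> V \<Longrightarrow> g (u + v) w = g u w + g v w"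
    and g_commute: "u \<in> V \<Longrightarrow> v \<in> V \<Longrightarrow> g u v = g v u"
    and g_scale: "u \<in> V \<Longrightarrow> v \<in> V \<Longrightarrow> g (of_real r *\<^sub>C u) v = r * g u v"
    and g_i: "u \<in> V \<Longrightarrow> v \<in> V \<Longrightarrow> g (\<i> *\<^sub>C u) (\<i> *\<^sub>C v) = g u v"
    and m_pos: "m > 0"
    and g_lower: "u \<in> V \<Longrightarrow> m * (N u)\<^sup>2 \<le> g u u"
    and g_upper: "u \<in> V \<Longrightarrow> g u u \<le> K * (N u)\<^sup>2"
    and g_diss: "u \<in> V \<Longrightarrow> g (T u) u \<le> \<epsilon> * g u u"
begin

lemma g_nonneg: "u \<in> V \<Longrightarrow> 0 \<le> g u u"
proof -
  assume u: "u \<in> V"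
  have "0 \<le> m * (N u)\<^sup>2" using m_pos by simp
  then show ?thesis using g_lower[OF u] by linarith
qed

lemma g_add_scaled:
  assumes "u \<in> V" "v \<in> V"
  shows "g (u + of_real h *\<^sub>C v) (u + of_real h *\<^sub>C v) = g u u + 2 * h * g v u + h\<^sup>2 * g v v"
proof -
  let ?w = "complex_of_real h *\<^sub>C v"
  have w: "?w \<in> V" using assms by simp
  have "g (u + ?w) (u + ?w) = g u (u + ?w) + g ?w (u + ?w)" using assms w by (simp add: g_add)
  also have "\<dots> = g (u + ?w) u + g (u + ?w) ?w"
    using assms w by (simp add: g_commute[of u "u + ?w"] g_commute[of ?w "u + ?w"])
  also have "\<dots> = g u u + g ?w u + (g u ?w + g ?w ?w)" using assms w by (simp add: g_add)
  also have "g u ?w = h * g v u" using assms w by (simp add: g_commute[of u ?w] g_scale)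
  also have "g ?w u = h * g v u" using assms by (simp add: g_scale)
  also have "g ?w ?w = h * (h * g v v)" using assms w by (simp add: g_scale g_commute[of v ?w])
  finally show ?thesis by (simp add: power2_eq_square algebra_simps)
qed

lemma g_i_self:
  assumes u: "u \<in> V"
  shows "g (\<i> *\<^sub>C u) u = 0"
proof -
  have "\<i> *\<^sub>C \<i> *\<^sub>C u = of_real (- 1) *\<^sub>C u" by (simp add: scaleC_scaleC)
  then have "g (\<i> *\<^sub>C u) u = g (of_real (- 1) *\<^sub>C u) (\<i> *\<^sub>C u)" using g_i[of "\<i> *\<^sub>C u" u] u by simp
  also have "\<dots> = - g (\<i> *\<^sub>C u) u" using u by (simp only: g_scale V_scale) (simp add: g_commute[of u "\<i> *\<^sub>C u"])
  finally show ?thesis by simp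
qed

text \<open>The imaginary part of \<open>z\<close> acts skew-symmetrically and drops out.\<close>

lemma g_complex_scale:
  assumes u: "u \<in> V"
  shows "g (z *\<^sub>C u) u = Re z * g u u"
proof -
  have "z *\<^sub>C u = of_real (Re z) *\<^sub>C u + of_real (Im z) *\<^sub>C \<i> *\<^sub>C u"
    using complex_eq[of z] by (simp add: scaleC_scaleC mult.commute flip: scaleC_add_left)
  then have "g (z *\<^sub>C u) u = g (of_real (Re z) *\<^sub>C u) u + g (of_real (Im z) *\<^sub>C \<i> *\<^sub>C u) u"
    using u by (simp only: g_add V_scale)
  then show ?thesis using u by (simp only: g_scale V_scale g_i_self)
qed

lemma g_bounded:
  assumes "bounded_op N V S"
  shows "\<exists>Q>0. \<forall>u\<in>V. g (S u) (S u) \<le> Q * g u u"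
proof -
  interpret S: operator V N S by unfold_locales (rule assms)
  obtain C where C: "C > 0" "\<forall>u\<in>V. N (S u) \<le> C * N u" using S.T_bound by blast
  have "g (S u) (S u) \<le> ((\<bar>K\<bar> + 1) * C\<^sup>2 / m) * g u u" if u: "u \<in> V" for u
  proof -
    have "g (S u) (S u) \<le> K * (N (S u))\<^sup>2" using g_upper S.T_V u by blast
    also have "\<dots> \<le> (\<bar>K\<bar> + 1) * (N (S u))\<^sup>2" by (intro mult_right_mono) auto
    also have "\<dots> \<le> (\<bar>K\<bar> + 1) * (C * N u)\<^sup>2"
      using C u N_nonneg S.T_V by (intro mult_left_mono power_mono) auto
    also have "\<dots> = ((\<bar>K\<bar> + 1) * C\<^sup>2 / m) * (m * (N u)\<^sup>2)"
      using m_pos by (simp add: field_simps power_mult_distrib)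
    also have "\<dots> \<le> ((\<bar>K\<bar> + 1) * C\<^sup>2 / m) * g u u"
      using g_lower[OF u] m_pos by (intro mult_left_mono) auto
    finally show ?thesis .
  qed
  moreover have "(\<bar>K\<bar> + 1) * C\<^sup>2 / m > 0" using C m_pos by simp
  ultimately show ?thesis by blast
qed

text \<open>Passing between \<open>g\<close> and \<open>N\<close> costs one fixed factor, so decay
  or growth measured with \<open>g\<close> over many steps keeps its rate.\<close>

lemma N_le_g:
  assumes u: "u \<in> V" and v: "v \<in> V" and a: "a \<ge> 0" and le: "g v v \<le> a * g u u"
  shows "N v \<le> sqrt ((\<bar>K\<bar> + 1) / m) * sqrt a * N u"
proof -
  have "m * (N v)\<^sup>2 \<le> a * g u u" using g_lower[OF v] le by simp
  also have "\<dots> \<le> a * (K * (N u)\<^sup>2)" using g_upper[OF u] a mult_left_mono by blast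
  also have "\<dots> \<le> a * ((\<bar>K\<bar> + 1) * (N u)\<^sup>2)" using a by (intro mult_left_mono mult_right_mono) auto
  finally have "(N v)\<^sup>2 \<le> (\<bar>K\<bar> + 1) / m * a * (N u)\<^sup>2" using m_pos by (simp add: field_simps)
  then have "N v \<le> sqrt ((\<bar>K\<bar> + 1) / m * a * (N u)\<^sup>2)" using real_le_rsqrt by blast
  then show ?thesis using N_nonneg[OF u] by (simp only: real_sqrt_mult real_sqrt_abs abs_of_nonneg)
qed

text \<open>A Lax-Milgram argument by iteration: \<open>A = z - T\<close> is coercive for
  \<open>g\<close> with constant \<open>\<delta>\<close>, hence \<open>1 - \<tau> A\<close>
  contracts \<open>g\<close> for the chosen \<open>\<tau>\<close>, and a Neumann series solves the
  equation.\<close>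

lemma regular_right_of:
  assumes z: "Re z > \<epsilon>"
  shows "regular N V T z"
proof -
  define \<delta> where "\<delta> = Re z - \<epsilon>"
  have \<delta>: "\<delta> > 0" using z by (simp add: \<delta>_def)
  define A where "A u = z *\<^sub>C u - T u" for u
  have A_V [simp]: "A u \<in> V" if "u \<in> V" for u using that by (simp add: A_def)
  obtain CT where CT: "CT > 0" "\<forall>u\<in>V. N (T u) \<le> CT * N u" using T_bound by blast
  have "linear_on V A"
    unfolding linear_on_def A_def using T_add T_scale
    by (simp add: scaleC_add_right cvs.scale_right_diff_distrib scaleC_scaleC mult.commute)
  moreover have "N (A u) \<le> (cmod z + CT) * N u" if "u \<in> V" for u
    using N_diff[of "z *\<^sub>C u" "T u"] CT that by (auto simp: A_def N_scale algebra_simps)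
  ultimately have A_op: "bounded_op N V A" unfolding bounded_op_def using A_V by blast
  have gA: "g (A u) u \<ge> \<delta> * g u u" if u: "u \<in> V" for u
  proof -
    have "g (A u) u = g (z *\<^sub>C u + of_real (- 1) *\<^sub>C T u) u" by (simp add: A_def)
    also have "\<dots> = g (z *\<^sub>C u) u + g (of_real (- 1) *\<^sub>C T u) u" using u by (intro g_add) auto
    also have "\<dots> = g (z *\<^sub>C u) u - g (T u) u" using u by (subst g_scale) auto
    finally show ?thesis using g_diss[OF u] u by (simp add: g_complex_scale \<delta>_def algebra_simps)
  qed
  obtain Q0 where Q0: "Q0 > 0" "\<forall>u\<in>V. g (A u) (A u) \<le> Q0 * g u u" using g_bounded[OF A_op] by blast
  \<comment> \<open>Adding \<open>\<delta>\<^sup>2\<close> makes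
    \<open>q = 1 - \<delta>\<^sup>2 / Q\<close> nonnegative.\<close>
  define Q where "Q = Q0 + \<delta>\<^sup>2"
  have Q: "g (A u) (A u) \<le> Q * g u u" if "u \<in> V" for u
  proof -
    have "Q0 * g u u \<le> Q * g u u" using g_nonneg[OF that] by (intro mult_right_mono) (auto simp: Q_def)
    then show ?thesis using Q0 that by force
  qed
  have Q_pos: "Q > 0" using Q0 \<delta> by (simp add: Q_def add_pos_nonneg)
  \<comment> \<open>The minimizer of \<open>1 - 2 * \<tau> * \<delta> + \<tau>\<^sup>2 * Q\<close>;
    the minimum is \<open>q\<close>.\<close>
  define \<tau> where "\<tau> = \<delta> / Q"
  define q where "q = 1 - \<delta>\<^sup>2 / Q"
  have \<tau>: "\<tau> > 0" using \<delta> Q_pos by (simp add: \<tau>_def)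
  have q: "0 \<le> q" "q < 1" using Q_pos Q0 \<delta> by (auto simp: q_def Q_def)
  define S where "S u = u + of_real (- \<tau>) *\<^sub>C A u" for u
  have gS: "g (S u) (S u) \<le> q * g u u" if u: "u \<in> V" for u
  proof -
    have "g (S u) (S u) = g u u + 2 * (- \<tau>) * g (A u) u + (- \<tau>)\<^sup>2 * g (A u) (A u)"
      unfolding S_def using u by (intro g_add_scaled) auto
    also have "\<dots> = g u u - 2 * \<tau> * g (A u) u + \<tau>\<^sup>2 * g (A u) (A u)" by simp
    also have "\<dots> \<le> g u u - 2 * \<tau> * (\<delta> * g u u) + \<tau>\<^sup>2 * (Q * g u u)"
      using gA[OF u] Q[OF u] \<tau> by (intro add_mono diff_mono mult_left_mono) auto
    also have "\<dots> = q * g u u"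
      using Q_pos by (simp add: \<tau>_def q_def power2_eq_square field_simps)
    finally show ?thesis .
  qed
  have S_V: "\<forall>u\<in>V. S u \<in> V" by (simp add: S_def)
  have "linear_on V S"
    unfolding linear_on_def S_def using \<open>linear_on V A\<close>
    by (auto simp: linear_on_def scaleC_add_right scaleC_scaleC mult.commute algebra_simps)
  moreover have "\<forall>u\<in>V. N (S u) \<le> sqrt ((\<bar>K\<bar> + 1) / m) * sqrt q * N u"
    using N_le_g gS q S_V by blast
  ultimately have "bounded_op N V S" unfolding bounded_op_def using S_V by blast
  then interpret S: operator V N S by unfold_locales
  have gSj: "g ((S ^^ j) w) ((S ^^ j) w) \<le> q ^ j * g w w" if w: "w \<in> V" for w j
  proof (induction j)
    case (Suc j)
    have "g ((S ^^ Suc j) w) ((S ^^ Suc j) w) \<le> q * g ((S ^^ j) w) ((S ^^ j) w)" using gS w by simp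
    also have "\<dots> \<le> q * (q ^ j * g w w)" using Suc q by (intro mult_left_mono) auto
    finally show ?case by simp
  qed simp
  show ?thesis
  proof (rule regularI)
    fix w assume w: "w \<in> V"
    let ?w = "complex_of_real \<tau> *\<^sub>C w"
    have "summable (\<lambda>j. N ((S ^^ j) ?w))"
    proof (rule summable_comparison_test)
      show "summable (\<lambda>j. sqrt ((\<bar>K\<bar> + 1) / m) * (sqrt q) ^ j * N ?w)"
        using q by (intro summable_mult2 summable_mult summable_geometric) auto
      have "N ((S ^^ j) ?w) \<le> sqrt ((\<bar>K\<bar> + 1) / m) * (sqrt q) ^ j * N ?w" for j
        using N_le_g[OF _ _ _ gSj, of ?w j] w q by (simp add: real_sqrt_power)
      then show "\<exists>M. \<forall>j\<ge>M. norm (N ((S ^^ j) ?w)) \<le> sqrt ((\<bar>K\<bar> + 1) / m) * (sqrt q) ^ j * N ?w"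
        using N_nonneg S.funpow_V w by auto
    qed
    from S.neumann[OF V_scale[OF w] this] obtain u where u: "u \<in> V" "u - S u = ?w" by blast
    then have "of_real \<tau> *\<^sub>C A u = of_real \<tau> *\<^sub>C w" by (simp add: S_def)
    then have "A u = w" using \<tau> by (metis cvs.scale_cancel_left less_irrefl of_real_eq_0_iff)
    then show "\<exists>u\<in>V. z *\<^sub>C u - T u = w" using u(1) by (auto simp: A_def)
  next
    fix u assume u: "u \<in> V"
    \<comment> \<open>Positivity at \<open>A u - \<delta> u\<close> takes the place of the
      Cauchy-Schwarz inequality for \<open>g\<close> and bounds \<open>g (A u) (A u)\<close> from
      below.\<close>
    have "0 \<le> g (A u + of_real (- \<delta>) *\<^sub>C u) (A u + of_real (- \<delta>) *\<^sub>C u)" using u by (intro g_nonneg) simp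
    also have "\<dots> = g (A u) (A u) - 2 * \<delta> * g u (A u) + \<delta>\<^sup>2 * g u u"
      using u by (subst g_add_scaled) auto
    also have "\<dots> \<le> g (A u) (A u) - 2 * \<delta> * (\<delta> * g u u) + \<delta>\<^sup>2 * g u u"
      using gA[OF u] \<delta> g_commute[of u "A u"] u by (intro add_right_mono diff_left_mono mult_left_mono) auto
    finally have "g u u \<le> (1 / \<delta>\<^sup>2) * g (A u) (A u)" using \<delta> by (simp add: field_simps power2_eq_square)
    then show "N u \<le> sqrt ((\<bar>K\<bar> + 1) / m) * sqrt (1 / \<delta>\<^sup>2) * N (z *\<^sub>C u - T u)"
      using N_le_g[of "A u" u] u by (simp add: A_def)
  qed
qed

text \<open>An Euler step of size \<open>h\<close> multiplies \<open>g\<close> by at most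
  \<open>exp (2 * h * \<epsilon> + h\<^sup>2 * Q)\<close>. Over the whole time the quadratic terms
  add up to \<open>t\<^sup>2 * Q\<close> divided by the number of steps and disappear in the
  limit.\<close>

lemma op_exp_dissipative:
  assumes u: "u \<in> V" and t: "t \<ge> 0"
  shows "N (op_exp N V T t u) \<le> sqrt ((\<bar>K\<bar> + 1) / m) * N u * exp (\<epsilon> * t)"
proof -
  obtain Q where Q: "Q > 0" "\<forall>u\<in>V. g (T u) (T u) \<le> Q * g u u" using g_bounded[OF bounded] by blast
  have step: "g (v + of_real h *\<^sub>C T v) (v + of_real h *\<^sub>C T v) \<le> exp (2 * h * \<epsilon> + h\<^sup>2 * Q) * g v v"
    if v: "v \<in> V" and h: "h \<ge> 0" for v h
  proof -
    have "g (v + of_real h *\<^sub>C T v) (v + of_real h *\<^sub>C T v) = g v v + 2 * h * g (T v) v + h\<^sup>2 * g (T v) (T v)"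
      using v by (intro g_add_scaled) auto
    also have "\<dots> \<le> g v v + 2 * h * (\<epsilon> * g v v) + h\<^sup>2 * (Q * g v v)"
      using g_diss[OF v] Q v h by (intro add_mono mult_left_mono) auto
    also have "\<dots> = (1 + (2 * h * \<epsilon> + h\<^sup>2 * Q)) * g v v" by (simp add: algebra_simps)
    also have "\<dots> \<le> exp (2 * h * \<epsilon> + h\<^sup>2 * Q) * g v v"
      by (intro mult_right_mono exp_ge_add_one_self g_nonneg v)
    finally show ?thesis .
  qed
  have E: "((\<lambda>u. u + of_real h *\<^sub>C T u) ^^ j) u \<in> V \<and>
    g (((\<lambda>u. u + of_real h *\<^sub>C T u) ^^ j) u) (((\<lambda>u. u + of_real h *\<^sub>C T u) ^^ j) u)
      \<le> exp (2 * h * \<epsilon> + h\<^sup>2 * Q) ^ j * g u u" if h: "h \<ge> 0" for h j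
  proof (induction j)
    case (Suc j)
    let ?v = "((\<lambda>u. u + of_real h *\<^sub>C T u) ^^ j) u"
    have "g (?v + of_real h *\<^sub>C T ?v) (?v + of_real h *\<^sub>C T ?v) \<le> exp (2 * h * \<epsilon> + h\<^sup>2 * Q) * g ?v ?v"
      using step Suc h by blast
    also have "\<dots> \<le> exp (2 * h * \<epsilon> + h\<^sup>2 * Q) * (exp (2 * h * \<epsilon> + h\<^sup>2 * Q) ^ j * g u u)"
      using Suc by (intro mult_left_mono) auto
    finally show ?case using Suc by (simp add: mult.assoc)
  qed (use u in simp)
  \<comment> \<open>\<open>Suc M\<close> steps, so that the step size never divides by zero.\<close>
  let ?E = "\<lambda>M. ((\<lambda>u. u + complex_of_real (t / real (Suc M)) *\<^sub>C T u) ^^ Suc M) u"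
  let ?a = "\<lambda>M. exp (2 * t * \<epsilon> + t\<^sup>2 * Q / real (Suc M))"
  have "exp (2 * (t / real (Suc M)) * \<epsilon> + (t / real (Suc M))\<^sup>2 * Q) ^ Suc M = ?a M" for M
  proof -
    have "real (Suc M) * (2 * (t / real (Suc M)) * \<epsilon> + (t / real (Suc M))\<^sup>2 * Q)
      = 2 * t * \<epsilon> + t\<^sup>2 * Q / real (Suc M)"
      by (simp add: field_simps power2_eq_square del: of_nat_Suc)
    then show ?thesis by (metis exp_of_nat_mult)
  qed
  then have "g (?E M) (?E M) \<le> ?a M * g u u" and E_V: "?E M \<in> V" for M
    using E[of "t / real (Suc M)" "Suc M"] t by auto
  then have le: "N (?E M) \<le> sqrt ((\<bar>K\<bar> + 1) / m) * sqrt (?a M) * N u" for M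
    by (intro N_le_g u) auto
  have "(\<lambda>M. sqrt ((\<bar>K\<bar> + 1) / m) * sqrt (?a M) * N u)
     \<longlonglongrightarrow> sqrt ((\<bar>K\<bar> + 1) / m) * sqrt (exp (2 * t * \<epsilon> + 0)) * N u"
    by (intro tendsto_intros LIMSEQ_Suc[OF lim_const_over_n])
  moreover have "sqrt (exp (2 * t * \<epsilon> + 0)) = exp (\<epsilon> * t)"
    by (rule real_sqrt_unique) (simp_all add: power2_eq_square flip: exp_add)
  ultimately show ?thesis
    using N_lim_le[of ?E, OF E_V op_exp_lim(1)[OF u, of t] LIMSEQ_Suc[OF op_exp_euler[OF u t]] le]
    by (simp add: mult_ac)
qed

end

subsection \<open>Splitting off finitely many eigenvectors\<close>

text \<open>Eigenvectors together with a biorthogonal family of eigenvectors of the transpose. This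
  makes both the span and the common kernel invariant, with bounded projections, before anything is
  known about the rest of the spectrum.\<close>

locale eigen_splitting = operator V N T for V :: "'a::complex_vs set" and N T +
  fixes I :: "'i set" and e :: "'i \<Rightarrow> 'a" and \<mu> :: "'i \<Rightarrow> complex" and \<theta> :: "'i \<Rightarrow> 'a \<Rightarrow> complex"
  assumes finite_I: "finite I"
    and e_V: "i \<in> I \<Longrightarrow> e i \<in> V"
    and T_e: "i \<in> I \<Longrightarrow> T (e i) = \<mu> i *\<^sub>C e i"
    and \<theta>_dual: "i \<in> I \<Longrightarrow> \<theta> i \<in> dual_space N V"
    and \<theta>_e: "i \<in> I \<Longrightarrow> j \<in> I \<Longrightarrow> \<theta> i (e j) = (if i = j then 1 else 0)"
    and \<theta>_T: "i \<in> I \<Longrightarrow> u \<in> V \<Longrightarrow> \<theta> i (T u) = \<mu> i * \<theta> i u"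
begin

text \<open>The projection onto the span of the \<open>e i\<close> along \<open>rest J\<close>. For
  the indices sharing one eigenvalue it is identified below with the Riesz projection.\<close>

definition part :: "'i set \<Rightarrow> 'a \<Rightarrow> 'a" where
  "part J u = (\<Sum>i\<in>J. \<theta> i u *\<^sub>C e i)"

definition rest :: "'i set \<Rightarrow> 'a set" where
  "rest J = ker_on V (\<theta> ` J)"

lemma rest_iff: "u \<in> rest J \<longleftrightarrow> u \<in> V \<and> (\<forall>i\<in>J. \<theta> i u = 0)"
  by (auto simp: rest_def ker_on_def)

lemma \<theta>_lin: "i \<in> I \<Longrightarrow> linear_on V (\<theta> i)"
  using \<theta>_dual by (auto simp: dual_space_def)

lemma \<theta>_add: "i \<in> I \<Longrightarrow> u \<in> V \<Longrightarrow> v \<in> V \<Longrightarrow> \<theta> i (u + v) = \<theta> i u + \<theta> i v"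
  and \<theta>_scale: "i \<in> I \<Longrightarrow> u \<in> V \<Longrightarrow> \<theta> i (c *\<^sub>C u) = c * \<theta> i u"
  using \<theta>_lin[of i] by (auto simp: linear_on_def scaleC_complex_def)

lemma \<theta>_diff: "i \<in> I \<Longrightarrow> u \<in> V \<Longrightarrow> v \<in> V \<Longrightarrow> \<theta> i (u - v) = \<theta> i u - \<theta> i v"
  using linear_on_diff[OF \<theta>_lin subspace] .

lemma e_neq_0: "i \<in> I \<Longrightarrow> e i \<noteq> 0"
  using \<theta>_e[of i i] linear_on_0[OF \<theta>_lin subspace, of i] by auto

lemma part_V [simp]: "J \<subseteq> I \<Longrightarrow> part J u \<in> V"
  unfolding part_def using e_V by (intro V_sum V_scale) auto

lemma \<theta>_part:
  assumes "J \<subseteq> I" "i \<in> I"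
  shows "\<theta> i (part J u) = (if i \<in> J then \<theta> i u else 0)"
proof -
  have fin: "finite J" using assms finite_I finite_subset by blast
  have "\<theta> i (part J u) = (\<Sum>j\<in>J. \<theta> i (\<theta> j u *\<^sub>C e j))"
    unfolding part_def using e_V assms by (intro linear_on_sum[OF \<theta>_lin subspace]) auto
  also have "\<dots> = (\<Sum>j\<in>J. if i = j then \<theta> i u else 0)"
    using assms e_V by (intro sum.cong) (auto simp: \<theta>_scale \<theta>_e)
  finally show ?thesis using fin by simp
qed

lemma T_part: "J \<subseteq> I \<Longrightarrow> T (part J u) = (\<Sum>i\<in>J. \<mu> i *\<^sub>C \<theta> i u *\<^sub>C e i)"
  unfolding part_def using e_V T_e
  by (subst T_sum) (auto intro!: sum.cong simp: T_scale scaleC_scaleC mult.commute subset_iff)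

lemma diff_part_rest: "J \<subseteq> I \<Longrightarrow> u \<in> V \<Longrightarrow> u - part J u \<in> rest J"
  by (auto simp: rest_iff \<theta>_diff \<theta>_part subset_iff)

lemma part_rest: "u \<in> rest J \<Longrightarrow> part J u = 0"
  by (simp add: part_def rest_iff)

lemma image_diff_part:
  assumes J: "J \<subseteq> I"
  shows "(\<lambda>u. u - part J u) ` V = rest J"
proof
  show "rest J \<subseteq> (\<lambda>u. u - part J u) ` V"
  proof
    fix u assume "u \<in> rest J"
    then have "u = u - part J u" "u \<in> V" by (simp_all add: part_rest rest_iff)
    then show "u \<in> (\<lambda>u. u - part J u) ` V" by blast
  qed
qed (use diff_part_rest[OF J] in auto)

lemma operator_rest:
  assumes J: "J \<subseteq> I"
  shows "operator (rest J) N T"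
proof -
  have "\<theta> ` J \<subseteq> dual_space N V" using \<theta>_dual J by auto
  then interpret R: nspace "rest J" N unfolding rest_def by (rule nspace_ker)
  obtain C where "\<forall>u\<in>V. N (T u) \<le> C * N u" using T_bound by blast
  then have "\<forall>u\<in>rest J. N (T u) \<le> C * N u" by (simp add: rest_iff)
  moreover have "linear_on (rest J) T" using T_lin by (simp add: linear_on_def rest_iff)
  moreover have "\<forall>u\<in>rest J. T u \<in> rest J" using \<theta>_T J by (auto simp: rest_iff subset_iff)
  ultimately have "bounded_op N (rest J) T" unfolding bounded_op_def by blast
  then show ?thesis by unfold_locales
qed

lemma part_bounded:
  assumes J: "J \<subseteq> I"
  shows "bounded_op N V (part J)"
proof -
  have fin: "finite J" using assms finite_I finite_subset by blast
  have "\<forall>i\<in>J. \<exists>C. \<forall>u\<in>V. cmod (\<theta> i u) \<le> C * N u" using \<theta>_dual J by (auto simp: dual_space_def)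
  then obtain C where C: "\<And>i u. i \<in> J \<Longrightarrow> u \<in> V \<Longrightarrow> cmod (\<theta> i u) \<le> C i * N u" by metis
  have "N (part J u) \<le> (\<Sum>i\<in>J. C i * N (e i)) * N u" if u: "u \<in> V" for u
  proof -
    have "N (part J u) \<le> (\<Sum>i\<in>J. N (\<theta> i u *\<^sub>C e i))"
      unfolding part_def using e_V J by (intro N_sum) auto
    also have "\<dots> \<le> (\<Sum>i\<in>J. C i * N (e i) * N u)"
    proof (rule sum_mono)
      fix i assume i: "i \<in> J"
      have "N (\<theta> i u *\<^sub>C e i) \<le> (C i * N u) * N (e i)"
        using C[OF i u] e_V i J N_nonneg by (subst N_scale) (auto intro!: mult_right_mono)
      then show "N (\<theta> i u *\<^sub>C e i) \<le> C i * N (e i) * N u" by (simp add: mult_ac)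
    qed
    finally show ?thesis by (simp add: sum_distrib_right)
  qed
  moreover have "linear_on V (part J)"
    unfolding linear_on_def part_def using J
    by (auto simp: \<theta>_add \<theta>_scale subset_iff scaleC_add_left sum.distrib cvs.scale_sum_right scaleC_scaleC
        intro!: sum.cong)
  ultimately show ?thesis unfolding bounded_op_def using J by auto
qed

text \<open>Applying \<open>\<theta> i\<close> to the equation multiplies by
  \<open>z - \<mu> i\<close>, which is nonzero because each \<open>\<mu> i\<close> is an eigenvalue.
  So for a right-hand side in \<open>rest J\<close> the solution lies there as well.\<close>

lemma regular_rest:
  assumes J: "J \<subseteq> I" and reg: "regular N V T z"
  shows "regular N (rest J) T z"
proof -
  interpret R: operator "rest J" N T by (rule operator_rest[OF J])
  obtain K where K: "K > 0" "\<And>u. u \<in> V \<Longrightarrow> N u \<le> K * N (z *\<^sub>C u - T u)"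
    and R_V: "\<And>w. w \<in> V \<Longrightarrow> resolvent V T z w \<in> V"
    and R_eq: "\<And>w. w \<in> V \<Longrightarrow> z *\<^sub>C resolvent V T z w - T (resolvent V T z w) = w"
    using regularE[OF reg] by metis
  have nz: "z \<noteq> \<mu> i" if "i \<in> I" for i
    using eigenvalue_not_regular[of "\<mu> i"] reg e_V[OF that] T_e[OF that] e_neq_0[OF that]
    by (auto simp: eigenvalue_def eigenspace_def)
  show ?thesis
  proof (rule R.regularI[where C = K])
    fix w assume w: "w \<in> rest J"
    then have wV: "w \<in> V" by (simp add: rest_iff)
    let ?u = "resolvent V T z w"
    have "\<theta> i ?u = 0" if i: "i \<in> J" for i
    proof -
      have iI: "i \<in> I" using i J by auto
      have "\<theta> i (z *\<^sub>C ?u - T ?u) = (z - \<mu> i) * \<theta> i ?u"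
        using R_V[OF wV] iI by (simp add: \<theta>_diff \<theta>_scale \<theta>_T left_diff_distrib)
      moreover have "\<theta> i (z *\<^sub>C ?u - T ?u) = 0" using R_eq[OF wV] w i by (simp add: rest_iff)
      ultimately show ?thesis using nz[OF iI] by simp
    qed
    then have "?u \<in> rest J" using R_V[OF wV] by (simp add: rest_iff)
    then show "\<exists>u\<in>rest J. z *\<^sub>C u - T u = w" using R_eq[OF wV] by blast
  qed (use K in \<open>auto simp: rest_iff\<close>)
qed

lemma part_inverse:
  assumes J: "J \<subseteq> I" and z: "z \<notin> \<mu> ` J"
  defines "v w \<equiv> \<Sum>i\<in>J. (\<theta> i w / (z - \<mu> i)) *\<^sub>C e i"
  shows "v w \<in> V" "z *\<^sub>C v w - T (v w) = part J w"
proof -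
  show "v w \<in> V" unfolding v_def using e_V J by (intro V_sum V_scale) auto
  have "T (v w) = (\<Sum>i\<in>J. (\<theta> i w / (z - \<mu> i)) *\<^sub>C \<mu> i *\<^sub>C e i)"
    unfolding v_def using e_V T_e J by (subst T_sum) (auto intro!: sum.cong simp: T_scale subset_iff)
  then have "z *\<^sub>C v w - T (v w) = (\<Sum>i\<in>J. ((\<theta> i w / (z - \<mu> i)) * (z - \<mu> i)) *\<^sub>C e i)"
    unfolding v_def
    by (simp add: cvs.scale_sum_right scaleC_scaleC right_diff_distrib cvs.scale_left_diff_distrib
        mult.commute sum_subtractf diff_divide_distrib)
  also have "\<dots> = part J w"
    unfolding part_def using z by (intro sum.cong) auto
  finally show "z *\<^sub>C v w - T (v w) = part J w" .
qed

text \<open>\<open>z - T\<close> is block diagonal for \<open>rest J\<close> and the span of the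
  eigenvectors, where \<open>part_inverse\<close> inverts it explicitly; the bounds of the two
  inverses combine.\<close>

lemma regular_from_rest:
  assumes J: "J \<subseteq> I" and z: "z \<notin> \<mu> ` J" and reg: "regular N (rest J) T z"
  shows "regular N V T z"
proof -
  interpret R: operator "rest J" N T by (rule operator_rest[OF J])
  obtain K where K: "K > 0" "\<And>u. u \<in> rest J \<Longrightarrow> N u \<le> K * N (z *\<^sub>C u - T u)"
    and R_V: "\<And>w. w \<in> rest J \<Longrightarrow> resolvent (rest J) T z w \<in> rest J"
    and R_eq: "\<And>w. w \<in> rest J \<Longrightarrow> z *\<^sub>C resolvent (rest J) T z w - T (resolvent (rest J) T z w) = w"
    using R.regularE[OF reg] by metis
  interpret P: operator V N "part J" by unfold_locales (rule part_bounded[OF J])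
  obtain Cp where Cp: "Cp > 0" "\<forall>u\<in>V. N (part J u) \<le> Cp * N u" using P.T_bound by blast
  have fin: "finite J" using assms finite_I finite_subset by blast
  define S where "S w = (\<Sum>i\<in>J. (\<theta> i w / (z - \<mu> i)) *\<^sub>C e i)" for w
  have S: "S w \<in> V" "z *\<^sub>C S w - T (S w) = part J w" for w
    using part_inverse[OF J z, of w] by (auto simp: S_def)
  have "\<forall>i\<in>J. \<exists>C. \<forall>u\<in>V. cmod (\<theta> i u) \<le> C * N u" using \<theta>_dual J by (auto simp: dual_space_def)
  then obtain C where C: "\<And>i u. i \<in> J \<Longrightarrow> u \<in> V \<Longrightarrow> cmod (\<theta> i u) \<le> C i * N u" by metis
  define Cs where "Cs = (\<Sum>i\<in>J. C i / cmod (z - \<mu> i) * N (e i))"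
  have S_bd: "N (S w) \<le> Cs * N w" if w: "w \<in> V" for w
  proof -
    have "N (S w) \<le> (\<Sum>i\<in>J. N ((\<theta> i w / (z - \<mu> i)) *\<^sub>C e i))"
      unfolding S_def using e_V J by (intro N_sum) auto
    also have "\<dots> \<le> (\<Sum>i\<in>J. C i / cmod (z - \<mu> i) * N (e i) * N w)"
    proof (rule sum_mono)
      fix i assume i: "i \<in> J"
      have "N ((\<theta> i w / (z - \<mu> i)) *\<^sub>C e i) \<le> (C i * N w) / cmod (z - \<mu> i) * N (e i)"
        using C[OF i w] e_V i J N_nonneg
        by (subst N_scale) (auto intro!: mult_right_mono divide_right_mono simp: norm_divide)
      then show "N ((\<theta> i w / (z - \<mu> i)) *\<^sub>C e i) \<le> C i / cmod (z - \<mu> i) * N (e i) * N w"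
        by (simp add: mult_ac)
    qed
    finally show ?thesis by (simp add: sum_distrib_right Cs_def)
  qed
  show ?thesis
  proof (rule regularI)
    fix w assume w: "w \<in> V"
    let ?y = "w - part J w"
    let ?r = "resolvent (rest J) T z ?y"
    have y: "?y \<in> rest J" using diff_part_rest J w by blast
    have rV: "?r \<in> V" using R_V[OF y] by (simp add: rest_iff)
    have "z *\<^sub>C (?r + S w) - T (?r + S w) = ?y + part J w"
      using shift_linear[OF rV S(1), of z 1] R_eq[OF y] S(2) by simp
    then show "\<exists>u\<in>V. z *\<^sub>C u - T u = w" using rV S(1) by (intro bexI[of _ "?r + S w"]) auto
  next
    fix u assume u: "u \<in> V"
    let ?w = "z *\<^sub>C u - T u" and ?y = "u - part J u"
    have wV: "?w \<in> V" using u by simp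
    have y: "?y \<in> rest J" using diff_part_rest J u by blast
    have th: "\<theta> i ?w = (z - \<mu> i) * \<theta> i u" if "i \<in> J" for i
    proof -
      have "i \<in> I" using that J by auto
      then show ?thesis using u by (simp add: \<theta>_diff \<theta>_scale \<theta>_T left_diff_distrib)
    qed
    have pS: "part J u = S ?w"
      unfolding part_def S_def using z by (intro sum.cong) (auto simp: th)
    have "z *\<^sub>C ?y - T ?y = ?w - part J ?w"
      using shift_linear[OF u part_V[OF J], of z "- 1" u] S(2)[of ?w] by (simp add: pS)
    then have "N ?y \<le> K * N (?w - part J ?w)" using K(2)[OF y] by simp
    also have "\<dots> \<le> K * (N ?w + Cp * N ?w)"
      using N_diff[OF wV part_V[OF J], of ?w] Cp(2)[rule_format, OF wV] K(1)
      by (intro mult_left_mono) linarith+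
    finally have "N ?y \<le> K * (N ?w + Cp * N ?w)" .
    moreover have "N u \<le> N ?y + N (part J u)" using N_triangle[of ?y "part J u"] u J by simp
    moreover have "N (part J u) \<le> Cs * N ?w" using S_bd[OF wV] pS by simp
    ultimately show "N u \<le> (K * (1 + Cp) + Cs) * N ?w" by (simp add: algebra_simps)
  qed
qed

lemma spectrum_splitting:
  assumes "J \<subseteq> I"
  shows "z \<in> spectrum N V T \<longleftrightarrow> z \<in> \<mu> ` J \<or> z \<in> spectrum N (rest J) T"
proof -
  have "\<not> regular N V T (\<mu> i)" if "i \<in> J" for i
  proof (rule eigenvalue_not_regular)
    have "i \<in> I" using that assms by auto
    then show "eigenvalue V T (\<mu> i)"
      unfolding eigenvalue_def eigenspace_def using e_V T_e e_neq_0 by blast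
  qed
  then show ?thesis
    using regular_from_rest[OF assms] regular_rest[OF assms] unfolding spectrum_regular by blast
qed

lemma op_exp_rest:
  assumes J: "J \<subseteq> I" and u: "u \<in> rest J"
  shows "op_exp N (rest J) T t u = op_exp N V T t u"
proof -
  interpret R: operator "rest J" N T by (rule operator_rest[OF J])
  show ?thesis
    using op_exp_unique[of u "op_exp N (rest J) T t u"] R.op_exp_lim[OF u, of t] u by (simp add: rest_iff)
qed

lemma op_exp_part: "J \<subseteq> I \<Longrightarrow> op_exp N V T t (part J u) = (\<Sum>i\<in>J. (exp (of_real t * \<mu> i) * \<theta> i u) *\<^sub>C e i)"
proof (induction J rule: infinite_finite_induct)
  case (infinite J)
  then show ?case using finite_I finite_subset by blast
next
  case empty
  then show ?case using op_exp_eigen[of 0 0 t 0] T_0 by (simp add: part_def)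
next
  case (insert i J)
  then have "part (insert i J) u = \<theta> i u *\<^sub>C e i + part J u" by (simp add: part_def)
  then show ?case using insert e_V T_e op_exp_eigen[of "e i" "\<mu> i" t "\<theta> i u"] by (simp add: op_exp_add)
qed

text \<open>A vector of \<open>rest J\<close> is split further against all of \<open>I\<close>: the
  slow remainder grows like exp (\<beta> t), and each remaining eigenvector at its own rate.\<close>

lemma op_exp_rest_growth:
  assumes J: "J \<subseteq> I"
    and growth: "\<And>t y. t \<ge> 0 \<Longrightarrow> y \<in> rest I \<Longrightarrow> N (op_exp N (rest I) T t y) \<le> C * N y * exp (\<beta> * t)"
    and C: "C \<ge> 0" and \<mu>: "\<And>i. i \<in> I - J \<Longrightarrow> Re (\<mu> i) \<le> \<beta>"
  shows "\<exists>C. C \<ge> 0 \<and> (\<forall>t\<ge>0. \<forall>u\<in>rest J. N (op_exp N V T t u) \<le> C * exp (\<beta> * t) * N u)"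
proof -
  interpret P: operator V N "part I" by unfold_locales (rule part_bounded, simp)
  obtain Cp where Cp: "Cp > 0" "\<forall>u\<in>V. N (part I u) \<le> Cp * N u" using P.T_bound by blast
  have "\<forall>i\<in>I. \<exists>C. \<forall>u\<in>V. cmod (\<theta> i u) \<le> C * N u" using \<theta>_dual by (auto simp: dual_space_def)
  then obtain D where D: "\<And>i u. i \<in> I \<Longrightarrow> u \<in> V \<Longrightarrow> cmod (\<theta> i u) \<le> D i * N u" by metis
  define C' where "C' = C * (1 + Cp) + (\<Sum>i\<in>I. \<bar>D i\<bar> * N (e i))"
  have "N (op_exp N V T t u) \<le> C' * exp (\<beta> * t) * N u" if t: "t \<ge> 0" and uJ: "u \<in> rest J" for t u
  proof -
    have u: "u \<in> V" using uJ by (simp add: rest_iff)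
    let ?y = "u - part I u"
    have y: "?y \<in> rest I" using diff_part_rest[of I u] u by simp
    have "N (op_exp N V T t u) = N (op_exp N V T t ?y + op_exp N V T t (part I u))"
      using op_exp_add[of ?y "part I u" t] u by simp
    also have "\<dots> \<le> N (op_exp N V T t ?y) + N (op_exp N V T t (part I u))"
      using u by (intro N_triangle op_exp_lim(1)) auto
    also have "N (op_exp N V T t ?y) \<le> C * N ?y * exp (\<beta> * t)"
      using growth[OF t y] op_exp_rest[OF _ y, of t] by simp
    also have "\<dots> \<le> C * ((1 + Cp) * N u) * exp (\<beta> * t)"
      using N_diff[OF u part_V[of I u]] Cp u C
      by (intro mult_right_mono mult_left_mono) (auto simp: algebra_simps intro: order_trans)
    also have "N (op_exp N V T t (part I u)) \<le> (\<Sum>i\<in>I. N ((exp (of_real t * \<mu> i) * \<theta> i u) *\<^sub>C e i))"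
      unfolding op_exp_part[OF order_refl] using e_V by (intro N_sum) auto
    also have "\<dots> \<le> (\<Sum>i\<in>I. \<bar>D i\<bar> * N (e i) * (exp (\<beta> * t) * N u))"
    proof (rule sum_mono)
      fix i assume i: "i \<in> I"
      \<comment> \<open>For \<open>i\<close> in \<open>J\<close> the coefficient vanishes, however
        large the rate is.\<close>
      have "cmod (exp (of_real t * \<mu> i) * \<theta> i u) \<le> exp (\<beta> * t) * (\<bar>D i\<bar> * N u)"
      proof (cases "i \<in> J")
        case True
        then show ?thesis using uJ N_nonneg[OF u] by (simp add: rest_iff)
      next
        case False
        have "cmod (exp (of_real t * \<mu> i)) \<le> exp (\<beta> * t)"
          using \<mu>[of i] False i t by (simp add: mult.commute[of \<beta>] mult_left_mono)
        moreover have "cmod (\<theta> i u) \<le> \<bar>D i\<bar> * N u"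
          using D[OF i u] mult_right_mono[OF abs_ge_self N_nonneg[OF u], of "D i"] by simp
        ultimately show ?thesis unfolding norm_mult by (intro mult_mono) auto
      qed
      then have "N ((exp (of_real t * \<mu> i) * \<theta> i u) *\<^sub>C e i) \<le> exp (\<beta> * t) * (\<bar>D i\<bar> * N u) * N (e i)"
        using e_V[OF i] N_nonneg by (subst N_scale) (auto intro!: mult_right_mono)
      then show "N ((exp (of_real t * \<mu> i) * \<theta> i u) *\<^sub>C e i) \<le> \<bar>D i\<bar> * N (e i) * (exp (\<beta> * t) * N u)"
        by (simp add: mult_ac)
    qed
    also have "\<dots> = (\<Sum>i\<in>I. \<bar>D i\<bar> * N (e i)) * (exp (\<beta> * t) * N u)" by (simp add: sum_distrib_right)
    finally show ?thesis by (simp add: C'_def algebra_simps)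
  qed
  moreover have "C' \<ge> 0"
    unfolding C'_def using C Cp N_nonneg e_V by (intro add_nonneg_nonneg sum_nonneg mult_nonneg_nonneg) auto
  ultimately show ?thesis by blast
qed

text \<open>Near \<open>z0\<close> the resolvent of \<open>u\<close> is a function holomorphic on the whole disk plus
  \<open>part J u / (z - z0)\<close>.\<close>

lemma riesz_projection_eq:
  assumes J: "J = {i\<in>I. \<mu> i = z0}" and reg0: "regular N (rest J) T z0"
    and iso: "isolating_radius N V T z0 r0" and u: "u \<in> V"
  shows "riesz_projection N V T z0 u = part J u"
proof -
  have JI: "J \<subseteq> I" using J by auto
  interpret R: operator "rest J" N T by (rule operator_rest[OF JI])
  have integral: "((\<lambda>z. \<phi> (resolvent V T z u)) has_contour_integral (2 * of_real pi * \<i> * \<phi> (part J u)))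
      (circlepath z0 r)" if r: "isolating_radius N V T z0 r" and \<phi>: "\<phi> \<in> dual_space N V" for r \<phi>
  proof -
    have r_pos: "r > 0" and sp: "spectrum N V T \<inter> cball z0 r = {z0}"
      using r by (auto simp: isolating_radius_def)
    have \<phi>lin: "linear_on V \<phi>" using \<phi> by (auto simp: dual_space_def)
    let ?y = "u - part J u"
    have y: "?y \<in> rest J" using diff_part_rest JI u by blast
    have regV: "regular N V T z" if "z \<in> cball z0 r" "z \<noteq> z0" for z
    proof -
      have "z \<notin> spectrum N V T" using sp that by blast
      then show ?thesis by (simp add: spectrum_regular)
    qed
    \<comment> \<open>\<open>regular_rest\<close> covers the punctured disk and \<open>reg0\<close>
      its centre. Hence the contribution of the rest is holomorphic on the whole disk and integrates
      to 0.\<close>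
    have regY: "regular N (rest J) T z" if "z \<in> cball z0 r" for z
      using regV[OF that] reg0 regular_rest[OF JI] by (cases "z = z0") auto
    have \<phi>': "\<phi> \<in> dual_space N (rest J)"
    proof -
      obtain C where "\<forall>u\<in>V. cmod (\<phi> u) \<le> C * N u" using \<phi> by (auto simp: dual_space_def)
      then have "\<forall>u\<in>rest J. cmod (\<phi> u) \<le> C * N u" by (simp add: rest_iff)
      moreover have "linear_on (rest J) \<phi>" using \<phi>lin by (simp add: linear_on_def rest_iff)
      ultimately show ?thesis unfolding dual_space_def by blast
    qed
    have hol: "(\<lambda>z. \<phi> (resolvent (rest J) T z ?y)) holomorphic_on {z. regular N (rest J) T z}"
      by (rule R.resolvent_dual_differentiable[OF \<phi>' y R.regular_open]) simp
    have hol_ball: "(\<lambda>z. \<phi> (resolvent (rest J) T z ?y)) holomorphic_on cball z0 r"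
      by (rule holomorphic_on_subset[OF hol]) (use regY in auto)
    have 1: "((\<lambda>z. \<phi> (resolvent (rest J) T z ?y)) has_contour_integral 0) (circlepath z0 r)"
    proof (rule Cauchy_theorem_disc[where K = "{}" and a = z0 and e = r])
      show "continuous_on (cball z0 r) (\<lambda>z. \<phi> (resolvent (rest J) T z ?y))"
        using hol_ball by (rule holomorphic_on_imp_continuous_on)
      fix z assume "z \<in> ball z0 r - {}"
      then have "z \<in> {z. regular N (rest J) T z}" using regY by auto
      then show "(\<lambda>z. \<phi> (resolvent (rest J) T z ?y)) field_differentiable at z"
        using holomorphic_on_imp_differentiable_at[OF hol R.regular_open] by blast
    qed (use r_pos in auto)
    have 2: "((\<lambda>z. \<phi> (part J u) / (z - z0)) has_contour_integral (2 * of_real pi * \<i> * \<phi> (part J u)))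
       (circlepath z0 r)"
      using Cauchy_integral_circlepath_simple[of "\<lambda>_. \<phi> (part J u)" z0 r z0] r_pos by auto
    have eq: "\<phi> (resolvent (rest J) T z ?y) + \<phi> (part J u) / (z - z0) = \<phi> (resolvent V T z u)"
      if z: "z \<in> path_image (circlepath z0 r)" for z
    proof -
      have z': "z \<in> cball z0 r" "z \<noteq> z0" using z r_pos by (auto simp: path_image_circlepath)
      let ?r = "resolvent (rest J) T z ?y"
      have rr: "?r \<in> rest J" "z *\<^sub>C ?r - T ?r = ?y" using R.regularE[OF regY[OF z'(1)]] y by metis+
      then have rV: "?r \<in> V" by (simp add: rest_iff)
      have "(\<Sum>i\<in>J. (\<theta> i u / (z - \<mu> i)) *\<^sub>C e i) = (1 / (z - z0)) *\<^sub>C part J u"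
        unfolding part_def cvs.scale_sum_right using J by (intro sum.cong) (auto simp: scaleC_scaleC)
      then have "(1 / (z - z0)) *\<^sub>C part J u \<in> V"
        "z *\<^sub>C (1 / (z - z0)) *\<^sub>C part J u - T ((1 / (z - z0)) *\<^sub>C part J u) = part J u"
        using part_inverse[OF JI, of z u] J z'(2) by auto
      then have "resolvent V T z u = ?r + (1 / (z - z0)) *\<^sub>C part J u"
        using rr rV shift_linear[OF rV, of "(1 / (z - z0)) *\<^sub>C part J u" z 1]
        by (intro resolvent_eqI[OF regV[OF z']]) auto
      then show ?thesis
        using \<phi>lin rV part_V[OF JI, of u] by (simp add: linear_on_def scaleC_complex_def)
    qed
    show ?thesis
      by (rule has_contour_integral_eq[OF has_contour_integral_add[OF 1 2, simplified] eq])
  qed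
  show ?thesis
    unfolding riesz_projection_def
  proof (rule the_equality)
    show "part J u \<in> V \<and> (\<forall>r. isolating_radius N V T z0 r \<longrightarrow> (\<forall>\<phi>\<in>dual_space N V.
       ((\<lambda>z. \<phi> (resolvent V T z u)) has_contour_integral (2 * of_real pi * \<i> * \<phi> (part J u)))
         (circlepath z0 r)))"
      using integral JI by simp
    fix v assume v: "v \<in> V \<and> (\<forall>r. isolating_radius N V T z0 r \<longrightarrow> (\<forall>\<phi>\<in>dual_space N V.
       ((\<lambda>z. \<phi> (resolvent V T z u)) has_contour_integral (2 * of_real pi * \<i> * \<phi> v)) (circlepath z0 r)))"
    \<comment> \<open>Functionals separate points, and the radius \<open>r0\<close> guarantees that
      the condition on \<open>v\<close> is not vacuous.\<close>
    show "v = part J u"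
    proof (rule ccontr)
      assume "v \<noteq> part J u"
      then obtain \<phi> where \<phi>: "\<phi> \<in> dual_space N V" "\<phi> (v - part J u) \<noteq> 0"
        using separating[of "v - part J u"] v JI by auto
      then have lin: "linear_on V \<phi>" by (auto simp: dual_space_def)
      have "2 * of_real pi * \<i> * \<phi> v = 2 * of_real pi * \<i> * \<phi> (part J u)"
        using v \<phi>(1) iso integral[OF iso \<phi>(1)] has_contour_integral_unique by blast
      then have "\<phi> v = \<phi> (part J u)" by simp
      then show False using \<phi>(2) linear_on_diff[OF lin subspace, of v "part J u"] v JI by simp
    qed
  qed
qed

lemma part_image:
  assumes J: "J \<subseteq> I"
  shows "part J ` V = cspan (e ` J)"
proof
  show "part J ` V \<subseteq> cspan (e ` J)"
    unfolding part_def by (auto intro!: cvs.span_sum cvs.span_scale intro: cvs.span_base)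
  have fin: "finite J" using J finite_I finite_subset by blast
  show "cspan (e ` J) \<subseteq> part J ` V"
  proof
    fix u assume "u \<in> cspan (e ` J)"
    then have "u \<in> V \<and> part J u = u"
    proof (induction rule: cvs.span_induct_alt)
      case base
      then show ?case using linear_on_0[OF \<theta>_lin subspace] J by (auto simp: part_def intro!: sum.neutral)
    next
      case (step c x y)
      then obtain i where i: "i \<in> J" "x = e i" by blast
      have x: "x \<in> V" using i e_V J by auto
      have "part J x = x"
      proof -
        have "part J x = (\<Sum>j\<in>J. if j = i then e i else 0)"
          unfolding part_def using i J by (intro sum.cong) (auto simp: \<theta>_e subset_iff)
        then show ?thesis using i fin by simp
      qed
      moreover have "linear_on V (part J)" using part_bounded[OF J] by (simp add: bounded_op_def)
      ultimately show ?case using step x by (simp add: linear_on_def)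
    qed
    then show "u \<in> part J ` V" by force
  qed
qed

lemma cdim_span:
  assumes J: "J \<subseteq> I"
  shows "cdim (cspan (e ` J)) = card J"
proof -
  have fin: "finite J" using J finite_I finite_subset by blast
  have inj: "inj_on e J"
  proof (rule inj_onI)
    fix i j assume ij: "i \<in> J" "j \<in> J" "e i = e j"
    then have "i \<in> I" "j \<in> I" using J by auto
    then have "(if i = j then 1 else 0 :: complex) = 1" using \<theta>_e[of i j] \<theta>_e[of i i] ij(3) by simp
    then show "i = j" by (simp split: if_splits)
  qed
  have "\<not> cvs.dependent (e ` J)"
  proof
    assume "cvs.dependent (e ` J)"
    then obtain i where i: "i \<in> J" "e i \<in> cspan (e ` J - {e i})" by (auto simp: cvs.dependent_def)
    have "e ` J - {e i} = e ` (J - {i})" using inj i(1) by (auto simp: inj_on_def)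
    then obtain u where "u \<in> V" "e i = part (J - {i}) u" using i part_image[of "J - {i}"] J by auto
    then have "\<theta> i (e i) = 0" using \<theta>_part[of "J - {i}" i u] i J by auto
    then show False using \<theta>_e[of i i] i J by auto
  qed
  then show ?thesis using cvs.dim_span_eq_card_independent inj by (metis card_image)
qed

end

section \<open>Weighted square-summable families\<close>

text \<open>Common form of \<open>sobolev1\<close>, \<open>sobolev2\<close> and \<open>L2\<close>,
  which differ only in the index set and the weight.\<close>

definition wsp :: "('i \<Rightarrow> real) \<Rightarrow> ('i \<Rightarrow> complex) set" where
  "wsp w = {c. (\<lambda>m. w m * (cmod (c m))\<^sup>2) summable_on UNIV}"

definition wn :: "('i \<Rightarrow> real) \<Rightarrow> ('i \<Rightarrow> complex) \<Rightarrow> real" where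
  "wn w c = sqrt (\<Sum>\<^sub>\<infinity>m. w m * (cmod (c m))\<^sup>2)"

text \<open>The weight \<open>p\<close> may change sign and may differ from the weight of the space;
  a bound of \<open>p\<close> by a multiple of \<open>w\<close> makes the sum converge on
  \<open>wsp w\<close>.\<close>

definition cip :: "('i \<Rightarrow> real) \<Rightarrow> ('i \<Rightarrow> complex) \<Rightarrow> ('i \<Rightarrow> complex) \<Rightarrow> complex" where
  "cip p c d = (\<Sum>\<^sub>\<infinity>m. of_real (p m) * (c m * cnj (d m)))"

abbreviation wabs :: "('i \<Rightarrow> real) \<Rightarrow> ('i \<Rightarrow> complex) \<Rightarrow> 'i \<Rightarrow> real" where
  "wabs w c m \<equiv> sqrt (w m) * cmod (c m)"

lemma sum_apply: "(sum f A) m = (\<Sum>j\<in>A. f j m)"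
  by (induction A rule: infinite_finite_induct) auto

lemma sqrt_sum_wabs:
  assumes "\<forall>m. w m \<ge> 0"
  shows "L2_set (wabs w c) F = sqrt (\<Sum>m\<in>F. w m * (cmod (c m))\<^sup>2)"
  using assms by (simp add: L2_set_def power_mult_distrib)

lemma wn_power2:
  assumes "\<forall>m. w m \<ge> 0"
  shows "(wn w c)\<^sup>2 = (\<Sum>\<^sub>\<infinity>m. w m * (cmod (c m))\<^sup>2)"
  unfolding wn_def using assms by (intro real_sqrt_pow2 infsum_nonneg) auto

lemma wn_nonneg: "\<forall>m. w m \<ge> 0 \<Longrightarrow> wn w c \<ge> 0"
  unfolding wn_def by (intro real_sqrt_ge_zero infsum_nonneg) auto

lemma L2_set_le_wn:
  assumes w: "\<forall>m. w m \<ge> 0" and c: "c \<in> wsp w" and F: "finite F"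
  shows "L2_set (wabs w c) F \<le> wn w c"
  unfolding sqrt_sum_wabs[OF w] wn_def
  using c F w by (intro real_sqrt_le_mono finite_sum_le_infsum) (auto simp: wsp_def)

text \<open>Membership and norm are reduced to finite sections, where \<open>L2_set\<close> provides
  monotonicity and the Minkowski inequality.\<close>

lemma wspI:
  assumes w: "\<forall>m. w m \<ge> 0" and bd: "\<And>F. finite F \<Longrightarrow> L2_set (wabs w c) F \<le> B"
  shows "c \<in> wsp w" "wn w c \<le> B"
proof -
  have B: "B \<ge> 0" using bd[of "{}"] by simp
  have fin: "(\<Sum>m\<in>F. w m * (cmod (c m))\<^sup>2) \<le> B\<^sup>2" if "finite F" for F
    using bd[OF that] w by (simp add: sqrt_sum_wabs sqrt_le_D)
  have "(\<lambda>m. w m * (cmod (c m))\<^sup>2) summable_on UNIV"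
    using fin w by (intro nonneg_bdd_above_summable_on bdd_aboveI2[where M = "B\<^sup>2"]) auto
  then show "c \<in> wsp w" by (simp add: wsp_def)
  then have "(\<Sum>\<^sub>\<infinity>m. w m * (cmod (c m))\<^sup>2) \<le> B\<^sup>2"
    using fin by (intro infsum_le_finite_sums) (auto simp: wsp_def)
  then show "wn w c \<le> B" using B by (simp add: wn_def real_le_lsqrt)
qed

text \<open>Covers shifts of the frequency and multipliers at once: \<open>f\<close> reindexes, and
  \<open>K\<close> absorbs the symbol and the change of weight.\<close>

lemma wsp_transfer:
  assumes w: "\<forall>m. w m \<ge> 0" and w': "\<forall>m. w' m \<ge> 0" and f: "inj f" and K: "K \<ge> 0"
    and le: "\<And>m. wabs w' d m \<le> K * wabs w c (f m)" and c: "c \<in> wsp w"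
  shows "d \<in> wsp w'" "wn w' d \<le> K * wn w c"
proof -
  have "L2_set (wabs w' d) F \<le> K * wn w c" if F: "finite F" for F
  proof -
    have "L2_set (wabs w' d) F \<le> L2_set (\<lambda>m. K * wabs w c (f m)) F"
      using le w' by (intro L2_set_mono) auto
    also have "\<dots> = K * L2_set (wabs w c) (f ` F)"
    proof -
      have "L2_set (wabs w c) (f ` F) = L2_set (\<lambda>m. wabs w c (f m)) F"
        unfolding L2_set_def by (subst sum.reindex) (auto intro: inj_on_subset[OF f])
      then show ?thesis using K by (simp only: L2_set_right_distrib)
    qed
    also have "\<dots> \<le> K * wn w c" using F K by (intro mult_left_mono L2_set_le_wn w c) auto
    finally show ?thesis .
  qed
  from wspI[OF w' this] show "d \<in> wsp w'" "wn w' d \<le> K * wn w c" by auto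
qed

lemma wsp_add:
  assumes w: "\<forall>m. w m \<ge> 0" and c: "c \<in> wsp w" and d: "d \<in> wsp w"
  shows "c + d \<in> wsp w" "wn w (c + d) \<le> wn w c + wn w d"
proof -
  have "L2_set (wabs w (c + d)) F \<le> wn w c + wn w d" if F: "finite F" for F
  proof -
    have "L2_set (\<lambda>m. wabs w (c + d) m) F \<le> L2_set (\<lambda>m. wabs w c m + wabs w d m) F"
      using w by (intro L2_set_mono)
        (auto simp: distrib_left[symmetric] norm_triangle_ineq intro!: mult_left_mono)
    also have "\<dots> \<le> L2_set (wabs w c) F + L2_set (wabs w d) F" by (rule L2_set_triangle_ineq)
    also have "\<dots> \<le> wn w c + wn w d" using L2_set_le_wn w c d F by (intro add_mono) auto
    finally show ?thesis .
  qed
  from wspI[OF w, of "c + d", OF this]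
  show "c + d \<in> wsp w" "wn w (c + d) \<le> wn w c + wn w d" by blast+
qed

lemma wsp_scale:
  assumes w: "\<forall>m. w m \<ge> 0" and c: "c \<in> wsp w"
  shows "z *\<^sub>C c \<in> wsp w" "wn w (z *\<^sub>C c) = cmod z * wn w c"
proof -
  have eq: "(\<lambda>m. w m * (cmod ((z *\<^sub>C c) m))\<^sup>2) = (\<lambda>m. (cmod z)\<^sup>2 * (w m * (cmod (c m))\<^sup>2))"
    by (simp add: scaleC_fun_def scaleC_complex_def norm_mult power_mult_distrib fun_eq_iff)
  show "z *\<^sub>C c \<in> wsp w"
    using c unfolding wsp_def mem_Collect_eq eq by (rule summable_on_cmult_right)
  show "wn w (z *\<^sub>C c) = cmod z * wn w c"
    unfolding wn_def eq by (simp add: infsum_cmult_right' real_sqrt_mult)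
qed

lemma subspace_wsp:
  assumes w: "\<forall>m. w m \<ge> 0"
  shows "cvs.subspace (wsp w)"
  using wsp_add(1)[OF w] wsp_scale(1)[OF w] by (intro cvs.subspaceI) (auto simp: wsp_def)

lemma coord_bound:
  assumes w: "\<forall>m. w m > 0" and c: "c \<in> wsp w"
  shows "cmod (c m) \<le> (1 / sqrt (w m)) * wn w c"
proof -
  have "wabs w c m \<le> wn w c"
    using L2_set_le_wn[of w c "{m}"] c w by (simp add: real_sqrt_mult less_imp_le)
  then show ?thesis using w[rule_format, of m] by (simp add: field_simps)
qed

lemma coord_dual:
  assumes w: "\<forall>m. w m > 0"
  shows "(\<lambda>c. c m) \<in> dual_space (wn w) (wsp w)"
proof -
  have "\<forall>c\<in>wsp w. cmod (c m) \<le> (1 / sqrt (w m)) * wn w c" using coord_bound[OF w] by blast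
  then show ?thesis unfolding dual_space_def linear_on_def
    by (auto simp: scaleC_fun_def simp del: times_divide_eq_left)
qed

text \<open>Coefficients are bounded functionals, so they separate points and converge along the
  series; finite sections of the tails then identify the coefficientwise sum as the norm
  limit.\<close>

lemma nspace_wsp:
  fixes w :: "'i \<Rightarrow> real"
  assumes w: "\<forall>m. w m > 0"
  shows "nspace (wsp w) (wn w)"
proof
  have w0: "\<forall>m. w m \<ge> 0" using w by (simp add: less_imp_le)
  show "cvs.subspace (wsp w)" using subspace_wsp w0 by blast
  show "0 \<le> wn w u" for u using wn_nonneg w0 by blast
  show "wn w (c *\<^sub>C u) = cmod c * wn w u" if "u \<in> wsp w" for c u using wsp_scale(2) w0 that by blast
  show "wn w (u + v) \<le> wn w u + wn w v" if "u \<in> wsp w" "v \<in> wsp w" for u v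
    using wsp_add(2) w0 that by blast
  show "\<exists>\<phi>\<in>dual_space (wn w) (wsp w). \<phi> u \<noteq> 0" if nz: "u \<noteq> 0" for u
  proof -
    obtain m where "u m \<noteq> 0" using nz by (auto simp: fun_eq_iff)
    then show ?thesis using coord_dual[OF w, of m] by (intro bexI[of _ "\<lambda>c. c m"])
  qed
  fix x :: "nat \<Rightarrow> 'i \<Rightarrow> complex"
  assume x: "\<And>j. x j \<in> wsp w" and sm: "summable (\<lambda>j. wn w (x j))"
  define v where "v m = (\<Sum>j. x j m)" for m
  have sm_m: "summable (\<lambda>j. x j m)" for m
  proof (rule summable_comparison_test)
    show "summable (\<lambda>j. (1 / sqrt (w m)) * wn w (x j))" using sm by (intro summable_mult)
    show "\<exists>N. \<forall>j\<ge>N. norm (x j m) \<le> (1 / sqrt (w m)) * wn w (x j)" using coord_bound[OF w x] by blast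
  qed
  define R where "R M = (\<Sum>j. wn w (x j)) - (\<Sum>j<M. wn w (x j))" for M
  have R_lim: "R \<longlonglongrightarrow> 0"
    using tendsto_diff[OF tendsto_const summable_LIMSEQ[OF sm], of "\<Sum>j. wn w (x j)"] by (simp add: R_def[abs_def])
  have fin: "L2_set (wabs w (\<lambda>m. (\<Sum>j<M. x j m) - v m)) F \<le> R M" if F: "finite F" for M F
  proof (rule tendsto_upperbound)
    show "(\<lambda>L. L2_set (wabs w (\<lambda>m. (\<Sum>j<M. x j m) - (\<Sum>j<L. x j m))) F)
       \<longlonglongrightarrow> L2_set (wabs w (\<lambda>m. (\<Sum>j<M. x j m) - v m)) F"
      unfolding L2_set_def v_def using summable_LIMSEQ[OF sm_m] by (intro tendsto_intros)
    have le: "L2_set (wabs w (\<lambda>m. (\<Sum>j<M. x j m) - (\<Sum>j<L. x j m))) F \<le> (\<Sum>j<L. wn w (x j)) - (\<Sum>j<M. wn w (x j))"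
      if "M \<le> L" for L
      using that
    proof (induction L rule: dec_induct)
      case (step L)
      have "L2_set (wabs w (\<lambda>m. (\<Sum>j<M. x j m) - (\<Sum>j<Suc L. x j m))) F
        \<le> L2_set (\<lambda>m. wabs w (\<lambda>m. (\<Sum>j<M. x j m) - (\<Sum>j<L. x j m)) m + wabs w (x L) m) F"
      proof (intro L2_set_mono)
        fix m
        have "cmod ((\<Sum>j<M. x j m) - (\<Sum>j<Suc L. x j m)) \<le> cmod ((\<Sum>j<M. x j m) - (\<Sum>j<L. x j m)) + cmod (x L m)"
          using norm_triangle_ineq4[of "(\<Sum>j<M. x j m) - (\<Sum>j<L. x j m)" "x L m"] by (simp add: algebra_simps)
        then show "wabs w (\<lambda>m. (\<Sum>j<M. x j m) - (\<Sum>j<Suc L. x j m)) m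
           \<le> wabs w (\<lambda>m. (\<Sum>j<M. x j m) - (\<Sum>j<L. x j m)) m + wabs w (x L) m"
          using w0[rule_format, of m] by (simp add: distrib_left[symmetric] mult_left_mono)
      qed (use w0 in auto)
      also have "\<dots> \<le> L2_set (wabs w (\<lambda>m. (\<Sum>j<M. x j m) - (\<Sum>j<L. x j m))) F + L2_set (wabs w (x L)) F"
        by (rule L2_set_triangle_ineq)
      also have "L2_set (wabs w (x L)) F \<le> wn w (x L)" using L2_set_le_wn[OF w0 x F] .
      finally show ?case using step by simp
    qed (simp add: L2_set_def)
    have tail: "(\<Sum>j<L. wn w (x j)) \<le> (\<Sum>j. wn w (x j))" for L
      using sm wn_nonneg[OF w0] by (intro sum_le_suminf) auto
    show "\<forall>\<^sub>F L in sequentially. L2_set (wabs w (\<lambda>m. (\<Sum>j<M. x j m) - (\<Sum>j<L. x j m))) F \<le> R M"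
      unfolding eventually_sequentially
    proof (intro exI allI impI)
      fix L assume "M \<le> L"
      from le[OF this] tail[of L]
      show "L2_set (wabs w (\<lambda>m. (\<Sum>j<M. x j m) - (\<Sum>j<L. x j m))) F \<le> R M"
        unfolding R_def by linarith
    qed
  qed simp
  have sum_eq: "(\<Sum>j<M. x j) - v = (\<lambda>m. (\<Sum>j<M. x j m) - v m)" for M
    by (simp add: fun_eq_iff sum_apply)
  have bd: "(\<Sum>j<M. x j) - v \<in> wsp w" "wn w ((\<Sum>j<M. x j) - v) \<le> R M" for M
    using wspI[OF w0 fin] unfolding sum_eq by auto
  have "- v \<in> wsp w" using bd(1)[of 0] by simp
  then have "v \<in> wsp w" using wsp_scale(1)[OF w0, of "- v" "- 1"] by simp
  moreover have "(\<lambda>M. wn w ((\<Sum>j<M. x j) - v)) \<longlonglongrightarrow> 0"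
    using bd(2) wn_nonneg[OF w0] by (intro Lim_null_comparison[OF _ R_lim] always_eventually) auto
  ultimately show "\<exists>v\<in>wsp w. (\<lambda>M. wn w ((\<Sum>j<M. x j) - v)) \<longlonglongrightarrow> 0" by blast
qed

lemma product_summable:
  fixes a b :: "'i \<Rightarrow> real"
  assumes "(\<lambda>m. (a m)\<^sup>2) summable_on S" "(\<lambda>m. (b m)\<^sup>2) summable_on S"
  shows "(\<lambda>m. \<bar>a m\<bar> * \<bar>b m\<bar>) summable_on S"
proof (rule summable_on_comparison_test)
  show "(\<lambda>m. (a m)\<^sup>2 + (b m)\<^sup>2) summable_on S" by (intro summable_on_add assms)
  show "\<bar>a m\<bar> * \<bar>b m\<bar> \<le> (a m)\<^sup>2 + (b m)\<^sup>2" for m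
  proof -
    have "2 * (\<bar>a m\<bar> * \<bar>b m\<bar>) \<le> (a m)\<^sup>2 + (b m)\<^sup>2"
      using sum_squares_bound[of "\<bar>a m\<bar>" "\<bar>b m\<bar>"] by simp
    moreover have "0 \<le> \<bar>a m\<bar> * \<bar>b m\<bar>" by simp
    ultimately show ?thesis by linarith
  qed
qed auto

lemma wsp_product_summable:
  assumes w: "\<forall>m. w m \<ge> 0" "\<forall>m. w' m \<ge> 0" and f: "inj f" and c: "c \<in> wsp w" and d: "d \<in> wsp w'"
  shows "(\<lambda>m. wabs w c m * wabs w' d (f m)) summable_on UNIV"
proof -
  have "(\<lambda>m. (wabs w c m)\<^sup>2) summable_on UNIV"
    using c w(1) by (simp add: wsp_def power_mult_distrib)
  moreover have "(\<lambda>m. (wabs w' d m)\<^sup>2) summable_on range f"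
  proof (rule summable_on_subset_banach)
    show "(\<lambda>m. (wabs w' d m)\<^sup>2) summable_on UNIV"
      using d w(2) by (simp add: wsp_def power_mult_distrib)
  qed simp
  then have "((\<lambda>m. (wabs w' d m)\<^sup>2) \<circ> f) summable_on UNIV"
    using summable_on_reindex[OF f] by blast
  then have "(\<lambda>m. (wabs w' d (f m))\<^sup>2) summable_on UNIV" by (simp only: o_def)
  ultimately have "(\<lambda>m. \<bar>wabs w c m\<bar> * \<bar>wabs w' d (f m)\<bar>) summable_on UNIV"
    by (rule product_summable)
  then show ?thesis using w by (simp add: abs_mult)
qed

lemma cip_summable:
  assumes w: "\<forall>m. w m \<ge> 0" and p: "\<forall>m. \<bar>p m\<bar> \<le> K * w m" and c: "c \<in> wsp w" and d: "d \<in> wsp w"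
  shows "(\<lambda>m. of_real (p m) * (c m * cnj (d m))) summable_on UNIV"
proof (rule abs_summable_summable, rule summable_on_comparison_test)
  show "(\<lambda>m. K * (wabs w c m * wabs w d (id m))) summable_on UNIV"
    using wsp_product_summable[OF w w inj_on_id c d] by (intro summable_on_cmult_right)
  fix m
  have "\<bar>p m\<bar> * (cmod (c m) * cmod (d m)) \<le> K * w m * (cmod (c m) * cmod (d m))"
    using p by (intro mult_right_mono) auto
  also have "K * w m * (cmod (c m) * cmod (d m)) = K * (sqrt (w m) * sqrt (w m)) * (cmod (c m) * cmod (d m))"
    using w[rule_format, of m] by simp
  finally show "norm (of_real (p m) * (c m * cnj (d m))) \<le> K * (wabs w c m * wabs w d (id m))"
    by (simp add: norm_mult mult_ac del: real_sqrt_mult_self)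
qed auto

lemma cip_add:
  assumes w: "\<forall>m. w m \<ge> 0" and p: "\<forall>m. \<bar>p m\<bar> \<le> K * w m" and "c \<in> wsp w" "c' \<in> wsp w" "d \<in> wsp w"
  shows "cip p (c + c') d = cip p c d + cip p c' d"
  unfolding cip_def using cip_summable[OF w p] assms(3-5)
  by (subst infsum_add[symmetric]) (auto simp: algebra_simps)

lemma cip_scale: "cip p (z *\<^sub>C c) d = z * cip p c d"
  unfolding cip_def
  by (subst infsum_cmult_right'[symmetric]) (simp add: scaleC_fun_def scaleC_complex_def mult_ac)

lemma cip_commute: "cip p c d = cnj (cip p d c)"
  unfolding cip_def by (simp add: infsum_cnj[symmetric] mult_ac)

lemma cip_self:
  assumes w: "\<forall>m. w m \<ge> 0" and p: "\<forall>m. \<bar>p m\<bar> \<le> K * w m" and c: "c \<in> wsp w"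
  shows "cip p c c = of_real (\<Sum>\<^sub>\<infinity>m. p m * (cmod (c m))\<^sup>2)"
    and "(\<lambda>m. p m * (cmod (c m))\<^sup>2) summable_on UNIV"
proof -
  have eq: "of_real (p m) * (c m * cnj (c m)) = complex_of_real (p m * (cmod (c m))\<^sup>2)" for m
    by (simp only: of_real_mult complex_norm_square)
  have sm: "(\<lambda>m. complex_of_real (p m * (cmod (c m))\<^sup>2)) summable_on UNIV"
    using cip_summable[OF w p c c] unfolding eq .
  then show *: "(\<lambda>m. p m * (cmod (c m))\<^sup>2) summable_on UNIV"
    using summable_on_Re[OF sm] by simp
  show "cip p c c = of_real (\<Sum>\<^sub>\<infinity>m. p m * (cmod (c m))\<^sup>2)"
    unfolding cip_def eq by (intro infsumI has_sum_of_real has_sum_infsum *)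
qed

lemma cip_le:
  fixes w :: "'i \<Rightarrow> real" and c :: "'i \<Rightarrow> complex"
  assumes w: "\<forall>m. w m \<ge> 0" and p: "\<forall>m. \<bar>p m\<bar> \<le> K * w m" and c: "c \<in> wsp w"
  shows "Re (cip p c c) \<le> K * (wn w c)\<^sup>2"
proof -
  have "(\<Sum>\<^sub>\<infinity>m. p m * (cmod (c m))\<^sup>2) \<le> (\<Sum>\<^sub>\<infinity>m. K * (w m * (cmod (c m))\<^sup>2))"
  proof (rule infsum_mono)
    show "(\<lambda>m. K * (w m * (cmod (c m))\<^sup>2)) summable_on UNIV"
      using c by (intro summable_on_cmult_right) (simp add: wsp_def)
    fix m
    have "p m * (cmod (c m))\<^sup>2 \<le> (K * w m) * (cmod (c m))\<^sup>2"
      using p[rule_format, of m] by (intro mult_right_mono) auto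
    then show "p m * (cmod (c m))\<^sup>2 \<le> K * (w m * (cmod (c m))\<^sup>2)" by (simp add: mult_ac)
  qed (rule cip_self(2)[OF assms])
  then show ?thesis using wn_power2[OF w, of c] by (simp add: cip_self(1)[OF assms] infsum_cmult_right')
qed

text \<open>The bound is asked only on the support: weights built from \<open>bsym\<close> vanish at
  frequency zero, where mean-zero states have no coefficient.\<close>

lemma cip_ge:
  fixes w :: "'i \<Rightarrow> real" and c :: "'i \<Rightarrow> complex"
  assumes w: "\<forall>m. w m \<ge> 0" and p: "\<forall>m. \<bar>p m\<bar> \<le> K * w m" and c: "c \<in> wsp w"
    and ge: "\<And>m. c m \<noteq> 0 \<Longrightarrow> \<kappa> * w m \<le> p m"
  shows "\<kappa> * (wn w c)\<^sup>2 \<le> Re (cip p c c)"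
proof -
  have "(\<Sum>\<^sub>\<infinity>m. \<kappa> * (w m * (cmod (c m))\<^sup>2)) \<le> (\<Sum>\<^sub>\<infinity>m. p m * (cmod (c m))\<^sup>2)"
  proof (rule infsum_mono)
    show "(\<lambda>m. \<kappa> * (w m * (cmod (c m))\<^sup>2)) summable_on UNIV"
      using c by (intro summable_on_cmult_right) (simp add: wsp_def)
    fix m
    show "\<kappa> * (w m * (cmod (c m))\<^sup>2) \<le> p m * (cmod (c m))\<^sup>2"
      using ge[of m] mult_right_mono[of "\<kappa> * w m" "p m" "(cmod (c m))\<^sup>2"]
      by (cases "c m = 0") (auto simp: mult_ac)
  qed (rule cip_self(2)[OF w p c])
  then show ?thesis using wn_power2[OF w, of c] by (simp add: cip_self(1)[OF w p c] infsum_cmult_right')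
qed

subsection \<open>Products\<close>

definition pair_norm :: "('a \<Rightarrow> real) \<Rightarrow> ('b \<Rightarrow> real) \<Rightarrow> 'a \<times> 'b \<Rightarrow> real" where
  "pair_norm N1 N2 u = sqrt ((N1 (fst u))\<^sup>2 + (N2 (snd u))\<^sup>2)"

lemma scaleC_fst [simp]: "fst (c *\<^sub>C u) = c *\<^sub>C fst u"
  and scaleC_snd [simp]: "snd (c *\<^sub>C u) = c *\<^sub>C snd u"
  by (simp_all add: scaleC_prod_def)

lemma le_pair_norm:
  "N1 (fst u) \<ge> 0 \<Longrightarrow> N1 (fst u) \<le> pair_norm N1 N2 u"
  "N2 (snd u) \<ge> 0 \<Longrightarrow> N2 (snd u) \<le> pair_norm N1 N2 u"
  unfolding pair_norm_def by (auto intro!: real_le_rsqrt)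

lemma pair_norm_le: "N1 (fst u) \<ge> 0 \<Longrightarrow> N2 (snd u) \<ge> 0 \<Longrightarrow> pair_norm N1 N2 u \<le> N1 (fst u) + N2 (snd u)"
  unfolding pair_norm_def by (rule sqrt_sum_squares_le_sum)

lemma dual_pair:
  assumes N1: "\<forall>v\<in>V1. N1 v \<ge> 0" and N2: "\<forall>v\<in>V2. N2 v \<ge> 0"
  shows "\<phi> \<in> dual_space N1 V1 \<Longrightarrow> (\<lambda>u. \<phi> (fst u)) \<in> dual_space (pair_norm N1 N2) (V1 \<times> V2)"
    and "\<psi> \<in> dual_space N2 V2 \<Longrightarrow> (\<lambda>u. \<psi> (snd u)) \<in> dual_space (pair_norm N1 N2) (V1 \<times> V2)"
proof -
  assume "\<phi> \<in> dual_space N1 V1"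
  then obtain C where C: "\<forall>u\<in>V1. cmod (\<phi> u) \<le> C * N1 u" and lin: "linear_on V1 \<phi>"
    by (auto simp: dual_space_def)
  have "cmod (\<phi> (fst u)) \<le> \<bar>C\<bar> * pair_norm N1 N2 u" if "u \<in> V1 \<times> V2" for u
  proof -
    have u: "fst u \<in> V1" using that by auto
    have "cmod (\<phi> (fst u)) \<le> \<bar>C\<bar> * N1 (fst u)"
      using C u mult_right_mono[OF abs_ge_self N1[rule_format, OF u], of C] by force
    also have "\<dots> \<le> \<bar>C\<bar> * pair_norm N1 N2 u" by (intro mult_left_mono le_pair_norm(1) N1[rule_format] u) auto
    finally show ?thesis .
  qed
  then have "\<exists>C. \<forall>u\<in>V1 \<times> V2. cmod (\<phi> (fst u)) \<le> C * pair_norm N1 N2 u" by blast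
  moreover have "linear_on (V1 \<times> V2) (\<lambda>u. \<phi> (fst u))" using lin by (simp add: linear_on_def)
  ultimately show "(\<lambda>u. \<phi> (fst u)) \<in> dual_space (pair_norm N1 N2) (V1 \<times> V2)"
    by (simp add: dual_space_def)
next
  assume "\<psi> \<in> dual_space N2 V2"
  then obtain C where C: "\<forall>u\<in>V2. cmod (\<psi> u) \<le> C * N2 u" and lin: "linear_on V2 \<psi>"
    by (auto simp: dual_space_def)
  have "cmod (\<psi> (snd u)) \<le> \<bar>C\<bar> * pair_norm N1 N2 u" if "u \<in> V1 \<times> V2" for u
  proof -
    have u: "snd u \<in> V2" using that by auto
    have "cmod (\<psi> (snd u)) \<le> \<bar>C\<bar> * N2 (snd u)"
      using C u mult_right_mono[OF abs_ge_self N2[rule_format, OF u], of C] by force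
    also have "\<dots> \<le> \<bar>C\<bar> * pair_norm N1 N2 u" by (intro mult_left_mono le_pair_norm(2) N2[rule_format] u) auto
    finally show ?thesis .
  qed
  then have "\<exists>C. \<forall>u\<in>V1 \<times> V2. cmod (\<psi> (snd u)) \<le> C * pair_norm N1 N2 u" by blast
  moreover have "linear_on (V1 \<times> V2) (\<lambda>u. \<psi> (snd u))" using lin by (simp add: linear_on_def)
  ultimately show "(\<lambda>u. \<psi> (snd u)) \<in> dual_space (pair_norm N1 N2) (V1 \<times> V2)"
    by (simp add: dual_space_def)
qed

lemma nspace_pair:
  assumes "nspace V1 N1" "nspace V2 N2"
  shows "nspace (V1 \<times> V2) (pair_norm N1 N2)"
proof -
  interpret V1: nspace V1 N1 by fact
  interpret V2: nspace V2 N2 by fact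
  show ?thesis
  proof
    show "cvs.subspace (V1 \<times> V2)"
      by (rule cvs.subspaceI) (auto simp: zero_prod_def scaleC_prod_def)
    show "0 \<le> pair_norm N1 N2 u" for u by (simp add: pair_norm_def)
    show "pair_norm N1 N2 (c *\<^sub>C u) = cmod c * pair_norm N1 N2 u" if "u \<in> V1 \<times> V2" for c u
      using that
      by (auto simp: pair_norm_def V1.N_scale V2.N_scale power_mult_distrib real_sqrt_mult
          simp flip: distrib_left)
    fix u v assume u: "u \<in> V1 \<times> V2" and v: "v \<in> V1 \<times> V2"
    have "pair_norm N1 N2 (u + v) \<le> sqrt ((N1 (fst u) + N1 (fst v))\<^sup>2 + (N2 (snd u) + N2 (snd v))\<^sup>2)"
      unfolding pair_norm_def using u v V1.N_triangle V2.N_triangle V1.N_nonneg V2.N_nonneg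
      by (intro real_sqrt_le_mono add_mono power_mono) auto
    also have "\<dots> \<le> pair_norm N1 N2 u + pair_norm N1 N2 v"
      unfolding pair_norm_def by (rule real_sqrt_sum_squares_triangle_ineq)
    finally show "pair_norm N1 N2 (u + v) \<le> pair_norm N1 N2 u + pair_norm N1 N2 v" .
  next
    fix x :: "nat \<Rightarrow> 'a \<times> 'b"
    assume x: "\<And>j. x j \<in> V1 \<times> V2" and sm: "summable (\<lambda>j. pair_norm N1 N2 (x j))"
    have x1: "fst (x j) \<in> V1" and x2: "snd (x j) \<in> V2" for j using x[of j] by auto
    have "norm (N1 (fst (x j))) \<le> pair_norm N1 N2 (x j)" "norm (N2 (snd (x j))) \<le> pair_norm N1 N2 (x j)" for j
      using V1.N_nonneg[OF x1[of j]] V2.N_nonneg[OF x2[of j]] le_pair_norm(1)[of N1 "x j" N2]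
        le_pair_norm(2)[of N2 "x j" N1] by simp_all
    then have "summable (\<lambda>j. N1 (fst (x j)))" "summable (\<lambda>j. N2 (snd (x j)))"
      by (blast intro: summable_comparison_test[OF _ sm])+
    then obtain v1 v2 where v: "v1 \<in> V1" "(\<lambda>M. N1 ((\<Sum>j<M. fst (x j)) - v1)) \<longlonglongrightarrow> 0"
      "v2 \<in> V2" "(\<lambda>M. N2 ((\<Sum>j<M. snd (x j)) - v2)) \<longlonglongrightarrow> 0"
      using V1.complete[of "\<lambda>j. fst (x j)"] V2.complete[of "\<lambda>j. snd (x j)"] x1 x2 by metis

    have "(\<lambda>M. sqrt ((N1 ((\<Sum>j<M. fst (x j)) - v1))\<^sup>2 + (N2 ((\<Sum>j<M. snd (x j)) - v2))\<^sup>2)) \<longlonglongrightarrow> sqrt (0\<^sup>2 + 0\<^sup>2)"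
      using v by (intro tendsto_intros)
    then show "\<exists>v\<in>V1 \<times> V2. (\<lambda>M. pair_norm N1 N2 ((\<Sum>j<M. x j) - v)) \<longlonglongrightarrow> 0"
      using v by (intro bexI[of _ "(v1, v2)"]) (auto simp: pair_norm_def fst_sum snd_sum)
  next
    fix u assume u: "u \<in> V1 \<times> V2" "u \<noteq> 0"
    then consider "fst u \<noteq> 0" | "snd u \<noteq> 0" by (auto simp: prod_eq_iff)
    then show "\<exists>\<phi>\<in>dual_space (pair_norm N1 N2) (V1 \<times> V2). \<phi> u \<noteq> 0"
    proof cases
      case 1
      moreover have "fst u \<in> V1" using u by auto
      ultimately obtain \<phi> where \<phi>: "\<phi> \<in> dual_space N1 V1" "\<phi> (fst u) \<noteq> 0" using V1.separating by blast
      have "(\<lambda>u. \<phi> (fst u)) \<in> dual_space (pair_norm N1 N2) (V1 \<times> V2)"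
        using V1.N_nonneg V2.N_nonneg \<phi>(1) by (intro dual_pair(1)) auto
      then show ?thesis by (rule bexI[rotated]) (rule \<phi>(2))
    next
      case 2
      moreover have "snd u \<in> V2" using u by auto
      ultimately obtain \<phi> where \<phi>: "\<phi> \<in> dual_space N2 V2" "\<phi> (snd u) \<noteq> 0" using V2.separating by blast
      have "(\<lambda>u. \<phi> (snd u)) \<in> dual_space (pair_norm N1 N2) (V1 \<times> V2)"
        using V1.N_nonneg V2.N_nonneg \<phi>(1) by (intro dual_pair(2)) auto
      then show ?thesis by (rule bexI[rotated]) (rule \<phi>(2))
    qed
  qed
qed

section \<open>The positive solution of the chain recursion\<close>

text \<open>Up to the signs \<open>(-1) ^ (j div 2)\<close> these are the entries of \<open>A F\<close> (even \<open>j\<close>) and of \<open>\<i> B \<omega>\<close> (odd \<open>j\<close>)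
  at frequency \<open>j k\<close> of a mode with rate \<open>c n k / 2\<close>; \<open>w j\<close> is the reciprocal of the symbol of \<open>A\<close>,
  respectively \<open>B\<close>.\<close>

fun rec_sol :: "(nat \<Rightarrow> real) \<Rightarrow> real \<Rightarrow> real \<Rightarrow> nat \<Rightarrow> real" where
  "rec_sol w \<alpha> c 0 = 1"
| "rec_sol w \<alpha> c (Suc 0) = c * \<alpha>"
| "rec_sol w \<alpha> c (Suc (Suc j)) = rec_sol w \<alpha> c j - c * w (Suc j) * rec_sol w \<alpha> c (Suc j)"

lemma continuous_rec_sol: "continuous_on UNIV (\<lambda>c. rec_sol w \<alpha> c j)"
  by (induction w \<alpha> "0::real" j rule: rec_sol.induct) (auto intro!: continuous_intros)

text \<open>If the solution is not positive throughout, the parity of the index of its first nonpositive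
  term is a locally constant function of \<open>c\<close>. It is odd for small and even for large \<open>c\<close>.\<close>

lemma rec_sol_positive_ex:
  assumes \<alpha>: "\<alpha> > 0" and w: "\<And>j. j \<ge> 1 \<Longrightarrow> w j \<ge> 1"
  shows "\<exists>c>0. \<forall>j. rec_sol w \<alpha> c j > 0"
proof (rule ccontr)
  assume neg: "\<not> ?thesis"
  define p where "p j c = rec_sol w \<alpha> c j" for j c
  have none: "\<exists>j. p j c \<le> 0" if "c > 0" for c
    using neg that unfolding p_def by (meson not_less)
  have p0: "p 0 c = 1" and p1: "p 1 c = c * \<alpha>" and p2: "p (j + 2) c = p j c - c * w (j + 1) * p (j + 1) c" for j c
    by (simp_all add: p_def numeral_2_eq_2)
  have cont: "continuous_on UNIV (p j)" for j
    unfolding p_def using continuous_rec_sol by blast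
  \<comment> \<open>The sign of \<open>p j c\<close> itself is left free: the first nonpositive term
    may be zero, and prescribing strict signs only for the other terms keeps \<open>G j\<close>
    open.\<close>
  define G where "G j = {c. c > 0 \<and> (\<forall>i<j. p i c > 0) \<and> p (j + 1) c > 0 \<and> p (j + 2) c < 0}" for j
  \<comment> \<open>After the first nonpositive term the recursion forces one positive and then one
    negative term.\<close>
  have G: "c \<in> G j" if c: "c > 0" and j: "p j c \<le> 0" and before: "\<forall>i<j. p i c > 0" for c j
  proof -
    have "p 0 c > 0" "p 1 c > 0" using p0 p1[of c] mult_pos_pos[OF c \<alpha>] by simp_all
    then have "j \<noteq> 0" "j \<noteq> 1" using j by (metis not_less)+
    then obtain l where l: "j = l + 2" by (metis One_nat_def Suc_1 add_2_eq_Suc' not0_implies_Suc)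
    have wp: "c * w i > 0" if "i \<ge> 1" for i
    proof -
      have "w i > 0" using w[OF that] by simp
      then show ?thesis using c by simp
    qed
    have "c * w (l + 1 + 1) * p j c \<le> 0" using wp[of "l + 2"] j by (simp add: mult_le_0_iff)
    moreover have "p (l + 1) c > 0" using before l by simp
    ultimately have 1: "p (j + 1) c > 0" using p2[of "l + 1" c] l by simp
    have "c * w (j + 1) * p (j + 1) c > 0" by (rule mult_pos_pos[OF wp 1]) simp
    then have "p (j + 2) c < 0" using p2[of j c] j by simp
    with 1 c before show ?thesis by (simp add: G_def)
  qed
  have first: "\<exists>j\<le>l. p j c \<le> 0 \<and> c \<in> G j" if c: "c > 0" and l: "p l c \<le> 0" for c l
  proof -
    obtain j where "j \<le> l" "\<forall>i<j. \<not> p i c \<le> 0" "p j c \<le> 0"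
      using ex_least_nat_le[of "\<lambda>j. p j c \<le> 0", OF l] by blast
    then show ?thesis using G[OF c, of j] by (auto simp: not_le)
  qed
  have openG: "open (G j)" for j
  proof -
    have pos: "open {c. p i c > 0}" and neg: "open {c. p i c < 0}" for i
      by (rule open_Collect_less[OF continuous_on_const cont]
        open_Collect_less[OF cont continuous_on_const])+
    have "G j = {0<..} \<inter> (\<Inter>i\<in>{..<j}. {c. p i c > 0}) \<inter> {c. p (j + 1) c > 0} \<inter> {c. p (j + 2) c < 0}"
      by (auto simp: G_def)
    then show ?thesis using pos neg by (auto intro!: open_Int open_INT)
  qed
  \<comment> \<open>\<open>G j\<close> and \<open>G (j + 2)\<close> may overlap because the sign of
    \<open>p j c\<close> is free, so only indices of different parity are separated.\<close>
  have disj: "G j \<inter> G l = {}" if "j < l" "even j \<noteq> even l" for j l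
  proof -
    have False if "c \<in> G j" "c \<in> G l" for c
    proof (cases "l = j + 1")
      case True
      then show False using \<open>c \<in> G j\<close> \<open>c \<in> G l\<close> by (simp add: G_def)
    next
      case False
      then have "l \<noteq> j + 2" "l > j + 1" using \<open>j < l\<close> \<open>even j \<noteq> even l\<close> by auto
      then have "j + 2 < l" by linarith
      then show False using \<open>c \<in> G j\<close> \<open>c \<in> G l\<close> by (force simp: G_def)
    qed
    then show ?thesis by blast
  qed
  define U where "U b = (\<Union>j\<in>{j. even j = b}. G j)" for b
  have openU: "open (U b)" for b using openG by (auto simp: U_def)
  have subU: "U b \<subseteq> {0<..}" for b by (auto simp: U_def G_def)
  have cover: "{0<..} \<subseteq> U True \<union> U False"
  proof
    fix c :: real assume "c \<in> {0<..}"
    then obtain j where "c \<in> G j" using none[of c] first[of c] by auto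
    then show "c \<in> U True \<union> U False" by (cases "even j") (auto simp: U_def)
  qed
  have disjU: "U True \<inter> U False = {}"
  proof -
    have False if c: "c \<in> G j" "even j" "c \<in> G l" "odd l" for c j l
    proof (cases "j < l")
      case True
      then show False using disj[of j l] c by auto
    next
      case False
      then have "l < j" using c by (metis linorder_neqE_nat)
      then show False using disj[of l j] c by auto
    qed
    then show ?thesis by (auto simp: U_def)
  qed
  have "U True \<noteq> {}"
  proof -
    \<comment> \<open>Chosen so that \<open>c > 1\<close> and \<open>c * \<alpha> \<ge> 1\<close>;
      with \<open>w 1 \<ge> 1\<close> the term of index 2 is then the first nonpositive one.\<close>
    define c where "c = 1 + 1 / \<alpha>"
    have c: "c > 1" using \<alpha> by (simp add: c_def)
    have "1 \<le> c * \<alpha>" using \<alpha> by (simp add: c_def field_simps)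
    then have "1 \<le> w 1 * (c * \<alpha>)" using w[of 1] mult_mono[of 1 "w 1" 1 "c * \<alpha>"] by simp
    then have "1 * 1 \<le> c * (w 1 * (c * \<alpha>))" using c by (intro mult_mono) auto
    moreover have "p 2 c = 1 - c * (w 1 * (c * \<alpha>))" using p2[of 0 c] p0 p1[of c] by (simp add: numeral_2_eq_2)
    ultimately have "p 2 c \<le> 0" by simp
    moreover have "\<forall>i<2. p i c > 0" using p0 p1[of c] c \<alpha> by (auto simp: less_2_cases_iff)
    ultimately have "c \<in> G 2" using G c by simp
    then have "c \<in> U True" unfolding U_def by (intro UN_I[of 2]) auto
    then show ?thesis by blast
  qed
  moreover have "U False \<noteq> {}"
  proof -
    \<comment> \<open>For \<open>c\<close> near 0 the even terms up to index \<open>2 * M\<close>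
      stay above 1/2, while the odd terms divided by \<open>c\<close> start at
      \<open>\<alpha>\<close> and drop by at least 1/2 each time. An odd term is therefore the first
      to fail.\<close>
    obtain M :: nat where M: "real M > 2 * \<alpha>" using reals_Archimedean2 by blast
    have p_at_0: "p j 0 = (if even j then 1 else 0)" for j
      unfolding p_def by (induction w \<alpha> "0::real" j rule: rec_sol.induct) auto
    have "\<forall>\<^sub>F c in at_right 0. p (2 * i) c > 1 / 2" for i
    proof -
      have "(p (2 * i) \<longlongrightarrow> p (2 * i) 0) (at_right 0)"
        using cont[of "2 * i"] unfolding continuous_on_def by (metis UNIV_I tendsto_within_subset subset_UNIV)
      then show ?thesis by (rule order_tendstoD) (simp add: p_at_0)
    qed
    then have "\<forall>\<^sub>F c in at_right 0. \<forall>i\<in>{..M}. p (2 * i) c > 1 / 2"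
      by (intro eventually_ball_finite) auto
    moreover have "\<forall>\<^sub>F c in at_right (0::real). c > 0" by (simp add: eventually_at_right_less)
    ultimately have "\<forall>\<^sub>F c in at_right 0. c > 0 \<and> (\<forall>i\<in>{..M}. p (2 * i) c > 1 / 2)" by eventually_elim auto
    then have "\<exists>c. c > 0 \<and> (\<forall>i\<in>{..M}. p (2 * i) c > 1 / 2)"
      using eventually_happens' trivial_limit_at_right_real by blast
    then obtain c where c: "c > 0" "\<And>i. i \<le> M \<Longrightarrow> p (2 * i) c > 1 / 2" by blast
    have "p (2 * i + 1) c \<le> c * (\<alpha> - real i / 2)" if "i \<le> M" for i
      using that
    proof (induction i)
      case (Suc i)
      have "1 * (1 / 2) \<le> w (2 * i + 2) * p (2 * Suc i) c"
        using w[of "2 * i + 2"] c(2)[OF Suc.prems] by (intro mult_mono) auto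
      then have "c * (1 / 2) \<le> c * w (2 * i + 2) * p (2 * Suc i) c"
        using c(1) by (simp add: mult_left_mono mult.assoc)
      moreover have "p (2 * Suc i + 1) c = p (2 * i + 1) c - c * w (2 * i + 2) * p (2 * Suc i) c"
        using p2[of "2 * i + 1" c] by simp
      moreover have "p (2 * i + 1) c \<le> c * (\<alpha> - real i / 2)" using Suc by simp
      moreover have "c * (\<alpha> - real (Suc i) / 2) = c * (\<alpha> - real i / 2) - c * (1 / 2)"
        by (simp add: field_simps)
      ultimately show ?case by linarith
    qed (use p1 in simp)
    then have "p (2 * M + 1) c \<le> c * (\<alpha> - real M / 2)" by simp
    also have "\<dots> \<le> 0" using M c(1) by (intro mult_nonneg_nonpos) auto
    finally obtain j where j: "c \<in> G j" "j \<le> 2 * M + 1" "p j c \<le> 0" using first c(1) by blast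
    have "odd j"
    proof
      assume even: "even j"
      obtain i where i: "j = 2 * i" using even by (rule evenE)
      then have "i \<le> M" using j(2) by linarith
      from c(2)[OF this] show False using i j(3) by simp
    qed
    then have "c \<in> U False" using j(1) by (auto simp: U_def)
    then show ?thesis by blast
  qed
  moreover have "U True \<inter> {0<..} = {} \<or> U False \<inter> {0<..} = {}"
    using disjU by (intro connectedD[of "{0::real<..}"] openU cover) auto
  ultimately show False using subU[of True] subU[of False] by blast
qed

section \<open>Growing modes of the cosine chains\<close>

definition asym :: "nat \<Rightarrow> int \<times> int \<Rightarrow> real" where
  "asym k m = 1 - (1 + (real k)\<^sup>2) / (1 + msq m)"

definition bsym :: "nat \<Rightarrow> int \<times> int \<Rightarrow> real" where
  "bsym k m = (1 + (real k)\<^sup>2) / msq m"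

text \<open>The coefficients of \<open>F\<close> and \<open>\<i> \<omega>\<close> on the line \<open>m2 = n\<close> for a mode growing like
  \<open>exp (\<rho> t)\<close>.\<close>

definition chain_mode :: "nat \<Rightarrow> nat \<Rightarrow> real \<Rightarrow> (int \<Rightarrow> real) \<Rightarrow> (int \<Rightarrow> real) \<Rightarrow> bool" where
  "chain_mode k n \<rho> \<phi> \<psi> \<longleftrightarrow> \<rho> > 0 \<and> \<phi> 0 \<noteq> 0
    \<and> (\<forall>m. \<phi> (- m) = \<phi> m \<and> \<psi> (- m) = \<psi> m)
    \<and> (\<forall>m. \<phi> m \<noteq> 0 \<longrightarrow> (\<exists>j. even j \<and> m = int k * j))
    \<and> (\<forall>m. \<psi> m \<noteq> 0 \<longrightarrow> (\<exists>j. odd j \<and> m = int k * j))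
    \<and> (\<forall>m. \<rho> * \<phi> m = - (real n * real k / 2) *
        (bsym k (m - int k, int n) * \<psi> (m - int k) + bsym k (m + int k, int n) * \<psi> (m + int k)))
    \<and> (\<forall>m. \<rho> * \<psi> m = (real n * real k / 2) *
        (asym k (m - int k, int n) * \<phi> (m - int k) + asym k (m + int k, int n) * \<phi> (m + int k)))
    \<and> (\<forall>q. \<exists>C. \<forall>m. \<bar>\<phi> m\<bar> * (1 + (real_of_int m)\<^sup>2) ^ q \<le> C \<and> \<bar>\<psi> m\<bar> * (1 + (real_of_int m)\<^sup>2) ^ q \<le> C)"

lemma msq_nonneg: "msq m \<ge> 0"
  by (simp add: msq_def)

lemma asym_eq: "asym k m = (msq m - (real k)\<^sup>2) / (1 + msq m)"
  using msq_nonneg[of m] by (simp add: asym_def field_simps)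

text \<open>Positivity of the next term but one bounds \<open>w (Suc j)\<close> times the term of
  index \<open>Suc j\<close> by the term of index \<open>j\<close> divided by \<open>c\<close>. The
  weights grow at least linearly at odd indices and are at least 1 at even ones, so an odd step
  gains a power of \<open>j\<close> that the following even step preserves; this is the induction on
  \<open>q\<close>.\<close>

lemma rec_sol_decay:
  assumes c: "c > 0" and pos: "\<And>j. rec_sol w \<alpha> c j > 0" and w: "\<And>j. j \<ge> 1 \<Longrightarrow> w j \<ge> 1"
    and d: "d > 0" and w_odd: "\<And>j. odd j \<Longrightarrow> w j \<ge> d * (1 + real j)"
  shows "\<exists>C. \<forall>j. rec_sol w \<alpha> c j * (1 + real j) ^ q \<le> C"
proof (induction q)
  let ?p = "rec_sol w \<alpha> c"
  have step: "w (Suc j) * ?p (Suc j) \<le> ?p j / c" for j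
    using pos[of "Suc (Suc j)"] c by (simp add: field_simps)
  {
    case 0
    have "?p j \<le> max 1 (?p 1)" for j
    proof (induction j rule: less_induct)
      case (less j)
      show ?case
      proof (cases "j \<le> 1")
        case True
        then show ?thesis by (cases j) auto
      next
        case False
        then obtain l where l: "j = Suc (Suc l)" by (metis One_nat_def Suc_le_D not_less_eq_eq)
        have "c * w (Suc l) * ?p (Suc l) \<ge> 0"
          using c w[of "Suc l"] pos[of "Suc l"] by (intro mult_nonneg_nonneg) auto
        then show ?thesis using less[of l] l by simp
      qed
    qed
    then show ?case by (intro exI[of _ "max 1 (?p 1)"]) auto
  next
    case (Suc q)
    then obtain C where C: "\<And>j. ?p j * (1 + real j) ^ q \<le> C" by blast
    have grow: "(1 + real (Suc j)) ^ r \<le> 2 ^ r * (1 + real j) ^ r" for j r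
      unfolding power_mult_distrib[symmetric] by (intro power_mono) auto
    have C0: "C \<ge> 0" using C[of 0] by simp
    define D where "D = 2 ^ q * C / (c * d)"
    have odd_bound: "?p (Suc j) * (1 + real (Suc j)) ^ Suc q \<le> D" if "even j" for j
    proof -
      have "d * (1 + real (Suc j)) * ?p (Suc j) \<le> w (Suc j) * ?p (Suc j)"
        using w_odd[of "Suc j"] that pos[of "Suc j"] by (intro mult_right_mono) auto
      also have "\<dots> \<le> ?p j / c" by (rule step)
      finally have "(d * (1 + real (Suc j)) * ?p (Suc j)) * (1 + real (Suc j)) ^ q \<le> ?p j / c * (1 + real (Suc j)) ^ q"
        by (intro mult_right_mono) auto
      also have "\<dots> \<le> ?p j / c * (2 ^ q * (1 + real j) ^ q)"
        using grow[of j q] pos[of j] c by (intro mult_left_mono) auto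
      also have "\<dots> = 2 ^ q * (?p j * (1 + real j) ^ q) / c" by simp
      also have "\<dots> \<le> 2 ^ q * C / c" using C[of j] c by (intro divide_right_mono mult_left_mono) auto
      finally have "d * (?p (Suc j) * (1 + real (Suc j)) ^ Suc q) \<le> 2 ^ q * C / c" by (simp add: mult_ac)
      then show ?thesis using d c by (simp add: D_def field_simps)
    qed
    have even_bound: "?p (Suc j) * (1 + real (Suc j)) ^ Suc q \<le> 2 ^ Suc q * D / c" if odd: "odd j" for j
    proof -
      obtain l where l: "j = Suc l" "even l" using odd by (cases j) auto
      have "1 * ?p (Suc j) \<le> w (Suc j) * ?p (Suc j)"
        using w[of "Suc j"] pos[of "Suc j"] by (intro mult_right_mono) auto
      also have "\<dots> \<le> ?p j / c" by (rule step)
      finally have "?p (Suc j) * (1 + real (Suc j)) ^ Suc q \<le> ?p j / c * (2 ^ Suc q * (1 + real j) ^ Suc q)"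
        using grow[of j "Suc q"] pos[of j] pos[of "Suc j"] c by (intro mult_mono) auto
      also have "\<dots> = 2 ^ Suc q * (?p j * (1 + real j) ^ Suc q) / c" by simp
      also have "\<dots> \<le> 2 ^ Suc q * D / c"
        using odd_bound[OF l(2)] l(1) c by (intro divide_right_mono mult_left_mono) auto
      finally show ?thesis .
    qed
    have "?p j * (1 + real j) ^ Suc q \<le> max 1 (max D (2 ^ Suc q * D / c))" for j
    proof (cases j)
      case (Suc l)
      then show ?thesis using odd_bound[of l] even_bound[of l] by (cases "even l") (auto simp: le_max_iff_disj)
    qed simp
    then show ?case by blast
  }
qed

text \<open>In terms of the entries \<open>S\<close> of A F and i B \<omega> both eigenvalue
  equations become the single relation \<open>S_rec\<close>. The condition \<open>n < k\<close>
  makes A negative at frequency zero, which starts the recursion with the right sign, and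
  \<open>1 \<le> n\<close> makes all later weights at least 1.\<close>

lemma chain_mode_ex:
  assumes n: "1 \<le> n" "n < k"
  shows "\<exists>\<rho> \<phi> \<psi>. chain_mode k n \<rho> \<phi> \<psi>"
proof -
  define a where "a m = asym k (m, int n)" for m
  define b where "b m = bsym k (m, int n)" for m
  have k: "real k > 0" "real n \<ge> 1" "real n + 1 \<le> real k" using n by auto
  have nk2: "(real n)\<^sup>2 < (real k)\<^sup>2" using k by (intro power_strict_mono) auto
  have n2: "(real n)\<^sup>2 \<ge> 1" using k by simp
  have msq_eq: "msq (m, int n) = (real_of_int m)\<^sup>2 + (real n)\<^sup>2" for m by (simp add: msq_def)
  have a_eq: "a m = ((real_of_int m)\<^sup>2 + (real n)\<^sup>2 - (real k)\<^sup>2) / (1 + (real_of_int m)\<^sup>2 + (real n)\<^sup>2)" for m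
    by (simp add: a_def asym_eq msq_eq add.assoc)
  have den: "1 + (real_of_int m)\<^sup>2 + (real n)\<^sup>2 > 0" for m
    by (smt (verit) zero_le_power2)
  have b_pos: "b m > 0" for m
    using n2 k by (simp add: b_def bsym_def msq_eq add_nonneg_pos add_pos_nonneg)
  have a0: "a 0 < 0" using nk2 by (simp add: a_eq divide_neg_pos add_pos_nonneg)
  have sq: "(real_of_int (int k * j))\<^sup>2 = (real k)\<^sup>2 * (real_of_int j)\<^sup>2" for j
    by (simp add: power_mult_distrib)
  have sq_ge: "(real_of_int (int k * j))\<^sup>2 \<ge> (real k)\<^sup>2" if "j \<noteq> 0" for j
  proof -
    have "(real_of_int j)\<^sup>2 \<ge> 1" using that by (metis int_one_le_iff_zero_less of_int_1_le_iff of_int_power zero_less_power2)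
    then have "(real k)\<^sup>2 * 1 \<le> (real k)\<^sup>2 * (real_of_int j)\<^sup>2" by (intro mult_left_mono) auto
    then show ?thesis by (simp only: sq)
  qed
  have a_pos: "a (int k * j) > 0" if "j \<noteq> 0" for j
    unfolding a_eq using sq_ge[OF that] n2 den[of "int k * j"] by (intro divide_pos_pos) auto
  define w where "w j = (if even j then 1 / a (int k * int j) else 1 / b (int k * int j))" for j :: nat
  \<comment> \<open>At \<open>j = 0\<close> the relation reads 2 S(1) = - c w(0) S(0) by evenness,
    so the initial slope is \<open>- w 0 / 2\<close>, positive because A is negative there.\<close>
  define \<alpha> where "\<alpha> = - w 0 / 2"
  have \<alpha>: "\<alpha> > 0" using a0 by (simp add: \<alpha>_def w_def)
  have w_odd_eq: "w j = ((real k)\<^sup>2 * (real j)\<^sup>2 + (real n)\<^sup>2) / (1 + (real k)\<^sup>2)" if "odd j" for j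
    using that by (simp add: w_def b_def bsym_def msq_eq power_mult_distrib)
  have w1: "w j \<ge> 1" if "j \<ge> 1" for j
  proof (cases "even j")
    case True
    have "a (int k * int j) \<le> 1" using msq_nonneg by (simp add: a_def asym_def add_nonneg_nonneg)
    then show ?thesis using a_pos[of "int j"] that True by (simp add: w_def)
  next
    case False
    have "1 * 1 \<le> (real j)\<^sup>2" using that by simp
    then have "(real k)\<^sup>2 * 1 \<le> (real k)\<^sup>2 * (real j)\<^sup>2" by (intro mult_left_mono) auto
    then have "1 + (real k)\<^sup>2 \<le> (real k)\<^sup>2 * (real j)\<^sup>2 + (real n)\<^sup>2" using n2 by linarith
    then show ?thesis unfolding w_odd_eq[OF False] by (simp add: le_divide_eq add_pos_nonneg)
  qed
  obtain c where c: "c > 0" and pos: "\<And>j. rec_sol w \<alpha> c j > 0"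
    using rec_sol_positive_ex[OF \<alpha>, of w] w1 by blast
  define p where "p = rec_sol w \<alpha> c"
  \<comment> \<open>The signs + + - - repeat with period four and turn the sum of neighbours into
    the difference occurring in \<open>rec_sol\<close>.\<close>
  define S where "S j = (-1) ^ (nat \<bar>j\<bar> div 2) * p (nat \<bar>j\<bar>)" for j :: int
  have S_minus: "S (- j) = S j" for j by (simp add: S_def)
  have S_abs: "\<bar>S j\<bar> = p (nat \<bar>j\<bar>)" for j using pos[of "nat \<bar>j\<bar>"] by (simp add: S_def p_def abs_mult power_abs)
  have S_rec_nat: "S (int j - 1) + S (int j + 1) = (if even j then - 1 else 1) * c * w j * S (int j)" for j
  proof (cases j)
    case 0
    then show ?thesis by (simp add: S_def p_def \<alpha>_def)
  next
    case (Suc i)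
    have nats: "nat \<bar>int j - 1\<bar> = i" "nat \<bar>int j + 1\<bar> = Suc (Suc i)" "nat \<bar>int j\<bar> = Suc i" using Suc by auto
    have rec: "p (Suc (Suc i)) = p i - c * w (Suc i) * p (Suc i)" by (simp add: p_def)
    show ?thesis
    proof (cases "even i")
      case True
      then obtain l where "i = 2 * l" by (rule evenE)
      then show ?thesis unfolding S_def nats rec using Suc by (simp add: algebra_simps)
    next
      case False
      then obtain l where "i = 2 * l + 1" by (rule oddE)
      then show ?thesis unfolding S_def nats rec using Suc by (simp add: algebra_simps)
    qed
  qed
  have S_rec: "S (j - 1) + S (j + 1) = (if even j then - 1 else 1) * c * w (nat \<bar>j\<bar>) * S j" for j
  proof (cases "j \<ge> 0")
    case True
    then show ?thesis using S_rec_nat[of "nat j"] by (simp add: even_nat_iff)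
  next
    case False
    have "S (j - 1) = S (- j + 1)" "S (j + 1) = S (- j - 1)" by (rule trans[OF S_minus[symmetric]], rule arg_cong[where f = S], simp)+
    then show ?thesis using False S_rec_nat[of "nat (- j)"] S_minus[of j] by (simp add: even_nat_iff)
  qed
  have w_a: "w (nat \<bar>j\<bar>) = 1 / a (int k * j)" if "even j" for j
    using that unfolding w_def by (simp add: a_eq even_nat_iff power_mult_distrib)
  have w_b: "w (nat \<bar>j\<bar>) = 1 / b (int k * j)" if "odd j" for j
    using that unfolding w_def by (simp add: b_def bsym_def msq_def even_nat_iff power_mult_distrib)
  define \<phi> where "\<phi> m = (if \<exists>j. even j \<and> m = int k * j then S (m div int k) / a m else 0)" for m
  define \<psi> where "\<psi> m = (if \<exists>j. odd j \<and> m = int k * j then S (m div int k) / b m else 0)" for m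
  have k0: "int k \<noteq> 0" using n by simp
  have \<phi>_even: "\<phi> (int k * j) = S j / a (int k * j)" if "even j" for j
    using that k0 by (auto simp: \<phi>_def)
  have \<psi>_odd: "\<psi> (int k * j) = S j / b (int k * j)" if "odd j" for j
    using that k0 by (auto simp: \<psi>_def)
  have a\<phi>: "a (int k * j) * \<phi> (int k * j) = S j" if "even j" for j
  proof -
    have "a (int k * j) \<noteq> 0" using a0 a_pos[of j] by (cases "j = 0") auto
    then show ?thesis using \<phi>_even[OF that] by simp
  qed
  have b\<psi>: "b (int k * j) * \<psi> (int k * j) = S j" if "odd j" for j
    using \<psi>_odd[OF that] b_pos[of "int k * j"] by simp
  have shift: "int k * j - int k = int k * (j - 1)" "int k * j + int k = int k * (j + 1)" for j
    by (simp_all add: algebra_simps)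
  have \<phi>0: "\<phi> m = 0" if "\<not> (\<exists>j. even j \<and> m = int k * j)" for m using that unfolding \<phi>_def by (rule if_not_P)
  have \<psi>0: "\<psi> m = 0" if "\<not> (\<exists>j. odd j \<and> m = int k * j)" for m using that unfolding \<psi>_def by (rule if_not_P)
  have shiftE: "\<exists>j. odd j = P \<and> m = int k * j"
    if "(\<exists>j. odd j = (\<not> P) \<and> m - int k = int k * j) \<or> (\<exists>j. odd j = (\<not> P) \<and> m + int k = int k * j)" for m P
  proof -
    from that consider j where "odd j = (\<not> P)" "m = int k * (j + 1)" | j where "odd j = (\<not> P)" "m = int k * (j - 1)"
      by (auto simp: algebra_simps eq_diff_eq)
    then show ?thesis
    proof cases
      case (1 j)
      then show ?thesis by (intro exI[of _ "j + 1"]) auto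
    next
      case (2 j)
      then show ?thesis by (intro exI[of _ "j - 1"]) auto
    qed
  qed
  define \<rho> where "\<rho> = c * real n * real k / 2"
  have eq\<phi>: "\<rho> * \<phi> m = - (real n * real k / 2) * (b (m - int k) * \<psi> (m - int k) + b (m + int k) * \<psi> (m + int k))" for m
  proof (cases "\<exists>j. even j \<and> m = int k * j")
    case True
    then obtain j where j: "even j" "m = int k * j" by blast
    have "b (m - int k) * \<psi> (m - int k) + b (m + int k) * \<psi> (m + int k) = S (j - 1) + S (j + 1)"
      unfolding j(2) shift using j(1) by (subst (1 2) b\<psi>) auto
    also have "\<dots> = - (c * \<phi> m)" using S_rec[of j] j by (simp add: w_a \<phi>_even)
    finally show ?thesis by (simp add: \<rho>_def)
  next
    case False
    then have "\<phi> m = 0" "\<psi> (m - int k) = 0" "\<psi> (m + int k) = 0"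
      using shiftE[of False m] by (auto intro!: \<phi>0 \<psi>0)
    then show ?thesis by simp
  qed
  have eq\<psi>: "\<rho> * \<psi> m = (real n * real k / 2) * (a (m - int k) * \<phi> (m - int k) + a (m + int k) * \<phi> (m + int k))" for m
  proof (cases "\<exists>j. odd j \<and> m = int k * j")
    case True
    then obtain j where j: "odd j" "m = int k * j" by blast
    have "a (m - int k) * \<phi> (m - int k) + a (m + int k) * \<phi> (m + int k) = S (j - 1) + S (j + 1)"
      unfolding j(2) shift using j(1) by (subst (1 2) a\<phi>) auto
    also have "\<dots> = c * \<psi> m" using S_rec[of j] j by (simp add: w_b \<psi>_odd)
    finally show ?thesis by (simp add: \<rho>_def)
  next
    case False
    then have "\<psi> m = 0" "\<phi> (m - int k) = 0" "\<phi> (m + int k) = 0"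
      using shiftE[of True m] by (auto intro!: \<phi>0 \<psi>0)
    then show ?thesis by simp
  qed
  have ab_even: "a (- m) = a m" "b (- m) = b m" for m by (simp_all add: a_eq b_def bsym_def msq_def)
  have parity: "\<phi> (- m) = \<phi> m" "\<psi> (- m) = \<psi> m" for m
  proof -
    show "\<phi> (- m) = \<phi> m"
    proof (cases "\<exists>j. even j \<and> m = int k * j")
      case True
      then obtain j where "even j" "m = int k * j" by blast
      then show ?thesis using \<phi>_even[of "- j"] \<phi>_even[of j] S_minus ab_even by simp
    next
      case False
      then have "\<not> (\<exists>j. even j \<and> - m = int k * j)" by (metis even_minus minus_equation_iff mult_minus_right)
      then show ?thesis using \<phi>0[of m] \<phi>0[of "- m"] False by simp
    qed
    show "\<psi> (- m) = \<psi> m"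
    proof (cases "\<exists>j. odd j \<and> m = int k * j")
      case True
      then obtain j where "odd j" "m = int k * j" by blast
      then show ?thesis using \<psi>_odd[of "- j"] \<psi>_odd[of j] S_minus ab_even by simp
    next
      case False
      then have "\<not> (\<exists>j. odd j \<and> - m = int k * j)" by (metis even_minus minus_equation_iff mult_minus_right)
      then show ?thesis using \<psi>0[of m] \<psi>0[of "- m"] False by simp
    qed
  qed
  \<comment> \<open>The reciprocal symbols grow at most quadratically. As \<open>\<phi>\<close> and
    \<open>\<psi>\<close> are \<open>S\<close> times \<open>w\<close>, this converts decay of
    \<open>S\<close> into decay of the mode.\<close>
  define W where "W = 2 + (real n)\<^sup>2 + \<bar>w 0\<bar>"
  have w_bound: "\<bar>w j\<bar> \<le> W * (1 + real j) ^ 2" for j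
  proof -
    have one: "1 \<le> (1 + real j)\<^sup>2" by (simp add: one_le_power)
    have W1: "W * 1 \<le> W * (1 + real j)\<^sup>2" using one by (intro mult_left_mono) (auto simp: W_def)
    show ?thesis
    proof (cases "j = 0")
      case True
      then show ?thesis by (simp add: W_def)
    next
      case j: False
      show ?thesis
      proof (cases "even j")
        case True
        let ?m = "int k * int j"
        obtain l where l: "j = 2 * l" using True by (rule evenE)
        have "(real l)\<^sup>2 \<ge> 1" using l j by simp
        then have "(real k)\<^sup>2 * 4 * 1 \<le> (real k)\<^sup>2 * 4 * (real l)\<^sup>2" by (intro mult_left_mono) auto
        then have m4: "(real_of_int ?m)\<^sup>2 \<ge> 4 * (real k)\<^sup>2" using l by (simp add: power_mult_distrib)
        have k1: "1 \<le> (real k)\<^sup>2" using k by (simp add: one_le_power)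
        have num: "(real_of_int ?m)\<^sup>2 + (real n)\<^sup>2 - (real k)\<^sup>2 > 0" using m4 n2 k1 by linarith
        have "w j = (1 + (real_of_int ?m)\<^sup>2 + (real n)\<^sup>2) / ((real_of_int ?m)\<^sup>2 + (real n)\<^sup>2 - (real k)\<^sup>2)"
          using True by (simp add: w_def a_eq)
        also have "\<dots> \<le> 2" using num m4 n2 k1 by (simp add: divide_le_eq)
        finally have "w j \<le> 2" .
        moreover have "\<bar>w j\<bar> = w j" using w1[of j] j by simp
        moreover have "2 \<le> W" by (simp add: W_def)
        ultimately show ?thesis using W1 by linarith
      next
        case False
        have "w j \<le> (real j)\<^sup>2 + (real n)\<^sup>2"
          unfolding w_odd_eq[OF False] by (simp add: divide_le_eq add_pos_nonneg algebra_simps)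
        also have "\<dots> \<le> (1 + real j)\<^sup>2 + (real n)\<^sup>2 * (1 + real j)\<^sup>2"
          using one mult_left_mono[OF one, of "(real n)\<^sup>2"] by (intro add_mono power_mono) auto
        also have "\<dots> \<le> W * (1 + real j)\<^sup>2" unfolding W_def by (simp add: algebra_simps)
        finally show ?thesis using w1[of j] j by simp
      qed
    qed
  qed
  have decay: "\<exists>C. \<forall>m. \<bar>\<phi> m\<bar> * (1 + (real_of_int m)\<^sup>2) ^ q \<le> C \<and> \<bar>\<psi> m\<bar> * (1 + (real_of_int m)\<^sup>2) ^ q \<le> C" for q
  proof -
    have w_odd: "w j \<ge> 1 / 4 * (1 + real j)" if "odd j" for j
    proof -
      have j: "real j \<ge> 1" using odd_pos[OF that] by linarith
      have k1: "1 \<le> (real k)\<^sup>2" using k by (simp add: one_le_power)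
      have "1 / 4 * (1 + x) \<le> x\<^sup>2 / 2" if "1 \<le> x" for x :: real
        using that self_le_power[of x 2] by simp
      then have "1 / 4 * (1 + real j) \<le> (real j)\<^sup>2 / 2" using j by blast
      also have "\<dots> \<le> (real k)\<^sup>2 * (real j)\<^sup>2 / (1 + (real k)\<^sup>2)"
      proof -
        have "(real j)\<^sup>2 * (1 + (real k)\<^sup>2) \<le> (real j)\<^sup>2 * (2 * (real k)\<^sup>2)"
          using k1 by (intro mult_left_mono) auto
        then show ?thesis by (simp add: field_simps add_pos_nonneg)
      qed
      also have "\<dots> \<le> w j" unfolding w_odd_eq[OF that] by (intro divide_right_mono) auto
      finally show ?thesis .
    qed
    \<comment> \<open>Two powers pay for \<open>w_bound\<close>, and \<open>2 * q\<close> powers for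
      the q-th power of 1 + m^2 at m = k j.\<close>
    obtain C where C: "\<And>j. p j * (1 + real j) ^ (2 + 2 * q) \<le> C"
      using rec_sol_decay[OF c pos w1 _ w_odd, of "2 + 2 * q"] unfolding p_def by auto
    have main: "\<bar>S j * w (nat \<bar>j\<bar>)\<bar> * (1 + (real_of_int (int k * j))\<^sup>2) ^ q \<le> W * (real k ^ 2) ^ q * C" for j
    proof -
      let ?j = "nat \<bar>j\<bar>"
      have k1: "1 \<le> (real k)\<^sup>2" using k by (simp add: one_le_power)
      have "1 + (real k)\<^sup>2 * (real ?j)\<^sup>2 \<le> (real k)\<^sup>2 * (1 + (real ?j)\<^sup>2)" using k1 by (simp add: distrib_left)
      also have "\<dots> \<le> (real k)\<^sup>2 * (1 + real ?j)\<^sup>2" by (intro mult_left_mono) (auto simp: power2_eq_square algebra_simps)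
      finally have "(1 + (real k)\<^sup>2 * (real ?j)\<^sup>2) ^ q \<le> ((real k)\<^sup>2 * (1 + real ?j)\<^sup>2) ^ q"
        by (intro power_mono) auto
      moreover have "(real_of_int (int k * j))\<^sup>2 = (real k)\<^sup>2 * (real ?j)\<^sup>2" by (simp add: power_mult_distrib)
      ultimately have 1: "(1 + (real_of_int (int k * j))\<^sup>2) ^ q \<le> ((real k)\<^sup>2 * (1 + real ?j)\<^sup>2) ^ q" by simp
      have "\<bar>S j * w ?j\<bar> \<le> p ?j * (W * (1 + real ?j) ^ 2)"
        unfolding abs_mult S_abs
        by (rule mult_left_mono[OF w_bound]) (simp add: p_def less_imp_le[OF pos])
      then have "\<bar>S j * w ?j\<bar> * (1 + (real_of_int (int k * j))\<^sup>2) ^ q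
        \<le> p ?j * (W * (1 + real ?j) ^ 2) * ((real k)\<^sup>2 * (1 + real ?j)\<^sup>2) ^ q"
        using 1 pos[of ?j] by (intro mult_mono) (auto simp: p_def W_def)
      also have "\<dots> = W * (real k ^ 2) ^ q * (p ?j * (1 + real ?j) ^ (2 + 2 * q))"
      proof -
        have e: "(1 + real ?j) ^ (2 + 2 * q) = (1 + real ?j)\<^sup>2 * ((1 + real ?j)\<^sup>2) ^ q"
          unfolding power_add power_mult ..
        show ?thesis unfolding e power_mult_distrib by (simp only: mult_ac)
      qed
      also have "\<dots> \<le> W * (real k ^ 2) ^ q * C" by (intro mult_left_mono C) (auto simp: W_def)
      finally show ?thesis .
    qed
    have C0: "W * (real k ^ 2) ^ q * C \<ge> 0" using order_trans[OF _ main[of 0]] by simp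
    have "\<bar>\<phi> m\<bar> * (1 + (real_of_int m)\<^sup>2) ^ q \<le> W * (real k ^ 2) ^ q * C" for m
    proof (cases "\<exists>j. even j \<and> m = int k * j")
      case True
      then obtain j where "even j" "m = int k * j" by blast
      then show ?thesis using main[of j] by (simp add: \<phi>_even w_a)
    next
      case False
      then show ?thesis using C0 \<phi>0[OF False] by simp
    qed
    moreover have "\<bar>\<psi> m\<bar> * (1 + (real_of_int m)\<^sup>2) ^ q \<le> W * (real k ^ 2) ^ q * C" for m
    proof (cases "\<exists>j. odd j \<and> m = int k * j")
      case True
      then obtain j where "odd j" "m = int k * j" by blast
      then show ?thesis using main[of j] by (simp add: \<psi>_odd w_b)
    next
      case False
      then show ?thesis using C0 \<psi>0[OF False] by simp
    qed
    ultimately show ?thesis by blast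
  qed
  have "\<rho> > 0" using c k by (simp add: \<rho>_def)
  moreover have "\<phi> 0 \<noteq> 0" using \<phi>_even[of 0] a0 by (simp add: S_def p_def)
  moreover have "\<forall>m. \<phi> m \<noteq> 0 \<longrightarrow> (\<exists>j. even j \<and> m = int k * j)" using \<phi>0 by blast
  moreover have "\<forall>m. \<psi> m \<noteq> 0 \<longrightarrow> (\<exists>j. odd j \<and> m = int k * j)" using \<psi>0 by blast
  ultimately have "chain_mode k n \<rho> \<phi> \<psi>"
    unfolding chain_mode_def using eq\<phi> eq\<psi> parity decay unfolding a_def b_def by blast
  then show ?thesis by blast
qed

section \<open>The operator in Fourier coefficients\<close>

lemma integral_cis: "integral {0..2 * pi} (\<lambda>x. cis (of_int j * x)) = (if j = 0 then of_real (2 * pi) else 0)"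
proof (cases "j = 0")
  case False
  have "((\<lambda>x. cis (of_int j * x)) has_integral
      cis (of_int j * (2 * pi)) / (\<i> * of_int j) - cis (of_int j * 0) / (\<i> * of_int j)) {0..2 * pi}"
  proof (rule fundamental_theorem_of_calculus)
    fix x :: real
    have "((\<lambda>x. exp (\<i> * of_int j * of_real x) / (\<i> * of_int j)) has_vector_derivative
        exp (\<i> * of_int j * of_real x)) (at x within {0..2 * pi})"
      using False by (auto intro!: derivative_eq_intros has_vector_derivative_real_field simp: field_simps)
    moreover have "exp (\<i> * of_int j * of_real x) = cis (of_int j * x)" for x
      by (simp add: cis_conv_exp mult.assoc)
    ultimately show "((\<lambda>x. cis (of_int j * x) / (\<i> * of_int j)) has_vector_derivative cis (of_int j * x))
        (at x within {0..2 * pi})" by simp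
  qed simp
  moreover have "cis (of_int j * (2 * pi)) = 1"
    by (metis Ints_of_int cis_multiple_2pi mult.assoc mult.commute)
  ultimately show ?thesis using False by (simp add: integral_unique)
qed (simp add: scaleR_conv_of_real)

lemma integrable_cis: "(\<lambda>x. cis (of_int j * x)) integrable_on {0..2 * pi}"
  by (intro integrable_continuous_real continuous_intros)

lemma fourier_cos: "fourier (\<lambda>x. cos (real n * x)) m = ((if m = int n then 1 else 0) + (if m = - int n then 1 else 0)) / 2"
proof -
  have eq: "complex_of_real (cos (real n * x)) * cis (- (of_int m * x))
      = (1 / 2) * (cis (of_int (int n - m) * x) + cis (of_int (- int n - m) * x))" for x
    by (simp add: complex_eq_iff cos_diff cos_add sin_diff sin_add algebra_simps add_divide_distrib diff_divide_distrib)
  have "integral {0..2 * pi} (\<lambda>x. complex_of_real (cos (real n * x)) * cis (- (of_int m * x)))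
      = (1 / 2) * ((if int n - m = 0 then of_real (2 * pi) else 0) + (if - int n - m = 0 then of_real (2 * pi) else 0))"
    unfolding eq integral_mult_right
    by (subst Henstock_Kurzweil_Integration.integral_add[OF integrable_cis integrable_cis]) (simp only: integral_cis)
  note int_eq = this
  show ?thesis unfolding fourier_def int_eq by (auto simp: field_simps)
qed

lemma fourier_sin: "fourier (\<lambda>x. sin (real n * x)) m = ((if m = int n then - \<i> else 0) + (if m = - int n then \<i> else 0)) / 2"
proof -
  have eq: "complex_of_real (sin (real n * x)) * cis (- (of_int m * x))
      = (\<i> / 2) * (cis (of_int (- int n - m) * x) - cis (of_int (int n - m) * x))" for x
    by (simp add: complex_eq_iff cos_diff cos_add sin_diff sin_add algebra_simps add_divide_distrib diff_divide_distrib)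
  have "integral {0..2 * pi} (\<lambda>x. complex_of_real (sin (real n * x)) * cis (- (of_int m * x)))
      = (\<i> / 2) * ((if - int n - m = 0 then of_real (2 * pi) else 0) - (if int n - m = 0 then of_real (2 * pi) else 0))"
    unfolding eq integral_mult_right
    by (subst Henstock_Kurzweil_Integration.integral_diff[OF integrable_cis integrable_cis]) (simp only: integral_cis)
  note int_eq = this
  show ?thesis unfolding fourier_def int_eq by (auto simp: field_simps)
qed

section \<open>The Sobolev scale as weighted sequence spaces\<close>

definition sob :: "real \<Rightarrow> int \<times> int \<Rightarrow> real" where
  "sob \<sigma> m = (1 + msq m) powr \<sigma>"

lemma msq1_pos: "1 + msq m > 0"
  using msq_nonneg[of m] by simp

lemma sob_pos: "\<forall>m. sob \<sigma> m > 0"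
  unfolding sob_def using msq1_pos by (metis powr_gt_zero less_irrefl)

lemma sob_nonneg: "\<forall>m. sob \<sigma> m \<ge> 0"
  by (simp add: sob_def)

lemma sobolev2_wsp: "sobolev2 \<sigma> = wsp (sob \<sigma>)"
  by (simp add: sobolev2_def wsp_def sob_def)

lemma norm2_wn: "norm2 \<sigma> = wn (sob \<sigma>)"
  by (simp add: norm2_def wn_def sob_def fun_eq_iff)

lemma Xnorm_pair: "Xnorm s = pair_norm (wn (sob (s - 1))) (wn (sob s))"
  by (simp add: Xnorm_def pair_norm_def norm2_wn fun_eq_iff split_def)

definition Xall :: "real \<Rightarrow> state set" where
  "Xall s = wsp (sob (s - 1)) \<times> wsp (sob s)"

lemma nspace_Xall: "nspace (Xall s) (Xnorm s)"
  unfolding Xall_def Xnorm_pair by (intro nspace_pair nspace_wsp sob_pos)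

lemma dual_comb:
  assumes "\<phi> \<in> dual_space N V" "\<psi> \<in> dual_space N V"
  shows "(\<lambda>u. a * \<phi> u + b * \<psi> u) \<in> dual_space N V"
proof -
  obtain C where C: "\<forall>u\<in>V. cmod (\<phi> u) \<le> C * N u" using assms(1) by (auto simp: dual_space_def)
  obtain D where D: "\<forall>u\<in>V. cmod (\<psi> u) \<le> D * N u" using assms(2) by (auto simp: dual_space_def)
  have "cmod (a * \<phi> u + b * \<psi> u) \<le> (cmod a * C + cmod b * D) * N u" if "u \<in> V" for u
  proof -
    have "cmod (a * \<phi> u + b * \<psi> u) \<le> cmod a * cmod (\<phi> u) + cmod b * cmod (\<psi> u)"
      using norm_triangle_ineq[of "a * \<phi> u" "b * \<psi> u"] by (simp add: norm_mult)
    also have "\<dots> \<le> cmod a * (C * N u) + cmod b * (D * N u)"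
      using C D that by (intro add_mono mult_left_mono) auto
    finally show ?thesis by (simp add: algebra_simps)
  qed
  moreover have "linear_on V (\<lambda>u. a * \<phi> u + b * \<psi> u)"
    using assms by (auto simp: dual_space_def linear_on_def scaleC_complex_def algebra_simps)
  ultimately show ?thesis unfolding dual_space_def by blast
qed

lemma dual_subset:
  assumes "\<phi> \<in> dual_space N V" "V' \<subseteq> V"
  shows "\<phi> \<in> dual_space N V'"
  using assms unfolding dual_space_def linear_on_def by blast

lemma coord_Xall:
  "(\<lambda>u. fst u m) \<in> dual_space (Xnorm s) (Xall s)" "(\<lambda>u. snd u m) \<in> dual_space (Xnorm s) (Xall s)"
proof -
  have N: "\<forall>v\<in>wsp (sob \<sigma>). 0 \<le> wn (sob \<sigma>) v" for \<sigma> using wn_nonneg[OF sob_nonneg] by simp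
  show "(\<lambda>u. fst u m) \<in> dual_space (Xnorm s) (Xall s)"
    unfolding Xall_def Xnorm_pair by (rule dual_pair(1)[OF N N coord_dual[OF sob_pos]])
  show "(\<lambda>u. snd u m) \<in> dual_space (Xnorm s) (Xall s)"
    unfolding Xall_def Xnorm_pair by (rule dual_pair(2)[OF N N coord_dual[OF sob_pos]])
qed

section \<open>The symmetry class in terms of Fourier coefficients\<close>

definition sg :: "int \<Rightarrow> complex" where
  "sg j = (if even j then 1 else - 1)"

lemma sg_simps [simp]: "sg (- j) = sg j" "sg (j + 1) = - sg j" "sg (j - 1) = - sg j" "sg j * sg j = 1"
  by (auto simp: sg_def)

lemma cis_pi_int: "cis (- (of_int (int k * j) * (pi / real k))) = sg j" if "k > 0"
proof -
  have "of_int (int k * j) * (pi / real k) = of_int j * pi" using that by simp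
  moreover have "cis (of_int j * pi) = sg j"
  proof (cases "even j")
    case True
    then obtain l where "j = 2 * l" by (rule evenE)
    then show ?thesis using cis_multiple_2pi[of "of_int l"] by (simp add: sg_def mult_ac)
  next
    case False
    then obtain l where "j = 2 * l + 1" by (rule oddE)
    then have "of_int j * pi = 2 * pi * of_int l + pi" by (simp add: algebra_simps)
    then have "cis (of_int j * pi) = cis (2 * pi * of_int l) * cis pi" by (simp only: cis_mult)
    then show ?thesis using cis_multiple_2pi[of "of_int l"] False by (simp add: sg_def)
  qed
  moreover have "cis (- x) = cnj (cis x)" for x by (simp add: cis_cnj)
  ultimately show ?thesis by (simp add: sg_def)
qed

lemma cis_eq_1: "cis (of_int m * (2 * pi / real k)) = 1 \<longleftrightarrow> int k dvd m" if "k > 0"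
proof
  assume "int k dvd m"
  then obtain j where "m = int k * j" by blast
  then have "of_int m * (2 * pi / real k) = 2 * pi * of_int j" using that by simp
  then show "cis (of_int m * (2 * pi / real k)) = 1" using cis_multiple_2pi[of "of_int j"] by simp
next
  assume "cis (of_int m * (2 * pi / real k)) = 1"
  then have "cos (of_int m * (2 * pi / real k)) = 1" by (simp add: complex_eq_iff)
  then obtain j :: int where "of_int m * (2 * pi / real k) = of_int j * 2 * pi"
    using cos_one_2pi_int by blast
  then have "of_int m = real k * of_int j" using that by (simp add: field_simps)
  then have "m = int k * j" by (metis of_int_eq_iff of_int_mult of_int_of_nat_eq)
  then show "int k dvd m" by simp
qed

text \<open>The conditions of \<open>Xsym\<close> on coefficients, freed from the norm: translation
  invariance restricts to m1 = k j, and on these frequencies the reflection x1 -> pi / k - x1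
  involves only the sign \<open>sg j\<close>.\<close>

definition sym :: "nat \<Rightarrow> state \<Rightarrow> bool" where
  "sym k u \<longleftrightarrow> fst u (0, 0) = 0
    \<and> (\<forall>m. \<not> int k dvd fst m \<longrightarrow> fst u m = 0 \<and> snd u m = 0)
    \<and> (\<forall>j l. fst u (- (int k * j), l) = - sg j * fst u (int k * j, l)
         \<and> snd u (- (int k * j), l) = sg j * snd u (int k * j, l))
    \<and> (\<forall>m l. fst u (m, - l) = - fst u (m, l) \<and> snd u (m, - l) = snd u (m, l))"

lemma Xsym_iff:
  assumes k: "k > 0"
  shows "u \<in> Xsym s k \<longleftrightarrow> u \<in> Xall s \<and> sym k u"
proof -
  obtain \<omega> F where u: "u = (\<omega>, F)" by (cases u)
  have tr: "translate1 (2 * pi / real k) c = c \<longleftrightarrow> (\<forall>m. \<not> int k dvd fst m \<longrightarrow> c m = 0)" for c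
    by (auto simp: translate1_def fun_eq_iff cis_eq_1[OF k] simp del: times_divide_eq_right)
  have re: "reflect1 (pi / real k) c = (\<lambda>m. \<epsilon> * c m) \<longleftrightarrow> (\<forall>j l. c (- (int k * j), l) = \<epsilon> * sg j * c (int k * j, l))"
    if supp: "\<forall>m. \<not> int k dvd fst m \<longrightarrow> c m = 0" for c \<epsilon>
  proof
    assume eq: "reflect1 (pi / real k) c = (\<lambda>m. \<epsilon> * c m)"
    show "\<forall>j l. c (- (int k * j), l) = \<epsilon> * sg j * c (int k * j, l)"
    proof (intro allI)
      fix j l
      have "sg j * c (- (int k * j), l) = \<epsilon> * c (int k * j, l)"
        using fun_cong[OF eq, of "(int k * j, l)"] cis_pi_int[OF k, of j] by (simp add: reflect1_def)
      then have "sg j * (sg j * c (- (int k * j), l)) = sg j * (\<epsilon> * c (int k * j, l))" by simp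
      then have "(sg j * sg j) * c (- (int k * j), l) = \<epsilon> * sg j * c (int k * j, l)" by (simp only: mult_ac)
      then show "c (- (int k * j), l) = \<epsilon> * sg j * c (int k * j, l)" by simp
    qed
  next
    assume eq: "\<forall>j l. c (- (int k * j), l) = \<epsilon> * sg j * c (int k * j, l)"
    show "reflect1 (pi / real k) c = (\<lambda>m. \<epsilon> * c m)"
    proof
      fix m :: "int \<times> int"
      obtain m1 l where m: "m = (m1, l)" by (cases m)
      show "reflect1 (pi / real k) c m = \<epsilon> * c m"
      proof (cases "int k dvd m1")
        case True
        then obtain j where j: "m1 = int k * j" by blast
        have "reflect1 (pi / real k) c m = sg j * c (- (int k * j), l)"
          using cis_pi_int[OF k, of j] by (simp add: reflect1_def m j)
        also have "\<dots> = \<epsilon> * (sg j * sg j) * c (int k * j, l)" using eq by (simp only: mult_ac)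
        finally show ?thesis by (simp add: m j)
      next
        case False
        then show ?thesis using supp by (simp add: reflect1_def m)
      qed
    qed
  qed
  have neg: "- c = (\<lambda>m. - 1 * c m)" for c :: dist2 by (simp add: fun_eq_iff)
  have pos: "c = (\<lambda>m. 1 * c m)" for c :: dist2 by simp
  have r2: "reflect2 \<omega> = - \<omega> \<longleftrightarrow> (\<forall>m l. \<omega> (m, - l) = - \<omega> (m, l))" "reflect2 F = F \<longleftrightarrow> (\<forall>m l. F (m, - l) = F (m, l))"
    by (auto simp: reflect2_def fun_eq_iff)
  have "u \<in> Xsym s k \<longleftrightarrow> u \<in> Xall s \<and> \<omega> (0, 0) = 0
     \<and> (\<forall>m. \<not> int k dvd fst m \<longrightarrow> \<omega> m = 0) \<and> (\<forall>m. \<not> int k dvd fst m \<longrightarrow> F m = 0)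
     \<and> reflect1 (pi / real k) \<omega> = (\<lambda>m. - 1 * \<omega> m) \<and> reflect1 (pi / real k) F = (\<lambda>m. 1 * F m)
     \<and> (\<forall>m l. \<omega> (m, - l) = - \<omega> (m, l)) \<and> (\<forall>m l. F (m, - l) = F (m, l))"
    unfolding u Xsym_def Xs_def Xall_def sobolev2_wsp tr[symmetric] r2[symmetric] neg[symmetric] pos[symmetric]
    by auto
  also have "\<dots> \<longleftrightarrow> u \<in> Xall s \<and> sym k u"
    unfolding sym_def u fst_conv snd_conv using re[of \<omega> "- 1"] re[of F 1] by auto
  finally show ?thesis .
qed

lemma sym_coords:
  assumes "sym k u"
  shows "\<not> int k dvd m1 \<Longrightarrow> fst u (m1, l) = 0" "\<not> int k dvd m1 \<Longrightarrow> snd u (m1, l) = 0"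
    "fst u (- (int k * j), l) = - sg j * fst u (int k * j, l)" "snd u (- (int k * j), l) = sg j * snd u (int k * j, l)"
    "fst u (m1, - l) = - fst u (m1, l)" "snd u (m1, - l) = snd u (m1, l)" "fst u (m1, 0) = 0"
proof -
  have "fst u (m1, - 0) = - fst u (m1, 0)" using assms unfolding sym_def by blast
  then show "fst u (m1, 0) = 0" by simp
qed (use assms in \<open>auto simp: sym_def\<close>)

text \<open>Each symmetry is a family of linear relations between at most two Fourier coefficients,
  hence a common kernel of bounded functionals; \<open>nspace_ker\<close> then gives
  completeness.\<close>

lemma Xsym_ker:
  assumes k: "k > 0"
  shows "\<exists>\<Phi>\<subseteq>dual_space (Xnorm s) (Xall s). Xsym s k = ker_on (Xall s) \<Phi>"
proof -
  let ?c1 = "\<lambda>a m b m'. \<lambda>u::state. a * fst u m + b * fst u m'"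
  let ?c2 = "\<lambda>a m b m'. \<lambda>u::state. a * snd u m + b * snd u m'"
  define \<Phi> where "\<Phi> = {?c1 1 (0, 0) 0 (0, 0)}
    \<union> {?c1 1 m 0 m | m. \<not> int k dvd fst m} \<union> {?c2 1 m 0 m | m. \<not> int k dvd fst m}
    \<union> {?c1 1 (- (int k * j), l) (sg j) (int k * j, l) | j l. True}
    \<union> {?c2 1 (- (int k * j), l) (- sg j) (int k * j, l) | j l. True}
    \<union> {?c1 1 (m, - l) 1 (m, l) | m l. True} \<union> {?c2 1 (m, - l) (- 1) (m, l) | m l. True}"
  have "\<Phi> \<subseteq> dual_space (Xnorm s) (Xall s)"
    unfolding \<Phi>_def using dual_comb[OF coord_Xall(1) coord_Xall(1)] dual_comb[OF coord_Xall(2) coord_Xall(2)]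
    by blast
  moreover have "(\<forall>\<phi>\<in>\<Phi>. \<phi> u = 0) \<longleftrightarrow> sym k u" for u
  proof
    assume h: "\<forall>\<phi>\<in>\<Phi>. \<phi> u = 0"
    have "fst u (0, 0) = 0" using bspec[OF h, of "?c1 1 (0, 0) 0 (0, 0)"] by (simp add: \<Phi>_def)
    moreover have "fst u m = 0 \<and> snd u m = 0" if "\<not> int k dvd fst m" for m
    proof -
      have "?c1 1 m 0 m \<in> \<Phi>" "?c2 1 m 0 m \<in> \<Phi>" using that unfolding \<Phi>_def by blast+
      from bspec[OF h this(1)] bspec[OF h this(2)] show ?thesis by simp
    qed
    moreover have "fst u (- (int k * j), l) = - sg j * fst u (int k * j, l)" for j l
    proof -
      have "?c1 1 (- (int k * j), l) (sg j) (int k * j, l) \<in> \<Phi>" unfolding \<Phi>_def by blast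
      from bspec[OF h this] show ?thesis by (simp add: eq_neg_iff_add_eq_0)
    qed
    moreover have "snd u (- (int k * j), l) = sg j * snd u (int k * j, l)" for j l
    proof -
      have "?c2 1 (- (int k * j), l) (- sg j) (int k * j, l) \<in> \<Phi>" unfolding \<Phi>_def by blast
      from bspec[OF h this] show ?thesis by (simp add: eq_neg_iff_add_eq_0)
    qed
    moreover have "fst u (m, - l) = - fst u (m, l)" for m l
    proof -
      have "?c1 1 (m, - l) 1 (m, l) \<in> \<Phi>" unfolding \<Phi>_def by blast
      from bspec[OF h this] show ?thesis by (simp add: eq_neg_iff_add_eq_0)
    qed
    moreover have "snd u (m, - l) = snd u (m, l)" for m l
    proof -
      have "?c2 1 (m, - l) (- 1) (m, l) \<in> \<Phi>" unfolding \<Phi>_def by blast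
      from bspec[OF h this] show ?thesis by (simp add: eq_neg_iff_add_eq_0)
    qed
    ultimately show "sym k u" unfolding sym_def by blast
  qed (auto simp: sym_def \<Phi>_def)
  ultimately show ?thesis
    by (intro exI[of _ \<Phi>]) (auto simp: ker_on_def Xsym_iff[OF k])
qed

lemma nspace_Xsym:
  assumes "k > 0"
  shows "nspace (Xsym s k) (Xnorm s)"
proof -
  obtain \<Phi> where \<Phi>: "\<Phi> \<subseteq> dual_space (Xnorm s) (Xall s)" "Xsym s k = ker_on (Xall s) \<Phi>"
    using Xsym_ker[OF assms, of s] by auto
  show ?thesis unfolding \<Phi>(2) by (rule nspace.nspace_ker[OF nspace_Xall \<Phi>(1)])
qed

text \<open>Parity in x2 determines the coefficients on the line \<open>- n\<close> from those on
  the line \<open>n\<close>, so support on these two lines already forces the sine and cosine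
  form.\<close>

lemma block_iff:
  assumes n: "n \<ge> 1"
  shows "u \<in> block s k n \<longleftrightarrow> u \<in> Xsym s k \<and> (\<forall>m. \<bar>snd m\<bar> \<noteq> int n \<longrightarrow> fst u m = 0 \<and> snd u m = 0)"
proof
  assume "u \<in> block s k n"
  then show "u \<in> Xsym s k \<and> (\<forall>m. \<bar>snd m\<bar> \<noteq> int n \<longrightarrow> fst u m = 0 \<and> snd u m = 0)"
    by (auto simp: block_def tensor_def fourier_cos fourier_sin)
next
  assume u: "u \<in> Xsym s k \<and> (\<forall>m. \<bar>snd m\<bar> \<noteq> int n \<longrightarrow> fst u m = 0 \<and> snd u m = 0)"
  obtain \<omega> F where uu: "u = (\<omega>, F)" by (cases u)
  have r: "\<omega> (m, - l) = - \<omega> (m, l)" "F (m, - l) = F (m, l)" for m l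
  proof -
    have "reflect2 \<omega> = - \<omega>" "reflect2 F = F" using u by (auto simp: Xsym_def uu)
    then show "\<omega> (m, - l) = - \<omega> (m, l)" "F (m, - l) = F (m, l)"
      by (auto simp: reflect2_def fun_eq_iff)
  qed
  have i2: "\<i> * (x * \<i>) = - x" for x by (metis complex_i_mult_minus mult.commute)
  \<comment> \<open>At frequency \<open>n\<close> the sine has coefficient - i / 2 and the cosine 1
    / 2, whence the factors 2 i here and 2 in \<open>f\<close>.\<close>
  define h where "h m = 2 * \<i> * \<omega> (m, int n)" for m
  define f where "f m = 2 * F (m, int n)" for m
  have "\<omega> = h \<otimes>\<^sub>D fourier (\<lambda>x. sin (real n * x))"
  proof
    fix m :: "int \<times> int"
    obtain m1 l where m: "m = (m1, l)" by (cases m)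
    consider "l = int n" | "l = - int n" | "\<bar>l\<bar> \<noteq> int n" by linarith
    then show "\<omega> m = (h \<otimes>\<^sub>D fourier (\<lambda>x. sin (real n * x))) m"
      using u n r by cases (auto simp: m uu tensor_def fourier_sin h_def i2)
  qed
  moreover have "F = f \<otimes>\<^sub>D fourier (\<lambda>x. cos (real n * x))"
  proof
    fix m :: "int \<times> int"
    obtain m1 l where m: "m = (m1, l)" by (cases m)
    consider "l = int n" | "l = - int n" | "\<bar>l\<bar> \<noteq> int n" by linarith
    then show "F m = (f \<otimes>\<^sub>D fourier (\<lambda>x. cos (real n * x))) m"
      using u n r by cases (auto simp: m uu tensor_def fourier_cos f_def)
  qed
  ultimately show "u \<in> block s k n" using u unfolding block_def uu by blast
qed

lemma coord_Xsym:
  assumes "k > 0"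
  shows "(\<lambda>u. fst u m) \<in> dual_space (Xnorm s) (Xsym s k)" "(\<lambda>u. snd u m) \<in> dual_space (Xnorm s) (Xsym s k)"
proof -
  have "Xsym s k \<subseteq> Xall s" by (auto simp: Xsym_iff[OF assms])
  then show "(\<lambda>u. fst u m) \<in> dual_space (Xnorm s) (Xsym s k)" "(\<lambda>u. snd u m) \<in> dual_space (Xnorm s) (Xsym s k)"
    using dual_subset[OF coord_Xall(1)] dual_subset[OF coord_Xall(2)] by blast+
qed

lemma nspace_block:
  assumes k: "k > 0" and n: "n \<ge> 1"
  shows "nspace (block s k n) (Xnorm s)"
proof -
  let ?\<Phi> = "{\<lambda>u. fst u m | m. \<bar>snd m\<bar> \<noteq> int n} \<union> {\<lambda>u. snd u m | m. \<bar>snd m\<bar> \<noteq> int n}"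
  have "?\<Phi> \<subseteq> dual_space (Xnorm s) (Xsym s k)" using coord_Xsym[OF k] by blast
  then have "nspace (ker_on (Xsym s k) ?\<Phi>) (Xnorm s)" by (rule nspace.nspace_ker[OF nspace_Xsym[OF k]])
  moreover have "ker_on (Xsym s k) ?\<Phi> = block s k n"
  proof (rule set_eqI)
    fix u
    show "u \<in> ker_on (Xsym s k) ?\<Phi> \<longleftrightarrow> u \<in> block s k n"
      unfolding block_iff[OF n] ker_on_def by (auto 0 3)
  qed
  ultimately show ?thesis by simp
qed

section \<open>The operator as a sum of two frequency shifts with symbols\<close>

lemma L_op_coeff:
  fixes u :: state
  shows "fst (L_op k u) (m1, m2) = - \<i> * (of_nat k * of_int m2 / 2) *
     (of_real (asym k (m1 - int k, m2)) * snd u (m1 - int k, m2) + of_real (asym k (m1 + int k, m2)) * snd u (m1 + int k, m2))"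
  "snd (L_op k u) (m1, m2) = - \<i> * (of_nat k * of_int m2 / 2) *
     (of_real (bsym k (m1 - int k, m2)) * fst u (m1 - int k, m2) + of_real (bsym k (m1 + int k, m2)) * fst u (m1 + int k, m2))"
proof -
  have ring: "- of_nat k * ((\<i> * of_int m2 * x + \<i> * of_int m2 * y) / 2)
    = - \<i> * (of_nat k * of_int m2 / 2) * (x + y)" for x y :: complex
    by (simp add: field_simps)
  show "fst (L_op k u) (m1, m2) = - \<i> * (of_nat k * of_int m2 / 2) *
     (of_real (asym k (m1 - int k, m2)) * snd u (m1 - int k, m2) + of_real (asym k (m1 + int k, m2)) * snd u (m1 + int k, m2))"
    unfolding ring[symmetric]
    by (simp add: L_op_def split_def cos_mult2_def d2_def A_op_def multiplier_def asym_def
        scaleC_fun_def scaleC_complex_def)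
  show "snd (L_op k u) (m1, m2) = - \<i> * (of_nat k * of_int m2 / 2) *
     (of_real (bsym k (m1 - int k, m2)) * fst u (m1 - int k, m2) + of_real (bsym k (m1 + int k, m2)) * fst u (m1 + int k, m2))"
    unfolding ring[symmetric]
    by (simp add: L_op_def split_def cos_mult2_def d2_def B_op_def multiplier_def bsym_def
        scaleC_fun_def scaleC_complex_def)
qed

lemma L_op_linear: "L_op k (u + v) = L_op k u + L_op k v" "L_op k (c *\<^sub>C u) = c *\<^sub>C L_op k u"
proof -
  have "fst (L_op k (u + v)) m = fst (L_op k u + L_op k v) m" "snd (L_op k (u + v)) m = snd (L_op k u + L_op k v) m"
    "fst (L_op k (c *\<^sub>C u)) m = fst (c *\<^sub>C L_op k u) m" "snd (L_op k (c *\<^sub>C u)) m = snd (c *\<^sub>C L_op k u) m" for m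
    by (cases m; simp only: L_op_coeff fst_add snd_add plus_fun_apply scaleC_fst scaleC_snd
        scaleC_fun_def scaleC_complex_def; simp only: algebra_simps)+
  then show "L_op k (u + v) = L_op k u + L_op k v" "L_op k (c *\<^sub>C u) = c *\<^sub>C L_op k u"
    by (simp_all add: prod_eq_iff fun_eq_iff)
qed

definition sh :: "int \<Rightarrow> int \<times> int \<Rightarrow> int \<times> int" where
  "sh e m = (fst m + e, snd m)"

lemma sh_simps [simp]: "fst (sh e m) = fst m + e" "snd (sh e m) = snd m" "sh e (sh (- e) m) = m" "sh (- e) (sh e m) = m"
  by (simp_all add: sh_def)

lemma inj_sh: "inj (sh e)"
  by (rule injI) (metis sh_simps(4))

lemma surj_sh: "range (sh e) = UNIV"
  using sh_simps(3)[of e] by (metis surjI)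

lemma msq_sh: "1 + msq (sh e m) \<le> (2 + 2 * (of_int e)\<^sup>2) * (1 + msq m)"
proof -
  have "1 + ((x + z)\<^sup>2 + y\<^sup>2) \<le> (2 + 2 * z\<^sup>2) * (1 + (x\<^sup>2 + y\<^sup>2))" for x y z :: real
  proof -
    have "(x + z)\<^sup>2 \<le> 2 * x\<^sup>2 + 2 * z\<^sup>2"
      using sum_squares_bound[of x z] by (simp add: power2_sum)
    moreover have "(2 + 2 * z\<^sup>2) * (1 + (x\<^sup>2 + y\<^sup>2)) = 2 + 2 * x\<^sup>2 + 2 * y\<^sup>2 + 2 * z\<^sup>2 + 2 * (z\<^sup>2 * (x\<^sup>2 + y\<^sup>2))"
      by (simp add: algebra_simps)
    moreover have "z\<^sup>2 * (x\<^sup>2 + y\<^sup>2) \<ge> 0" "y\<^sup>2 \<ge> 0" by simp_all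
    ultimately show ?thesis by linarith
  qed
  then show ?thesis by (simp add: msq_def)
qed

text \<open>Peetre's inequality; the two signs of \<open>\<sigma>\<close> use \<open>msq_sh\<close>
  in opposite directions.\<close>

lemma sob_sh: "sob \<sigma> m \<le> (2 + 2 * (of_int e)\<^sup>2) powr \<bar>\<sigma>\<bar> * sob \<sigma> (sh e m)"
proof (cases "\<sigma> \<ge> 0")
  case True
  have "(1 + msq m) powr \<sigma> \<le> ((2 + 2 * (of_int e)\<^sup>2) * (1 + msq (sh e m))) powr \<sigma>"
    using msq_sh[of "- e" "sh e m"] msq1_pos[of m] True by (intro powr_mono2) auto
  then show ?thesis using True msq1_pos[of "sh e m"] by (simp add: sob_def powr_mult)
next
  case False
  have "((2 + 2 * (of_int e)\<^sup>2) * (1 + msq m)) powr \<sigma> \<le> (1 + msq (sh e m)) powr \<sigma>"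
    using msq_sh[of e m] msq1_pos[of "sh e m"] False by (intro powr_mono2') auto
  then have "(2 + 2 * (real_of_int e)\<^sup>2) powr \<sigma> * sob \<sigma> m \<le> sob \<sigma> (sh e m)"
    using msq1_pos[of m] by (simp add: sob_def powr_mult)
  moreover have pos: "2 + 2 * (real_of_int e)\<^sup>2 > 0" by (simp add: add_pos_nonneg)
  then have "(2 + 2 * (real_of_int e)\<^sup>2) powr \<sigma> > 0" by (metis powr_gt_zero less_irrefl)
  ultimately show ?thesis using False by (simp add: powr_minus field_simps)
qed

lemma sqrt_sob_sh: "sqrt (sob \<sigma> m) \<le> sqrt ((2 + 2 * (of_int e)\<^sup>2) powr \<bar>\<sigma>\<bar>) * sqrt (sob \<sigma> (sh e m))"
  using sob_sh[of \<sigma> m e] by (simp flip: real_sqrt_mult)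

lemma sob_Suc: "sob s m = (1 + msq m) * sob (s - 1) m"
  using msq1_pos[of m] by (simp add: sob_def powr_diff)

lemma abs_snd_le: "\<bar>real_of_int (snd m)\<bar> \<le> sqrt (1 + msq m)"
  by (rule real_le_rsqrt) (simp add: msq_def add_nonneg_nonneg)

lemma asym_bound: "\<bar>asym k m\<bar> \<le> 1 + (real k)\<^sup>2"
proof -
  have "(1 + (real k)\<^sup>2) / (1 + msq m) \<le> 1 + (real k)\<^sup>2" "0 \<le> (1 + (real k)\<^sup>2) / (1 + msq m)"
    using msq_nonneg[of m] by (simp_all add: divide_le_eq algebra_simps mult_nonneg_nonneg)
  then show ?thesis
    unfolding asym_def abs_le_iff using zero_le_power2[of "real k"] by (intro conjI) linarith+
qed

lemma asym_le_1: "asym k m \<le> 1"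
  using msq_nonneg[of m] by (simp add: asym_def)

lemma bsym_nonneg: "bsym k m \<ge> 0"
  using msq_nonneg[of m] by (simp add: bsym_def)

lemma msq_ge_1:
  assumes "msq m \<noteq> 0"
  shows "msq m \<ge> 1"
proof -
  have eq: "msq m = of_int ((fst m)\<^sup>2 + (snd m)\<^sup>2)" by (simp add: msq_def)
  then have "0 < (fst m)\<^sup>2 + (snd m)\<^sup>2" using assms msq_nonneg[of m] by linarith
  then show ?thesis unfolding eq by linarith
qed

lemma bsym_le: "bsym k m \<le> 2 * (1 + (real k)\<^sup>2) / (1 + msq m)"
proof (cases "msq m = 0")
  case False
  have "(1 + (real k)\<^sup>2) * (1 + msq m) \<le> (1 + (real k)\<^sup>2) * (2 * msq m)"
    using msq_ge_1[OF False] by (intro mult_left_mono) auto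
  then show ?thesis using msq_ge_1[OF False] by (simp add: bsym_def field_simps)
qed (simp add: bsym_def)

text \<open>B gains two derivatives: one is spent on the derivative in x2, the other on raising the
  order from \<open>s - 1\<close> to \<open>s\<close>.\<close>

lemma snd_bsym_le: "\<bar>real_of_int (snd m)\<bar> * bsym k m * sqrt (1 + msq m) \<le> 2 * (1 + (real k)\<^sup>2)"
proof -
  have "\<bar>real_of_int (snd m)\<bar> * bsym k m * sqrt (1 + msq m)
    \<le> sqrt (1 + msq m) * (2 * (1 + (real k)\<^sup>2) / (1 + msq m)) * sqrt (1 + msq m)"
    using abs_snd_le[of m] bsym_le[of k m] bsym_nonneg[of k m] msq_nonneg[of m]
    by (intro mult_right_mono mult_mono) auto
  also have "\<dots> = (2 * (1 + (real k)\<^sup>2) / (1 + msq m)) * (sqrt (1 + msq m) * sqrt (1 + msq m))" by (simp only: mult_ac)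
  also have "\<dots> = 2 * (1 + (real k)\<^sup>2)" using msq1_pos[of m] by simp
  finally show ?thesis .
qed

subsection \<open>Boundedness and invariance\<close>

text \<open>One of the two exponentials of the cosine, with \<open>e = int k\<close> or
  \<open>e = - int k\<close>. Keeping the shifts apart lets each be estimated by
  \<open>wsp_transfer\<close>.\<close>

definition compA :: "nat \<Rightarrow> int \<Rightarrow> dist2 \<Rightarrow> dist2" where
  "compA k e c = (\<lambda>m. - \<i> * (of_nat k * of_int (snd m) / 2) * (of_real (asym k (sh e m)) * c (sh e m)))"

definition compB :: "nat \<Rightarrow> int \<Rightarrow> dist2 \<Rightarrow> dist2" where
  "compB k e c = (\<lambda>m. - \<i> * (of_nat k * of_int (snd m) / 2) * (of_real (bsym k (sh e m)) * c (sh e m)))"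

lemma L_op_split:
  fixes u :: state
  shows "fst (L_op k u) = compA k (- int k) (snd u) + compA k (int k) (snd u)"
    and "snd (L_op k u) = compB k (- int k) (fst u) + compB k (int k) (fst u)"
  by (rule ext, case_tac x, simp only: L_op_coeff compA_def compB_def plus_fun_apply sh_def fst_conv snd_conv
      distrib_left add_uminus_conv_diff)+

lemma cmod_shift_coeff: "cmod (- \<i> * (of_nat k * of_int l / 2) * (of_real x * z)) = real k / 2 * \<bar>real_of_int l\<bar> * \<bar>x\<bar> * cmod z"
  by (simp add: norm_mult norm_divide)

text \<open>The orders balance: \<open>compA\<close> loses one derivative and \<open>compB\<close>
  gains one, while the bounded frequency shift costs a constant factor.\<close>

lemma comp_bounded:
  fixes s :: real and k :: nat and e :: int
  shows "\<exists>K\<ge>0. \<forall>c\<in>wsp (sob s). compA k e c \<in> wsp (sob (s - 1)) \<and> wn (sob (s - 1)) (compA k e c) \<le> K * wn (sob s) c"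
    and "\<exists>K\<ge>0. \<forall>c\<in>wsp (sob (s - 1)). compB k e c \<in> wsp (sob s) \<and> wn (sob s) (compB k e c) \<le> K * wn (sob (s - 1)) c"
proof -
  let ?D = "2 + 2 * (real_of_int e)\<^sup>2"
  define K1 where "K1 = real k / 2 * (1 + (real k)\<^sup>2) * sqrt (?D powr \<bar>s - 1\<bar>)"
  define K2 where "K2 = real k / 2 * (2 * (1 + (real k)\<^sup>2)) * sqrt (?D powr \<bar>s\<bar>)"
  have K: "K1 \<ge> 0" "K2 \<ge> 0" by (simp_all add: K1_def K2_def)
  have f: "wabs (sob (s - 1)) (compA k e c) m \<le> K1 * wabs (sob s) c (sh e m)" for c m
  proof -
    let ?m = "sh e m"
    have "wabs (sob (s - 1)) (compA k e c) m = sqrt (sob (s - 1) m) * (real k / 2 * \<bar>real_of_int (snd ?m)\<bar> * \<bar>asym k ?m\<bar> * cmod (c ?m))"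
      unfolding compA_def cmod_shift_coeff by simp
    also have "\<dots> \<le> (sqrt (?D powr \<bar>s - 1\<bar>) * sqrt (sob (s - 1) ?m)) * (real k / 2 * sqrt (1 + msq ?m) * (1 + (real k)\<^sup>2) * cmod (c ?m))"
      using sqrt_sob_sh[of "s - 1" m e] abs_snd_le[of ?m] asym_bound[of k ?m] msq_nonneg[of ?m]
      by (intro mult_mono mult_left_mono mult_right_mono mult_nonneg_nonneg) (auto simp: sob_def simp del: sh_simps)
    also have "\<dots> = K1 * ((sqrt (sob (s - 1) ?m) * sqrt (1 + msq ?m)) * cmod (c ?m))"
      unfolding K1_def by (simp only: mult_ac)
    also have "sqrt (sob (s - 1) ?m) * sqrt (1 + msq ?m) = sqrt (sob s ?m)"
      unfolding sob_Suc[of s ?m] real_sqrt_mult by (simp only: mult_ac)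
    finally show ?thesis .
  qed
  have g: "wabs (sob s) (compB k e c) m \<le> K2 * wabs (sob (s - 1)) c (sh e m)" for c m
  proof -
    let ?m = "sh e m"
    have "wabs (sob s) (compB k e c) m = sqrt (sob s m) * (real k / 2 * \<bar>real_of_int (snd ?m)\<bar> * \<bar>bsym k ?m\<bar> * cmod (c ?m))"
      unfolding compB_def cmod_shift_coeff by simp
    also have "\<dots> \<le> (sqrt (?D powr \<bar>s\<bar>) * sqrt (sob s ?m)) * (real k / 2 * \<bar>real_of_int (snd ?m)\<bar> * \<bar>bsym k ?m\<bar> * cmod (c ?m))"
      using sqrt_sob_sh[of s m e] by (intro mult_right_mono) (auto simp del: sh_simps)
    also have "sqrt (sob s ?m) = sqrt (1 + msq ?m) * sqrt (sob (s - 1) ?m)"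
      unfolding sob_Suc[of s ?m] real_sqrt_mult ..
    also have "(sqrt (?D powr \<bar>s\<bar>) * (sqrt (1 + msq ?m) * sqrt (sob (s - 1) ?m))) * (real k / 2 * \<bar>real_of_int (snd ?m)\<bar> * \<bar>bsym k ?m\<bar> * cmod (c ?m))
       = (sqrt (?D powr \<bar>s\<bar>) * (real k / 2) * (sqrt (sob (s - 1) ?m) * cmod (c ?m))) * (\<bar>real_of_int (snd ?m)\<bar> * bsym k ?m * sqrt (1 + msq ?m))"
      using bsym_nonneg[of k ?m] by (simp only: mult_ac abs_of_nonneg)
    also have "\<dots> \<le> (sqrt (?D powr \<bar>s\<bar>) * (real k / 2) * (sqrt (sob (s - 1) ?m) * cmod (c ?m))) * (2 * (1 + (real k)\<^sup>2))"
      by (intro mult_left_mono[OF snd_bsym_le] mult_nonneg_nonneg) (auto simp: sob_def)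
    also have "\<dots> = K2 * wabs (sob (s - 1)) c ?m" unfolding K2_def by (simp only: mult_ac)
    finally show ?thesis .
  qed
  have "compA k e c \<in> wsp (sob (s - 1))" "wn (sob (s - 1)) (compA k e c) \<le> K1 * wn (sob s) c" if "c \<in> wsp (sob s)" for c
    by (rule wsp_transfer[OF sob_nonneg sob_nonneg inj_sh K(1) _ that], rule f)+
  then show "\<exists>K\<ge>0. \<forall>c\<in>wsp (sob s). compA k e c \<in> wsp (sob (s - 1)) \<and> wn (sob (s - 1)) (compA k e c) \<le> K * wn (sob s) c"
    using K(1) by blast
  have "compB k e c \<in> wsp (sob s)" "wn (sob s) (compB k e c) \<le> K2 * wn (sob (s - 1)) c" if "c \<in> wsp (sob (s - 1))" for c
    by (rule wsp_transfer[OF sob_nonneg sob_nonneg inj_sh K(2) _ that], rule g)+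
  then show "\<exists>K\<ge>0. \<forall>c\<in>wsp (sob (s - 1)). compB k e c \<in> wsp (sob s) \<and> wn (sob s) (compB k e c) \<le> K * wn (sob (s - 1)) c"
    using K(2) by blast
qed

lemma comp_wsp:
  "c \<in> wsp (sob s) \<Longrightarrow> compA k e c \<in> wsp (sob (s - 1))"
  "c \<in> wsp (sob (s - 1)) \<Longrightarrow> compB k e c \<in> wsp (sob s)"
  using comp_bounded[of s k e] by blast+

lemma L_op_bounded:
  shows "bounded_op (Xnorm s) (Xall s) (L_op k)"
proof -
  obtain K1 K2 where K: "K1 \<ge> 0" "K2 \<ge> 0"
    and A1: "\<And>c. c \<in> wsp (sob s) \<Longrightarrow> wn (sob (s - 1)) (compA k (int k) c) \<le> K1 * wn (sob s) c"
    and A2: "\<And>c. c \<in> wsp (sob s) \<Longrightarrow> wn (sob (s - 1)) (compA k (- int k) c) \<le> K2 * wn (sob s) c"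
    using comp_bounded(1)[of s k "int k"] comp_bounded(1)[of s k "- int k"] by blast
  obtain K3 K4 where K': "K3 \<ge> 0" "K4 \<ge> 0"
    and B1: "\<And>c. c \<in> wsp (sob (s - 1)) \<Longrightarrow> wn (sob s) (compB k (int k) c) \<le> K3 * wn (sob (s - 1)) c"
    and B2: "\<And>c. c \<in> wsp (sob (s - 1)) \<Longrightarrow> wn (sob s) (compB k (- int k) c) \<le> K4 * wn (sob (s - 1)) c"
    using comp_bounded(2)[of s k "int k"] comp_bounded(2)[of s k "- int k"] by blast
  have main: "L_op k u \<in> Xall s \<and> Xnorm s (L_op k u) \<le> (K2 + K1 + (K4 + K3)) * Xnorm s u" if u: "u \<in> Xall s" for u
  proof -
    have u12: "fst u \<in> wsp (sob (s - 1))" "snd u \<in> wsp (sob s)" using u by (auto simp: Xall_def)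
    have 1: "fst (L_op k u) \<in> wsp (sob (s - 1))"
        "wn (sob (s - 1)) (fst (L_op k u)) \<le> (K2 + K1) * wn (sob s) (snd u)"
      unfolding L_op_split distrib_right
      using wsp_add[OF sob_nonneg comp_wsp(1)[OF u12(2)] comp_wsp(1)[OF u12(2)], of k "- int k" k "int k"]
        A1[OF u12(2)] A2[OF u12(2)] by linarith+
    have 2: "snd (L_op k u) \<in> wsp (sob s)"
        "wn (sob s) (snd (L_op k u)) \<le> (K4 + K3) * wn (sob (s - 1)) (fst u)"
      unfolding L_op_split distrib_right
      using wsp_add[OF sob_nonneg comp_wsp(2)[OF u12(1)] comp_wsp(2)[OF u12(1)], of k "- int k" k "int k"]
        B1[OF u12(1)] B2[OF u12(1)] by linarith+
    have nn: "wn (sob \<sigma>) c \<ge> 0" for \<sigma> c using wn_nonneg[OF sob_nonneg] by simp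
    have "Xnorm s (L_op k u) \<le> wn (sob (s - 1)) (fst (L_op k u)) + wn (sob s) (snd (L_op k u))"
      unfolding Xnorm_pair by (intro pair_norm_le nn)
    also have "\<dots> \<le> (K2 + K1) * Xnorm s u + (K4 + K3) * Xnorm s u"
    proof -
      have "(K2 + K1) * wn (sob s) (snd u) \<le> (K2 + K1) * Xnorm s u"
        "(K4 + K3) * wn (sob (s - 1)) (fst u) \<le> (K4 + K3) * Xnorm s u"
        unfolding Xnorm_pair by (intro mult_left_mono add_nonneg_nonneg K K' le_pair_norm nn)+
      then show ?thesis using 1(2) 2(2) by linarith
    qed
    also have "\<dots> = (K2 + K1 + (K4 + K3)) * Xnorm s u" by (rule distrib_right[symmetric])
    finally show ?thesis using 1(1) 2(1) by (simp add: Xall_def mem_Times_iff)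
  qed
  moreover have "linear_on (Xall s) (L_op k)" unfolding linear_on_def using L_op_linear by blast
  ultimately show ?thesis unfolding bounded_op_def by blast
qed

lemma asym_neg: "asym k (- m, l) = asym k (m, l)" "asym k (m, - l) = asym k (m, l)"
  and bsym_neg: "bsym k (- m, l) = bsym k (m, l)" "bsym k (m, - l) = bsym k (m, l)"
  by (simp_all add: asym_def bsym_def msq_def)

text \<open>Multiplication by cos (k x1) reverses the parity under x1 -> pi / k - x1, and the
  derivative reverses the parity in x2. The two components have opposite parities in both respects,
  so exchanging them preserves the class.\<close>

lemma L_op_sym:
  assumes u: "sym k u"
  shows "sym k (L_op k u)"
  unfolding sym_def
proof (intro conjI allI impI)
  show "fst (L_op k u) (0, 0) = 0" by (simp add: L_op_coeff)
next
  fix m :: "int \<times> int" assume m: "\<not> int k dvd fst m"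
  obtain m1 l where ml: "m = (m1, l)" by (cases m)
  have d: "\<not> int k dvd m1 - int k" "\<not> int k dvd m1 + int k"     using m ml by (metis diff_add_cancel dvd_add_triv_right_iff fst_conv, metis dvd_add_triv_right_iff fst_conv)
  show "fst (L_op k u) m = 0" "snd (L_op k u) m = 0"
    unfolding ml L_op_coeff using sym_coords(1,2)[OF u d(1)] sym_coords(1,2)[OF u d(2)] by simp_all
next
  fix j l
  have e: "- (int k * j) - int k = - (int k * (j + 1))" "- (int k * j) + int k = - (int k * (j - 1))"
    "int k * j - int k = int k * (j - 1)" "int k * j + int k = int k * (j + 1)"
    by (simp_all add: algebra_simps)
  show "fst (L_op k u) (- (int k * j), l) = - sg j * fst (L_op k u) (int k * j, l)"
    "snd (L_op k u) (- (int k * j), l) = sg j * snd (L_op k u) (int k * j, l)"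
    unfolding L_op_coeff e asym_neg bsym_neg sym_coords(3,4)[OF u] sg_simps
    by (simp_all only: algebra_simps minus_minus mult_minus_left mult_minus_right)
next
  fix m l
  show "fst (L_op k u) (m, - l) = - fst (L_op k u) (m, l)" "snd (L_op k u) (m, - l) = snd (L_op k u) (m, l)"
    unfolding L_op_coeff asym_neg bsym_neg sym_coords(5,6)[OF u] by (simp_all add: algebra_simps)
qed

lemma bounded_op_subset:
  assumes "bounded_op N V T" "V' \<subseteq> V" "\<And>u. u \<in> V' \<Longrightarrow> T u \<in> V'"
  shows "bounded_op N V' T"
  using assms unfolding bounded_op_def linear_on_def by (meson subset_iff)

lemma operator_Xsym:
  assumes k: "k > 0"
  shows "operator (Xsym s k) (Xnorm s) (L_op k)"
proof -
  interpret nspace "Xsym s k" "Xnorm s" by (rule nspace_Xsym[OF k])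
  have inv: "L_op k u \<in> Xsym s k" if "u \<in> Xsym s k" for u
    using that L_op_sym L_op_bounded[of s k] by (simp add: Xsym_iff[OF k] bounded_op_def)
  show ?thesis
    by unfold_locales (rule bounded_op_subset[OF L_op_bounded _ inv], simp_all add: Xsym_iff[OF k] subset_iff)
qed

lemma operator_block:
  assumes k: "k > 0" and n: "n \<ge> 1"
  shows "operator (block s k n) (Xnorm s) (L_op k)"
proof -
  interpret nspace "block s k n" "Xnorm s" by (rule nspace_block[OF k n])
  interpret X: operator "Xsym s k" "Xnorm s" "L_op k" by (rule operator_Xsym[OF k])
  have inv: "L_op k u \<in> block s k n" if "u \<in> block s k n" for u
  proof -
    have "fst (L_op k u) m = 0 \<and> snd (L_op k u) m = 0" if "\<bar>snd m\<bar> \<noteq> int n" for m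
      using \<open>u \<in> block s k n\<close> that unfolding block_iff[OF n] by (cases m) (simp add: L_op_coeff)
    then show ?thesis using that X.T_V unfolding block_iff[OF n] by blast
  qed
  show ?thesis
    by unfold_locales (rule bounded_op_subset[OF X.bounded _ inv], simp_all add: block_iff[OF n] subset_iff)
qed

section \<open>Quadratic forms and dissipativity\<close>

text \<open>Only the real part is kept, with arbitrary real weights, to fit the interface of
  \<open>dissipative\<close>.\<close>

definition form :: "(int \<times> int \<Rightarrow> real) \<Rightarrow> (int \<times> int \<Rightarrow> real) \<Rightarrow> state \<Rightarrow> state \<Rightarrow> real" where
  "form q p u v = Re (cip q (fst u) (fst v)) + Re (cip p (snd u) (snd v))"

definition adm :: "real \<Rightarrow> (int \<times> int \<Rightarrow> real) \<Rightarrow> (int \<times> int \<Rightarrow> real) \<Rightarrow> real \<Rightarrow> bool" where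
  "adm s q p K \<longleftrightarrow> (\<forall>m. \<bar>q m\<bar> \<le> K * sob (s - 1) m) \<and> (\<forall>m. \<bar>p m\<bar> \<le> K * sob s m)"

lemma XallD: "u \<in> Xall s \<Longrightarrow> fst u \<in> wsp (sob (s - 1)) \<and> snd u \<in> wsp (sob s)"
  by (auto simp: Xall_def)

lemma form_commute: "form q p u v = form q p v u"
  unfolding form_def by (subst cip_commute, subst (2) cip_commute) simp

lemma form_scale: "form q p (of_real r *\<^sub>C u) v = r * form q p u v"
  by (simp add: form_def cip_scale distrib_left)

lemma form_i: "form q p (\<i> *\<^sub>C u) (\<i> *\<^sub>C v) = form q p u v"
proof -
  have "cip q (\<i> *\<^sub>C c) (\<i> *\<^sub>C d) = cip q c d" for q :: "int \<times> int \<Rightarrow> real" and c d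
    by (subst cip_scale, subst cip_commute, subst cip_scale, subst cip_commute) simp
  then show ?thesis by (simp add: form_def)
qed

lemma form_add:
  assumes "adm s q p K" "u \<in> Xall s" "v \<in> Xall s" "w \<in> Xall s"
  shows "form q p (u + v) w = form q p u w + form q p v w"
  using assms XallD unfolding form_def adm_def
  by (simp add: cip_add[OF sob_nonneg, of q K "s - 1"] cip_add[OF sob_nonneg, of p K s])

lemma form_self:
  assumes a: "adm s q p K" and u: "u \<in> Xall s"
  shows "form q p u u = (\<Sum>\<^sub>\<infinity>m. q m * (cmod (fst u m))\<^sup>2) + (\<Sum>\<^sub>\<infinity>m. p m * (cmod (snd u m))\<^sup>2)"
    and "(\<lambda>m. q m * (cmod (fst u m))\<^sup>2) summable_on UNIV" "(\<lambda>m. p m * (cmod (snd u m))\<^sup>2) summable_on UNIV"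
proof -
  have q: "\<forall>m. \<bar>q m\<bar> \<le> K * sob (s - 1) m" and p: "\<forall>m. \<bar>p m\<bar> \<le> K * sob s m" using a by (auto simp: adm_def)
  note 1 = cip_self[OF sob_nonneg q conjunct1[OF XallD[OF u]]]
  note 2 = cip_self[OF sob_nonneg p conjunct2[OF XallD[OF u]]]
  show "form q p u u = (\<Sum>\<^sub>\<infinity>m. q m * (cmod (fst u m))\<^sup>2) + (\<Sum>\<^sub>\<infinity>m. p m * (cmod (snd u m))\<^sup>2)"
    unfolding form_def 1(1) 2(1) by simp
  show "(\<lambda>m. q m * (cmod (fst u m))\<^sup>2) summable_on UNIV" "(\<lambda>m. p m * (cmod (snd u m))\<^sup>2) summable_on UNIV"
    by (rule 1(2) 2(2))+
qed

lemma Xnorm_power2: "(Xnorm s u)\<^sup>2 = (wn (sob (s - 1)) (fst u))\<^sup>2 + (wn (sob s) (snd u))\<^sup>2"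
  by (simp add: Xnorm_pair pair_norm_def)

lemma form_le:
  assumes a: "adm s q p K" and u: "u \<in> Xall s"
  shows "form q p u u \<le> K * (Xnorm s u)\<^sup>2"
proof -
  have q: "\<forall>m. \<bar>q m\<bar> \<le> K * sob (s - 1) m" and p: "\<forall>m. \<bar>p m\<bar> \<le> K * sob s m" using a by (auto simp: adm_def)
  show ?thesis
    unfolding form_def Xnorm_power2 distrib_left
    by (intro add_mono cip_le[OF sob_nonneg q] cip_le[OF sob_nonneg p] XallD[OF u, THEN conjunct1] XallD[OF u, THEN conjunct2])
qed

lemma form_ge:
  assumes a: "adm s q p K" and u: "u \<in> Xall s"
    and lq: "\<And>m. fst u m \<noteq> 0 \<Longrightarrow> \<kappa> * sob (s - 1) m \<le> q m" and lp: "\<And>m. snd u m \<noteq> 0 \<Longrightarrow> \<kappa> * sob s m \<le> p m"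
  shows "\<kappa> * (Xnorm s u)\<^sup>2 \<le> form q p u u"
proof -
  have q: "\<forall>m. \<bar>q m\<bar> \<le> K * sob (s - 1) m" and p: "\<forall>m. \<bar>p m\<bar> \<le> K * sob s m" using a by (auto simp: adm_def)
  show ?thesis
    unfolding form_def Xnorm_power2 distrib_left
    by (intro add_mono cip_ge[OF sob_nonneg q] cip_ge[OF sob_nonneg p] XallD[OF u, THEN conjunct1] XallD[OF u, THEN conjunct2]
        lq lp)
qed

lemma cip_weights:
  assumes w: "\<forall>m. w m \<ge> 0" and p: "\<forall>m. \<bar>p m\<bar> \<le> K * w m" and p': "\<forall>m. \<bar>p' m\<bar> \<le> K' * w m"
    and c: "c \<in> wsp w" and d: "d \<in> wsp w"
  shows "cip (\<lambda>m. p m + x * p' m) c d = cip p c d + of_real x * cip p' c d"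
proof -
  have "cip (\<lambda>m. p m + x * p' m) c d
      = (\<Sum>\<^sub>\<infinity>m. of_real (p m) * (c m * cnj (d m)) + of_real x * (of_real (p' m) * (c m * cnj (d m))))"
    unfolding cip_def by (simp add: algebra_simps)
  also have "\<dots> = cip p c d + of_real x * cip p' c d"
    unfolding cip_def using cip_summable[OF w p c d] cip_summable[OF w p' c d]
    by (subst infsum_add) (auto simp: infsum_cmult_right' intro: summable_on_cmult_right)
  finally show ?thesis .
qed

lemma form_weights:
  assumes a: "adm s q p K" "adm s q' p' K'" and u: "u \<in> Xall s" and v: "v \<in> Xall s"
  shows "form (\<lambda>m. q m + x * q' m) (\<lambda>m. p m + x * p' m) u v = form q p u v + x * form q' p' u v"
proof -
  have q: "\<forall>m. \<bar>q m\<bar> \<le> K * sob (s - 1) m" "\<forall>m. \<bar>q' m\<bar> \<le> K' * sob (s - 1) m"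
    and p: "\<forall>m. \<bar>p m\<bar> \<le> K * sob s m" "\<forall>m. \<bar>p' m\<bar> \<le> K' * sob s m" using a by (auto simp: adm_def)
  note uv = XallD[OF u] XallD[OF v]
  show ?thesis
    unfolding form_def
      cip_weights[OF sob_nonneg q conjunct1[OF uv(1)] conjunct1[OF uv(2)]]
      cip_weights[OF sob_nonneg p conjunct2[OF uv(1)] conjunct2[OF uv(2)]]
    by (simp add: distrib_left)
qed

lemma adm_weights:
  assumes a: "adm s q p K" "adm s q' p' K'"
  shows "adm s (\<lambda>m. q m + x * q' m) (\<lambda>m. p m + x * p' m) (K + \<bar>x\<bar> * K')"
proof -
  have "\<bar>a + x * b\<bar> \<le> (K + \<bar>x\<bar> * K') * w" if "\<bar>a\<bar> \<le> K * w" "\<bar>b\<bar> \<le> K' * w" for a b w :: real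
  proof -
    have "\<bar>a + x * b\<bar> \<le> \<bar>a\<bar> + \<bar>x\<bar> * \<bar>b\<bar>" by (metis abs_mult abs_triangle_ineq)
    also have "\<dots> \<le> K * w + \<bar>x\<bar> * (K' * w)" using that by (intro add_mono mult_left_mono) auto
    finally show ?thesis by (simp add: algebra_simps)
  qed
  then show ?thesis using a unfolding adm_def by blast
qed

section \<open>The derivative of a quadratic form along the flow\<close>

lemma bij_sh: "bij (sh e)"
  using inj_sh surj_sh by (simp add: bij_def)

text \<open>Contribution of the pair F(m), \<omega>(m + e) to \<open>form q p (L_op k u) u\<close>.
  The bracket vanishes when \<open>q\<close> and \<open>p\<close> are the symbols of B and A, which
  is the conservation law.\<close>

definition cross :: "nat \<Rightarrow> (int \<times> int \<Rightarrow> real) \<Rightarrow> (int \<times> int \<Rightarrow> real) \<Rightarrow> state \<Rightarrow> int \<Rightarrow> int \<times> int \<Rightarrow> real" where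
  "cross k q p u e m = real k * of_int (snd m) / 2 * (p m * bsym k (sh e m) - q (sh e m) * asym k m)
     * Im (fst u (sh e m) * cnj (snd u m))"

text \<open>The A-term with shift \<open>- e\<close> and the B-term with shift \<open>e\<close>
  couple the same pair of coefficients; reindexing the former by \<open>sh e\<close> combines them
  termwise.\<close>

lemma form_comp:
  assumes a: "adm s q p K" and u: "u \<in> Xall s"
  shows "cross k q p u e summable_on UNIV"
    "Re (cip q (compA k (- e) (snd u)) (fst u)) + Re (cip p (compB k e (fst u)) (snd u)) = infsum (cross k q p u e) UNIV"
proof -
  let ?\<omega> = "fst u" and ?F = "snd u"
  have q: "\<forall>m. \<bar>q m\<bar> \<le> K * sob (s - 1) m" and p: "\<forall>m. \<bar>p m\<bar> \<le> K * sob s m" using a by (auto simp: adm_def)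
  have w: "?\<omega> \<in> wsp (sob (s - 1))" "?F \<in> wsp (sob s)" using XallD[OF u] by auto
  define X where "X m = real k * of_int (snd m) / 2 * p m * bsym k (sh e m) * Im (?\<omega> (sh e m) * cnj (?F m))" for m
  define Z where "Z m = real k * of_int (snd m) / 2 * q m * asym k (sh (- e) m) * Im (?F (sh (- e) m) * cnj (?\<omega> m))" for m
  have Re_i: "Re (of_real x * (- \<i> * (of_nat k * of_int l / 2) * (of_real y * z) * v)) = real k * of_int l / 2 * x * y * Im (z * v)"
    for x y :: real and l :: int and z v :: complex
  proof -
    have Rr: "Re (of_real r * w) = r * Re w" for r w by simp
    have eq: "of_real x * (- \<i> * (of_nat k * of_int l / 2) * (of_real y * z) * v)
        = of_real (real k * of_int l / 2 * x * y) * (- \<i> * (z * v))"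
      by (simp add: mult_ac)
    show ?thesis unfolding eq Rr by simp
  qed
  have smX: "(\<lambda>m. of_real (p m) * (compB k e ?\<omega> m * cnj (?F m))) summable_on UNIV"
    by (rule cip_summable[OF sob_nonneg p comp_wsp(2)[OF w(1)] w(2)])
  have X_eq: "(\<lambda>m. Re (of_real (p m) * (compB k e ?\<omega> m * cnj (?F m)))) = X"
    unfolding compB_def X_def by (rule ext, rule Re_i)
  have X: "X summable_on UNIV" "Re (cip p (compB k e ?\<omega>) ?F) = infsum X UNIV"
    using summable_on_Re[OF smX] infsum_Re[OF smX] unfolding X_eq by (simp_all add: cip_def)
  have smZ: "(\<lambda>m. of_real (q m) * (compA k (- e) ?F m * cnj (?\<omega> m))) summable_on UNIV"
    by (rule cip_summable[OF sob_nonneg q comp_wsp(1)[OF w(2)] w(1)])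
  have Z_eq: "(\<lambda>m. Re (of_real (q m) * (compA k (- e) ?F m * cnj (?\<omega> m)))) = Z"
    unfolding compA_def Z_def by (rule ext, rule Re_i)
  have Z: "Z summable_on UNIV" "Re (cip q (compA k (- e) ?F) ?\<omega>) = infsum Z UNIV"
    using summable_on_Re[OF smZ] infsum_Re[OF smZ] unfolding Z_eq by (simp_all add: cip_def)
  have Z': "(\<lambda>m. Z (sh e m)) summable_on UNIV" "infsum (\<lambda>m. Z (sh e m)) UNIV = infsum Z UNIV"
    using Z(1) summable_on_reindex_bij_betw[OF bij_sh, of Z e] infsum_reindex_bij_betw[OF bij_sh, of Z e] by auto
  have Im_c: "Im (x * cnj y) = - Im (y * cnj x)" for x y by simp
  have eq: "cross k q p u e = (\<lambda>m. Z (sh e m) + X m)"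
  proof
    fix m
    show "cross k q p u e m = Z (sh e m) + X m"
      unfolding cross_def Z_def X_def sh_simps Im_c[of "?F m"] by (simp only: algebra_simps)
  qed
  show "cross k q p u e summable_on UNIV" unfolding eq by (intro summable_on_add Z' X)
  show "Re (cip q (compA k (- e) (snd u)) (fst u)) + Re (cip p (compB k e (fst u)) (snd u)) = infsum (cross k q p u e) UNIV"
    unfolding eq X(2) Z(2) Z'(2)[symmetric] by (rule infsum_add[symmetric, OF Z'(1) X(1)])
qed

lemma form_L:
  assumes a: "adm s q p K" and u: "u \<in> Xall s"
  shows "form q p (L_op k u) u = infsum (cross k q p u (int k)) UNIV + infsum (cross k q p u (- int k)) UNIV"
proof -
  have q: "\<forall>m. \<bar>q m\<bar> \<le> K * sob (s - 1) m" and p: "\<forall>m. \<bar>p m\<bar> \<le> K * sob s m" using a by (auto simp: adm_def)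
  have w: "fst u \<in> wsp (sob (s - 1))" "snd u \<in> wsp (sob s)" using XallD[OF u] by auto
  show ?thesis
    unfolding form_def L_op_split form_comp(2)[OF a u, symmetric]
      cip_add[OF sob_nonneg q comp_wsp(1)[OF w(2)] comp_wsp(1)[OF w(2)] w(1)]
      cip_add[OF sob_nonneg p comp_wsp(2)[OF w(1)] comp_wsp(2)[OF w(1)] w(2)]
    by simp
qed

text \<open>After division by the geometric mean the difference depends only on the ratio
  \<open>y / x\<close>, through a function \<open>h\<close> that is continuous and vanishes at
  1.\<close>

lemma powr_close:
  fixes s \<delta> :: real
  assumes \<delta>: "\<delta> > 0"
  shows "\<exists>\<rho>>0. \<forall>x>0. \<forall>y>0. \<bar>x - y\<bar> \<le> \<rho> * x \<longrightarrow> \<bar>x powr s - y powr s\<bar> \<le> \<delta> * (x powr (s / 2) * y powr (s / 2))"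
proof -
  define h where "h t = t powr (s / 2) - t powr (- (s / 2))" for t :: real
  have "continuous (at 1) h" unfolding h_def by (intro continuous_intros) auto
  then obtain d where d: "d > 0" "\<And>t. dist t 1 < d \<Longrightarrow> dist (h t) (h 1) < \<delta>"
    using \<delta> unfolding continuous_at_eps_delta by blast
  show ?thesis
  proof (intro exI[of _ "d / 2"] conjI allI impI)
    fix x y :: real assume xy: "x > 0" "y > 0" "\<bar>x - y\<bar> \<le> d / 2 * x"
    have "\<bar>y / x - 1\<bar> = \<bar>x - y\<bar> / x" using xy(1) by (simp add: field_simps abs_minus_commute)
    also have "\<dots> \<le> d / 2" using xy by (simp add: divide_le_eq)
    also have "\<dots> < d" using d(1) by simp
    finally have "\<bar>h (y / x)\<bar> < \<delta>" using d(2)[of "y / x"] by (simp add: dist_real_def h_def)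
    moreover have "x powr s - y powr s = - h (y / x) * (x powr (s / 2) * y powr (s / 2))"
    proof -
      have sq: "x powr s = x powr (s / 2) * x powr (s / 2)" "y powr s = y powr (s / 2) * y powr (s / 2)"
        by (simp_all flip: powr_add)
      have "h (y / x) = y powr (s / 2) / x powr (s / 2) - x powr (s / 2) / y powr (s / 2)"
        unfolding h_def using xy by (simp add: powr_divide powr_minus)
      then show ?thesis unfolding sq using xy by (simp add: field_simps)
    qed
    ultimately show "\<bar>x powr s - y powr s\<bar> \<le> \<delta> * (x powr (s / 2) * y powr (s / 2))"
      by (simp add: abs_mult mult_right_mono)
  qed (use d in simp)
qed

text \<open>In the symmetry class, \<open>chi0\<close> marks the frequencies of \<open>F\<close> where \<open>A < 0\<close>, except the \<open>m2 = 0\<close> line,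
  which \<open>\<partial>\<^sub>2\<close> annihilates; \<open>chi1\<close> marks the frequencies of \<open>\<omega>\<close> coupled to them.\<close>

definition chi0 :: "nat \<Rightarrow> int \<times> int \<Rightarrow> real" where
  "chi0 k m = (if fst m = 0 \<and> 0 < \<bar>snd m\<bar> \<and> \<bar>snd m\<bar> < int k then 1 else 0)"

definition chi1 :: "nat \<Rightarrow> int \<times> int \<Rightarrow> real" where
  "chi1 k m = (if \<bar>fst m\<bar> = int k \<and> 0 < \<bar>snd m\<bar> \<and> \<bar>snd m\<bar> < int k then 1 else 0)"

lemma sob_ge:
  assumes "s \<ge> 0"
  shows "1 \<le> sob s m" "1 / (1 + msq m) \<le> sob (s - 1) m"
proof -
  show "1 \<le> sob s m" using assms msq_nonneg[of m] by (auto simp: sob_def intro!: ge_one_powr_ge_zero)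
  then show "1 / (1 + msq m) \<le> sob (s - 1) m"
    unfolding sob_Suc[of s m] using msq1_pos[of m] by (simp add: divide_le_eq mult.commute)
qed

lemma adm_chi:
  assumes s: "s \<ge> 0"
  shows "adm s (chi1 k) (chi0 k) (1 + 2 * (real k)\<^sup>2)"
  unfolding adm_def
proof (intro conjI allI)
  fix m
  show "\<bar>chi1 k m\<bar> \<le> (1 + 2 * (real k)\<^sup>2) * sob (s - 1) m"
  proof (cases "chi1 k m = 0")
    case False
    then have "\<bar>fst m\<bar> = int k" "\<bar>snd m\<bar> < int k" by (auto simp: chi1_def split: if_splits)
    then have "\<bar>real_of_int (fst m)\<bar> \<le> real k" "\<bar>real_of_int (snd m)\<bar> \<le> real k" by linarith+
    then have "(real_of_int (fst m))\<^sup>2 \<le> (real k)\<^sup>2" "(real_of_int (snd m))\<^sup>2 \<le> (real k)\<^sup>2"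
      by (metis abs_of_nat abs_le_square_iff)+
    then have "1 + msq m \<le> 1 + 2 * (real k)\<^sup>2" by (simp add: msq_def)
    then have "1 \<le> (1 + 2 * (real k)\<^sup>2) * (1 / (1 + msq m))" using msq1_pos[of m] by (simp add: le_divide_eq)
    also have "\<dots> \<le> (1 + 2 * (real k)\<^sup>2) * sob (s - 1) m" using sob_ge(2)[OF s] by (intro mult_left_mono) auto
    finally show ?thesis by (simp add: chi1_def)
  qed (simp add: sob_def)
  have "1 * 1 \<le> (1 + 2 * (real k)\<^sup>2) * sob s m" using sob_ge(1)[OF s, of m] by (intro mult_mono) auto
  then show "\<bar>chi0 k m\<bar> \<le> (1 + 2 * (real k)\<^sup>2) * sob s m"
    by (simp add: chi0_def)
qed

text \<open>The form with weights \<open>(q, p)\<close> is a norm equivalent to that of \<open>X\<^sup>s\<close>: on high frequencies it is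
  the conserved energy times \<open>(R + msq) powr s\<close>, a weight that varies slowly for large \<open>R\<close>.\<close>

lemma dissipation_weights:
  assumes k: "k > 0" and s: "s \<ge> 0" and \<epsilon>: "\<epsilon> > 0"
  shows "\<exists>q p K \<kappa> C. adm s q p K \<and> \<kappa> > 0 \<and> C \<ge> 0 \<and> (\<forall>m. \<kappa> * sob s m \<le> p m)
    \<and> (\<forall>m. msq m \<noteq> 0 \<longrightarrow> \<kappa> * sob (s - 1) m \<le> q m)
    \<and> (\<forall>u\<in>Xsym s k. form q p (L_op k u) u \<le> \<epsilon> * form q p u u + C * form (chi1 k) (chi0 k) u u)"
proof -
  let ?k = "real k"
  \<comment> \<open>Bound for |m2| times the square root of \<open>bsym\<close> at the shifted
    frequency, see \<open>lb\<close>.\<close>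
  define \<kappa>0 where "\<kappa>0 = sqrt (1 + ?k\<^sup>2)"
  have k1: "?k \<ge> 1" using k by simp
  have k2: "1 \<le> ?k\<^sup>2" using k1 by (simp add: one_le_power)
  have \<kappa>0: "\<kappa>0 > 0" "\<kappa>0\<^sup>2 = 1 + ?k\<^sup>2" using k2 by (auto simp: \<kappa>0_def)
  \<comment> \<open>Makes the product \<open>k / 2 * \<delta> * \<kappa>0\<close> of the constants
    met below equal to \<open>\<epsilon>\<close>.\<close>
  define \<delta> where "\<delta> = 2 * \<epsilon> / (?k * \<kappa>0)"
  have \<delta>: "\<delta> > 0" using \<epsilon> k1 \<kappa>0 by (simp add: \<delta>_def)
  obtain \<rho> where \<rho>: "\<rho> > 0" "\<And>x y. x > 0 \<Longrightarrow> y > 0 \<Longrightarrow> \<bar>x - y\<bar> \<le> \<rho> * x \<Longrightarrow>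
      \<bar>x powr s - y powr s\<bar> \<le> \<delta> * (x powr (s / 2) * y powr (s / 2))"
    using powr_close[OF \<delta>, of s] by blast
  \<comment> \<open>With \<open>R = r\<^sup>2\<close> one has 2 r |m1| <= R + m1^2, so the change of
    \<open>msq\<close> under a shift, at most 2 k |m1| + k^2, is bounded by
    \<open>\<rho> * (R + msq m)\<close>.\<close>
  define r where "r = max 1 ((?k + ?k\<^sup>2) / \<rho>)"
  define R where "R = r\<^sup>2"
  have r: "r \<ge> 1" "?k + ?k\<^sup>2 \<le> \<rho> * r"
    using \<rho>(1) by (auto simp: r_def field_simps max_def)
  have R: "R \<ge> 1" using r(1) by (simp add: R_def one_le_power)
  define W where "W m = (R + msq m) powr s" for m
  have Rm: "R + msq m > 0" for m using R msq_nonneg[of m] by linarith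
  have W_pos: "W m > 0" for m using Rm[of m] by (simp add: W_def)
  have W_half: "(R + msq m) powr (s / 2) = sqrt (W m)" for m
    using Rm[of m] by (simp add: W_def powr_half_sqrt_powr)
  have W_sob: "sob s m \<le> W m" "W m \<le> R powr s * sob s m" for m
  proof -
    show "sob s m \<le> W m" unfolding sob_def W_def using R msq1_pos[of m] s by (intro powr_mono2) auto
    have "R + msq m \<le> R * (1 + msq m)" using mult_right_mono[OF R msq_nonneg[of m]] by (simp add: algebra_simps)
    then have "W m \<le> (R * (1 + msq m)) powr s" unfolding W_def using Rm[of m] s by (intro powr_mono2) auto
    then show "W m \<le> R powr s * sob s m" using R msq1_pos[of m] by (simp add: sob_def powr_mult)
  qed
  have W_shift: "\<bar>W m - W (sh e m)\<bar> \<le> \<delta> * (sqrt (W m) * sqrt (W (sh e m)))" if e: "\<bar>e\<bar> = int k" for e m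
  proof -
    let ?x = "real_of_int (fst m)"
    have "msq m - msq (sh e m) = - (2 * real_of_int e * ?x + (real_of_int e)\<^sup>2)"
      by (simp add: msq_def power2_sum algebra_simps)
    moreover have ek: "\<bar>real_of_int e\<bar> = ?k" using e by (metis of_int_abs of_int_of_nat_eq)
    ultimately have "\<bar>msq m - msq (sh e m)\<bar> \<le> 2 * ?k * \<bar>?x\<bar> + ?k\<^sup>2"
      using abs_triangle_ineq[of "2 * real_of_int e * ?x" "(real_of_int e)\<^sup>2"]
      by (simp add: abs_mult flip: ek)
    moreover have "2 * ?k * \<bar>?x\<bar> + ?k\<^sup>2 \<le> \<rho> * (R + msq m)"
    proof -
      have 1: "2 * (r * \<bar>?x\<bar>) \<le> R + msq m"
      proof -
        have "R + msq m = r\<^sup>2 + \<bar>?x\<bar>\<^sup>2 + (real_of_int (snd m))\<^sup>2" by (simp add: R_def msq_def)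
        then show ?thesis
          using sum_squares_bound[of r "\<bar>?x\<bar>"] zero_le_power2[of "real_of_int (snd m)"] by linarith
      qed
      have "r * 1 \<le> r * r" using r(1) by (intro mult_left_mono) auto
      then have 2: "r \<le> R + msq m" using msq_nonneg[of m] by (simp add: R_def power2_eq_square)
      have "r * (2 * ?k * \<bar>?x\<bar> + ?k\<^sup>2) = ?k * (2 * (r * \<bar>?x\<bar>)) + ?k\<^sup>2 * r" by (simp add: algebra_simps)
      also have "\<dots> \<le> ?k * (R + msq m) + ?k\<^sup>2 * (R + msq m)"
        using 1 2 by (intro add_mono mult_left_mono) auto
      also have "\<dots> = (?k + ?k\<^sup>2) * (R + msq m)" by (simp add: algebra_simps)
      also have "\<dots> \<le> \<rho> * r * (R + msq m)" using r(2) Rm[of m] by (intro mult_right_mono) auto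
      finally have "r * (2 * ?k * \<bar>?x\<bar> + ?k\<^sup>2) \<le> r * (\<rho> * (R + msq m))" by (simp add: mult_ac)
      then show ?thesis using r(1) by simp
    qed
    ultimately have "\<bar>(R + msq m) - (R + msq (sh e m))\<bar> \<le> \<rho> * (R + msq m)" by simp
    from \<rho>(2)[OF Rm Rm this] show ?thesis unfolding W_half by (simp add: W_def)
  qed
  \<comment> \<open>Three regimes: A itself where it is bounded away from 0; a small weight at m1 =
    0, |m2| = k, where A vanishes and cannot serve as a weight; and 1 elsewhere, where in the
    symmetry class either the error is charged to \<open>chi0\<close> and \<open>chi1\<close> or m2
    = 0.\<close>
  define \<alpha> where "\<alpha> m = (if msq m \<ge> ?k\<^sup>2 + 1 then asym k m else if \<bar>snd m\<bar> = int k then \<delta>\<^sup>2 else 1)" for m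
  define p where "p m = W m * \<alpha> m" for m
  define q where "q m = W m * bsym k m" for m
  have asym_pos: "asym k m \<ge> 1 / (?k\<^sup>2 + 2)" if "msq m \<ge> ?k\<^sup>2 + 1" for m
  proof -
    have "(1 + ?k\<^sup>2) / (1 + msq m) \<le> (1 + ?k\<^sup>2) / (?k\<^sup>2 + 2)"
      using that k2 by (intro divide_left_mono) auto
    moreover have "1 - (1 + ?k\<^sup>2) / (?k\<^sup>2 + 2) = 1 / (?k\<^sup>2 + 2)" using k2 by (simp add: field_simps)
    ultimately show ?thesis by (simp add: asym_def)
  qed
  define \<kappa> where "\<kappa> = min (1 / (?k\<^sup>2 + 2)) (\<delta>\<^sup>2)"
  have "1 / (?k\<^sup>2 + 2) \<le> 1" by (simp add: divide_le_eq)
  then have \<kappa>: "\<kappa> > 0" "\<kappa> \<le> 1" using \<delta> k2 by (auto simp: \<kappa>_def intro: min.coboundedI1)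
  have \<alpha>_ge: "\<alpha> m \<ge> \<kappa>" for m
    using asym_pos[of m] \<kappa>(2) by (auto simp: \<alpha>_def \<kappa>_def)
  have \<alpha>_le: "\<alpha> m \<le> 1 + \<delta>\<^sup>2" for m
    using asym_le_1[of k m] by (auto simp: \<alpha>_def intro: order_trans)
  have \<alpha>_nonneg: "\<alpha> m \<ge> 0" for m using \<alpha>_ge[of m] \<kappa>(1) by linarith
  have b_ge: "bsym k m \<ge> 1 / (1 + msq m)" if "msq m \<noteq> 0" for m
  proof -
    have "msq m > 0" using that msq_nonneg[of m] by linarith
    then have "1 / (1 + msq m) \<le> 1 / msq m" by (simp add: field_simps)
    also have "\<dots> \<le> bsym k m" unfolding bsym_def using \<open>msq m > 0\<close> by (intro divide_right_mono) auto
    finally show ?thesis .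
  qed
  define K where "K = R powr s * (2 * (1 + ?k\<^sup>2)) + R powr s * (1 + \<delta>\<^sup>2)"
  have Rs: "R powr s \<ge> 0" by simp
  have adm: "adm s q p K"
    unfolding adm_def
  proof (intro conjI allI)
    fix m
    have "\<bar>q m\<bar> = W m * bsym k m" using W_pos[of m] bsym_nonneg[of k m] by (simp add: q_def)
    also have "\<dots> \<le> (R powr s * sob s m) * (2 * (1 + ?k\<^sup>2) / (1 + msq m))"
      using W_sob(2)[of m] bsym_le[of k m] bsym_nonneg[of k m] by (intro mult_mono) (auto simp: sob_def)
    also have "\<dots> = R powr s * (2 * (1 + ?k\<^sup>2)) * sob (s - 1) m"
      unfolding sob_Suc[of s m] using msq1_pos[of m] by (simp add: field_simps)
    also have "\<dots> \<le> K * sob (s - 1) m"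
      unfolding K_def using Rs by (intro mult_right_mono) (auto simp: sob_def)
    finally show "\<bar>q m\<bar> \<le> K * sob (s - 1) m" .
    have "\<bar>p m\<bar> = W m * \<alpha> m" using W_pos[of m] \<alpha>_nonneg[of m] by (simp add: p_def)
    also have "\<dots> \<le> (R powr s * sob s m) * (1 + \<delta>\<^sup>2)"
      using W_sob(2)[of m] \<alpha>_le[of m] \<alpha>_nonneg[of m] by (intro mult_mono) (auto simp: sob_def)
    also have "\<dots> = R powr s * (1 + \<delta>\<^sup>2) * sob s m" by (simp only: mult_ac)
    also have "\<dots> \<le> K * sob s m" unfolding K_def using Rs by (intro mult_right_mono) (auto simp: sob_def)
    finally show "\<bar>p m\<bar> \<le> K * sob s m" .
  qed
  have p_ge: "\<kappa> * sob s m \<le> p m" for m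
    unfolding p_def using mult_mono[OF \<alpha>_ge[of m] W_sob(1)[of m]] \<kappa>(1) \<alpha>_nonneg[of m] W_pos[of m]
    by (simp add: sob_def mult.commute)
  have q_ge: "\<kappa> * sob (s - 1) m \<le> q m" if "msq m \<noteq> 0" for m
  proof -
    have "\<kappa> * sob (s - 1) m \<le> 1 * sob (s - 1) m" using \<kappa>(2) by (intro mult_right_mono) (auto simp: sob_def)
    also have "\<dots> = sob s m * (1 / (1 + msq m))" unfolding sob_Suc[of s m] using msq1_pos[of m] by simp
    also have "\<dots> \<le> W m * bsym k m"
      using W_sob(1)[of m] b_ge[OF that] W_pos[of m] msq1_pos[of m] by (intro mult_mono) auto
    finally show ?thesis by (simp add: q_def)
  qed
  \<comment> \<open>Upper bound of \<open>W\<close> at the frequencies marked by \<open>chi0\<close>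
    and \<open>chi1\<close>, where \<open>msq\<close> is at most 2 k^2.\<close>
  define B where "B = (R + 2 * ?k\<^sup>2) powr s"
  define C where "C = ?k\<^sup>2 / 2 * (B * (1 + ?k\<^sup>2) + B * (1 + ?k\<^sup>2) * (1 + ?k\<^sup>2))"
  have B: "B \<ge> 0" by (simp add: B_def)
  have C: "C \<ge> 0" using B by (simp add: C_def)
  have termwise: "cross k q p u e m \<le> \<epsilon> / 2 * (p m * (cmod (snd u m))\<^sup>2 + q (sh e m) * (cmod (fst u (sh e m)))\<^sup>2)
      + C / 2 * (chi0 k m * (cmod (snd u m))\<^sup>2 + chi1 k (sh e m) * (cmod (fst u (sh e m)))\<^sup>2)"
    if u: "u \<in> Xsym s k" and e: "\<bar>e\<bar> = int k" for u e m
  proof -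
    let ?F = "cmod (snd u m)" and ?G = "cmod (fst u (sh e m))" and ?l = "\<bar>real_of_int (snd m)\<bar>"
    let ?d = "p m * bsym k (sh e m) - q (sh e m) * asym k m"
    have pq: "p m \<ge> 0" "q (sh e m) \<ge> 0" "chi0 k m \<ge> 0" "chi1 k (sh e m) \<ge> 0"
      using W_pos \<alpha>_nonneg bsym_nonneg by (auto simp: p_def q_def chi0_def chi1_def less_imp_le)
    have rhs0: "0 \<le> \<epsilon> / 2 * (p m * ?F\<^sup>2 + q (sh e m) * ?G\<^sup>2)" "0 \<le> C / 2 * (chi0 k m * ?F\<^sup>2 + chi1 k (sh e m) * ?G\<^sup>2)"
      using pq \<epsilon> C by (auto intro!: mult_nonneg_nonneg add_nonneg_nonneg)
    have "cross k q p u e m \<le> \<bar>cross k q p u e m\<bar>" by simp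
    also have "\<dots> = ?k * ?l / 2 * \<bar>?d\<bar> * \<bar>Im (fst u (sh e m) * cnj (snd u m))\<bar>"
      by (simp add: cross_def abs_mult)
    also have "\<dots> \<le> ?k * ?l / 2 * \<bar>?d\<bar> * (?G * ?F)"
      using abs_Im_le_cmod[of "fst u (sh e m) * cnj (snd u m)"] by (intro mult_left_mono) (auto simp: norm_mult)
    finally have cr: "cross k q p u e m \<le> ?k * ?l / 2 * \<bar>?d\<bar> * (?G * ?F)" .
    show ?thesis
    proof (cases "snd m = 0 \<or> snd u m = 0")
      case True
      then have "?k * ?l / 2 * \<bar>?d\<bar> * (?G * ?F) = 0" by auto
      then show ?thesis using cr rhs0 by linarith
    next
      case False
      then have l1: "?l \<ge> 1" by linarith
      have l2: "?l\<^sup>2 \<ge> 1" by (rule one_le_power[OF l1])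
      have msq_l: "?l\<^sup>2 \<le> msq (sh e m)" by (simp add: msq_def)
      have msq_pos: "msq (sh e m) > 0" using l2 msq_l by linarith
      have lb: "?l * sqrt (bsym k (sh e m)) \<le> \<kappa>0"
      proof -
        have "?l * sqrt (bsym k (sh e m)) = sqrt (?l\<^sup>2 * bsym k (sh e m))" by (simp add: real_sqrt_mult)
        also have "\<dots> \<le> sqrt (1 + ?k\<^sup>2)"
          using msq_l msq_pos mult_left_mono[OF msq_l, of "1 + ?k\<^sup>2"]
          by (intro real_sqrt_le_mono) (simp add: bsym_def divide_le_eq mult.commute)
        finally show ?thesis by (simp add: \<kappa>0_def)
      qed
      have sb: "bsym k (sh e m) = sqrt (bsym k (sh e m)) * sqrt (bsym k (sh e m))" using bsym_nonneg[of k "sh e m"] by simp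
      \<comment> \<open>The regimes other than the last end with the inequality of the arithmetic
        and geometric mean, applied to a suitable \<open>X\<close> whose square is at most
        \<open>p m * ?F\<^sup>2\<close>.\<close>
      have final: "?thesis" if X: "X \<ge> 0" and le: "?k * ?l / 2 * \<bar>?d\<bar> * (?G * ?F) \<le> ?k / 2 * \<delta> * \<kappa>0 * (X * (sqrt (q (sh e m)) * ?G))"
        and Xp: "X\<^sup>2 \<le> p m * ?F\<^sup>2" for X
      proof -
        have "X * (sqrt (q (sh e m)) * ?G) \<le> (X\<^sup>2 + (sqrt (q (sh e m)) * ?G)\<^sup>2) / 2"
          using sum_squares_bound[of X "sqrt (q (sh e m)) * ?G"] by simp
        also have "\<dots> \<le> (p m * ?F\<^sup>2 + q (sh e m) * ?G\<^sup>2) / 2" using Xp pq by (simp add: power_mult_distrib)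
        finally have "\<epsilon> * (X * (sqrt (q (sh e m)) * ?G)) \<le> \<epsilon> * ((p m * ?F\<^sup>2 + q (sh e m) * ?G\<^sup>2) / 2)"
          using \<epsilon> by (intro mult_left_mono) auto
        also have "\<dots> = \<epsilon> / 2 * (p m * ?F\<^sup>2 + q (sh e m) * ?G\<^sup>2)" by simp
        finally have 1: "\<epsilon> * (X * (sqrt (q (sh e m)) * ?G)) \<le> \<epsilon> / 2 * (p m * ?F\<^sup>2 + q (sh e m) * ?G\<^sup>2)" .
        have "?k / 2 * \<delta> * \<kappa>0 = \<epsilon>" using k1 \<kappa>0 by (simp add: \<delta>_def field_simps)
        from le[unfolded this] show ?thesis using cr 1 rhs0(2) by linarith
      qed
      have qs: "sqrt (q (sh e m)) = sqrt (W (sh e m)) * sqrt (bsym k (sh e m))" by (simp add: q_def real_sqrt_mult)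
      show ?thesis
      proof (cases "msq m \<ge> ?k\<^sup>2 + 1")
        case True
        have a: "0 \<le> asym k m" "asym k m \<le> 1" using asym_pos[OF True] asym_le_1[of k m] k2
          by (auto intro: order_trans[of 0 "1 / (?k\<^sup>2 + 2)"])
        have pa: "p m = W m * asym k m" using True by (simp add: p_def \<alpha>_def)
        have d: "?d = (W m - W (sh e m)) * (asym k m * bsym k (sh e m))" by (simp add: pa q_def algebra_simps)
        have sa: "asym k m = sqrt (asym k m) * sqrt (asym k m)" using a by simp
        have sa1: "sqrt (asym k m) \<le> 1" using a by simp
        show ?thesis
        proof (rule final[of "sqrt (p m) * ?F"])
          have "\<bar>?d\<bar> = \<bar>W m - W (sh e m)\<bar> * (asym k m * bsym k (sh e m))"
            unfolding d abs_mult using a bsym_nonneg[of k "sh e m"] by simp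
          also have "\<dots> \<le> \<delta> * (sqrt (W m) * sqrt (W (sh e m))) * (asym k m * bsym k (sh e m))"
            using W_shift[OF e] a bsym_nonneg[of k "sh e m"] by (intro mult_right_mono) auto
          finally have "?k * ?l / 2 * \<bar>?d\<bar> * (?G * ?F) \<le> ?k * ?l / 2 * (\<delta> * (sqrt (W m) * sqrt (W (sh e m))) * (asym k m * bsym k (sh e m))) * (?G * ?F)"
            by (intro mult_right_mono mult_left_mono) auto
          also have "\<dots> = ?k / 2 * \<delta> * (?l * (asym k m * bsym k (sh e m))) * (sqrt (W m) * sqrt (W (sh e m)) * (?G * ?F))"
            by (simp only: mult_ac times_divide_eq_right times_divide_eq_left)
          also have "?l * (asym k m * bsym k (sh e m)) = sqrt (asym k m) * (?l * sqrt (bsym k (sh e m))) * (sqrt (asym k m) * sqrt (bsym k (sh e m)))"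
            by (subst sa, subst sb) (simp only: mult_ac)
          also have "?k / 2 * \<delta> * (sqrt (asym k m) * (?l * sqrt (bsym k (sh e m))) * (sqrt (asym k m) * sqrt (bsym k (sh e m)))) * (sqrt (W m) * sqrt (W (sh e m)) * (?G * ?F))
            = ?k / 2 * \<delta> * (sqrt (asym k m) * (?l * sqrt (bsym k (sh e m)))) * (sqrt (p m) * ?F * (sqrt (q (sh e m)) * ?G))"
            unfolding qs pa real_sqrt_mult by (simp only: mult_ac)
          also have "\<dots> \<le> ?k / 2 * \<delta> * (1 * \<kappa>0) * (sqrt (p m) * ?F * (sqrt (q (sh e m)) * ?G))"
            using sa1 lb k1 \<delta> pq bsym_nonneg[of k "sh e m"] a
            by (intro mult_right_mono mult_left_mono mult_mono mult_nonneg_nonneg) auto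
          finally show "?k * ?l / 2 * \<bar>?d\<bar> * (?G * ?F) \<le> ?k / 2 * \<delta> * \<kappa>0 * (sqrt (p m) * ?F * (sqrt (q (sh e m)) * ?G))"
            by simp
        qed (use pq in \<open>auto simp: power_mult_distrib\<close>)
      next
        case small: False
        \<comment> \<open>Here the symmetry class enters: m1 is a multiple of k, so a low frequency
          with m2 nonzero must have m1 = 0.\<close>
        have "int k dvd fst m" using u False Xsym_iff[OF k, of u s] unfolding sym_def by blast
        then obtain j where j: "fst m = int k * j" by blast
        have m1: "fst m = 0"
        proof (rule ccontr)
          assume "fst m \<noteq> 0"
          then have "1 \<le> \<bar>j\<bar>" using j by auto
          then have "int k * 1 \<le> int k * \<bar>j\<bar>" by (intro mult_left_mono) auto
          then have "int k \<le> \<bar>fst m\<bar>" by (simp add: j abs_mult)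
          then have "?k \<le> \<bar>real_of_int (fst m)\<bar>" by linarith
          then have "?k\<^sup>2 \<le> (real_of_int (fst m))\<^sup>2" using power_mono[of ?k "\<bar>real_of_int (fst m)\<bar>" 2] by simp
          then show False using small l2 by (simp add: msq_def)
        qed
        have msq_m: "msq m = ?l\<^sup>2" by (simp add: msq_def m1)
        have e2: "(real_of_int e)\<^sup>2 = ?k\<^sup>2" using e by (metis of_int_abs of_int_of_nat_eq power2_abs)
        have msq_e: "msq (sh e m) = ?k\<^sup>2 + ?l\<^sup>2" by (simp add: msq_def m1 e2)
        have lk: "?l \<le> ?k"
        proof (rule ccontr)
          assume "\<not> ?l \<le> ?k"
          then have "int k + 1 \<le> \<bar>snd m\<bar>" by linarith
          then have "real_of_int (int k + 1) \<le> real_of_int \<bar>snd m\<bar>" by (simp only: of_int_le_iff)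
          then have "?k + 1 \<le> ?l" by simp
          then have "(?k + 1)\<^sup>2 \<le> ?l\<^sup>2" by (intro power_mono) auto
          then show False using small msq_m by (simp add: power2_sum)
        qed
        have l2k: "?l\<^sup>2 \<le> ?k\<^sup>2" using lk by (intro power_mono) auto
        show ?thesis
        proof (cases "\<bar>snd m\<bar> = int k")
          case True
          then have lk': "?l = ?k" by (metis of_int_abs of_int_of_nat_eq)
          \<comment> \<open>With A = 0 only the B-term survives; of the weight
            \<open>\<delta>\<^sup>2\<close> one factor \<open>\<delta>\<close> goes into
            \<open>sqrt (p m)\<close> and the other is the required smallness.\<close>
          have a0: "asym k m = 0" unfolding asym_eq msq_m lk' by simp
          have pm: "p m = W m * \<delta>\<^sup>2" using small True by (simp add: p_def \<alpha>_def)
          have WW: "sqrt (W m) \<le> sqrt (W (sh e m))"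
            unfolding W_def using msq_e msq_m s R by (intro real_sqrt_le_mono powr_mono2) auto
          show ?thesis
          proof (rule final[of "sqrt (p m) * ?F"])
            have sp: "sqrt (p m) = sqrt (W m) * \<delta>" unfolding pm using \<delta> by (simp add: real_sqrt_mult)
            have pp: "p m = sqrt (W m) * sqrt (W m) * \<delta> * \<delta>" unfolding pm using W_pos[of m] by (simp add: power2_eq_square)
            have "\<bar>?d\<bar> = p m * bsym k (sh e m)" using a0 pq bsym_nonneg[of k "sh e m"] by (simp add: abs_mult)
            then have d: "\<bar>?d\<bar> = p m * (sqrt (bsym k (sh e m)) * sqrt (bsym k (sh e m)))" using sb by metis
            have d': "\<bar>?d\<bar> = sqrt (W m) * sqrt (W m) * \<delta> * \<delta> * (sqrt (bsym k (sh e m)) * sqrt (bsym k (sh e m)))"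
              using d pp by metis
            have "?k * ?l / 2 * \<bar>?d\<bar> * (?G * ?F) = ?k / 2 * \<delta> * (?l * sqrt (bsym k (sh e m))) * (sqrt (p m) * ?F * (sqrt (W m) * sqrt (bsym k (sh e m)) * ?G))"
              unfolding d' sp by (simp only: mult_ac times_divide_eq_right times_divide_eq_left)
            also have "\<dots> \<le> ?k / 2 * \<delta> * \<kappa>0 * (sqrt (p m) * ?F * (sqrt (W (sh e m)) * sqrt (bsym k (sh e m)) * ?G))"
              using lb k1 \<delta> \<kappa>0 pq bsym_nonneg[of k "sh e m"] WW W_pos[of m]
              by (intro mult_mono mult_left_mono mult_right_mono mult_nonneg_nonneg) (auto simp: less_imp_le)
            finally show "?k * ?l / 2 * \<bar>?d\<bar> * (?G * ?F) \<le> ?k / 2 * \<delta> * \<kappa>0 * (sqrt (p m) * ?F * (sqrt (q (sh e m)) * ?G))"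
              unfolding qs .
          qed (use pq in \<open>auto simp: power_mult_distrib\<close>)
        next
          case lne: False
          have lz: "0 < \<bar>snd m\<bar>" "\<bar>snd m\<bar> < int k" using False lk lne by linarith+
          have chi: "chi0 k m = 1" "chi1 k (sh e m) = 1" using m1 e lz by (auto simp: chi0_def chi1_def)
          have pm: "p m = W m" using small lne by (simp add: p_def \<alpha>_def)
          have W1: "W m \<le> B" "W (sh e m) \<le> B"
            unfolding W_def B_def using msq_m msq_e l2k k2 s R by (auto intro!: powr_mono2)
          have b1: "bsym k (sh e m) \<le> 1 + ?k\<^sup>2"
            unfolding bsym_def using msq_e l2 k2 mult_left_mono[of 1 "msq (sh e m)" "1 + ?k\<^sup>2"]
            by (simp add: divide_le_eq)
          have "\<bar>?d\<bar> \<le> \<bar>p m * bsym k (sh e m)\<bar> + \<bar>q (sh e m) * asym k m\<bar>" by (rule abs_triangle_ineq4)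
          also have "\<dots> = W m * bsym k (sh e m) + W (sh e m) * bsym k (sh e m) * \<bar>asym k m\<bar>"
            using W_pos[of m] W_pos[of "sh e m"] bsym_nonneg[of k "sh e m"] by (simp add: pm q_def abs_mult)
          also have "\<dots> \<le> B * (1 + ?k\<^sup>2) + B * (1 + ?k\<^sup>2) * (1 + ?k\<^sup>2)"
            using W1 b1 asym_bound[of k m] W_pos[of m] W_pos[of "sh e m"] bsym_nonneg[of k "sh e m"] B
            by (intro add_mono mult_mono mult_nonneg_nonneg) (auto simp: less_imp_le)
          finally have d: "\<bar>?d\<bar> \<le> B * (1 + ?k\<^sup>2) + B * (1 + ?k\<^sup>2) * (1 + ?k\<^sup>2)" .
          have "?k * ?l / 2 * \<bar>?d\<bar> \<le> ?k * ?k / 2 * (B * (1 + ?k\<^sup>2) + B * (1 + ?k\<^sup>2) * (1 + ?k\<^sup>2))"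
            using d lk by (intro mult_mono divide_right_mono mult_left_mono) auto
          then have "?k * ?l / 2 * \<bar>?d\<bar> \<le> C" by (simp add: C_def power2_eq_square)
          then have "?k * ?l / 2 * \<bar>?d\<bar> * (?G * ?F) \<le> C * (?G * ?F)" by (intro mult_right_mono) auto
          also have "\<dots> \<le> C * ((?F\<^sup>2 + ?G\<^sup>2) / 2)"
            using sum_squares_bound[of ?F ?G] C by (intro mult_left_mono) (auto simp: mult_ac)
          finally show ?thesis using cr rhs0(1) unfolding chi by simp
        qed
      qed
    qed
  qed
  note adm' = adm_chi[OF s, of k]
  have diss: "form q p (L_op k u) u \<le> \<epsilon> * form q p u u + C * form (chi1 k) (chi0 k) u u" if u: "u \<in> Xsym s k" for u
  proof -
    have ua: "u \<in> Xall s" using u Xsym_iff[OF k] by blast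
    note f1 = form_self[OF adm ua] and f2 = form_self[OF adm' ua]
    have half: "infsum (cross k q p u e) UNIV \<le> \<epsilon> / 2 * form q p u u + C / 2 * form (chi1 k) (chi0 k) u u"
      if e: "\<bar>e\<bar> = int k" for e
    proof -
      have re: "(\<lambda>m. f (sh e m)) summable_on UNIV" "infsum (\<lambda>m. f (sh e m)) UNIV = infsum f UNIV"
        if "f summable_on UNIV" for f :: "int \<times> int \<Rightarrow> real"
        using that summable_on_reindex_bij_betw[OF bij_sh, of f e] infsum_reindex_bij_betw[OF bij_sh, of f e] by auto
      let ?r = "\<lambda>m. \<epsilon> / 2 * (p m * (cmod (snd u m))\<^sup>2 + q (sh e m) * (cmod (fst u (sh e m)))\<^sup>2)"
      let ?r' = "\<lambda>m. C / 2 * (chi0 k m * (cmod (snd u m))\<^sup>2 + chi1 k (sh e m) * (cmod (fst u (sh e m)))\<^sup>2)"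
      have hr: "(?r has_sum (\<epsilon> / 2 * form q p u u)) UNIV"
        using has_sum_add[OF has_sum_infsum[OF f1(3)] has_sum_infsum[OF re(1)[OF f1(2)]]]
        unfolding f1(1) re(2)[OF f1(2)] by (intro has_sum_cmult_right) (simp only: add.commute)
      have hr': "(?r' has_sum (C / 2 * form (chi1 k) (chi0 k) u u)) UNIV"
        using has_sum_add[OF has_sum_infsum[OF f2(3)] has_sum_infsum[OF re(1)[OF f2(2)]]]
        unfolding f2(1) re(2)[OF f2(2)] by (intro has_sum_cmult_right) (simp only: add.commute)
      show ?thesis
        by (rule has_sum_mono[OF has_sum_infsum[OF form_comp(1)[OF adm ua]] has_sum_add[OF hr hr']])
          (rule termwise[OF u e])
    qed
    show ?thesis unfolding form_L[OF adm ua] using half[of "int k"] half[of "- int k"] by simp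
  qed
  show ?thesis
    using adm \<kappa>(1) C p_ge q_ge diss by blast
qed

section \<open>The conserved energy and the growing modes\<close>

text \<open>Cauchy-Schwarz on finite sections. The weight \<open>w\<close> may vanish, so the bound
  also applies to the semidefinite weight \<open>pp\<close> in
  \<open>line_energy_pos\<close>.\<close>

lemma cip_bound:
  assumes w: "\<forall>m. w m \<ge> 0" and p: "\<forall>m. \<bar>p m\<bar> \<le> K * w m" and c: "c \<in> wsp w" and d: "d \<in> wsp w" and K: "K \<ge> 0"
  shows "cmod (cip p c d) \<le> K * wn w c * wn w d"
proof -
  let ?f = "\<lambda>m. of_real (p m) * (c m * cnj (d m))"
  have le: "norm (?f m) \<le> K * (wabs w c m * wabs w d m)" for m
  proof -
    have "\<bar>p m\<bar> * (cmod (c m) * cmod (d m)) \<le> K * w m * (cmod (c m) * cmod (d m))"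
      using p by (intro mult_right_mono) auto
    also have "K * w m * (cmod (c m) * cmod (d m)) = K * (sqrt (w m) * sqrt (w m)) * (cmod (c m) * cmod (d m))"
      using w by simp
    finally show ?thesis by (simp add: norm_mult mult_ac del: real_sqrt_mult_self)
  qed
  have fin: "(\<Sum>m\<in>F. norm (?f m)) \<le> K * wn w c * wn w d" if F: "finite F" for F
  proof -
    have "(\<Sum>m\<in>F. norm (?f m)) \<le> (\<Sum>m\<in>F. K * (\<bar>wabs w c m\<bar> * \<bar>wabs w d m\<bar>))"
      using le w by (intro sum_mono) simp
    also have "\<dots> = K * (\<Sum>m\<in>F. \<bar>wabs w c m\<bar> * \<bar>wabs w d m\<bar>)" by (simp add: sum_distrib_left)
    also have "\<dots> \<le> K * (L2_set (wabs w c) F * L2_set (wabs w d) F)"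
      using K by (intro mult_left_mono L2_set_mult_ineq)
    also have "\<dots> \<le> K * (wn w c * wn w d)"
      using K L2_set_le_wn[OF w c F] L2_set_le_wn[OF w d F] wn_nonneg[OF w, of c]
      by (intro mult_left_mono mult_mono) auto
    finally show ?thesis by (simp add: mult.assoc)
  qed
  have sm: "(\<lambda>m. norm (?f m)) summable_on UNIV"
    using fin by (intro nonneg_bdd_above_summable_on bdd_aboveI2) auto
  have "cmod (cip p c d) \<le> (\<Sum>\<^sub>\<infinity>m. norm (?f m))" unfolding cip_def by (rule norm_infsum_bound[OF sm])
  also have "\<dots> \<le> K * wn w c * wn w d" using fin by (intro infsum_le_finite_sums[OF sm]) auto
  finally show ?thesis .
qed

text \<open>Complex valued, unlike \<open>form\<close>, because pairing with a mode has to be a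
  complex linear functional.\<close>

definition energy :: "nat \<Rightarrow> state \<Rightarrow> state \<Rightarrow> complex" where
  "energy k u v = cip (bsym k) (fst u) (fst v) + cip (asym k) (snd u) (snd v)"

lemma adm_energy:
  assumes s: "s \<ge> 0"
  shows "adm s (bsym k) (asym k) (2 * (1 + (real k)\<^sup>2))"
  unfolding adm_def
proof (intro conjI allI)
  fix m
  have "\<bar>bsym k m\<bar> \<le> 2 * (1 + (real k)\<^sup>2) * (1 / (1 + msq m))" using bsym_le[of k m] bsym_nonneg[of k m] by simp
  also have "\<dots> \<le> 2 * (1 + (real k)\<^sup>2) * sob (s - 1) m" using sob_ge(2)[OF s] by (intro mult_left_mono) auto
  finally show "\<bar>bsym k m\<bar> \<le> 2 * (1 + (real k)\<^sup>2) * sob (s - 1) m" .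
  have "\<bar>asym k m\<bar> \<le> 2 * (1 + (real k)\<^sup>2) * 1" using asym_bound[of k m] by simp
  also have "\<dots> \<le> 2 * (1 + (real k)\<^sup>2) * sob s m" using sob_ge(1)[OF s] by (intro mult_left_mono) auto
  finally show "\<bar>asym k m\<bar> \<le> 2 * (1 + (real k)\<^sup>2) * sob s m" .
qed

lemma Re_energy: "Re (energy k u v) = form (bsym k) (asym k) u v"
  by (simp add: energy_def form_def)

lemma energy_scale: "energy k (c *\<^sub>C u) v = c * energy k u v"
  by (simp add: energy_def cip_scale distrib_left)

lemma energy_commute: "energy k u v = cnj (energy k v u)"
  unfolding energy_def by (subst cip_commute, subst (2) cip_commute) simp

lemma energy_scale_right: "energy k u (c *\<^sub>C v) = cnj c * energy k u v"
  by (subst energy_commute, simp add: energy_scale) (simp flip: energy_commute)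

lemma energy_add:
  assumes "s \<ge> 0" "u \<in> Xall s" "v \<in> Xall s" "w \<in> Xall s"
  shows "energy k (u + v) w = energy k u w + energy k v w"
proof -
  have "\<forall>m. \<bar>bsym k m\<bar> \<le> 2 * (1 + (real k)\<^sup>2) * sob (s - 1) m" "\<forall>m. \<bar>asym k m\<bar> \<le> 2 * (1 + (real k)\<^sup>2) * sob s m"
    using adm_energy[OF assms(1), of k] by (auto simp: adm_def)
  note c = cip_add[OF sob_nonneg this(1)] cip_add[OF sob_nonneg this(2)]
  show ?thesis
    using assms(2-4)[THEN XallD] by (simp add: energy_def c)
qed

lemma energy_bound:
  assumes s: "s \<ge> 0" and u: "u \<in> Xall s" and v: "v \<in> Xall s"
  shows "cmod (energy k u v) \<le> (2 * (2 * (1 + (real k)\<^sup>2)) * Xnorm s v) * Xnorm s u"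
proof -
  let ?K = "2 * (1 + (real k)\<^sup>2)"
  have K: "?K \<ge> 0" by simp
  have qp: "\<forall>m. \<bar>bsym k m\<bar> \<le> ?K * sob (s - 1) m" "\<forall>m. \<bar>asym k m\<bar> \<le> ?K * sob s m"
    using adm_energy[OF s, of k] by (auto simp: adm_def)
  have nn: "wn (sob \<sigma>) c \<ge> 0" for \<sigma> c using wn_nonneg[OF sob_nonneg] by simp
  have le: "wn (sob (s - 1)) (fst u) \<le> Xnorm s u" "wn (sob s) (snd u) \<le> Xnorm s u" for u
    unfolding Xnorm_pair by (rule le_pair_norm, rule nn)+
  have X0: "Xnorm s u \<ge> 0" for u using le(1)[of u] nn order_trans by blast
  have "cmod (energy k u v) \<le> cmod (cip (bsym k) (fst u) (fst v)) + cmod (cip (asym k) (snd u) (snd v))"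
    unfolding energy_def by (rule norm_triangle_ineq)
  also have "\<dots> \<le> ?K * wn (sob (s - 1)) (fst u) * wn (sob (s - 1)) (fst v) + ?K * wn (sob s) (snd u) * wn (sob s) (snd v)"
    using XallD[OF u] XallD[OF v] by (intro add_mono cip_bound[OF sob_nonneg qp(1)] cip_bound[OF sob_nonneg qp(2)] K) auto
  also have "\<dots> \<le> ?K * Xnorm s u * Xnorm s v + ?K * Xnorm s u * Xnorm s v"
    by (intro add_mono mult_mono mult_left_mono le mult_nonneg_nonneg nn X0 K)
  finally show ?thesis by (simp add: mult_ac)
qed

text \<open>Conservation holds termwise: \<open>cross\<close> vanishes identically for these
  weights.\<close>

lemma energy_L_self:
  assumes s: "s \<ge> 0" and u: "u \<in> Xall s"
  shows "Re (energy k (L_op k u) u) = 0"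
proof -
  have "cross k (bsym k) (asym k) u e = (\<lambda>m. 0)" for e by (simp add: cross_def fun_eq_iff)
  then show ?thesis unfolding Re_energy form_L[OF adm_energy[OF s] u] by simp
qed

text \<open>Polarization of \<open>energy_L_self\<close>; replacing \<open>u\<close> by
  \<open>\<i> *\<^sub>C u\<close> carries the real part over to the imaginary part.\<close>

lemma energy_L:
  assumes s: "s \<ge> 0" and u: "u \<in> Xall s" and v: "v \<in> Xall s"
  shows "energy k (L_op k u) v = - energy k u (L_op k v)"
proof -
  interpret X: nspace "Xall s" "Xnorm s" by (rule nspace_Xall)
  have L: "L_op k u \<in> Xall s" if "u \<in> Xall s" for u using L_op_bounded[of s k] that by (simp add: bounded_op_def)
  have re: "Re (energy k (L_op k u) v) = - Re (energy k u (L_op k v))" if u: "u \<in> Xall s" and v: "v \<in> Xall s" for u v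
  proof -
    note add = form_add[OF adm_energy[OF s, of k]]
    have "0 = form (bsym k) (asym k) (L_op k (u + v)) (u + v)"
      using energy_L_self[OF s, of "u + v" k] u v by (simp add: Re_energy)
    also have "\<dots> = form (bsym k) (asym k) (L_op k u) (u + v) + form (bsym k) (asym k) (L_op k v) (u + v)"
      unfolding L_op_linear using L u v by (intro add) auto
    also have "\<dots> = form (bsym k) (asym k) (u + v) (L_op k u) + form (bsym k) (asym k) (u + v) (L_op k v)"
      by (simp add: form_commute)
    also have "\<dots> = form (bsym k) (asym k) u (L_op k u) + form (bsym k) (asym k) v (L_op k u)
      + (form (bsym k) (asym k) u (L_op k v) + form (bsym k) (asym k) v (L_op k v))"
      using L u v by (subst (1 2) add) auto
    also have "form (bsym k) (asym k) u (L_op k u) = 0"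
      using energy_L_self[OF s u, of k] by (simp add: Re_energy form_commute)
    also have "form (bsym k) (asym k) v (L_op k v) = 0"
      using energy_L_self[OF s v, of k] by (simp add: Re_energy form_commute)
    finally show ?thesis by (simp add: Re_energy form_commute)
  qed
  have "Im (energy k (L_op k u) v) = - Im (energy k u (L_op k v))"
    using re[of "\<i> *\<^sub>C u" v] u v by (simp add: L_op_linear energy_scale)
  with re[OF u v] show ?thesis by (simp add: complex_eq_iff)
qed

section \<open>Rapidly decaying coefficients and the eigenvectors built from them\<close>

lemma summable_inverse_square: "(\<lambda>m::int. 1 / (1 + (real_of_int m)\<^sup>2)) summable_on UNIV"
proof -
  let ?f = "\<lambda>m::int. 1 / (1 + (real_of_int m)\<^sup>2)"
  have nat: "(\<lambda>j::nat. 1 / (1 + (real j)\<^sup>2)) summable_on UNIV"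
  proof (rule summable_on_comparison_test)
    have "summable (\<lambda>j::nat. 1 / (real (Suc j))\<^sup>2)"
      using summable_Suc_iff[of "\<lambda>j. 1 / (real j)\<^sup>2"] inverse_power_summable[of 2] by (simp add: inverse_eq_divide)
    then show "(\<lambda>j::nat. 2 * (1 / (real (Suc j))\<^sup>2)) summable_on UNIV"
      by (intro summable_on_cmult_right) (simp add: summable_on_UNIV_nonneg_real_iff)
    fix j :: nat
    have "(1 + real j)\<^sup>2 \<le> 2 * (1 + (real j)\<^sup>2)"
      using sum_squares_bound[of 1 "real j"] by (simp add: power2_sum)
    then show "1 / (1 + (real j)\<^sup>2) \<le> 2 * (1 / (real (Suc j))\<^sup>2)"
      by (simp add: field_simps add_pos_nonneg)
  qed auto
  have inj: "inj int" "inj (\<lambda>j. - int j)" by (auto simp: inj_on_def)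
  have "?f summable_on range int" "?f summable_on range (\<lambda>j. - int j)"
    using nat by (subst summable_on_reindex[OF inj(1)], simp add: o_def)
      (use nat in \<open>subst summable_on_reindex[OF inj(2)], simp add: o_def\<close>)
  moreover have "range int \<union> range (\<lambda>j. - int j) = UNIV"
    by (auto simp: image_iff) (metis int_cases2)
  ultimately show ?thesis by (metis summable_on_union)
qed

text \<open>Decay of every order in m1 beats each Sobolev weight on the two lines, which puts the
  modes into the spaces of all orders.\<close>

lemma line_wsp:
  fixes c :: dist2 and \<sigma> :: real
  assumes supp: "\<And>m. \<bar>snd m\<bar> \<noteq> int n \<Longrightarrow> c m = 0"
    and decay: "\<And>q. \<exists>C. \<forall>m. cmod (c m) * (1 + (real_of_int (fst m))\<^sup>2) ^ q \<le> C"
  shows "c \<in> wsp (sob \<sigma>)"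
proof -
  define q where "q = nat \<lceil>\<bar>\<sigma>\<bar>\<rceil> + 1"
  obtain C where C: "\<And>m. cmod (c m) * (1 + (real_of_int (fst m))\<^sup>2) ^ q \<le> C" using decay by blast
  let ?D = "(1 + (real n)\<^sup>2) ^ q"
  have bound: "sob \<sigma> m * (cmod (c m))\<^sup>2 \<le> C\<^sup>2 * ?D * (1 / (1 + (real_of_int (fst m))\<^sup>2))" for m
  proof (cases "\<bar>snd m\<bar> = int n")
    case True
    let ?x = "1 + (real_of_int (fst m))\<^sup>2"
    have x: "?x \<ge> 1" by simp
    have "(real_of_int (snd m))\<^sup>2 = (real n)\<^sup>2" using True by (metis of_int_abs of_int_of_nat_eq power2_abs)
    then have m: "1 + msq m \<le> ?x * (1 + (real n)\<^sup>2)" by (simp add: msq_def algebra_simps)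
    have "sob \<sigma> m \<le> (1 + msq m) powr (real q)"
      unfolding sob_def q_def using msq_nonneg[of m] by (intro powr_mono) linarith+
    also have "\<dots> = (1 + msq m) ^ q" using msq1_pos[of m] by (simp add: powr_realpow)
    also have "\<dots> \<le> (?x * (1 + (real n)\<^sup>2)) ^ q" using m msq_nonneg[of m] by (intro power_mono) auto
    finally have "sob \<sigma> m \<le> ?x ^ q * ?D" by (simp add: power_mult_distrib)
    then have "sob \<sigma> m * ((cmod (c m))\<^sup>2 * ?x) \<le> ?x ^ q * ?D * ((cmod (c m))\<^sup>2 * ?x ^ q)"
      using x self_le_power[OF x, of q]
      by (intro mult_mono mult_left_mono mult_nonneg_nonneg) (auto simp: q_def)
    also have "\<dots> = ?D * (cmod (c m) * ?x ^ q)\<^sup>2" by (simp add: power_mult_distrib power2_eq_square mult_ac)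
    also have "\<dots> \<le> ?D * C\<^sup>2" using C[of m] by (intro mult_left_mono power_mono) auto
    finally have "(sob \<sigma> m * (cmod (c m))\<^sup>2) * ?x \<le> C\<^sup>2 * ?D" by (simp only: mult_ac)
    moreover have "?x > 0" using x by linarith
    ultimately show ?thesis using pos_le_divide_eq[of ?x "sob \<sigma> m * (cmod (c m))\<^sup>2" "C\<^sup>2 * ?D"] by simp
  qed (simp add: supp)
  have line: "(\<lambda>m. sob \<sigma> m * (cmod (c m))\<^sup>2) summable_on range (\<lambda>j. (j, l))" for l
  proof -
    have inj: "inj (\<lambda>j::int. (j, l))" by (auto simp: inj_on_def)
    have "(\<lambda>j. sob \<sigma> (j, l) * (cmod (c (j, l)))\<^sup>2) summable_on UNIV"
    proof (rule summable_on_comparison_test)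
      show "(\<lambda>j. C\<^sup>2 * ?D * (1 / (1 + (real_of_int j)\<^sup>2))) summable_on UNIV"
        by (intro summable_on_cmult_right summable_inverse_square)
      show "sob \<sigma> (j, l) * (cmod (c (j, l)))\<^sup>2 \<le> C\<^sup>2 * ?D * (1 / (1 + (real_of_int j)\<^sup>2))" for j
        using bound[of "(j, l)"] by (simp only: fst_conv)
    qed (simp add: sob_def)
    then show ?thesis by (subst summable_on_reindex[OF inj]) (simp add: o_def)
  qed
  have "(\<lambda>m. sob \<sigma> m * (cmod (c m))\<^sup>2) summable_on range (\<lambda>j. (j, int n)) \<union> range (\<lambda>j. (j, - int n))"
    by (intro summable_on_union line)
  moreover have "c m = 0" if "m \<notin> range (\<lambda>j. (j, int n)) \<union> range (\<lambda>j. (j, - int n))" for m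
  proof (rule supp, rule notI)
    assume "\<bar>snd m\<bar> = int n"
    then have "m = (fst m, int n) \<or> m = (fst m, - int n)" by (auto simp: prod_eq_iff abs_if split: if_splits)
    then show False using that by blast
  qed
  ultimately have "(\<lambda>m. sob \<sigma> m * (cmod (c m))\<^sup>2) summable_on UNIV"
    by (subst summable_on_cong_neutral[where T = "range (\<lambda>j. (j, int n)) \<union> range (\<lambda>j. (j, - int n))"]) auto
  then show ?thesis by (simp add: wsp_def)
qed

text \<open>The mode data do not refer to \<open>s\<close>. Since \<open>lam\<close> quantifies over
  all orders and ground states are compared with modes at order 0, the locale is interpreted again
  at other orders with the same modes.\<close>

locale modes =
  fixes k :: nat and s :: real and lm :: "nat \<Rightarrow> real" and ph ps :: "nat \<Rightarrow> int \<Rightarrow> real"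
  assumes k: "k > 0" and s: "s \<ge> 0"
    and mode: "n \<in> {1..<k} \<Longrightarrow> chain_mode k n (lm n) (ph n) (ps n)"
begin

text \<open>\<open>\<sigma> = 1\<close> gives the growing and \<open>\<sigma> = - 1\<close> the
  decaying mode, as reversing the sign of \<omega> reverses time. The factor - i undoes the i in the
  meaning of \<open>ps\<close>, and \<open>sgn\<close> makes \<omega> odd in x2.\<close>

definition vec :: "nat \<Rightarrow> real \<Rightarrow> state" where
  "vec n \<sigma> = (\<lambda>m. if \<bar>snd m\<bar> = int n then - \<i> * of_real (\<sigma> * of_int (sgn (snd m)) * ps n (fst m)) else 0,
    \<lambda>m. if \<bar>snd m\<bar> = int n then of_real (ph n (fst m)) else 0)"

text \<open>The B-part of the energy of a mode; the A-part is its negative, because the total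
  vanishes.\<close>

definition el :: "nat \<Rightarrow> real" where
  "el n = Re (cip (bsym k) (fst (vec n 1)) (fst (vec n 1)))"

text \<open>The conserved form pairs eigenvectors only if their eigenvalues add up to zero; so the mode of
  rate \<open>- \<sigma> lm n\<close> represents the functional dual to that of rate \<open>\<sigma> lm n\<close>.\<close>

definition th :: "nat \<times> real \<Rightarrow> state \<Rightarrow> complex" where
  "th i u = - energy k u (vec (fst i) (- snd i)) / (2 * of_real (el (fst i)))"

definition mu :: "nat \<times> real \<Rightarrow> complex" where
  "mu i = of_real (snd i * lm (fst i))"

definition idx :: "(nat \<times> real) set" where
  "idx = {1..<k} \<times> {1, - 1}"

lemma
  assumes n: "n \<in> {1..<k}"
  shows lm_pos: "lm n > 0" and ph_0: "ph n 0 \<noteq> 0"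
    and mode_even: "ph n (- m) = ph n m" "ps n (- m) = ps n m"
    and ph_supp: "ph n m \<noteq> 0 \<Longrightarrow> \<exists>j. even j \<and> m = int k * j"
    and ps_supp: "ps n m \<noteq> 0 \<Longrightarrow> \<exists>j. odd j \<and> m = int k * j"
    and ph_eq: "lm n * ph n m = - (real n * real k / 2) *
        (bsym k (m - int k, int n) * ps n (m - int k) + bsym k (m + int k, int n) * ps n (m + int k))"
    and ps_eq: "lm n * ps n m = (real n * real k / 2) *
        (asym k (m - int k, int n) * ph n (m - int k) + asym k (m + int k, int n) * ph n (m + int k))"
    and mode_decay: "\<exists>C. \<forall>m. \<bar>ph n m\<bar> * (1 + (real_of_int m)\<^sup>2) ^ q \<le> C \<and> \<bar>ps n m\<bar> * (1 + (real_of_int m)\<^sup>2) ^ q \<le> C"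
  using mode[OF n] unfolding chain_mode_def by blast+

lemma vec_Xall:
  assumes n: "n \<in> {1..<k}"
  shows "vec n \<sigma> \<in> Xall s'"
  unfolding Xall_def mem_Times_iff
proof
  have C: "\<exists>C. \<forall>m. \<bar>ph n m\<bar> * (1 + (real_of_int m)\<^sup>2) ^ q \<le> C \<and> \<bar>ps n m\<bar> * (1 + (real_of_int m)\<^sup>2) ^ q \<le> C" for q
    by (rule mode_decay[OF n])
  show "fst (vec n \<sigma>) \<in> wsp (sob (s' - 1))"
  proof (rule line_wsp[where n = n])
    fix q
    obtain C where C: "\<And>m. \<bar>ps n m\<bar> * (1 + (real_of_int m)\<^sup>2) ^ q \<le> C" using C by blast
    have "cmod (fst (vec n \<sigma>) m) * (1 + (real_of_int (fst m))\<^sup>2) ^ q \<le> \<bar>\<sigma>\<bar> * C" for m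
    proof -
      have "cmod (fst (vec n \<sigma>) m) \<le> \<bar>\<sigma>\<bar> * 1 * \<bar>ps n (fst m)\<bar>"
      proof (cases "\<bar>snd m\<bar> = int n")
        case True
        have "\<bar>real_of_int (sgn (snd m))\<bar> \<le> 1" by (simp add: sgn_if)
        then have "\<bar>\<sigma>\<bar> * \<bar>real_of_int (sgn (snd m))\<bar> * \<bar>ps n (fst m)\<bar> \<le> \<bar>\<sigma>\<bar> * 1 * \<bar>ps n (fst m)\<bar>"
          by (intro mult_left_mono mult_right_mono) auto
        then show ?thesis using True unfolding vec_def by (simp add: norm_mult abs_mult)
      qed (simp add: vec_def)
      then have "cmod (fst (vec n \<sigma>) m) * (1 + (real_of_int (fst m))\<^sup>2) ^ q
        \<le> \<bar>\<sigma>\<bar> * 1 * \<bar>ps n (fst m)\<bar> * (1 + (real_of_int (fst m))\<^sup>2) ^ q" by (intro mult_right_mono) auto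
      also have "\<dots> = \<bar>\<sigma>\<bar> * (\<bar>ps n (fst m)\<bar> * (1 + (real_of_int (fst m))\<^sup>2) ^ q)" by simp
      also have "\<dots> \<le> \<bar>\<sigma>\<bar> * C" by (intro mult_left_mono C) auto
      finally show ?thesis .
    qed
    then show "\<exists>C. \<forall>m. cmod (fst (vec n \<sigma>) m) * (1 + (real_of_int (fst m))\<^sup>2) ^ q \<le> C" by blast
  qed (simp add: vec_def)
  show "snd (vec n \<sigma>) \<in> wsp (sob s')"
  proof (rule line_wsp[where n = n])
    fix q
    obtain C where C: "\<And>m. \<bar>ph n m\<bar> * (1 + (real_of_int m)\<^sup>2) ^ q \<le> C" using C by blast
    have "0 \<le> C" using order_trans[OF _ C[of 0]] by simp
    then have "cmod (snd (vec n \<sigma>) m) * (1 + (real_of_int (fst m))\<^sup>2) ^ q \<le> C" for m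
      using C[of "fst m"] by (simp add: vec_def)
    then show "\<exists>C. \<forall>m. cmod (snd (vec n \<sigma>) m) * (1 + (real_of_int (fst m))\<^sup>2) ^ q \<le> C" by blast
  qed (simp add: vec_def)
qed

lemma vec_sym:
  assumes n: "n \<in> {1..<k}"
  shows "sym k (vec n \<sigma>)"
  unfolding sym_def
proof (intro conjI allI impI)
  show "fst (vec n \<sigma>) (0, 0) = 0" using n by (simp add: vec_def)
next
  fix m :: "int \<times> int" assume "\<not> int k dvd fst m"
  then have "\<not> (\<exists>j. P j \<and> fst m = int k * j)" for P by auto
  then have "ph n (fst m) = 0" "ps n (fst m) = 0" using ph_supp[OF n] ps_supp[OF n] by blast+
  then show "fst (vec n \<sigma>) m = 0" "snd (vec n \<sigma>) m = 0" by (simp_all add: vec_def)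
next
  fix j l
  have k0: "int k \<noteq> 0" using k by simp
  have h: "ps n (int k * j) = - sg j * ps n (int k * j)"
  proof (cases "ps n (int k * j) = 0")
    case False
    then obtain i where "odd i" "int k * j = int k * i" using ps_supp[OF n] by blast
    then have "odd j" using k0 by simp
    then show ?thesis by (simp add: sg_def)
  qed simp
  show "fst (vec n \<sigma>) (- (int k * j), l) = - sg j * fst (vec n \<sigma>) (int k * j, l)"
  proof (cases "\<bar>l\<bar> = int n")
    case True
    define c where "c = - \<i> * of_real (\<sigma> * of_int (sgn l))"
    have "fst (vec n \<sigma>) (m1, l) = c * of_real (ps n m1)" for m1 using True by (simp add: vec_def c_def)
    moreover have "c * of_real (ps n (int k * j)) = - sg j * (c * of_real (ps n (int k * j)))"
      using arg_cong[OF h, of "\<lambda>x. c * x"] by (rule trans) (rule mult.left_commute)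
    ultimately show ?thesis by (simp add: mode_even[OF n])
  qed (simp add: vec_def)
  have "ph n (int k * j) = sg j * ph n (int k * j)"
  proof (cases "ph n (int k * j) = 0")
    case False
    then obtain i where "even i" "int k * j = int k * i" using ph_supp[OF n] by blast
    then have "even j" using k0 by simp
    then show ?thesis by (simp add: sg_def)
  qed simp
  then show "snd (vec n \<sigma>) (- (int k * j), l) = sg j * snd (vec n \<sigma>) (int k * j, l)"
    by (simp add: vec_def mode_even[OF n])
next
  fix m l
  show "fst (vec n \<sigma>) (m, - l) = - fst (vec n \<sigma>) (m, l)" "snd (vec n \<sigma>) (m, - l) = snd (vec n \<sigma>) (m, l)"
    by (simp_all add: vec_def sgn_minus)
qed

lemma vec_Xsym: "n \<in> {1..<k} \<Longrightarrow> vec n \<sigma> \<in> Xsym s' k"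
  using vec_Xall vec_sym by (simp add: Xsym_iff[OF k])

lemma vec_block: "n \<in> {1..<k} \<Longrightarrow> vec n \<sigma> \<in> block s' k n"
  using vec_Xsym by (subst block_iff) (auto simp: vec_def)

lemma fst_vec: "fst (vec n \<sigma>) = of_real \<sigma> *\<^sub>C fst (vec n 1)"
  by (simp add: vec_def fun_eq_iff scaleC_fun_def scaleC_complex_def)

lemma snd_vec: "snd (vec n \<sigma>) = snd (vec n 1)"
  by (simp add: vec_def)

lemma L_vec:
  assumes n: "n \<in> {1..<k}" and \<sigma>: "\<sigma> * \<sigma> = 1"
  shows "L_op k (vec n \<sigma>) = of_real (\<sigma> * lm n) *\<^sub>C vec n \<sigma>"
proof -
  have coeffs: "fst (L_op k (vec n \<sigma>)) (m1, l) = of_real (\<sigma> * lm n) * fst (vec n \<sigma>) (m1, l)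
      \<and> snd (L_op k (vec n \<sigma>)) (m1, l) = of_real (\<sigma> * lm n) * snd (vec n \<sigma>) (m1, l)" for m1 l
  proof (cases "\<bar>l\<bar> = int n")
    case False
    then show ?thesis by (simp add: L_op_coeff vec_def)
  next
    case True
    have ab: "asym k (m, l) = asym k (m, int n)" "bsym k (m, l) = bsym k (m, int n)" for m
    proof -
      have "l = int n \<or> l = - int n" using True by linarith
      then show "asym k (m, l) = asym k (m, int n)" "bsym k (m, l) = bsym k (m, int n)"
        using asym_neg(2)[of k m "int n"] bsym_neg(2)[of k m "int n"] by auto
    qed
    have l: "real_of_int l = real_of_int (sgn l) * real n" using True by (simp add: sgn_if split: if_splits) linarith
    have sl: "real_of_int (sgn l) * real_of_int (sgn l) = 1" using True n by (auto simp: sgn_if)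
    have lc: "complex_of_int l = of_real (real_of_int l)" by simp
    define xa where "xa = asym k (m1 - int k, int n) * ph n (m1 - int k) + asym k (m1 + int k, int n) * ph n (m1 + int k)"
    define xb where "xb = bsym k (m1 - int k, int n) * ps n (m1 - int k) + bsym k (m1 + int k, int n) * ps n (m1 + int k)"
    have "fst (L_op k (vec n \<sigma>)) (m1, l) = - \<i> * of_real (real k * real_of_int l / 2 * xa)"
      unfolding L_op_coeff ab xa_def using True by (simp add: vec_def)
    also have "real k * real_of_int l / 2 * xa = real_of_int (sgn l) * (lm n * ps n m1)"
      unfolding ps_eq[OF n] xa_def l by simp
    also have "\<dots> = \<sigma> * lm n * (\<sigma> * of_int (sgn l) * ps n m1)" using \<sigma> by (simp add: algebra_simps)
    finally have 1: "fst (L_op k (vec n \<sigma>)) (m1, l) = of_real (\<sigma> * lm n) * fst (vec n \<sigma>) (m1, l)"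
      using True by (simp add: vec_def)
    have "snd (L_op k (vec n \<sigma>)) (m1, l) = of_real (- (real k * real_of_int l / 2) * (\<sigma> * of_int (sgn l) * xb))"
      unfolding L_op_coeff ab xb_def using True by (simp add: vec_def algebra_simps)
    also have "- (real k * real_of_int l / 2) * (\<sigma> * of_int (sgn l) * xb)
        = \<sigma> * ((real_of_int (sgn l) * real_of_int (sgn l)) * (- (real n * real k / 2) * xb))"
      unfolding l by (simp add: algebra_simps)
    also have "\<dots> = \<sigma> * (lm n * ph n m1)" unfolding ph_eq[OF n] xb_def sl by simp
    finally have 2: "snd (L_op k (vec n \<sigma>)) (m1, l) = of_real (\<sigma> * lm n) * snd (vec n \<sigma>) (m1, l)"
      using True by (simp add: vec_def)
    show ?thesis using 1 2 by simp
  qed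
  show ?thesis
  proof (rule prod_eqI; rule ext)
    fix m :: "int \<times> int"
    obtain m1 l where m: "m = (m1, l)" by (cases m)
    show "fst (L_op k (vec n \<sigma>)) m = fst (of_real (\<sigma> * lm n) *\<^sub>C vec n \<sigma>) m"
      "snd (L_op k (vec n \<sigma>)) m = snd (of_real (\<sigma> * lm n) *\<^sub>C vec n \<sigma>) m"
      unfolding m using coeffs[of m1 l] by (simp_all add: scaleC_fun_def scaleC_complex_def)
  qed
qed

lemma cip_el: "n \<in> {1..<k} \<Longrightarrow> cip (bsym k) (fst (vec n 1)) (fst (vec n 1)) = of_real (el n)"
  using cip_self(1)[OF sob_nonneg _ conjunct1[OF XallD[OF vec_Xall]], of "bsym k" "2 * (1 + (real k)\<^sup>2)" s n 1]
    adm_energy[OF s, of k] unfolding el_def adm_def by simp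

text \<open>Conservation makes \<open>lm n\<close> times the energy of the mode vanish.\<close>

lemma energy_vec_self:
  assumes n: "n \<in> {1..<k}"
  shows "energy k (vec n 1) (vec n 1) = 0"
proof -
  have "Re (energy k (L_op k (vec n 1)) (vec n 1)) = 0" by (rule energy_L_self[OF s vec_Xall[OF n]])
  then have "lm n * Re (energy k (vec n 1) (vec n 1)) = 0" using L_vec[OF n, of 1] by (simp add: energy_scale)
  then have "Re (energy k (vec n 1) (vec n 1)) = 0" using lm_pos[OF n] by simp
  moreover have "Im (energy k (vec n 1) (vec n 1)) = 0"
    using arg_cong[OF energy_commute[of k "vec n 1" "vec n 1"], of Im] by simp
  ultimately show ?thesis by (simp add: complex_eq_iff)
qed

lemma cip_asym_vec:
  assumes n: "n \<in> {1..<k}"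
  shows "cip (asym k) (snd (vec n 1)) (snd (vec n 1)) = - of_real (el n)"
  using energy_vec_self[OF n] cip_el[OF n] by (simp add: energy_def eq_neg_iff_add_eq_0 add.commute)

lemma energy_vec:
  assumes n: "n \<in> {1..<k}"
  shows "energy k u (vec n \<sigma>) = of_real \<sigma> * cip (bsym k) (fst u) (fst (vec n 1)) + cip (asym k) (snd u) (snd (vec n 1))"
proof -
  have "cip (bsym k) (fst u) (fst (vec n \<sigma>)) = of_real \<sigma> * cip (bsym k) (fst u) (fst (vec n 1))"
    unfolding fst_vec[of n \<sigma>] by (subst cip_commute, simp add: cip_scale) (simp flip: cip_commute)
  then show ?thesis unfolding energy_def snd_vec[of n \<sigma>] by simp
qed

lemma energy_vec_vec:
  assumes n: "n \<in> {1..<k}" "n' \<in> {1..<k}"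
  shows "energy k (vec n \<sigma>) (vec n' \<tau>) = (if n = n' then of_real ((\<sigma> * \<tau> - 1) * el n) else 0)"
proof (cases "n = n'")
  case True
  then show ?thesis
    unfolding energy_vec[OF n(2)] fst_vec[of n \<sigma>] snd_vec[of n \<sigma>] cip_scale
    using cip_el[OF n(1)] cip_asym_vec[OF n(1)] by (simp add: algebra_simps)
next
  case False
  have "cip p (fst (vec n \<sigma>)) (fst (vec n' \<tau>)) = 0" "cip p (snd (vec n \<sigma>)) (snd (vec n' \<tau>)) = 0" for p
    unfolding cip_def using False by (auto simp: vec_def intro!: infsum_0)
  then show ?thesis using False by (simp add: energy_def)
qed

text \<open>If \<open>ps\<close> vanished identically, the equation at frequency zero would force
  \<open>ph n 0 = 0\<close>.\<close>

lemma el_pos: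
  assumes n: "n \<in> {1..<k}"
  shows "el n > 0"
proof -
  obtain m where m: "ps n m \<noteq> 0"
    using ph_eq[OF n, of 0] ph_0[OF n] lm_pos[OF n] by fastforce
  let ?m = "(m, int n)"
  have adm: "\<forall>m. \<bar>bsym k m\<bar> \<le> (2 * (1 + (real k)\<^sup>2)) * sob (s - 1) m" using adm_energy[OF s, of k] by (simp add: adm_def)
  note c = cip_self[OF sob_nonneg adm conjunct1[OF XallD[OF vec_Xall[OF n]]], of 1]
  have "msq ?m > 0" using n by (simp add: msq_def add_nonneg_pos)
  then have "bsym k ?m > 0" by (simp add: bsym_def add_pos_nonneg)
  moreover have "cmod (fst (vec n 1) ?m) > 0" using m n by (simp add: vec_def sgn_if)
  ultimately have "0 < (\<Sum>m\<in>{?m}. bsym k m * (cmod (fst (vec n 1) m))\<^sup>2)" by simp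
  also have "\<dots> \<le> (\<Sum>\<^sub>\<infinity>m. bsym k m * (cmod (fst (vec n 1) m))\<^sup>2)"
    using bsym_nonneg by (intro finite_sum_le_infsum c(2)) auto
  finally show ?thesis unfolding el_def c(1) by simp
qed

lemma th_vec:
  assumes i: "i \<in> idx" "j \<in> idx"
  shows "th i (vec (fst j) (snd j)) = (if i = j then 1 else 0)"
proof -
  have n: "fst i \<in> {1..<k}" "fst j \<in> {1..<k}" "snd i \<in> {1, - 1}" "snd j \<in> {1, - 1}" using i by (auto simp: idx_def)
  show ?thesis
  proof (cases "i = j")
    case True
    have "snd i * snd i = 1" using n(3) by auto
    then show ?thesis unfolding th_def energy_vec_vec[OF n(2,1)] using True el_pos[OF n(1)] by simp
  next
    case False
    have "snd j * snd i = - 1" if "fst j = fst i" using n(3,4) False that by (auto simp: prod_eq_iff)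
    then show ?thesis unfolding th_def energy_vec_vec[OF n(2,1)] using False by simp
  qed
qed

text \<open>Antisymmetry of the operator and the opposite rate of the paired mode contribute one
  minus sign each.\<close>

lemma th_L:
  assumes i: "i \<in> idx" and u: "u \<in> Xall s"
  shows "th i (L_op k u) = mu i * th i u"
proof -
  have n: "fst i \<in> {1..<k}" "(- snd i) * (- snd i) = 1" using i by (auto simp: idx_def)
  have "energy k (L_op k u) (vec (fst i) (- snd i)) = of_real (snd i * lm (fst i)) * energy k u (vec (fst i) (- snd i))"
    unfolding energy_L[OF s u vec_Xall[OF n(1)]] L_vec[OF n] energy_scale_right by simp
  then show ?thesis by (simp add: th_def mu_def)
qed

lemma th_dual:
  assumes i: "i \<in> idx" and V: "V \<subseteq> Xall s"
  shows "th i \<in> dual_space (Xnorm s) V"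
proof -
  have n: "fst i \<in> {1..<k}" using i by (auto simp: idx_def)
  let ?v = "vec (fst i) (- snd i)"
  have "linear_on (Xall s) (\<lambda>u. energy k u ?v)"
    unfolding linear_on_def by (simp add: energy_add[OF s _ _ vec_Xall[OF n]] energy_scale scaleC_complex_def)
  then have d: "(\<lambda>u. energy k u ?v) \<in> dual_space (Xnorm s) (Xall s)"
    unfolding dual_space_def using energy_bound[OF s _ vec_Xall[OF n]] by blast
  have th: "th i = (\<lambda>u. (- 1 / (2 * of_real (el (fst i)))) * energy k u ?v + 0 * energy k u ?v)"
    by (simp add: th_def fun_eq_iff)
  have "th i \<in> dual_space (Xnorm s) (Xall s)" unfolding th by (rule dual_comb[OF d d])
  then show ?thesis using V by (rule dual_subset)
qed

lemma splitting_Xsym: "eigen_splitting (Xsym s k) (Xnorm s) (L_op k) idx (\<lambda>i. vec (fst i) (snd i)) mu th"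
proof -
  interpret operator "Xsym s k" "Xnorm s" "L_op k" by (rule operator_Xsym[OF k])
  have sub: "Xsym s k \<subseteq> Xall s" by (auto simp: Xsym_iff[OF k])
  show ?thesis
    by unfold_locales
      (use sub vec_Xsym L_vec th_vec th_L th_dual[OF _ sub] in \<open>auto simp: idx_def mu_def\<close>)
qed

lemma splitting_block:
  assumes n: "n \<in> {1..<k}"
  shows "eigen_splitting (block s k n) (Xnorm s) (L_op k) ({n} \<times> {1, - 1}) (\<lambda>i. vec (fst i) (snd i)) mu th"
proof -
  have n1: "n \<ge> 1" using n by simp
  interpret operator "block s k n" "Xnorm s" "L_op k" by (rule operator_block[OF k n1])
  have sub: "block s k n \<subseteq> Xall s" by (auto simp: Xsym_iff[OF k] block_iff[OF n1])
  have i: "i \<in> idx" if "i \<in> {n} \<times> {1, - 1}" for i using that n by (auto simp: idx_def)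
  show ?thesis
    by unfold_locales
      (use sub vec_block[OF n] L_vec[OF n] th_vec[OF i i] th_L[OF i] th_dual[OF i sub] in \<open>auto simp: mu_def\<close>)
qed

lemma th_block:
  assumes n: "n \<in> {1..<k}" and u: "u \<in> block s k n" and i: "i \<in> idx" "fst i \<noteq> n"
  shows "th i u = 0"
proof -
  have n1: "n \<ge> 1" using n by simp
  have "cip p (fst u) (fst (vec (fst i) \<sigma>)) = 0" "cip p (snd u) (snd (vec (fst i) \<sigma>)) = 0" for p \<sigma>
    unfolding cip_def using i u[unfolded block_iff[OF n1]] by (auto simp: vec_def intro!: infsum_0)
  then show ?thesis by (simp add: th_def energy_def)
qed

end

section \<open>Nonnegativity of the energy on the complement of the modes\<close>

lemma has_sum_finite_sum:
  fixes f :: "'a \<Rightarrow> 'b \<Rightarrow> complex"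
  shows "(\<And>n. n \<in> A \<Longrightarrow> (f n has_sum x n) S) \<Longrightarrow> ((\<lambda>m. \<Sum>n\<in>A. f n m) has_sum (\<Sum>n\<in>A. x n)) S"
  by (induction A rule: infinite_finite_induct) (auto intro: has_sum_add)

context modes
begin

lemma cip_wn:
  assumes w: "\<forall>m. w m \<ge> 0" and c: "c \<in> wsp w"
  shows "Re (cip w c c) = (wn w c)\<^sup>2"
proof -
  have "\<forall>m. \<bar>w m\<bar> \<le> 1 * w m" using w by simp
  then show ?thesis using cip_self(1)[OF w _ c, of w 1] wn_power2[OF w, of c] by simp
qed

text \<open>Reverse Cauchy-Schwarz inequality: \<open>A\<close> has a single negative direction on the line \<open>|m2| = n\<close>,
  and the mode is negative for it, so \<open>A\<close> is nonnegative on the \<open>A\<close>-orthogonal complement of the mode.\<close>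

lemma line_energy_pos:
  assumes n: "n \<in> {1..<k}" and u: "u \<in> Xsym s k" and th: "\<And>i. i \<in> idx \<Longrightarrow> th i u = 0"
  shows "el n / (2 * (ph n 0)\<^sup>2) * Re (cip (\<lambda>m. if \<bar>snd m\<bar> = int n then chi0 k m else 0) (snd u) (snd u))
     \<le> Re (cip (\<lambda>m. if \<bar>snd m\<bar> = int n then asym k m else 0) (snd u) (snd u))"
proof -
  let ?F = "snd u" and ?f = "snd (vec n 1)"
  have ua: "u \<in> Xall s" and us: "sym k u" using u Xsym_iff[OF k] by auto
  have wF: "?F \<in> wsp (sob s)" and wf: "?f \<in> wsp (sob s)" using XallD[OF ua] XallD[OF vec_Xall[OF n]] by auto
  have nk: "real n < real k" "real n \<ge> 1" using n by auto
  define a0 where "a0 = asym k (0, int n)"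
  have "(real n)\<^sup>2 < (real k)\<^sup>2" using nk by (intro power_strict_mono) auto
  then have a0: "a0 < 0" unfolding a0_def asym_eq by (simp add: msq_def divide_neg_pos add_pos_nonneg)
  define pn where "pn m = (if \<bar>snd m\<bar> = int n then asym k m else 0)" for m
  \<comment> \<open>The nonnegative part of A on the lines |m2| = n, within the symmetry class.
    Adding \<open>a0 * d\<close>, the negative part at m1 = 0, recovers \<open>pn\<close>.\<close>
  define pp where "pp m = (if \<bar>snd m\<bar> = int n \<and> fst m \<noteq> 0 \<and> int k dvd fst m then asym k m else 0)" for m
  define d where "d m = (if fst m = 0 \<and> \<bar>snd m\<bar> = int n then 1 else 0 :: real)" for m :: "int \<times> int"
  have pp0: "\<forall>m. pp m \<ge> 0"
  proof
    fix m
    show "pp m \<ge> 0"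
    proof (cases "fst m \<noteq> 0 \<and> int k dvd fst m")
      case True
      then obtain j where j: "fst m = int k * j" "j \<noteq> 0" by auto
      have "1 \<le> \<bar>j\<bar>" using j(2) by linarith
      then have "int k * 1 \<le> int k * \<bar>j\<bar>" by (intro mult_left_mono) auto
      then have "int k \<le> \<bar>fst m\<bar>" by (simp add: j abs_mult)
      then have "real k \<le> \<bar>real_of_int (fst m)\<bar>" by linarith
      then have "(real k)\<^sup>2 \<le> (real_of_int (fst m))\<^sup>2" using power_mono[of "real k" "\<bar>real_of_int (fst m)\<bar>" 2] by simp
      then have "msq m - (real k)\<^sup>2 \<ge> 0" by (simp add: msq_def add_increasing2)
      then have "asym k m \<ge> 0" unfolding asym_eq using msq_nonneg[of m] by (intro divide_nonneg_pos) auto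
      then show ?thesis by (simp add: pp_def)
    qed (auto simp: pp_def)
  qed
  have bounds: "\<forall>m. \<bar>pp m\<bar> \<le> (2 * (1 + (real k)\<^sup>2)) * sob s m" "\<forall>m. \<bar>d m\<bar> \<le> 1 * sob s m"
    using adm_energy[OF s, of k] sob_ge(1)[OF s] sob_nonneg[of s]
    by (auto simp: adm_def pp_def d_def intro: order_trans[OF zero_le_one])
  note sF = cip_self[OF sob_nonneg bounds(1) wF] and sf = cip_self[OF sob_nonneg bounds(1) wf]
  have pF: "?F \<in> wsp pp" and pf: "?f \<in> wsp pp" using sF(2) sf(2) by (simp_all add: wsp_def)
  have split: "cip pn c c' = cip pp c c' + of_real a0 * cip d c c'"
    if "c \<in> wsp (sob s)" "c' \<in> wsp (sob s)" "\<And>m. \<not> int k dvd fst m \<Longrightarrow> c m = 0" for c c'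
  proof -
    have "cip pn c c' = cip (\<lambda>m. pp m + a0 * d m) c c'"
      unfolding cip_def
    proof (rule infsum_cong)
      fix m
      have "pn m = pp m + a0 * d m" if "int k dvd fst m"
      proof (cases "fst m = 0 \<and> \<bar>snd m\<bar> = int n")
        case True
        then have "m = (0, int n) \<or> m = (0, - int n)" by (auto simp: prod_eq_iff)
        then have "asym k m = a0" using asym_neg(2)[of k 0 "int n"] by (auto simp: a0_def)
        then show ?thesis using True by (simp add: pn_def pp_def d_def)
      qed (use that in \<open>auto simp: pn_def pp_def d_def\<close>)
      then show "of_real (pn m) * (c m * cnj (c' m)) = of_real (pp m + a0 * d m) * (c m * cnj (c' m))"
        using that(3)[of m] by (cases "int k dvd fst m") auto
    qed
    also have "\<dots> = cip pp c c' + of_real a0 * cip d c c'"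
      by (rule cip_weights[OF sob_nonneg bounds that(1,2)])
    finally show ?thesis .
  qed
  have dsum: "cip d c c' = c (0, int n) * cnj (c' (0, int n)) + c (0, - int n) * cnj (c' (0, - int n))" for c c'
  proof -
    have "cip d c c' = (\<Sum>\<^sub>\<infinity>m\<in>{(0, int n), (0, - int n)}. of_real (d m) * (c m * cnj (c' m)))"
      unfolding cip_def by (rule infsum_cong_neutral) (auto simp: d_def prod_eq_iff)
    then show ?thesis using n by (simp add: d_def)
  qed
  have F_sym: "?F (0, - int n) = ?F (0, int n)" using sym_coords(6)[OF us] .
  have F_supp: "\<not> int k dvd fst m \<Longrightarrow> ?F m = 0" and f_supp: "\<not> int k dvd fst m \<Longrightarrow> ?f m = 0" for m
    using us vec_sym[OF n, of 1] unfolding sym_def by blast+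
  have f0: "?f (0, int n) = of_real (ph n 0)" "?f (0, - int n) = of_real (ph n 0)" by (simp_all add: vec_def)
  have asym_pn: "cip (asym k) c ?f = cip pn c ?f" for c
    unfolding cip_def by (rule infsum_cong) (simp add: pn_def vec_def)
  define x where "x = (cmod (?F (0, int n)))\<^sup>2"
  define y where "y = (ph n 0)\<^sup>2"
  define P where "P = Re (cip pp ?F ?F)"
  have y: "y > 0" using ph_0[OF n] by (simp add: y_def)
  \<comment> \<open>Both functionals vanish, so the A-part and the B-part of the pairing with the
    mode vanish separately.\<close>
  have "energy k u (vec n \<sigma>) = 0" if "\<sigma> \<in> {1, - 1}" for \<sigma>
    using th[of "(n, - \<sigma>)"] that n el_pos[OF n] by (auto simp: idx_def th_def)
  from this[of 1] this[of "- 1"] have "cip (asym k) ?F ?f = 0"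
    by (simp add: energy_vec[OF n] add_eq_0_iff)
  then have Ff: "cip pp ?F ?f = of_real (- 2 * a0 * ph n 0) * ?F (0, int n)"
    using split[OF wF wf F_supp] by (simp add: asym_pn dsum F_sym f0 eq_neg_iff_add_eq_0 algebra_simps)
  have "- of_real (el n) = cip pp ?f ?f + of_real (2 * a0 * y)"
    using cip_asym_vec[OF n] split[OF wf wf f_supp]
    by (simp add: asym_pn dsum f0 y_def power2_eq_square algebra_simps)
  from arg_cong[OF this, of Re] have ff: "Re (cip pp ?f ?f) = - 2 * a0 * y - el n" by simp
  have P0: "P \<ge> 0" unfolding P_def cip_wn[OF pp0 pF] by simp
  have "(cmod (cip pp ?F ?f))\<^sup>2 \<le> (1 * wn pp ?F * wn pp ?f)\<^sup>2"
    by (intro power_mono cip_bound[OF pp0 _ pF pf]) (use pp0 in auto)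
  also have "\<dots> = P * (- 2 * a0 * y - el n)"
    unfolding ff[symmetric] P_def cip_wn[OF pp0 pF] cip_wn[OF pp0 pf] by (simp add: power_mult_distrib)
  finally have "4 * a0\<^sup>2 * x * y \<le> P * (- 2 * a0 * y - el n)"
    unfolding Ff x_def y_def by (simp add: norm_mult power_mult_distrib mult_ac)
  \<comment> \<open>The inequality is used twice: dropping \<open>P * e\<close> bounds
    \<open>P\<close> from below, and this bound inserted into \<open>P * e\<close> yields the extra
    term \<open>x * e / y\<close>, which makes the final estimate quantitative.\<close>
  moreover have "2 * (- a0) * x + x * e / y \<le> P" if "4 * a0\<^sup>2 * x * y \<le> P * (- 2 * a0 * y - e)" "e > 0" for e
  proof -
    let ?A = "2 * (- a0)"
    have A: "?A > 0" using a0 by simp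
    have 1: "?A * ?A * x * y + P * e \<le> P * (?A * y)"
      using that(1) by (simp add: power2_eq_square algebra_simps)
    have "?A * x * (?A * y) = ?A * ?A * x * y" by (simp only: mult_ac)
    then have "?A * x * (?A * y) \<le> P * (?A * y)"
      using 1 mult_nonneg_nonneg[OF P0 less_imp_le[OF that(2)]] by linarith
    then have 2: "?A * x \<le> P" by (rule mult_right_le_imp_le) (rule mult_pos_pos[OF A y])
    then have "?A * x * e \<le> P * e" using that(2) by (intro mult_right_mono) auto
    then have "(?A * x + x * e / y) * (?A * y) \<le> P * (?A * y)"
    proof -
      have "(?A * x + x * e / y) * (?A * y) = ?A * ?A * x * y + ?A * x * e"
        using y by (simp add: field_simps)
      then show ?thesis using 1 \<open>?A * x * e \<le> P * e\<close> by linarith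
    qed
    then show ?thesis by (rule mult_right_le_imp_le) (rule mult_pos_pos[OF A y])
  qed
  ultimately have main: "- 2 * a0 * x + x * el n / y \<le> P" using el_pos[OF n] by simp
  have "Re (cip pn ?F ?F) = P + a0 * (2 * x)"
    using split[OF wF wF F_supp] unfolding dsum F_sym P_def x_def
    by (simp add: complex_mult_cnj cmod_power2)
  then have "el n / (2 * y) * (2 * x) \<le> Re (cip pn ?F ?F)" using main by (simp add: field_simps)
  moreover have "Re (cip d ?F ?F) = 2 * x"
    unfolding dsum F_sym x_def by (simp add: complex_mult_cnj cmod_power2)
  moreover have "(\<lambda>m. if \<bar>snd m\<bar> = int n then chi0 k m else 0) = d"
    using n by (auto simp: fun_eq_iff chi0_def d_def)
  ultimately show ?thesis unfolding y_def pn_def by simp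
qed

text \<open>The line m2 = 0 has to be left out: A is negative at frequency zero, and no mode
  compensates for it. The cut respects conservation because the operator preserves m2.\<close>

definition qE :: "int \<times> int \<Rightarrow> real" where
  "qE m = (if 0 < \<bar>snd m\<bar> \<and> \<bar>snd m\<bar> < int k then bsym k m else 0)"

definition pE :: "int \<times> int \<Rightarrow> real" where
  "pE m = (if 0 < \<bar>snd m\<bar> \<and> \<bar>snd m\<bar> < int k then asym k m else 0)"

lemma adm_E: "adm s qE pE (2 * (1 + (real k)\<^sup>2))"
proof -
  have "0 \<le> 2 * (1 + (real k)\<^sup>2) * sob \<sigma> m" for \<sigma> m by (simp add: sob_def)
  then show ?thesis using adm_energy[OF s, of k] by (simp add: adm_def qE_def pE_def)
qed

lemma form_E_L: "u \<in> Xall s \<Longrightarrow> form qE pE (L_op k u) u = 0"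
proof -
  assume u: "u \<in> Xall s"
  have "cross k qE pE u e = (\<lambda>m. 0)" for e by (auto simp: cross_def fun_eq_iff qE_def pE_def)
  then show ?thesis unfolding form_L[OF adm_E u] by simp
qed

lemma cip_lines:
  assumes p: "\<forall>m. \<bar>p m\<bar> \<le> K * sob s m" and c: "c \<in> wsp (sob s)"
    and p0: "\<And>m. p m \<noteq> 0 \<Longrightarrow> 0 < \<bar>snd m\<bar> \<and> \<bar>snd m\<bar> < int k"
  shows "cip p c c = (\<Sum>n\<in>{1..<k}. cip (\<lambda>m. if \<bar>snd m\<bar> = int n then p m else 0) c c)"
proof -
  let ?p = "\<lambda>n m. if \<bar>snd m\<bar> = int n then p m else 0"
  have pn: "\<forall>m. \<bar>?p n m\<bar> \<le> K * sob s m" for n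
  proof
    fix m
    have "0 \<le> K * sob s m" using p order_trans[OF abs_ge_zero] by blast
    then show "\<bar>?p n m\<bar> \<le> K * sob s m" using p[rule_format, of m] by simp
  qed
  have "p m = (\<Sum>n\<in>{1..<k}. ?p n m)" for m
  proof (cases "0 < \<bar>snd m\<bar> \<and> \<bar>snd m\<bar> < int k")
    case True
    have "(\<Sum>n\<in>{1..<k}. ?p n m) = (\<Sum>n\<in>{1..<k}. if n = nat \<bar>snd m\<bar> then p m else 0)"
      by (intro sum.cong) auto
    moreover have "nat \<bar>snd m\<bar> \<in> {1..<k}" using True by auto
    ultimately show ?thesis by simp
  next
    case False
    then have "p m = 0" using p0[of m] by blast
    then show ?thesis by (simp cong: if_cong)
  qed
  then have "cip p c c = (\<Sum>\<^sub>\<infinity>m. \<Sum>n\<in>{1..<k}. of_real (?p n m) * (c m * cnj (c m)))"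
    unfolding cip_def by (intro infsum_cong) (simp flip: sum_distrib_right of_real_sum)
  also have "\<dots> = (\<Sum>n\<in>{1..<k}. cip (?p n) c c)"
    unfolding cip_def
    by (intro infsumI has_sum_finite_sum has_sum_infsum cip_summable[OF sob_nonneg pn c c])
  finally show ?thesis .
qed

text \<open>The F-part comes line by line from \<open>line_energy_pos\<close>, the \<omega>-part
  from the positivity of B.\<close>

lemma energy_pos:
  "\<exists>c>0. \<forall>u\<in>Xsym s k. (\<forall>i\<in>idx. th i u = 0) \<longrightarrow> c * form (chi1 k) (chi0 k) u u \<le> form qE pE u u"
proof -
  let ?r = "\<lambda>n. el n / (2 * (ph n 0)\<^sup>2)"
  \<comment> \<open>\<open>1 / 2\<close> bounds \<open>bsym\<close> from below at the frequencies
    marked by \<open>chi1\<close>, and inserting it keeps the set nonempty.\<close>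
  define c where "c = Min (insert (1 / 2) (?r ` {1..<k}))"
  have r: "?r n > 0" if "n \<in> {1..<k}" for n using el_pos[OF that] ph_0[OF that] by simp
  have c: "c > 0" unfolding c_def using r by (subst Min_gr_iff) auto
  have c_le: "c \<le> x" if "x \<in> insert (1 / 2) (?r ` {1..<k})" for x
    unfolding c_def by (rule Min_le[OF _ that]) simp
  have "c * form (chi1 k) (chi0 k) u u \<le> form qE pE u u"
    if u: "u \<in> Xsym s k" and th: "\<forall>i\<in>idx. th i u = 0" for u
  proof -
    have ua: "u \<in> Xall s" using u Xsym_iff[OF k] by auto
    have wF: "snd u \<in> wsp (sob s)" and w\<omega>: "fst u \<in> wsp (sob (s - 1))" using XallD[OF ua] by auto
    have ad: "\<forall>m. \<bar>pE m\<bar> \<le> (2 * (1 + (real k)\<^sup>2)) * sob s m" "\<forall>m. \<bar>chi0 k m\<bar> \<le> (1 + 2 * (real k)\<^sup>2) * sob s m"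
      "\<forall>m. \<bar>qE m\<bar> \<le> (2 * (1 + (real k)\<^sup>2)) * sob (s - 1) m" "\<forall>m. \<bar>chi1 k m\<bar> \<le> (1 + 2 * (real k)\<^sup>2) * sob (s - 1) m"
      using adm_E adm_chi[OF s, of k] by (auto simp: adm_def)
    let ?l = "\<lambda>p n m. if \<bar>snd m\<bar> = int n then p m else 0 :: real"
    have "c * Re (cip (chi0 k) (snd u) (snd u)) = (\<Sum>n\<in>{1..<k}. c * Re (cip (?l (chi0 k) n) (snd u) (snd u)))"
      by (subst cip_lines[OF ad(2) wF]) (auto simp: chi0_def sum_distrib_left split: if_splits)
    also have "\<dots> \<le> (\<Sum>n\<in>{1..<k}. Re (cip (?l pE n) (snd u) (snd u)))"
    proof (rule sum_mono)
      fix n assume n: "n \<in> {1..<k}"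
      have nn: "Re (cip (?l (chi0 k) n) (snd u) (snd u)) \<ge> 0"
      proof -
        have "\<forall>m. \<bar>?l (chi0 k) n m\<bar> \<le> (1 + 2 * (real k)\<^sup>2) * sob s m"
          using ad(2) sob_nonneg[of s] by (auto intro!: mult_nonneg_nonneg)
        then show ?thesis using cip_self(1)[OF sob_nonneg _ wF] by (auto intro!: infsum_nonneg simp: chi0_def)
      qed
      have "c * Re (cip (?l (chi0 k) n) (snd u) (snd u)) \<le> ?r n * Re (cip (?l (chi0 k) n) (snd u) (snd u))"
        using c_le[of "?r n"] n nn by (intro mult_right_mono) auto
      also have "\<dots> \<le> Re (cip (?l (asym k) n) (snd u) (snd u))" using line_energy_pos[OF n u] th by blast
      also have "?l (asym k) n = ?l pE n" using n by (auto simp: pE_def fun_eq_iff)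
      finally show "c * Re (cip (?l (chi0 k) n) (snd u) (snd u)) \<le> Re (cip (?l pE n) (snd u) (snd u))" .
    qed
    also have "\<dots> = Re (cip pE (snd u) (snd u))"
      by (subst cip_lines[OF ad(1) wF]) (auto simp: pE_def split: if_splits)
    finally have 1: "c * Re (cip (chi0 k) (snd u) (snd u)) \<le> Re (cip pE (snd u) (snd u))" .
    note s1 = cip_self[OF sob_nonneg ad(4) w\<omega>] and s2 = cip_self[OF sob_nonneg ad(3) w\<omega>]
    have "c * Re (cip (chi1 k) (fst u) (fst u)) = (\<Sum>\<^sub>\<infinity>m. c * (chi1 k m * (cmod (fst u m))\<^sup>2))"
      unfolding s1(1) by (simp add: infsum_cmult_right')
    also have "\<dots> \<le> (\<Sum>\<^sub>\<infinity>m. qE m * (cmod (fst u m))\<^sup>2)"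
    proof (rule infsum_mono)
      fix m
      have "c * chi1 k m \<le> qE m"
      proof (cases "chi1 k m = 0")
        case False
        then have h: "\<bar>fst m\<bar> = int k" "0 < \<bar>snd m\<bar>" "\<bar>snd m\<bar> < int k" by (auto simp: chi1_def split: if_splits)
        then have "\<bar>real_of_int (fst m)\<bar> \<le> real k" "\<bar>real_of_int (snd m)\<bar> \<le> real k" "1 \<le> \<bar>real_of_int (snd m)\<bar>" by linarith+
        then have "(real_of_int (fst m))\<^sup>2 \<le> (real k)\<^sup>2" "(real_of_int (snd m))\<^sup>2 \<le> (real k)\<^sup>2" "1 \<le> (real_of_int (snd m))\<^sup>2"
          by (metis abs_of_nat abs_le_square_iff abs_one one_power2)+
        then have "msq m \<le> 2 * (real k)\<^sup>2" "msq m > 0"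
          using zero_le_power2[of "real_of_int (fst m)"] unfolding msq_def by linarith+
        then have "1 / 2 \<le> bsym k m" by (simp add: bsym_def le_divide_eq)
        then show ?thesis using c_le[of "1 / 2"] h by (simp add: chi1_def qE_def)
      qed (simp add: qE_def bsym_nonneg)
      then have "c * chi1 k m * (cmod (fst u m))\<^sup>2 \<le> qE m * (cmod (fst u m))\<^sup>2" by (intro mult_right_mono) auto
      then show "c * (chi1 k m * (cmod (fst u m))\<^sup>2) \<le> qE m * (cmod (fst u m))\<^sup>2" by (simp only: mult.assoc)
    qed (intro summable_on_cmult_right s1(2) s2(2))+
    also have "\<dots> = Re (cip qE (fst u) (fst u))" unfolding s2(1) by simp
    finally show ?thesis using 1 by (simp add: form_def distrib_left)
  qed
  with c show ?thesis by blast
qed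

text \<open>Stated for a general \<open>V\<close> so as to serve the complement of the modes both in
  the symmetry class and in a single block. The functionals of all modes must vanish on it for the
  energy to control \<open>chi0\<close> and \<open>chi1\<close>.\<close>

lemma slow_part:
  assumes V: "V \<subseteq> Xsym s k" and th: "\<And>u i. u \<in> V \<Longrightarrow> i \<in> idx \<Longrightarrow> th i u = 0"
    and op: "operator V (Xnorm s) (L_op k)" and \<epsilon>: "\<epsilon> > 0"
  shows "\<And>z. Re z > \<epsilon> \<Longrightarrow> regular (Xnorm s) V (L_op k) z"
    and "\<exists>C\<ge>0. \<forall>t\<ge>0. \<forall>u\<in>V. Xnorm s (op_exp (Xnorm s) V (L_op k) t u) \<le> C * Xnorm s u * exp (\<epsilon> * t)"
proof -
  obtain q p K \<kappa> C where adm: "adm s q p K" and \<kappa>: "\<kappa> > 0" and C: "C \<ge> 0"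
    and pl: "\<forall>m. \<kappa> * sob s m \<le> p m" and ql: "\<forall>m. msq m \<noteq> 0 \<longrightarrow> \<kappa> * sob (s - 1) m \<le> q m"
    and diss: "\<forall>u\<in>Xsym s k. form q p (L_op k u) u \<le> \<epsilon> * form q p u u + C * form (chi1 k) (chi0 k) u u"
    using dissipation_weights[OF k s \<epsilon>] by blast
  obtain c where c: "c > 0"
    and pos: "\<forall>u\<in>Xsym s k. (\<forall>i\<in>idx. th i u = 0) \<longrightarrow> c * form (chi1 k) (chi0 k) u u \<le> form qE pE u u"
    using energy_pos by blast
  \<comment> \<open>Then \<open>C = \<epsilon> * M * c\<close>, so the error is at most
    \<open>\<epsilon> * M\<close> times the energy, and the added energy, being conserved, leaves
    the left-hand side unchanged.\<close>
  define M where "M = C / (c * \<epsilon>)"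
  have M: "M \<ge> 0" using C c \<epsilon> by (simp add: M_def)
  define q' where "q' m = q m + M * qE m" for m
  define p' where "p' m = p m + M * pE m" for m
  have adm': "adm s q' p' (K + \<bar>M\<bar> * (2 * (1 + (real k)\<^sup>2)))"
    unfolding q'_def p'_def by (rule adm_weights[OF adm adm_E])
  have Va: "u \<in> Xall s" if "u \<in> V" for u using Xsym_iff[OF k, of u s] that V by blast
  have LV: "L_op k u \<in> V" if "u \<in> V" for u using op that by (simp add: operator_def operator_axioms_def bounded_op_def)
  have fw: "form q' p' u v = form q p u v + M * form qE pE u v" if "u \<in> V" "v \<in> V" for u v
    unfolding q'_def p'_def by (rule form_weights[OF adm adm_E]) (use that Va in auto)
  have chi_nn: "0 \<le> form (chi1 k) (chi0 k) u u" if "u \<in> V" for u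
    unfolding form_self(1)[OF adm_chi[OF s] Va[OF that]]
    by (intro add_nonneg_nonneg infsum_nonneg) (auto simp: chi0_def chi1_def)
  have E: "c * form (chi1 k) (chi0 k) u u \<le> form qE pE u u" if "u \<in> V" for u
    using pos th[OF that] V that by blast
  have E_nn: "0 \<le> form qE pE u u" if "u \<in> V" for u
    using E[OF that] mult_nonneg_nonneg[OF less_imp_le[OF c] chi_nn[OF that]] by linarith
  have "dissipative V (Xnorm s) (L_op k) (form q' p') \<kappa> (K + \<bar>M\<bar> * (2 * (1 + (real k)\<^sup>2))) \<epsilon>"
  proof (intro dissipative.intro op dissipative_axioms.intro)
    fix u assume u: "u \<in> V"
    have "\<kappa> * (Xnorm s u)\<^sup>2 \<le> form q p u u"
    proof (rule form_ge[OF adm Va[OF u]])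
      fix m assume "fst u m \<noteq> 0"
      moreover have "fst u (0, 0) = 0" using u V Xsym_iff[OF k, of u s] unfolding sym_def by blast
      ultimately have "msq m \<noteq> 0" by (auto simp: msq_def add_nonneg_eq_0_iff prod_eq_iff) (metis prod.collapse)
      then show "\<kappa> * sob (s - 1) m \<le> q m" using ql by blast
    qed (use pl in blast)
    then show "\<kappa> * (Xnorm s u)\<^sup>2 \<le> form q' p' u u"
      using fw[OF u u] mult_nonneg_nonneg[OF M E_nn[OF u]] by linarith
    show "form q' p' u u \<le> (K + \<bar>M\<bar> * (2 * (1 + (real k)\<^sup>2))) * (Xnorm s u)\<^sup>2"
      by (rule form_le[OF adm' Va[OF u]])
    have "form q' p' (L_op k u) u = form q p (L_op k u) u"
      using fw[OF LV[OF u] u] form_E_L[OF Va[OF u]] by simp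
    also have "\<dots> \<le> \<epsilon> * form q p u u + C * form (chi1 k) (chi0 k) u u" using diss u V by blast
    also have "C * form (chi1 k) (chi0 k) u u = \<epsilon> * M * (c * form (chi1 k) (chi0 k) u u)"
      using c \<epsilon> by (simp add: M_def)
    also have "\<dots> \<le> \<epsilon> * M * form qE pE u u" using E[OF u] M \<epsilon> by (intro mult_left_mono) auto
    finally show "form q' p' (L_op k u) u \<le> \<epsilon> * form q' p' u u"
      unfolding fw[OF u u] by (simp add: distrib_left mult.assoc)
  next
    fix u v w assume "u \<in> V" "v \<in> V" "w \<in> V"
    then show "form q' p' (u + v) w = form q' p' u w + form q' p' v w" by (intro form_add[OF adm'] Va)
  qed (use \<kappa> in \<open>auto simp: form_scale form_i intro: form_commute\<close>)
  then interpret dissipative V "Xnorm s" "L_op k" "form q' p'" \<kappa> "K + \<bar>M\<bar> * (2 * (1 + (real k)\<^sup>2))" \<epsilon> .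
  show "\<And>z. Re z > \<epsilon> \<Longrightarrow> regular (Xnorm s) V (L_op k) z" by (rule regular_right_of)
  let ?C = "sqrt ((\<bar>K + \<bar>M\<bar> * (2 * (1 + (real k)\<^sup>2))\<bar> + 1) / \<kappa>)"
  have "?C \<ge> 0" using \<kappa> by simp
  then show "\<exists>C\<ge>0. \<forall>t\<ge>0. \<forall>u\<in>V. Xnorm s (op_exp (Xnorm s) V (L_op k) t u) \<le> C * Xnorm s u * exp (\<epsilon> * t)"
    using op_exp_dissipative by blast
qed

end

section \<open>Closed spans of cosines\<close>

definition cosines :: "nat set \<Rightarrow> dist1 set" where
  "cosines D = {fourier (\<lambda>x. cos (real d * x)) | d. d \<in> D}"

lemma cosines_span:
  assumes "v \<in> cspan (cosines D)"
  shows "v (- m) = v m" "nat \<bar>m\<bar> \<notin> D \<Longrightarrow> v m = 0"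
proof -
  have "v (- m) = v m \<and> (nat \<bar>m\<bar> \<notin> D \<longrightarrow> v m = 0)"
    using assms
  proof (induction rule: cvs.span_induct_alt)
    case (step c x y)
    then obtain d where d: "d \<in> D" "x = fourier (\<lambda>x. cos (real d * x))" by (auto simp: cosines_def)
    have "x (- m) = x m" unfolding d(2) fourier_cos by auto
    moreover have "nat \<bar>m\<bar> \<notin> D \<longrightarrow> x m = 0" unfolding d(2) fourier_cos using d(1) by auto
    ultimately show ?case using step by (simp add: scaleC_fun_def)
  qed simp
  then show "v (- m) = v m" "nat \<bar>m\<bar> \<notin> D \<Longrightarrow> v m = 0" by auto
qed

text \<open>Norm limits inherit evenness and support because coefficients are continuous.
  Conversely, truncations to low frequencies are finite cosine sums and converge.\<close>

lemma closed_span_cosines: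
  fixes w :: "int \<Rightarrow> real"
  assumes w: "\<forall>m. w m > 0"
  shows "c \<in> closed_span (wn w) (wsp w) (cosines D)
    \<longleftrightarrow> c \<in> wsp w \<and> (\<forall>m. c (- m) = c m) \<and> (\<forall>m. c m \<noteq> 0 \<longrightarrow> nat \<bar>m\<bar> \<in> D)"
proof
  have w0: "\<forall>m. w m \<ge> 0" using w by (simp add: less_imp_le)
  have span_wsp: "cspan (cosines D) \<subseteq> wsp w"
  proof (rule cvs.span_minimal[OF _ subspace_wsp[OF w0]])
    show "cosines D \<subseteq> wsp w"
    proof
      fix v assume "v \<in> cosines D"
      then obtain d where d: "v = fourier (\<lambda>x. cos (real d * x))" by (auto simp: cosines_def)
      have "(\<lambda>m. w m * (cmod (v m))\<^sup>2) summable_on {int d, - int d}" by simp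
      then have "(\<lambda>m. w m * (cmod (v m))\<^sup>2) summable_on UNIV"
        by (subst summable_on_cong_neutral[where T = "{int d, - int d}"]) (auto simp: d fourier_cos)
      then show "v \<in> wsp w" by (simp add: wsp_def)
    qed
  qed
  {
    assume c: "c \<in> closed_span (wn w) (wsp w) (cosines D)"
    then have cw: "c \<in> wsp w" by (simp add: closed_span_def)
    have ap: "\<exists>v\<in>cspan (cosines D). cmod (c m - v m) < e \<and> cmod (c (- m) - v (- m)) < e" if e: "e > 0" for e m
    proof -
      define \<delta> where "\<delta> = e * min (sqrt (w m)) (sqrt (w (- m)))"
      have \<delta>: "\<delta> > 0" using e w by (simp add: \<delta>_def)
      then obtain v where v: "v \<in> cspan (cosines D)" "wn w (c - v) < \<delta>" using c by (auto simp: closed_span_def)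
      interpret nspace "wsp w" "wn w" by (rule nspace_wsp[OF w])
      have cv: "c - v \<in> wsp w" using cw v(1) span_wsp by auto
      have "cmod ((c - v) i) < e" if "i \<in> {m, - m}" for i
      proof -
        have "cmod ((c - v) i) \<le> (1 / sqrt (w i)) * wn w (c - v)" by (rule coord_bound[OF w cv])
        also have "\<dots> < (1 / sqrt (w i)) * \<delta>" using v(2) w by (intro mult_strict_left_mono) auto
        also have "\<dots> \<le> (1 / sqrt (w i)) * (e * sqrt (w i))"
          unfolding \<delta>_def using e w[rule_format, of i] that by (intro mult_left_mono) auto
        also have "\<dots> = e" using w[rule_format, of i] by simp
        finally show ?thesis .
      qed
      then show ?thesis using v(1) by auto
    qed
    have "c (- m) = c m" for m
    proof (rule ccontr)
      assume ne: "c (- m) \<noteq> c m"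
      define e where "e = cmod (c (- m) - c m) / 2"
      have "e > 0" using ne by (simp add: e_def)
      then obtain v where v: "v \<in> cspan (cosines D)" "cmod (c m - v m) < e" "cmod (c (- m) - v (- m)) < e"
        using ap by blast
      have "c (- m) - c m = (c (- m) - v (- m)) - (c m - v m)" using cosines_span(1)[OF v(1), of m] by simp
      then have "cmod (c (- m) - c m) < e + e"
        using norm_triangle_ineq4[of "c (- m) - v (- m)" "c m - v m"] v(2,3) by simp
      then show False by (simp add: e_def)
    qed
    moreover have "nat \<bar>m\<bar> \<in> D" if ne: "c m \<noteq> 0" for m
    proof (rule ccontr)
      assume nd: "nat \<bar>m\<bar> \<notin> D"
      obtain v where v: "v \<in> cspan (cosines D)" "cmod (c m - v m) < cmod (c m)"
        using ap[of "cmod (c m)" m] ne by auto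
      then show False using cosines_span(2)[OF v(1) nd] by simp
    qed
    ultimately show "c \<in> wsp w \<and> (\<forall>m. c (- m) = c m) \<and> (\<forall>m. c m \<noteq> 0 \<longrightarrow> nat \<bar>m\<bar> \<in> D)" using cw by blast
  }
  assume c: "c \<in> wsp w \<and> (\<forall>m. c (- m) = c m) \<and> (\<forall>m. c m \<noteq> 0 \<longrightarrow> nat \<bar>m\<bar> \<in> D)"
  then have sm: "(\<lambda>m. w m * (cmod (c m))\<^sup>2) summable_on UNIV" by (simp add: wsp_def)
  have "\<exists>v\<in>cspan (cosines D). wn w (c - v) < e" if e: "e > 0" for e
  proof -
    have "e\<^sup>2 / 2 > 0" using e by simp
    from tendstoD[OF has_sum_infsum[OF sm, unfolded has_sum_def] this]
    have "\<exists>F. finite F \<and> F \<subseteq> UNIV \<and> (\<forall>G. finite G \<and> F \<subseteq> G \<and> G \<subseteq> UNIV \<longrightarrow>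
        dist (\<Sum>m\<in>G. w m * (cmod (c m))\<^sup>2) (\<Sum>\<^sub>\<infinity>m. w m * (cmod (c m))\<^sup>2) < e\<^sup>2 / 2)"
      unfolding eventually_finite_subsets_at_top .
    then obtain F where F: "finite F" "\<forall>G. finite G \<and> F \<subseteq> G \<and> G \<subseteq> UNIV \<longrightarrow>
        dist (\<Sum>m\<in>G. w m * (cmod (c m))\<^sup>2) (\<Sum>\<^sub>\<infinity>m. w m * (cmod (c m))\<^sup>2) < e\<^sup>2 / 2"
      by (elim exE conjE)
    define J where "J = Max (insert 0 ((\<lambda>m. nat \<bar>m\<bar>) ` F))"
    have J: "m \<in> F \<Longrightarrow> nat \<bar>m\<bar> \<le> J" for m unfolding J_def using F(1) by (intro Max_ge) auto
    define v where "v m = (if nat \<bar>m\<bar> \<le> J then c m else 0)" for m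
    \<comment> \<open>A cosine has coefficient 1 / 2 at \<open>d\<close> and \<open>- d\<close>, but
      1 when \<open>d = 0\<close>.\<close>
    have v_eq: "v = (\<Sum>d\<in>D \<inter> {..J}. (if d = 0 then c 0 else 2 * c (int d)) *\<^sub>C fourier (\<lambda>x. cos (real d * x)))" (is "v = ?s")
    proof
      fix m
      have "?s m = (\<Sum>d\<in>D \<inter> {..J}. (if d = nat \<bar>m\<bar> then c m else 0))"
        unfolding sum_apply
      proof (rule sum.cong)
        fix d
        have "c (int d) = c m" if "d = nat \<bar>m\<bar>" using c that by (cases "m \<ge> 0") auto
        then show "((if d = 0 then c 0 else 2 * c (int d)) *\<^sub>C fourier (\<lambda>x. cos (real d * x))) m = (if d = nat \<bar>m\<bar> then c m else 0)"
          by (auto simp: scaleC_fun_def scaleC_complex_def fourier_cos)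
      qed simp
      then show "v m = ?s m" using c by (auto simp: v_def)
    qed
    have vs: "v \<in> cspan (cosines D)"
      unfolding v_eq by (intro cvs.span_sum cvs.span_scale cvs.span_base) (auto simp: cosines_def)
    have "L2_set (wabs w (c - v)) G \<le> sqrt (e\<^sup>2 / 2)" if G: "finite G" for G
    proof -
      let ?G = "G - {m. nat \<bar>m\<bar> \<le> J}" and ?H = "{m. nat \<bar>m\<bar> \<le> J}"
      have H: "finite ?H"
      proof (rule finite_subset)
        show "?H \<subseteq> {- int J..int J}" by auto
      qed simp
      have "(\<Sum>m\<in>G. w m * (cmod ((c - v) m))\<^sup>2) = (\<Sum>m\<in>?G. w m * (cmod (c m))\<^sup>2)"
        using G by (intro sum.mono_neutral_cong_right) (auto simp: v_def)
      also have "\<dots> = (\<Sum>m\<in>?G \<union> ?H. w m * (cmod (c m))\<^sup>2) - (\<Sum>m\<in>?H. w m * (cmod (c m))\<^sup>2)"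
        using G H by (subst sum.union_disjoint) auto
      also have "\<dots> \<le> (\<Sum>\<^sub>\<infinity>m. w m * (cmod (c m))\<^sup>2) - (\<Sum>m\<in>?H. w m * (cmod (c m))\<^sup>2)"
        using G H w0 by (intro diff_right_mono finite_sum_le_infsum sm) auto
      also have "\<dots> \<le> e\<^sup>2 / 2"
      proof -
        have "F \<subseteq> ?H" using J by auto
        have "?H \<subseteq> UNIV" by simp
        with F(2) H \<open>F \<subseteq> ?H\<close> have "dist (\<Sum>m\<in>?H. w m * (cmod (c m))\<^sup>2) (\<Sum>\<^sub>\<infinity>m. w m * (cmod (c m))\<^sup>2) < e\<^sup>2 / 2" by blast
        then show ?thesis unfolding dist_real_def abs_less_iff by linarith
      qed
      finally show ?thesis unfolding sqrt_sum_wabs[OF w0] by simp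
    qed
    from wspI(2)[OF w0, of "c - v", OF this] have "wn w (c - v) \<le> sqrt (e\<^sup>2 / 2)" .
    also have "\<dots> < e" using e by (intro real_less_lsqrt) auto
    finally show ?thesis using vs by blast
  qed
  then show "c \<in> closed_span (wn w) (wsp w) (cosines D)" using c by (simp add: closed_span_def)
qed

section \<open>Cosine spans as even sequences supported on multiples of k\<close>

definition sob1 :: "real \<Rightarrow> int \<Rightarrow> real" where
  "sob1 \<sigma> m = (1 + (of_int m)\<^sup>2) powr \<sigma>"

lemma sob1_pos: "\<forall>m. sob1 \<sigma> m > 0"
proof
  fix m
  have "1 + (real_of_int m)\<^sup>2 > 0" by (simp add: add_pos_nonneg)
  then show "sob1 \<sigma> m > 0" unfolding sob1_def by (metis powr_gt_zero less_irrefl)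
qed

lemma sobolev1_wsp: "sobolev1 \<sigma> = wsp (sob1 \<sigma>)" "norm1 \<sigma> = wn (sob1 \<sigma>)"
  by (simp_all add: sobolev1_def norm1_def wsp_def wn_def sob1_def fun_eq_iff)

lemma L2_wsp: "L2 = wsp (\<lambda>_. 1)" "L2_norm = wn (\<lambda>_. 1)"
  by (simp_all add: L2_def L2_norm_def wsp_def wn_def fun_eq_iff)

lemma cos_even_cosines: "cos_even k = cosines {d. \<exists>j. d = 2 * j * k}"
  unfolding cos_even_def cosines_def by blast

lemma cos_odd_cosines: "cos_odd k = cosines {d. \<exists>j. d = (2 * j + 1) * k}"
  unfolding cos_odd_def cosines_def by blast

lemma even_multiple_iff: "(\<exists>j. nat \<bar>m\<bar> = 2 * j * k) \<longleftrightarrow> (\<exists>j. even j \<and> m = int k * j)"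
proof
  assume "\<exists>j. nat \<bar>m\<bar> = 2 * j * k"
  then obtain j where "nat \<bar>m\<bar> = 2 * j * k" ..
  then have "\<bar>m\<bar> = int k * (2 * int j)" by (metis mult.commute nat_0_le abs_ge_zero of_nat_mult of_nat_numeral)
  then have "m = int k * (2 * int j) \<or> m = int k * - (2 * int j)" by (auto simp: abs_if split: if_splits)
  then show "\<exists>j. even j \<and> m = int k * j" by (metis dvd_triv_left even_minus)
next
  assume "\<exists>j. even j \<and> m = int k * j"
  then obtain j where j: "even j" "m = int k * j" by blast
  then obtain i where "j = 2 * i" by (metis evenE)
  then have "nat \<bar>m\<bar> = 2 * nat \<bar>i\<bar> * k" using j(2) by (simp add: abs_mult nat_mult_distrib)
  then show "\<exists>j. nat \<bar>m\<bar> = 2 * j * k" ..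
qed

lemma odd_multiple_iff: "(\<exists>j. nat \<bar>m\<bar> = (2 * j + 1) * k) \<longleftrightarrow> (\<exists>j. odd j \<and> m = int k * j)"
proof
  assume "\<exists>j. nat \<bar>m\<bar> = (2 * j + 1) * k"
  then obtain j where j: "nat \<bar>m\<bar> = (2 * j + 1) * k" ..
  have "\<bar>m\<bar> = int (nat \<bar>m\<bar>)" by simp
  also have "\<dots> = int k * (2 * int j + 1)" unfolding j by (simp add: algebra_simps)
  finally have "\<bar>m\<bar> = int k * (2 * int j + 1)" .
  then have "m = int k * (2 * int j + 1) \<or> m = - (int k * (2 * int j + 1))" by arith
  then have "m = int k * (2 * int j + 1) \<or> m = int k * - (2 * int j + 1)" by (simp only: mult_minus_right)
  moreover have "odd (2 * int j + 1)" "odd (- (2 * int j + 1))" by simp_all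
  ultimately show "\<exists>j. odd j \<and> m = int k * j" by blast
next
  assume "\<exists>j. odd j \<and> m = int k * j"
  then obtain j where j: "odd j" "m = int k * j" by blast
  then have "odd (nat \<bar>j\<bar>)" by (simp add: even_nat_iff)
  then obtain i where i: "nat \<bar>j\<bar> = 2 * i + 1" by (metis oddE)
  have "nat \<bar>m\<bar> = nat \<bar>j\<bar> * k" using j(2) by (simp add: abs_mult nat_mult_distrib)
  then show "\<exists>j. nat \<bar>m\<bar> = (2 * j + 1) * k" unfolding i ..
qed

lemma closed_span_cos_even:
  "c \<in> closed_span (norm1 \<sigma>) (sobolev1 \<sigma>) (cos_even k) \<longleftrightarrow>
    c \<in> sobolev1 \<sigma> \<and> (\<forall>m. c (- m) = c m) \<and> (\<forall>m. c m \<noteq> 0 \<longrightarrow> (\<exists>j. even j \<and> m = int k * j))"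
  unfolding sobolev1_wsp cos_even_cosines closed_span_cosines[OF sob1_pos] mem_Collect_eq even_multiple_iff ..

lemma closed_span_cos_odd:
  "c \<in> closed_span (norm1 \<sigma>) (sobolev1 \<sigma>) (cos_odd k) \<longleftrightarrow>
    c \<in> sobolev1 \<sigma> \<and> (\<forall>m. c (- m) = c m) \<and> (\<forall>m. c m \<noteq> 0 \<longrightarrow> (\<exists>j. odd j \<and> m = int k * j))"
  unfolding sobolev1_wsp cos_odd_cosines closed_span_cosines[OF sob1_pos] mem_Collect_eq odd_multiple_iff ..

lemma L2_even_iff:
  "c \<in> L2_even k \<longleftrightarrow> c \<in> L2 \<and> (\<forall>m. c (- m) = c m) \<and> (\<forall>m. c m \<noteq> 0 \<longrightarrow> (\<exists>j. even j \<and> m = int k * j))"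
proof -
  have "\<forall>m::int. (1::real) > 0" by simp
  note cs = closed_span_cosines[OF this]
  show ?thesis
    unfolding L2_even_def L2_wsp cos_even_cosines cs mem_Collect_eq even_multiple_iff ..
qed

text \<open>On a fixed line the one-dimensional weight is at most \<open>K\<close> times the
  two-dimensional one; for negative \<open>\<sigma>\<close> this uses that 1 + m^2 + l^2 is at most
  the product of 1 + m^2 and 1 + l^2.\<close>

lemma sobolev1_line:
  assumes "(\<lambda>m1. u (m1, l)) = c" "u \<in> wsp (sob \<sigma>)"
  shows "c \<in> sobolev1 \<sigma>"
proof -
  define K where "K = (1 + (real_of_int l)\<^sup>2) powr \<bar>\<sigma>\<bar>"
  have K: "K \<ge> 0" by (simp add: K_def)
  have inj: "inj (\<lambda>m1::int. (m1, l))" by (auto simp: inj_on_def)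
  have l1: "1 + (real_of_int l)\<^sup>2 \<ge> 1" by simp
  have "sob1 \<sigma> m \<le> K * sob \<sigma> (m, l)" for m
  proof -
    have x: "1 + (real_of_int m)\<^sup>2 \<ge> 1" by simp
    have msq: "1 + msq (m, l) = 1 + (real_of_int m)\<^sup>2 + (real_of_int l)\<^sup>2" by (simp add: msq_def)
    show ?thesis
    proof (cases "\<sigma> \<ge> 0")
      case True
      have "sob1 \<sigma> m \<le> sob \<sigma> (m, l)" unfolding sob1_def sob_def msq using True x by (intro powr_mono2) auto
      also have "\<dots> \<le> K * sob \<sigma> (m, l)"
        using mult_right_mono[of 1 K "sob \<sigma> (m, l)"] l1 by (simp add: K_def sob_def ge_one_powr_ge_zero)
      finally show ?thesis .
    next
      case False
      have "1 + msq (m, l) \<le> (1 + (real_of_int m)\<^sup>2) * (1 + (real_of_int l)\<^sup>2)"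
        unfolding msq by (simp add: algebra_simps)
      then have "((1 + (real_of_int m)\<^sup>2) * (1 + (real_of_int l)\<^sup>2)) powr \<sigma> \<le> sob \<sigma> (m, l)"
        unfolding sob_def using False msq1_pos[of "(m, l)"] by (intro powr_mono2') auto
      then have "sob1 \<sigma> m * (1 + (real_of_int l)\<^sup>2) powr \<sigma> \<le> sob \<sigma> (m, l)"
        using x l1 by (simp add: sob1_def powr_mult)
      then have "K * (sob1 \<sigma> m * (1 + (real_of_int l)\<^sup>2) powr \<sigma>) \<le> K * sob \<sigma> (m, l)" using K by (rule mult_left_mono)
      moreover have "K * (1 + (real_of_int l)\<^sup>2) powr \<sigma> = 1"
      proof -
        have "1 + (real_of_int l)\<^sup>2 \<noteq> 0" using l1 by linarith
        then show ?thesis unfolding K_def using False by (simp flip: powr_add)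
      qed
      ultimately show ?thesis by (simp only: mult.left_commute[of K "sob1 \<sigma> m"] mult_1_right)
    qed
  qed
  have "(\<lambda>m. sob \<sigma> m * (cmod (u m))\<^sup>2) summable_on UNIV" using assms(2) by (simp add: wsp_def)
  from summable_on_subset_banach[OF this subset_UNIV]
  have "(\<lambda>m. sob \<sigma> m * (cmod (u m))\<^sup>2) summable_on range (\<lambda>m1. (m1, l))" .
  then have "((\<lambda>m. sob \<sigma> m * (cmod (u m))\<^sup>2) \<circ> (\<lambda>m1. (m1, l))) summable_on UNIV"
    by (simp only: summable_on_reindex[OF inj])
  moreover have "u (m, l) = c m" for m using fun_cong[OF assms(1), of m] by simp
  ultimately have s: "(\<lambda>m. sob \<sigma> (m, l) * (cmod (c m))\<^sup>2) summable_on UNIV"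
    by (simp add: o_def)
  have "(\<lambda>m. sob1 \<sigma> m * (cmod (c m))\<^sup>2) summable_on UNIV"
  proof (rule summable_on_comparison_test)
    show "(\<lambda>m. K * (sob \<sigma> (m, l) * (cmod (c m))\<^sup>2)) summable_on UNIV" by (rule summable_on_cmult_right[OF s])
    show "sob1 \<sigma> m * (cmod (c m))\<^sup>2 \<le> K * (sob \<sigma> (m, l) * (cmod (c m))\<^sup>2)" for m
      using mult_right_mono[OF \<open>sob1 \<sigma> m \<le> K * sob \<sigma> (m, l)\<close>, of "(cmod (c m))\<^sup>2"] by (simp add: mult.assoc)
  qed (simp add: sob1_def)
  then show ?thesis by (simp add: sobolev1_wsp wsp_def)
qed

context modes
begin

lemma vec_chain:
  assumes n: "n \<in> {1..<k}"
  shows "vec n 1 \<in> cosine_chain s' k n"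
proof -
  define h where "h m = of_real (2 * ps n m) * (1::complex)" for m
  define f where "f m = of_real (2 * ph n m) * (1::complex)" for m
  have "fst (vec n 1) = h \<otimes>\<^sub>D fourier (\<lambda>x. sin (real n * x))"
    using n by (auto simp: fun_eq_iff vec_def tensor_def fourier_sin h_def sgn_if)
  moreover have "snd (vec n 1) = f \<otimes>\<^sub>D fourier (\<lambda>x. cos (real n * x))"
    using n by (auto simp: fun_eq_iff vec_def tensor_def fourier_cos f_def)
  ultimately have eq: "vec n 1 = (h \<otimes>\<^sub>D fourier (\<lambda>x. sin (real n * x)), f \<otimes>\<^sub>D fourier (\<lambda>x. cos (real n * x)))"
    by (simp add: prod_eq_iff)
  have wv: "fst (vec n 1) \<in> wsp (sob (s' - 1))" "snd (vec n 1) \<in> wsp (sob s')"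
    using XallD[OF vec_Xall[OF n]] by auto
  have "(2 * \<i>) *\<^sub>C fst (vec n 1) \<in> wsp (sob (s' - 1))" "2 *\<^sub>C snd (vec n 1) \<in> wsp (sob s')"
    using wv wsp_scale(1)[OF sob_nonneg] by blast+
  moreover have "(\<lambda>m1. ((2 * \<i>) *\<^sub>C fst (vec n 1)) (m1, int n)) = h" "(\<lambda>m1. (2 *\<^sub>C snd (vec n 1)) (m1, int n)) = f"
    using n by (auto simp: fun_eq_iff vec_def h_def f_def scaleC_fun_def scaleC_complex_def sgn_if)
  ultimately have "h \<in> sobolev1 (s' - 1)" "f \<in> sobolev1 s'" using sobolev1_line by metis+
  moreover have "h (- m) = h m" "f (- m) = f m" for m using mode_even[OF n] by (simp_all add: h_def f_def)
  moreover have "h m \<noteq> 0 \<Longrightarrow> \<exists>j. odd j \<and> m = int k * j" "f m \<noteq> 0 \<Longrightarrow> \<exists>j. even j \<and> m = int k * j" for m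
    using ps_supp[OF n, of m] ph_supp[OF n, of m] by (auto simp: h_def f_def)
  ultimately have "h \<in> closed_span (norm1 (s' - 1)) (sobolev1 (s' - 1)) (cos_odd k)"
    "f \<in> closed_span (norm1 s') (sobolev1 s') (cos_even k)"
    unfolding closed_span_cos_odd closed_span_cos_even by blast+
  then show ?thesis unfolding cosine_chain_def using vec_block[OF n] eq by blast
qed

end

section \<open>The unstable spectrum\<close>

context eigen_splitting
begin

lemma splitting_rest:
  assumes J: "J \<subseteq> I"
  shows "eigen_splitting (rest J) N T (I - J) e \<mu> \<theta>"
proof -
  interpret R: operator "rest J" N T by (rule operator_rest[OF J])
  have sub: "rest J \<subseteq> V" by (auto simp: rest_iff)
  show ?thesis
  proof unfold_locales
    fix i assume i: "i \<in> I - J"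
    then show "e i \<in> rest J" using J e_V \<theta>_e[of _ i] by (auto simp: rest_iff subset_iff)
    show "T (e i) = \<mu> i *\<^sub>C e i" using i T_e by simp
    show "\<theta> i \<in> dual_space N (rest J)" using i \<theta>_dual dual_subset[OF _ sub] by simp
    show "\<theta> i (e j) = (if i = j then 1 else 0)" if "j \<in> I - J" for j using i that \<theta>_e by simp
    show "\<theta> i (T u) = \<mu> i * \<theta> i u" if "u \<in> rest J" for u using i that sub \<theta>_T by auto
  qed (use finite_I in simp)
qed

text \<open>\<open>rest J\<close> is the direct sum of \<open>rest I\<close> and the eigenvectors
  with index in \<open>I - J\<close>, so the splitting is applied once more inside
  \<open>rest J\<close>.\<close>

lemma regular_rest_from_full:
  assumes J: "J \<subseteq> I" and z: "z \<notin> \<mu> ` (I - J)" and reg: "regular N (rest I) T z"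
  shows "regular N (rest J) T z"
proof -
  interpret R: eigen_splitting "rest J" N T "I - J" e \<mu> \<theta> by (rule splitting_rest[OF J])
  have "u \<in> R.rest (I - J) \<longleftrightarrow> u \<in> rest I" for u using J unfolding R.rest_iff rest_iff by blast
  then have "R.rest (I - J) = rest I" by blast
  then show ?thesis using R.regular_from_rest[OF subset_refl z] reg by simp
qed

end

text \<open>The conclusion drawn from dissipativity in abstract form, shared by the whole symmetry
  class and by each single block.\<close>

locale stable_rest = eigen_splitting V N T I e \<mu> \<theta>
  for V :: "'a::complex_vs set" and N T and I :: "'i set" and e \<mu> \<theta> +
  assumes rest_regular: "Re z > 0 \<Longrightarrow> regular N (rest I) T z"
begin

lemma unstable_spectrum:
  assumes "Re z > 0"
  shows "z \<in> spectrum N V T \<longleftrightarrow> z \<in> \<mu> ` I"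
  using spectrum_splitting[OF subset_refl, of z] rest_regular[OF assms] by (simp add: spectrum_regular)

lemma spectrum_rest:
  assumes J: "J \<subseteq> I" and z: "z \<in> spectrum N (rest J) T" "Re z > 0"
  shows "z \<in> \<mu> ` (I - J)"
  using regular_rest_from_full[OF J _ rest_regular[OF z(2)]] z(1) by (auto simp: spectrum_regular)

context
  fixes z0 J assumes z0: "Re z0 > 0" "z0 \<in> \<mu> ` I"
  defines "J \<equiv> {i\<in>I. \<mu> i = z0}"
begin

lemma isolating_radius_ex: "\<exists>r. isolating_radius N V T z0 r"
proof -
  have fin: "finite (\<mu> ` I - {z0})" using finite_I by simp
  obtain d where d: "d > 0" "\<forall>x\<in>\<mu> ` I - {z0}. x \<noteq> z0 \<longrightarrow> d \<le> dist z0 x"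
    using finite_set_avoid[OF fin, of z0] by blast
  \<comment> \<open>The first bound isolates \<open>z0\<close> among the finitely many
    \<open>\<mu> i\<close>; the second keeps the disk in the half-plane where these are the whole
    spectrum.\<close>
  define r where "r = min d (Re z0) / 2"
  have r: "r > 0" "r < d" "r < Re z0" using d(1) z0(1) by (auto simp: r_def)
  have "spectrum N V T \<inter> cball z0 r = {z0}"
  proof (intro equalityI subsetI)
    fix z assume z: "z \<in> spectrum N V T \<inter> cball z0 r"
    then have "\<bar>Re (z0 - z)\<bar> \<le> r" using abs_Re_le_cmod[of "z0 - z"] by (simp add: dist_norm)
    then have "Re z > 0" using r(3) by simp
    then have "z \<in> \<mu> ` I" using z unstable_spectrum by blast
    then show "z \<in> {z0}" using z d(2) r(2) by force
  qed (use z0 unstable_spectrum r in auto)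
  then show ?thesis using r(1) by (auto simp: isolating_radius_def)
qed

lemma riesz_eq:
  assumes u: "u \<in> V"
  shows "riesz_projection N V T z0 u = part J u"
proof -
  obtain r where r: "isolating_radius N V T z0 r" using isolating_radius_ex by blast
  have "regular N (rest J) T z0"
    using regular_rest_from_full[OF _ _ rest_regular[OF z0(1)], of J] by (auto simp: J_def)
  from riesz_projection_eq[OF J_def[THEN meta_eq_to_obj_eq] this r u] show ?thesis .
qed

lemma riesz_image: "riesz_projection N V T z0 ` V = cspan (e ` J)"
proof -
  have "riesz_projection N V T z0 ` V = part J ` V" using riesz_eq by (intro image_cong) auto
  then show ?thesis using part_image[of J] by (simp add: J_def)
qed

lemma simple_iff: "algebraically_simple N V T z0 \<longleftrightarrow> card J = 1"
  using isolating_radius_ex cdim_span[of J] by (simp add: algebraically_simple_def riesz_image J_def)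

text \<open>Subtracting the projection from an eigenvector leaves a solution of the eigenvalue
  equation in \<open>rest J\<close>, where \<open>z0\<close> is regular; so the difference is
  0.\<close>

lemma eigenspace_eq: "eigenspace V T z0 = cspan (e ` J)"
proof
  have J: "J \<subseteq> I" by (auto simp: J_def)
  show "eigenspace V T z0 \<subseteq> cspan (e ` J)"
  proof
    fix u assume "u \<in> eigenspace V T z0"
    then have u: "u \<in> V" "T u = z0 *\<^sub>C u" by (auto simp: eigenspace_def)
    define v where "v = u - part J u"
    have "T (part J u) = (\<Sum>i\<in>J. z0 *\<^sub>C \<theta> i u *\<^sub>C e i)"
      unfolding T_part[OF J] by (intro sum.cong) (auto simp: J_def)
    then have "T (part J u) = z0 *\<^sub>C part J u" by (simp add: part_def cvs.scale_sum_right)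
    then have Tv: "T v = z0 *\<^sub>C v" using u J by (simp add: v_def T_diff cvs.scale_right_diff_distrib)
    interpret R: operator "rest J" N T by (rule operator_rest[OF J])
    have v: "v \<in> rest J" unfolding v_def using J u(1) by (rule diff_part_rest)
    have "regular N (rest J) T z0"
      using regular_rest_from_full[OF J _ rest_regular[OF z0(1)]] by (auto simp: J_def)
    then have "\<not> eigenvalue (rest J) T z0" using R.eigenvalue_not_regular by blast
    then have "v = 0" using v Tv by (auto simp: eigenvalue_def eigenspace_def)
    then have "u = part J u" by (simp add: v_def)
    then show "u \<in> cspan (e ` J)" using part_image[OF J] u(1) by blast
  qed
  show "cspan (e ` J) \<subseteq> eigenspace V T z0"
  proof (rule cvs.span_minimal)
    show "e ` J \<subseteq> eigenspace V T z0" using e_V T_e by (auto simp: J_def eigenspace_def)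
    show "cvs.subspace (eigenspace V T z0)"
      unfolding cvs.subspace_def eigenspace_def
      by (auto simp: T_0 T_add T_scale scaleC_add_right mult.commute scaleC_scaleC)
  qed
qed

end

end

section \<open>Unstable spectrum of the symmetry class and of its blocks\<close>

context modes
begin

lemma stable_rest_Xsym: "stable_rest (Xsym s k) (Xnorm s) (L_op k) idx (\<lambda>i. vec (fst i) (snd i)) mu th"
proof -
  interpret eigen_splitting "Xsym s k" "Xnorm s" "L_op k" idx "\<lambda>i. vec (fst i) (snd i)" mu th
    by (rule splitting_Xsym)
  show ?thesis
  proof
    fix z :: complex assume z: "Re z > 0"
    show "regular (Xnorm s) (rest idx) (L_op k) z"
      by (rule slow_part(1)[where \<epsilon> = "Re z / 2"])
        (use z operator_rest[OF subset_refl] in \<open>auto simp: rest_iff\<close>)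
  qed
qed

text \<open>Modes of the other blocks have disjoint Fourier support, so their functionals vanish on
  this block automatically and \<open>slow_part\<close> applies.\<close>

lemma stable_rest_block:
  assumes n: "n \<in> {1..<k}"
  shows "stable_rest (block s k n) (Xnorm s) (L_op k) ({n} \<times> {1, - 1}) (\<lambda>i. vec (fst i) (snd i)) mu th"
proof -
  interpret eigen_splitting "block s k n" "Xnorm s" "L_op k" "{n} \<times> {1, - 1}" "\<lambda>i. vec (fst i) (snd i)" mu th
    by (rule splitting_block[OF n])
  show ?thesis
  proof
    fix z :: complex assume z: "Re z > 0"
    show "regular (Xnorm s) (rest ({n} \<times> {1, - 1})) (L_op k) z"
    proof (rule slow_part(1)[where \<epsilon> = "Re z / 2"])
      show "th i u = 0" if "u \<in> rest ({n} \<times> {1, - 1})" "i \<in> idx" for u i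
        using that th_block[OF n, of u i] by (cases "fst i = n") (auto simp: rest_iff idx_def)
      show "rest ({n} \<times> {1, - 1}) \<subseteq> Xsym s k"
      proof
        fix u assume "u \<in> rest ({n} \<times> {1, - 1})"
        then have "u \<in> block s k n" using rest_iff by blast
        then show "u \<in> Xsym s k" by (simp add: block_def)
      qed
    qed (use z operator_rest[OF subset_refl] in auto)
  qed
qed

lemma unstable_mu:
  assumes "Re z > 0" and M: "M \<subseteq> {1..<k}"
  shows "z \<in> mu ` (M \<times> {1, - 1}) \<longleftrightarrow> z \<in> (\<lambda>n. of_real (lm n)) ` M"
proof
  assume "z \<in> mu ` (M \<times> {1, - 1})"
  then obtain i where i: "i \<in> M \<times> {1, - 1::real}" "z = mu i" by blast
  obtain n \<sigma> where n: "n \<in> M" "\<sigma> \<in> {1, - 1::real}" "z = of_real (\<sigma> * lm n)"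
    using i by (intro that[of "fst i" "snd i"]) (auto simp: mu_def)
  have "lm n > 0" using n(1) M lm_pos by blast
  then have "\<sigma> = 1" using n assms by auto
  then show "z \<in> (\<lambda>n. of_real (lm n)) ` M" using n by auto
qed (force simp: mu_def)

lemma block_spectrum:
  assumes n: "n \<in> {1..<k}" and z: "Re z > 0"
  shows "z \<in> spectrum (Xnorm s) (block s k n) (L_op k) \<longleftrightarrow> z = of_real (lm n)"
proof -
  interpret stable_rest "block s k n" "Xnorm s" "L_op k" "{n} \<times> {1, - 1}" "\<lambda>i. vec (fst i) (snd i)" mu th
    by (rule stable_rest_block[OF n])
  show ?thesis using unstable_spectrum[OF z] unstable_mu[OF z, of "{n}"] n by auto
qed

lemma vec_neq_0:
  assumes "n \<in> {1..<k}"
  shows "vec n \<sigma> \<noteq> 0"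
proof -
  have "snd (vec n \<sigma>) (0, int n) \<noteq> 0" using ph_0[OF assms] by (simp add: vec_def)
  then show ?thesis by auto
qed

text \<open>Existence is the mode itself; uniqueness is inherited from the spectrum of the larger
  block.\<close>

lemma chain_eigenvalues:
  assumes n: "n \<in> {1..<k}"
  shows "{x. x > 0 \<and> eigenvalue (cosine_chain s k n) (L_op k) (of_real x)} = {lm n}"
proof (intro equalityI subsetI)
  interpret operator "block s k n" "Xnorm s" "L_op k" using n by (intro operator_block[OF k]) auto
  fix x assume "x \<in> {x. x > 0 \<and> eigenvalue (cosine_chain s k n) (L_op k) (of_real x)}"
  then have x: "x > 0" "eigenvalue (cosine_chain s k n) (L_op k) (of_real x)" by auto
  have "cosine_chain s k n \<subseteq> block s k n" by (auto simp: cosine_chain_def)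
  then have "eigenvalue (block s k n) (L_op k) (of_real x)" using x(2)
    by (auto simp: eigenvalue_def eigenspace_def)
  then have "of_real x \<in> spectrum (Xnorm s) (block s k n) (L_op k)"
    using eigenvalue_not_regular by (simp add: spectrum_regular)
  then show "x \<in> {lm n}" using block_spectrum[OF n, of "of_real x"] x(1) by simp
next
  fix x assume x: "x \<in> {lm n}"
  have "vec n 1 \<in> eigenspace (cosine_chain s k n) (L_op k) (of_real (lm n))"
    using vec_chain[OF n] L_vec[OF n, of 1] by (simp add: eigenspace_def)
  then show "x \<in> {x. x > 0 \<and> eigenvalue (cosine_chain s k n) (L_op k) (of_real x)}"
    using x vec_neq_0[OF n] lm_pos[OF n] by (auto simp: eigenvalue_def)
qed

lemma lam_eq:
  assumes n: "n \<in> {1..<k}"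
  shows "lam k n = lm n"
  unfolding lam_def
proof (rule the_equality)
  have "{x. x > 0 \<and> eigenvalue (cosine_chain s' k n) (L_op k) (of_real x)} = {lm n}" if s': "s' \<ge> 0" for s'
  proof -
    interpret S: modes k s' lm ph ps using k s' mode by unfold_locales
    show ?thesis by (rule S.chain_eigenvalues[OF n])
  qed
  then show "\<forall>s'\<ge>0. {x. x > 0 \<and> eigenvalue (cosine_chain s' k n) (L_op k) (of_real x)} = {lm n}" by blast
next
  fix l assume "\<forall>s'\<ge>0. {x. x > 0 \<and> eigenvalue (cosine_chain s' k n) (L_op k) (of_real x)} = {l}"
  then have "{x. x > 0 \<and> eigenvalue (cosine_chain s k n) (L_op k) (of_real x)} = {l}" using s by blast
  then show "l = lm n" using chain_eigenvalues[OF n] by simp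
qed

lemma block_simple:
  assumes n: "n \<in> {1..<k}"
  shows "algebraically_simple (Xnorm s) (block s k n) (L_op k) (of_real (lam k n))"
    and block_eigenspace: "eigenspace (block s k n) (L_op k) (of_real (lam k n)) = cspan {vec n 1}"
proof -
  interpret stable_rest "block s k n" "Xnorm s" "L_op k" "{n} \<times> {1, - 1}" "\<lambda>i. vec (fst i) (snd i)" mu th
    by (rule stable_rest_block[OF n])
  have J: "{i \<in> {n} \<times> {1, - 1}. mu i = of_real (lam k n)} = {(n, 1)}"
    using lm_pos[OF n] by (auto simp: lam_eq[OF n] mu_def simp flip: of_real_mult of_real_minus)
  have z: "Re (of_real (lam k n)) > 0" "complex_of_real (lam k n) \<in> mu ` ({n} \<times> {1, - 1})"
    using lm_pos[OF n] by (auto simp: lam_eq[OF n] mu_def image_def)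
  show "algebraically_simple (Xnorm s) (block s k n) (L_op k) (of_real (lam k n))"
    unfolding simple_iff[OF z] J by simp
  show "eigenspace (block s k n) (L_op k) (of_real (lam k n)) = cspan {vec n 1}"
    unfolding eigenspace_eq[OF z] J by simp
qed

lemma Xsym_spectrum:
  "spectrum (Xnorm s) (Xsym s k) (L_op k) \<inter> {z. Re z > 0} = (\<lambda>n. complex_of_real (lam k n)) ` {1..<k}"
proof -
  interpret stable_rest "Xsym s k" "Xnorm s" "L_op k" idx "\<lambda>i. vec (fst i) (snd i)" mu th
    by (rule stable_rest_Xsym)
  have "(\<lambda>n. complex_of_real (lam k n)) ` {1..<k} = (\<lambda>n. of_real (lm n)) ` {1..<k}"
    using lam_eq by (intro image_cong) auto
  moreover have "Re z > 0" if "z \<in> (\<lambda>n. of_real (lm n)) ` {1..<k}" for z using that lm_pos by auto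
  ultimately show ?thesis
    using unstable_spectrum unstable_mu[of _ "{1..<k}"] by (auto simp: idx_def)
qed

end

section \<open>The leading rate\<close>

locale leading_modes = modes +
  assumes k2: "k \<ge> 2"
begin

sublocale stable_rest "Xsym s k" "Xnorm s" "L_op k" idx "\<lambda>i. vec (fst i) (snd i)" mu th
  by (rule stable_rest_Xsym)

definition leading :: "nat set" where
  "leading = {n \<in> {1..<k}. lam k n = Lam k}"

lemma lam_le_Lam: "n \<in> {1..<k} \<Longrightarrow> lam k n \<le> Lam k"
  unfolding Lam_def by (intro Max_ge) auto

lemma leading_ex: "\<exists>n. n \<in> leading"
proof -
  have "Lam k \<in> lam k ` {1..<k}" unfolding Lam_def using k2 by (intro Max_in) auto
  then show ?thesis by (auto simp: leading_def)
qed

lemma Lam_pos: "Lam k > 0"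
proof -
  obtain n where "n \<in> {1..<k}" "lam k n = Lam k" using leading_ex by (auto simp: leading_def)
  then show ?thesis using lm_pos[of n] lam_eq[of n] by simp
qed

lemma Lam2_less: "Lam2 k < Lam k"
  unfolding Lam2_def using Lam_pos by (subst Max_less_iff) auto

lemma lam_le_Lam2: "n \<in> {1..<k} \<Longrightarrow> n \<notin> leading \<Longrightarrow> lam k n \<le> Lam2 k"
  unfolding Lam2_def using lam_le_Lam[of n] by (intro Max_ge) (auto simp: leading_def)

lemma Lam2_nonneg: "Lam2 k \<ge> 0"
  unfolding Lam2_def by (intro Max_ge) auto

lemma leading_idx: "{i \<in> idx. mu i = of_real (Lam k)} = leading \<times> {1}"
proof -
  have *: "\<sigma> * lm n = Lam k \<longleftrightarrow> \<sigma> = 1 \<and> n \<in> leading" if "n \<in> {1..<k}" "\<sigma> = 1 \<or> \<sigma> = -1" for n \<sigma>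
    using that(2) lm_pos[OF that(1)] Lam_pos lam_eq[OF that(1)] that(1) by (auto simp: leading_def)
  show ?thesis
  proof (intro equalityI subsetI)
    fix i assume i: "i \<in> {i \<in> idx. mu i = of_real (Lam k)}"
    then have "fst i \<in> {1..<k}" "snd i = 1 \<or> snd i = - 1" by (auto simp: idx_def)
    moreover have "snd i * lm (fst i) = Lam k" using i by (simp add: mu_def del: of_real_mult)
    ultimately show "i \<in> leading \<times> {1}" using * by (cases i) auto
  next
    fix i assume i: "i \<in> leading \<times> {1::real}"
    then have "fst i \<in> {1..<k}" "snd i = 1" by (auto simp: leading_def)
    moreover from this have "snd i * lm (fst i) = Lam k" using *[of "fst i" "snd i"] i by auto
    ultimately show "i \<in> {i \<in> idx. mu i = of_real (Lam k)}"
      by (cases i) (simp add: mu_def idx_def del: of_real_mult)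
  qed
qed

lemma leading_subset: "leading \<times> {1} \<subseteq> idx"
  by (auto simp: idx_def leading_def)

lemma leading_value: "Re (complex_of_real (Lam k)) > 0" "complex_of_real (Lam k) \<in> mu ` idx"
proof -
  obtain n where "n \<in> leading" using leading_ex by blast
  then have "(n, 1) \<in> {i \<in> idx. mu i = of_real (Lam k)}" unfolding leading_idx by simp
  then show "complex_of_real (Lam k) \<in> mu ` idx" by force
qed (simp add: Lam_pos)

lemmas leading_isolating = isolating_radius_ex[OF leading_value]

lemma P_op_eq: "u \<in> Xsym s k \<Longrightarrow> P_op s k u = part (leading \<times> {1}) u"
  using riesz_eq[OF leading_value] unfolding leading_idx .

lemma leading_space_eq: "leading_space s k = cspan ((\<lambda>n. vec n 1) ` leading)"
proof -
  have "leading_space s k = cspan (\<Union>n\<in>leading. cspan {vec n 1})"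
    unfolding leading_space_def leading_def[symmetric]
    by (intro arg_cong[where f = cspan] SUP_cong block_eigenspace) (auto simp: leading_def)
  also have "\<dots> = cspan ((\<lambda>n. vec n 1) ` leading)"
  proof
    show "cspan (\<Union>n\<in>leading. cspan {vec n 1}) \<subseteq> cspan ((\<lambda>n. vec n 1) ` leading)"
      by (intro cvs.span_minimal UN_least cvs.subspace_span) (auto intro: cvs.span_base)
    show "cspan ((\<lambda>n. vec n 1) ` leading) \<subseteq> cspan (\<Union>n\<in>leading. cspan {vec n 1})"
      by (intro cvs.span_mono) (auto intro: cvs.span_base)
  qed
  finally show ?thesis .
qed

lemma leading_vecs: "(\<lambda>i. vec (fst i) (snd i)) ` (leading \<times> {1}) = (\<lambda>n. vec n 1) ` leading"
  by force

lemma P_op_image: "P_op s k ` Xsym s k = leading_space s k"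
  using riesz_image[OF leading_value] unfolding leading_idx leading_vecs leading_space_eq .

lemma cdim_leading_space: "cdim (leading_space s k) = card leading"
  using cdim_span[OF leading_subset] unfolding leading_vecs leading_space_eq by (simp add: card_cartesian_product)

lemma leading_space_eigenspace: "leading_space s k = eigenspace (Xsym s k) (L_op k) (of_real (Lam k))"
  using eigenspace_eq[OF leading_value] unfolding leading_idx leading_vecs leading_space_eq ..

lemma P_op_bounded: "bounded_op (Xnorm s) (Xsym s k) (P_op s k)"
proof -
  have "bounded_op (Xnorm s) (Xsym s k) (part (leading \<times> {1}))" by (rule part_bounded[OF leading_subset])
  then show ?thesis unfolding bounded_op_def linear_on_def by (simp add: P_op_eq)
qed

lemma diff_P_op_image: "(\<lambda>u. u - P_op s k u) ` Xsym s k = rest (leading \<times> {1})"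
proof -
  have "(\<lambda>u. u - P_op s k u) ` Xsym s k = (\<lambda>u. u - part (leading \<times> {1}) u) ` Xsym s k"
    by (intro image_cong) (simp_all add: P_op_eq)
  then show ?thesis using image_diff_part[OF leading_subset] by simp
qed

lemma mu_le_Lam2: "i \<in> idx - leading \<times> {1} \<Longrightarrow> Re (mu i) \<le> Lam2 k"
proof -
  assume i: "i \<in> idx - leading \<times> {1}"
  then have n: "fst i \<in> {1..<k}" and \<sigma>: "snd i = 1 \<and> fst i \<notin> leading \<or> snd i = - 1" by (auto simp: idx_def)
  show ?thesis using \<sigma> lam_le_Lam2[OF n] lm_pos[OF n] lam_eq[OF n] Lam2_nonneg by (auto simp: mu_def)
qed

lemma rest_spectrum:
  "spectrum (Xnorm s) ((\<lambda>u. u - P_op s k u) ` Xsym s k) (L_op k) \<subseteq> {z. Re z \<le> Lam2 k}"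
proof
  fix z assume "z \<in> spectrum (Xnorm s) ((\<lambda>u. u - P_op s k u) ` Xsym s k) (L_op k)"
  then have z: "z \<in> spectrum (Xnorm s) (rest (leading \<times> {1})) (L_op k)" unfolding diff_P_op_image .
  show "z \<in> {z. Re z \<le> Lam2 k}"
  proof (cases "Re z > 0")
    case True
    then show ?thesis using spectrum_rest[OF leading_subset z] mu_le_Lam2 by auto
  qed (use Lam2_nonneg in auto)
qed

text \<open>On the complement of all modes every positive rate is admissible, so
  \<open>\<beta>\<close> itself may be taken there; only the modes outside \<open>J\<close> restrict
  it.\<close>

lemma rest_growth:
  assumes J: "J \<subseteq> idx" and \<beta>: "\<beta> > 0" "\<And>i. i \<in> idx - J \<Longrightarrow> Re (mu i) \<le> \<beta>"
  shows "\<exists>C\<ge>0. \<forall>t\<ge>0. \<forall>u\<in>rest J. Xnorm s (op_exp (Xnorm s) (Xsym s k) (L_op k) t u) \<le> C * exp (\<beta> * t) * Xnorm s u"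
proof -
  have "\<exists>C\<ge>0. \<forall>t\<ge>0. \<forall>u\<in>rest idx. Xnorm s (op_exp (Xnorm s) (rest idx) (L_op k) t u) \<le> C * Xnorm s u * exp (\<beta> * t)"
    by (rule slow_part(2)[OF _ _ operator_rest[OF subset_refl] \<beta>(1)]) (auto simp: rest_iff)
  then obtain C where C: "C \<ge> 0" "\<forall>t\<ge>0. \<forall>u\<in>rest idx. Xnorm s (op_exp (Xnorm s) (rest idx) (L_op k) t u) \<le> C * Xnorm s u * exp (\<beta> * t)"
    by blast
  have "Xnorm s (op_exp (Xnorm s) (rest idx) (L_op k) t y) \<le> C * Xnorm s y * exp (\<beta> * t)" if "t \<ge> 0" "y \<in> rest idx" for t y
    using C(2) that by blast
  from op_exp_rest_growth[OF J this C(1) \<beta>(2)] show ?thesis by blast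
qed

text \<open>\<open>Lam2 k\<close> can be 0, whereas the slow part asks for a positive rate; this is
  the origin of \<open>\<eta>\<close>.\<close>

lemma gap_growth:
  assumes \<eta>: "\<eta> > 0"
  shows "\<exists>C. \<forall>t\<ge>0. \<forall>u\<in>Xsym s k. Xnorm s (op_exp (Xnorm s) (Xsym s k) (L_op k) t (u - P_op s k u))
    \<le> C * exp ((Lam2 k + \<eta>) * t) * Xnorm s u"
proof -
  have "Lam2 k + \<eta> > 0" using Lam2_nonneg \<eta> by simp
  moreover have "Re (mu i) \<le> Lam2 k + \<eta>" if "i \<in> idx - leading \<times> {1}" for i using mu_le_Lam2[OF that] \<eta> by simp
  ultimately obtain C where C: "C \<ge> 0" "\<forall>t\<ge>0. \<forall>u\<in>rest (leading \<times> {1}).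
      Xnorm s (op_exp (Xnorm s) (Xsym s k) (L_op k) t u) \<le> C * exp ((Lam2 k + \<eta>) * t) * Xnorm s u"
    using rest_growth[OF leading_subset] by blast
  obtain D where D: "\<forall>u\<in>Xsym s k. Xnorm s (P_op s k u) \<le> D * Xnorm s u"
    using P_op_bounded by (auto simp: bounded_op_def)
  show ?thesis
  proof (intro exI allI impI ballI)
    fix t :: real and u assume t: "t \<ge> 0" and u: "u \<in> Xsym s k"
    have P: "P_op s k u \<in> Xsym s k" using P_op_bounded u by (auto simp: bounded_op_def)
    have "u - P_op s k u \<in> rest (leading \<times> {1})" using u diff_P_op_image by blast
    then have "Xnorm s (op_exp (Xnorm s) (Xsym s k) (L_op k) t (u - P_op s k u))
        \<le> C * exp ((Lam2 k + \<eta>) * t) * Xnorm s (u - P_op s k u)" using C(2) t by blast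
    also have "\<dots> \<le> C * exp ((Lam2 k + \<eta>) * t) * ((1 + D) * Xnorm s u)"
      using N_diff[OF u P] D u C(1) by (intro mult_left_mono) (auto simp: algebra_simps)
    also have "\<dots> = C * (1 + D) * exp ((Lam2 k + \<eta>) * t) * Xnorm s u" by simp
    finally show "Xnorm s (op_exp (Xnorm s) (Xsym s k) (L_op k) t (u - P_op s k u))
        \<le> C * (1 + D) * exp ((Lam2 k + \<eta>) * t) * Xnorm s u" .
  qed
qed

lemma mu_le_Lam: "i \<in> idx \<Longrightarrow> Re (mu i) \<le> Lam k"
  using mu_le_Lam2[of i] Lam2_less lam_le_Lam[of "fst i"]
  by (cases "i \<in> leading \<times> {1}") (auto simp: mu_def leading_def lam_eq)

text \<open>As \<open>Lam k\<close> is positive, it can itself serve as the rate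
  \<open>\<beta>\<close> of the slow part, and the exponent suffers no loss.\<close>

lemma total_growth:
  "\<exists>C. \<forall>t\<ge>0. \<forall>u\<in>Xsym s k. Xnorm s (op_exp (Xnorm s) (Xsym s k) (L_op k) t u) \<le> C * exp (Lam k * t) * Xnorm s u"
proof -
  have "rest {} = Xsym s k" by (auto simp: rest_iff)
  then show ?thesis using rest_growth[of "{}" "Lam k"] Lam_pos mu_le_Lam by auto
qed

lemma leading_simple_iff:
  "algebraically_simple (Xnorm s) (Xsym s k) (L_op k) (of_real (Lam k)) \<longleftrightarrow> card leading = 1"
  using simple_iff[OF leading_value] unfolding leading_idx by (simp add: card_cartesian_product)

lemma eigenvalue_le_Lam:
  assumes "eigenvalue (Xsym s k) (L_op k) w"
  shows "Re w \<le> Lam k"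
proof (cases "Re w > 0")
  case True
  have "w \<in> spectrum (Xnorm s) (Xsym s k) (L_op k)"
    using eigenvalue_not_regular[OF assms] by (simp add: spectrum_regular)
  then have "w \<in> (\<lambda>n. complex_of_real (lam k n)) ` {1..<k}" using Xsym_spectrum True by blast
  then show ?thesis using lam_le_Lam by auto
qed (use Lam_pos in auto)

lemma real_states_iff:
  "u \<in> real_states \<longleftrightarrow> (\<forall>m1 m2. fst u (- m1, - m2) = cnj (fst u (m1, m2)) \<and> snd u (- m1, - m2) = cnj (snd u (m1, m2)))"
  by (cases u) (simp add: real_states_def)

text \<open>A complex multiple of the mode is real only for a real factor, since the coefficient
  \<open>ph n 0\<close> is real and nonzero.\<close>

lemma leading_space_real:
  assumes n: "leading = {n}"
  shows "rdim (leading_space s k \<inter> real_states) = 1"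
proof -
  interpret R: vector_space "\<lambda>r::real. scaleC (complex_of_real r) :: state \<Rightarrow> state"
    by (rule vector_space_scaleC_real)
  have nk: "n \<in> {1..<k}" using n by (auto simp: leading_def)
  have real: "c *\<^sub>C vec n 1 \<in> real_states \<longleftrightarrow> c \<in> \<real>" for c
  proof
    assume "c *\<^sub>C vec n 1 \<in> real_states"
    then have "snd (c *\<^sub>C vec n 1) (- 0, - int n) = cnj (snd (c *\<^sub>C vec n 1) (0, int n))"
      unfolding real_states_iff by blast
    then have "c * ph n 0 = cnj c * ph n 0" by (simp add: vec_def scaleC_prod_def scaleC_fun_def scaleC_complex_def)
    then show "c \<in> \<real>" using ph_0[OF nk] by (simp add: Reals_cnj_iff)
  next
    assume "c \<in> \<real>"
    then show "c *\<^sub>C vec n 1 \<in> real_states"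
      using nk by (auto elim!: Reals_cases simp: real_states_iff vec_def scaleC_prod_def scaleC_fun_def
          scaleC_complex_def mode_even[OF nk] sgn_minus)
  qed
  have "leading_space s k \<inter> real_states = R.span {vec n 1}"
  proof (intro equalityI subsetI)
    fix u assume u: "u \<in> leading_space s k \<inter> real_states"
    then obtain c where c: "u = c *\<^sub>C vec n 1" by (auto simp: leading_space_eq n cvs.span_singleton)
    then obtain r where "c = of_real r" using u real by (auto elim: Reals_cases)
    then show "u \<in> R.span {vec n 1}" using c by (auto simp: R.span_singleton)
  next
    fix u assume "u \<in> R.span {vec n 1}"
    then obtain r where "u = of_real r *\<^sub>C vec n 1" by (auto simp: R.span_singleton)
    then show "u \<in> leading_space s k \<inter> real_states" using real by (auto simp: leading_space_eq n cvs.span_singleton)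
  qed
  then show ?thesis using vec_neq_0[OF nk, of 1] R.dim_span_eq_card_independent[of "{vec n 1}"] by simp
qed

end

section \<open>Square roots of positive operators\<close>

locale inner_space = nspace V N for V :: "'a::complex_vs set" and N +
  fixes ip :: "'a \<Rightarrow> 'a \<Rightarrow> complex"
  assumes ip_add: "u \<in> V \<Longrightarrow> v \<in> V \<Longrightarrow> w \<in> V \<Longrightarrow> ip (u + v) w = ip u w + ip v w"
    and ip_scale: "u \<in> V \<Longrightarrow> w \<in> V \<Longrightarrow> ip (c *\<^sub>C u) w = c * ip u w"
    and ip_commute: "ip u w = cnj (ip w u)"
    and ip_self: "u \<in> V \<Longrightarrow> ip u u = of_real ((N u)\<^sup>2)"
    and ip_bound: "u \<in> V \<Longrightarrow> w \<in> V \<Longrightarrow> cmod (ip u w) \<le> N u * N w"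
begin

definition positive :: "('a \<Rightarrow> 'a) \<Rightarrow> bool" where
  "positive T \<longleftrightarrow> bounded_op N V T
     \<and> (\<forall>u\<in>V. \<forall>w\<in>V. ip (T u) w = ip u (T w)) \<and> (\<forall>u\<in>V. Re (ip (T u) u) \<ge> 0)"

lemma ip_add_right: "u \<in> V \<Longrightarrow> v \<in> V \<Longrightarrow> w \<in> V \<Longrightarrow> ip w (u + v) = ip w u + ip w v"
  using ip_add[of u v w] ip_commute[of w "u + v"] ip_commute[of w u] ip_commute[of w v] by simp

lemma ip_scale_right: "u \<in> V \<Longrightarrow> w \<in> V \<Longrightarrow> ip w (c *\<^sub>C u) = cnj c * ip w u"
  using ip_scale[of u w c] ip_commute[of w "c *\<^sub>C u"] ip_commute[of w u] by simp

lemma ip_diff: "u \<in> V \<Longrightarrow> v \<in> V \<Longrightarrow> w \<in> V \<Longrightarrow> ip (u - v) w = ip u w - ip v w"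
  using ip_add[of "u - v" v w] by simp

lemma ip_diff_right: "u \<in> V \<Longrightarrow> v \<in> V \<Longrightarrow> w \<in> V \<Longrightarrow> ip w (u - v) = ip w u - ip w v"
  using ip_add_right[of "u - v" v w] by simp

lemma ip_dual: "w \<in> V \<Longrightarrow> (\<lambda>u. ip u w) \<in> dual_space N V"
  using ip_bound[of _ w] by (auto simp: dual_space_def linear_on_def ip_add ip_scale scaleC_complex_def mult.commute
      intro!: exI[of _ "N w"])

text \<open>Positivity at \<open>y + t z\<close> with \<open>z = P y\<close> is a nonnegative
  quadratic polynomial in t without constant term, so its linear coefficient, twice the squared norm
  of \<open>z\<close>, vanishes.\<close>

lemma positive_null:
  assumes P: "positive P" and y: "y \<in> V" and 0: "Re (ip (P y) y) = 0"
  shows "P y = 0"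
proof -
  interpret operator V N P using P by unfold_locales (simp add: positive_def)
  have sa: "ip (P u) w = ip u (P w)" if "u \<in> V" "w \<in> V" for u w using P that by (simp add: positive_def)
  define z where "z = P y"
  have z: "z \<in> V" using y by (simp add: z_def)
  define a b where "a = (N z)\<^sup>2" and "b = Re (ip (P z) z)"
  have b: "b \<ge> 0" using P z unfolding b_def positive_def by blast
  have "0 \<le> 2 * t * a + t\<^sup>2 * b" for t
  proof -
    have "y + of_real t *\<^sub>C z \<in> V" using y z by simp
    then have "0 \<le> Re (ip (P (y + of_real t *\<^sub>C z)) (y + of_real t *\<^sub>C z))" using P unfolding positive_def by blast
    also have "ip (P (y + of_real t *\<^sub>C z)) (y + of_real t *\<^sub>C z)
        = ip (P y) y + of_real t * (ip (P z) y + ip (P y) z) + of_real (t\<^sup>2) * ip (P z) z"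
      using y z by (simp add: T_add T_scale ip_add ip_add_right ip_scale ip_scale_right power2_eq_square algebra_simps)
    also have "ip (P z) y + ip (P y) z = of_real (2 * a)"
      using ip_self[OF z] sa[OF z y] by (simp add: z_def[symmetric] a_def)
    finally show ?thesis using 0 by (simp add: b_def algebra_simps)
  qed
  \<comment> \<open>The polynomial is negative at this point unless \<open>a = 0\<close>; adding 1
    to \<open>b\<close> avoids a division by zero.\<close>
  from this[of "- a / (b + 1)"] have "0 \<le> (2 * (- a / (b + 1)) * a + (- a / (b + 1))\<^sup>2 * b) * (b + 1)\<^sup>2"
    by (intro mult_nonneg_nonneg) auto
  also have "\<dots> = - (a\<^sup>2 * (b + 2))"
    using b by (simp add: power_divide divide_simps) (simp add: power2_eq_square algebra_simps)
  finally have "a\<^sup>2 * (b + 2) \<le> 0" by simp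
  then have "a\<^sup>2 \<le> 0" using b by (simp add: mult_le_0_iff)
  then have "N z = 0" by (simp add: a_def)
  then show ?thesis using N_zero_iff[OF z] by (simp add: z_def)
qed

end

text \<open>For a self-adjoint operator \<open>quad\<close> encodes 0 <= T <= \<kappa> in one
  inequality, which is easily verified for \<open>D1\<close> and directly makes \<open>X\<close> a
  contraction.\<close>

locale sqrt_setting = inner_space V N ip for V :: "'a::complex_vs set" and N ip +
  fixes T :: "'a \<Rightarrow> 'a" and \<kappa> :: real
  assumes lin: "linear_on V T" and maps: "u \<in> V \<Longrightarrow> T u \<in> V"
    and sa: "u \<in> V \<Longrightarrow> w \<in> V \<Longrightarrow> ip (T u) w = ip u (T w)"
    and \<kappa>: "\<kappa> > 0" and quad: "u \<in> V \<Longrightarrow> (N (T u))\<^sup>2 \<le> \<kappa> * Re (ip (T u) u)"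
begin

definition X :: "'a \<Rightarrow> 'a" where
  "X u = u - of_real (1 / \<kappa>) *\<^sub>C T u"

text \<open>The square root is \<open>sqrt \<kappa> (1 - Y)\<close> with \<open>Y = (X + Y\<^sup>2) / 2\<close>; the iterates below
  are dominated in norm by those of the same recursion for numbers, which stay below \<open>1\<close>.\<close>

fun iter :: "nat \<Rightarrow> 'a \<Rightarrow> 'a" where
  "iter 0 u = 0"
| "iter (Suc m) u = (1 / 2) *\<^sub>C (X u + iter m (iter m u))"

fun bnd :: "nat \<Rightarrow> real" where
  "bnd 0 = 0"
| "bnd (Suc m) = (1 + (bnd m)\<^sup>2) / 2"

lemma bnd_range: "0 \<le> bnd m \<and> bnd m \<le> 1"
proof (induction m)
  case (Suc m)
  then have "(bnd m)\<^sup>2 \<le> 1" by (simp add: power_le_one)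
  then show ?case by simp
qed simp

lemma bnd_mono: "bnd m \<le> bnd (Suc m)"
  using sum_squares_bound[of "bnd m" 1] by simp

lemma T_add: "u \<in> V \<Longrightarrow> v \<in> V \<Longrightarrow> T (u + v) = T u + T v"
  and T_scale: "u \<in> V \<Longrightarrow> T (c *\<^sub>C u) = c *\<^sub>C T u"
  using lin by (auto simp: linear_on_def)

lemma X_V [simp]: "u \<in> V \<Longrightarrow> X u \<in> V"
  by (simp add: X_def maps)

lemma X_lin: "linear_on V X"
  unfolding linear_on_def X_def
  by (simp add: T_add T_scale scaleC_add_right cvs.scale_right_diff_distrib mult.commute scaleC_scaleC)

lemma X_sa: "u \<in> V \<Longrightarrow> w \<in> V \<Longrightarrow> ip (X u) w = ip u (X w)"
  by (simp add: X_def ip_diff ip_diff_right ip_scale ip_scale_right maps sa)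

text \<open>In the expanded square, \<open>quad\<close> absorbs the last term into half of the mixed
  one.\<close>

lemma X_bound:
  assumes u: "u \<in> V"
  shows "N (X u) \<le> N u"
proof -
  have "complex_of_real ((N (X u))\<^sup>2) = ip (X u) (X u)" using u by (simp add: ip_self)
  also have "\<dots> = ip u u - of_real (2 / \<kappa>) * ip (T u) u + of_real (1 / \<kappa>\<^sup>2) * ip (T u) (T u)"
    using u by (simp add: X_def ip_diff ip_diff_right ip_scale ip_scale_right maps sa power2_eq_square algebra_simps)
  also have "\<dots> = of_real ((N u)\<^sup>2 + (N (T u))\<^sup>2 / \<kappa>\<^sup>2) - of_real (2 / \<kappa>) * ip (T u) u"
    using u by (simp add: ip_self maps)
  finally have "Re (complex_of_real ((N (X u))\<^sup>2)) = Re (of_real ((N u)\<^sup>2 + (N (T u))\<^sup>2 / \<kappa>\<^sup>2) - of_real (2 / \<kappa>) * ip (T u) u)"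
    by simp
  then have eq: "(N (X u))\<^sup>2 = (N u)\<^sup>2 + (N (T u))\<^sup>2 / \<kappa>\<^sup>2 - 2 / \<kappa> * Re (ip (T u) u)" by simp
  have "(N (T u))\<^sup>2 / \<kappa>\<^sup>2 \<le> \<kappa> * Re (ip (T u) u) / \<kappa>\<^sup>2" using quad[OF u] by (intro divide_right_mono) auto
  also have "\<dots> = 1 / \<kappa> * Re (ip (T u) u)" using \<kappa> by (simp add: power2_eq_square)
  finally have "(N (X u))\<^sup>2 \<le> (N u)\<^sup>2 - 1 / \<kappa> * Re (ip (T u) u)" using eq by simp
  moreover have "0 \<le> 1 / \<kappa> * Re (ip (T u) u)"
  proof -
    have "0 \<le> \<kappa> * Re (ip (T u) u)" using quad[OF u] by (rule order_trans[OF zero_le_power2])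
    then show ?thesis using \<kappa> by (simp add: zero_le_mult_iff)
  qed
  ultimately have "(N (X u))\<^sup>2 \<le> (N u)\<^sup>2" by linarith
  then show ?thesis using N_nonneg[OF u] by (rule power2_le_imp_le)
qed

lemma iter_V [simp]: "u \<in> V \<Longrightarrow> iter m u \<in> V"
  by (induction m arbitrary: u) auto

lemma iter_lin: "linear_on V (iter m)"
proof (induction m)
  case (Suc m)
  have "iter m (u + v) = iter m u + iter m v" "iter m (c *\<^sub>C u) = c *\<^sub>C iter m u" if "u \<in> V" "v \<in> V" for u v c
    using Suc that by (auto simp: linear_on_def)
  moreover have "X (u + v) = X u + X v" "X (c *\<^sub>C u) = c *\<^sub>C X u" if "u \<in> V" "v \<in> V" for u v c
    using X_lin that by (auto simp: linear_on_def)
  ultimately show ?case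
    unfolding linear_on_def by (auto simp: scaleC_add_right scaleC_scaleC mult.commute)
qed (simp add: linear_on_def)

lemma iter_add: "u \<in> V \<Longrightarrow> v \<in> V \<Longrightarrow> iter m (u + v) = iter m u + iter m v"
  and iter_scale: "u \<in> V \<Longrightarrow> iter m (c *\<^sub>C u) = c *\<^sub>C iter m u"
  using iter_lin[of m] by (auto simp: linear_on_def)

lemmas iter_diff = linear_on_diff[OF iter_lin subspace]

lemma iter_bound: "u \<in> V \<Longrightarrow> N (iter m u) \<le> bnd m * N u"
proof (induction m arbitrary: u)
  case (Suc m)
  have "N (iter m (iter m u)) \<le> bnd m * N (iter m u)" using Suc by simp
  also have "\<dots> \<le> bnd m * (bnd m * N u)" using Suc bnd_range by (intro mult_left_mono) auto
  finally have "N (X u + iter m (iter m u)) \<le> N u + (bnd m)\<^sup>2 * N u"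
    using N_triangle[of "X u" "iter m (iter m u)"] X_bound[OF Suc.prems] Suc.prems by (simp add: power2_eq_square mult.assoc)
  then have le: "(N (X u + iter m (iter m u))) / 2 \<le> (N u + (bnd m)\<^sup>2 * N u) / 2" by simp
  have e1: "N (iter (Suc m) u) = N (X u + iter m (iter m u)) / 2"
    unfolding iter.simps(2) using Suc.prems by (subst N_scale) auto
  have e2: "bnd (Suc m) * N u = (N u + (bnd m)\<^sup>2 * N u) / 2" by (simp add: algebra_simps add_divide_distrib)
  show ?case unfolding e1 e2 by (rule le)
qed simp

lemma iter_commute:
  assumes R: "linear_on V R" "\<And>u. u \<in> V \<Longrightarrow> R u \<in> V" "\<And>u. u \<in> V \<Longrightarrow> R (X u) = X (R u)"
  shows "u \<in> V \<Longrightarrow> R (iter m u) = iter m (R u)"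
proof (induction m arbitrary: u)
  case 0
  then show ?case using linear_on_0[OF R(1) subspace] by simp
next
  case (Suc m)
  then have "R (iter (Suc m) u) = (1 / 2) *\<^sub>C (R (X u) + R (iter m (iter m u)))"
    using R(1) by (simp add: linear_on_def)
  then show ?case using Suc by (simp add: R)
qed

lemma iter_iter: "u \<in> V \<Longrightarrow> iter m (iter l u) = iter l (iter m u)"
proof -
  assume u: "u \<in> V"
  have "X (iter m v) = iter m (X v)" if "v \<in> V" for v
    using iter_commute[OF X_lin X_V refl that] .
  then show ?thesis using iter_commute[OF iter_lin iter_V _ u, of m l] by simp
qed

lemma iter_sa: "u \<in> V \<Longrightarrow> w \<in> V \<Longrightarrow> ip (iter m u) w = ip u (iter m w)"
proof (induction m arbitrary: u w)
  case 0
  have "ip 0 w = 0" using ip_scale[of 0 w 0] 0 by simp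
  moreover have "ip u 0 = 0" using ip_scale_right[of 0 u 0] 0 by simp
  ultimately show ?case by simp
next
  case (Suc m)
  then show ?case by (simp add: ip_scale ip_scale_right ip_add ip_add_right X_sa)
qed

text \<open>The iterates commute, so the difference of squares factors and the induction hypothesis
  applies to \<open>v\<close>; the numbers \<open>bnd\<close> satisfy the same identity.\<close>

lemma iter_step: "u \<in> V \<Longrightarrow> N (iter (Suc m) u - iter m u) \<le> (bnd (Suc m) - bnd m) * N u"
proof (induction m arbitrary: u)
  case 0
  then show ?case using X_bound[of u] by (simp add: N_scale)
next
  case (Suc m)
  define v where "v = iter (Suc m) u + iter m u"
  have v: "v \<in> V" using Suc.prems unfolding v_def by (intro V_add iter_V)
  have iV: "iter (Suc m) u \<in> V" "iter m u \<in> V" using Suc.prems iter_V by blast+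
  have "iter (Suc m) v - iter m v = iter (Suc m) (iter (Suc m) u) - iter m (iter m u)"
    unfolding v_def iter_add[OF iV] iter_iter[OF Suc.prems, of m "Suc m"] by simp
  moreover have "iter (Suc (Suc m)) u - iter (Suc m) u = (1 / 2) *\<^sub>C (iter (Suc m) (iter (Suc m) u) - iter m (iter m u))"
    unfolding iter.simps(2)[of "Suc m" u] iter.simps(2)[of m u]
    by (simp only: cvs.scale_right_diff_distrib[symmetric] add_diff_cancel_left)
  ultimately have eq: "iter (Suc (Suc m)) u - iter (Suc m) u = (1 / 2) *\<^sub>C (iter (Suc m) v - iter m v)" by (simp only:)
  have "iter (Suc m) v - iter m v \<in> V" by (intro V_diff iter_V v)
  then have "N (iter (Suc (Suc m)) u - iter (Suc m) u) = cmod (1 / 2) * N (iter (Suc m) v - iter m v)"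
    unfolding eq by (rule N_scale)
  also have "\<dots> = N (iter (Suc m) v - iter m v) / 2" by (simp only: norm_divide norm_one norm_numeral)
  also have "\<dots> \<le> (bnd (Suc m) - bnd m) * N v / 2" using Suc.IH[OF v] by (intro divide_right_mono) (simp_all del: iter.simps bnd.simps)
  also have "\<dots> \<le> (bnd (Suc m) - bnd m) * ((bnd (Suc m) + bnd m) * N u) / 2"
  proof -
    have "N v \<le> bnd (Suc m) * N u + bnd m * N u"
      unfolding v_def using N_triangle[OF iV] iter_bound[OF Suc.prems, of "Suc m"] iter_bound[OF Suc.prems, of m] by linarith
    then show ?thesis using bnd_mono[of m] by (intro divide_right_mono mult_left_mono) (auto simp: algebra_simps)
  qed
  also have "\<dots> = (bnd (Suc (Suc m)) - bnd (Suc m)) * N u"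
    unfolding bnd.simps(2)[of "Suc m"] bnd.simps(2)[of m] by (simp add: field_simps power2_eq_square)
  finally show ?case .
qed

definition Y :: "'a \<Rightarrow> 'a" where
  "Y u = (SOME v. v \<in> V \<and> (\<lambda>M. N (iter M u - v)) \<longlonglongrightarrow> 0)"

lemma Y_lim:
  assumes u: "u \<in> V"
  shows "Y u \<in> V" "(\<lambda>M. N (iter M u - Y u)) \<longlonglongrightarrow> 0"
proof -
  define x where "x j = iter (Suc j) u - iter j u" for j
  have x: "x j \<in> V" for j using u unfolding x_def by (intro V_diff iter_V)
  have "summable (\<lambda>j. N (x j))"
  proof (rule summableI_nonneg_bounded)
    show "0 \<le> N (x j)" for j using x N_nonneg by blast
    fix M
    have "(\<Sum>j<M. N (x j)) \<le> (\<Sum>j<M. (bnd (Suc j) - bnd j) * N u)"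
      unfolding x_def by (intro sum_mono iter_step u)
    also have "\<dots> = bnd M * N u"
      unfolding sum_distrib_right[symmetric] sum_lessThan_telescope by simp
    also have "\<dots> \<le> 1 * N u" using bnd_range N_nonneg[OF u] by (intro mult_right_mono) auto
    finally show "(\<Sum>j<M. N (x j)) \<le> N u" by simp
  qed
  from complete[OF x this] obtain v where v: "v \<in> V" "(\<lambda>M. N ((\<Sum>j<M. x j) - v)) \<longlonglongrightarrow> 0" by blast
  have "(\<Sum>j<M. x j) = iter M u" for M unfolding x_def by (simp only: sum_lessThan_telescope[of "\<lambda>j. iter j u"] iter.simps(1) diff_zero)
  then have "\<exists>v. v \<in> V \<and> (\<lambda>M. N (iter M u - v)) \<longlonglongrightarrow> 0" using v by auto
  from someI_ex[OF this] show "Y u \<in> V" "(\<lambda>M. N (iter M u - Y u)) \<longlonglongrightarrow> 0" unfolding Y_def by auto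
qed

lemmas Y_V [simp] = Y_lim(1)

lemma Y_eqI: "u \<in> V \<Longrightarrow> v \<in> V \<Longrightarrow> (\<lambda>M. N (iter M u - v)) \<longlonglongrightarrow> 0 \<Longrightarrow> Y u = v"
  using lim_unique[of "\<lambda>M. iter M u" "Y u" v] Y_lim[of u] by simp

lemma Y_lin: "linear_on V Y"
  unfolding linear_on_def
proof (intro conjI ballI allI)
  fix u v assume u: "u \<in> V" and v: "v \<in> V"
  show "Y (u + v) = Y u + Y v"
  proof (rule Y_eqI)
    have lim: "(\<lambda>M. N (iter M u - Y u) + N (iter M v - Y v)) \<longlonglongrightarrow> 0"
      using tendsto_add[OF Y_lim(2)[OF u] Y_lim(2)[OF v]] by simp
    have "norm (N (iter M (u + v) - (Y u + Y v))) \<le> N (iter M u - Y u) + N (iter M v - Y v)" for M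
      using N_triangle[of "iter M u - Y u" "iter M v - Y v"] N_nonneg[of "iter M (u + v) - (Y u + Y v)"] u v
      by (simp add: iter_add algebra_simps)
    then show "(\<lambda>M. N (iter M (u + v) - (Y u + Y v))) \<longlonglongrightarrow> 0"
      by (intro Lim_null_comparison[OF _ lim] always_eventually allI)
  qed (use u v in auto)
next
  fix c u assume u: "u \<in> V"
  show "Y (c *\<^sub>C u) = c *\<^sub>C Y u"
  proof (rule Y_eqI)
    have "(\<lambda>M. cmod c * N (iter M u - Y u)) \<longlonglongrightarrow> cmod c * 0" by (intro tendsto_mult_left Y_lim u)
    moreover have "cmod c * N (iter M u - Y u) = N (iter M (c *\<^sub>C u) - c *\<^sub>C Y u)" for M
      using u by (simp add: iter_scale N_scale flip: cvs.scale_right_diff_distrib)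
    ultimately show "(\<lambda>M. N (iter M (c *\<^sub>C u) - c *\<^sub>C Y u)) \<longlonglongrightarrow> 0" by simp
  qed (use u in auto)
qed

lemma Y_bound:
  assumes u: "u \<in> V"
  shows "N (Y u) \<le> N u"
proof (rule N_lim_le[OF _ _ Y_lim(2)[OF u] _ tendsto_const])
  show "N (iter M u) \<le> N u" for M
    using iter_bound[OF u, of M] mult_right_mono[of "bnd M" 1 "N u"] bnd_range[of M] N_nonneg[OF u] by simp
qed (use u in auto)

lemma Y_sa:
  assumes u: "u \<in> V" and w: "w \<in> V"
  shows "ip (Y u) w = ip u (Y w)"
proof -
  have "(\<lambda>M. ip (iter M u) w) \<longlonglongrightarrow> ip (Y u) w"
    using u by (intro dual_tendsto[OF ip_dual[OF w] _ _ Y_lim(2)]) auto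
  moreover have "(\<lambda>M. cnj (ip (iter M w) u)) \<longlonglongrightarrow> cnj (ip (Y w) u)"
    using w by (intro tendsto_cnj dual_tendsto[OF ip_dual[OF u] _ _ Y_lim(2)]) auto
  ultimately show ?thesis
    using iter_sa[OF u w] by (simp add: LIMSEQ_unique flip: ip_commute)
qed

text \<open>\<open>Y\<close> is a pointwise limit of polynomials in \<open>X\<close>. The
  commutation is needed for the uniqueness of the root.\<close>

lemma Y_commute:
  assumes R: "bounded_op N V R" "\<And>u. u \<in> V \<Longrightarrow> R (X u) = X (R u)" and u: "u \<in> V"
  shows "R (Y u) = Y (R u)"
proof -
  interpret R: operator V N R using R(1) by unfold_locales
  obtain C where C: "\<forall>u\<in>V. N (R u) \<le> C * N u" using R.T_bound by blast
  have "Y (R u) = R (Y u)"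
  proof (rule Y_eqI)
    have "(\<lambda>M. C * N (iter M u - Y u)) \<longlonglongrightarrow> C * 0" by (intro tendsto_mult_left Y_lim u)
    then have lim: "(\<lambda>M. C * N (iter M u - Y u)) \<longlonglongrightarrow> 0" by simp
    have "norm (N (iter M (R u) - R (Y u))) \<le> C * N (iter M u - Y u)" for M
    proof -
      have "iter M (R u) - R (Y u) = R (iter M u - Y u)"
        using u iter_commute[OF R.T_lin R.T_V R(2) u, of M] by (simp add: R.T_diff)
      then show ?thesis using C u N_nonneg[of "R (iter M u - Y u)"] by simp
    qed
    then show "(\<lambda>M. N (iter M (R u) - R (Y u))) \<longlonglongrightarrow> 0"
      by (intro Lim_null_comparison[OF _ lim] always_eventually allI)
  qed (use u in auto)
  then show ?thesis ..
qed

text \<open>The fixed point equation of the iteration. It says that the square of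
  \<open>1 - Y\<close> is \<open>1 - X\<close>, which is \<open>T\<close> divided by
  \<open>\<kappa>\<close>.\<close>

lemma Y_square:
  assumes u: "u \<in> V"
  shows "X u + Y (Y u) = 2 *\<^sub>C Y u"
proof -
  have lim: "(\<lambda>M. N (iter M u - Y u) + N (iter M (Y u) - Y (Y u))) \<longlonglongrightarrow> 0"
    using tendsto_add[OF Y_lim(2)[OF u] Y_lim(2)[OF Y_V[OF u]]] by simp
  define v where "v = (1 / 2) *\<^sub>C (X u + Y (Y u))"
  have v: "v \<in> V" using u by (simp add: v_def)
  have "norm (N (iter (Suc M) u - v)) \<le> N (iter M u - Y u) + N (iter M (Y u) - Y (Y u))" for M
  proof -
    have "iter (Suc M) u - v = (1 / 2) *\<^sub>C (iter M (iter M u - Y u) + (iter M (Y u) - Y (Y u)))"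
      using u by (simp add: v_def iter_diff flip: cvs.scale_right_diff_distrib)
    then have "N (iter (Suc M) u - v) = N (iter M (iter M u - Y u) + (iter M (Y u) - Y (Y u))) / 2"
      using u by (simp add: N_scale)
    moreover have "N (iter M (iter M u - Y u)) \<le> N (iter M u - Y u)"
      using iter_bound[of "iter M u - Y u" M] bnd_range[of M] mult_right_mono[of "bnd M" 1 "N (iter M u - Y u)"]
        N_nonneg[of "iter M u - Y u"] u by simp
    moreover have "0 \<le> N (iter M u - Y u)" "0 \<le> N (iter M (Y u) - Y (Y u))" using u by (simp_all add: N_nonneg)
    moreover have "0 \<le> N (iter (Suc M) u - v)" using u v by (intro N_nonneg V_diff iter_V)
    ultimately show ?thesis
      using N_triangle[of "iter M (iter M u - Y u)" "iter M (Y u) - Y (Y u)"] u by simp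
  qed
  then have "(\<lambda>M. N (iter (Suc M) u - v)) \<longlonglongrightarrow> 0"
    by (intro Lim_null_comparison[OF _ lim] always_eventually allI)
  then have "(\<lambda>M. N (iter M u - v)) \<longlonglongrightarrow> 0" by (rule LIMSEQ_imp_Suc)
  then have "Y u = v" by (rule Y_eqI[OF u v])
  moreover have "2 *\<^sub>C v = X u + Y (Y u)" by (simp add: v_def scaleC_scaleC scaleC_one del: cvs.scale_right_distrib)
  ultimately show ?thesis by metis
qed

definition root :: "'a \<Rightarrow> 'a" where
  "root u = (if u \<in> V then of_real (sqrt \<kappa>) *\<^sub>C (u - Y u) else 0)"

lemma root_V [simp]: "u \<in> V \<Longrightarrow> root u \<in> V"
  by (simp add: root_def)

lemma root_root:
  assumes u: "u \<in> V"
  shows "root (root u) = T u"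
proof -
  have Yd: "Y (of_real (sqrt \<kappa>) *\<^sub>C (u - Y u)) = of_real (sqrt \<kappa>) *\<^sub>C (Y u - Y (Y u))"
    using Y_lin linear_on_diff[OF Y_lin subspace, of u "Y u"] u by (simp add: linear_on_def)
  have "root (root u) = of_real (sqrt \<kappa>) *\<^sub>C (of_real (sqrt \<kappa>) *\<^sub>C (u - Y u) - of_real (sqrt \<kappa>) *\<^sub>C (Y u - Y (Y u)))"
    using u unfolding root_def by (simp only: Yd if_True V_scale V_diff Y_V)
  also have "\<dots> = of_real (sqrt \<kappa> * sqrt \<kappa>) *\<^sub>C (u - Y u - (Y u - Y (Y u)))"
    by (simp only: scaleC_scaleC of_real_mult cvs.scale_right_diff_distrib[symmetric])
  also have "u - Y u - (Y u - Y (Y u)) = u - (2 *\<^sub>C Y u - Y (Y u))"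
    using scaleC_add_left[of 1 1 "Y u"] by (simp add: scaleC_one algebra_simps)
  also have "2 *\<^sub>C Y u - Y (Y u) = X u" using Y_square[OF u] by (simp add: diff_eq_eq)
  also have "of_real (sqrt \<kappa> * sqrt \<kappa>) *\<^sub>C (u - X u) = T u" using \<kappa> by (simp add: X_def scaleC_scaleC scaleC_one)
  finally show ?thesis .
qed

lemma root_positive: "positive root"
proof -
  have "linear_on V root"
    using Y_lin unfolding linear_on_def root_def
    by (simp add: scaleC_add_right cvs.scale_right_diff_distrib scaleC_scaleC mult.commute algebra_simps)
  moreover have "N (root u) \<le> sqrt \<kappa> * 2 * N u" if u: "u \<in> V" for u
  proof -
    have "N (u - Y u) \<le> 2 * N u" using N_diff[of u "Y u"] Y_bound[OF u] u by simp
    then show ?thesis using u \<kappa> by (simp add: root_def N_scale mult_left_mono)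
  qed
  ultimately have "bounded_op N V root" by (auto simp: bounded_op_def)
  moreover have "ip (root u) w = ip u (root w)" if "u \<in> V" "w \<in> V" for u w
    using that by (simp add: root_def ip_scale ip_scale_right ip_diff ip_diff_right Y_sa)
  moreover have "Re (ip (root u) u) \<ge> 0" if u: "u \<in> V" for u
  proof -
    have "cmod (ip (Y u) u) \<le> N (Y u) * N u" using u by (intro ip_bound) auto
    also have "\<dots> \<le> N u * N u" using Y_bound[OF u] N_nonneg[OF u] by (intro mult_right_mono)
    finally have "Re (ip (Y u) u) \<le> (N u)\<^sup>2"
      using complex_Re_le_cmod[of "ip (Y u) u"] by (simp add: power2_eq_square)
    then show ?thesis using u \<kappa> by (simp add: root_def ip_scale ip_diff ip_self)
  qed
  ultimately show ?thesis by (auto simp: positive_def)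
qed

text \<open>\<open>S\<close> commutes with its square \<open>T\<close>, hence with the root. For
  \<open>y = root u - S u\<close> this gives \<open>root y + S y = 0\<close>; both terms vanish by
  \<open>positive_null\<close>, and then \<open>y\<close> is orthogonal to itself.\<close>

lemma root_unique:
  assumes S: "positive S" "\<forall>u\<in>V. S (S u) = T u" "\<forall>u. u \<notin> V \<longrightarrow> S u = 0"
  shows "S = root"
proof
  fix u
  interpret S: operator V N S using S(1) by unfold_locales (simp add: positive_def)
  interpret R: operator V N root using root_positive by unfold_locales (simp add: positive_def)
  show "S u = root u"
  proof (cases "u \<in> V")
    case True
    have "S (T v) = T (S v)" if "v \<in> V" for v using S(2) that by (metis S.T_V)
    then have SX: "S (X v) = X (S v)" if "v \<in> V" for v using that by (simp add: X_def S.T_diff S.T_scale maps)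
    have "S (Y u) = Y (S u)"
      by (rule Y_commute) (use S(1) SX True in \<open>auto simp: positive_def\<close>)
    then have comm: "S (root u) = root (S u)" using True by (simp add: root_def S.T_scale S.T_diff)
    define y where "y = root u - S u"
    have y: "y \<in> V" using True by (simp add: y_def)
    have "root y + S y = root (root u) - S (S u)"
      using True comm by (simp add: y_def S.T_diff R.T_diff)
    also have "\<dots> = 0" using True root_root S(2) by simp
    finally have "ip (root y + S y) y = 0" using ip_scale[of 0 y 0] y by simp
    then have "ip (root y) y + ip (S y) y = 0" using y by (simp add: ip_add)
    then have "Re (ip (root y) y) + Re (ip (S y) y) = 0" by (metis plus_complex.sel(1) zero_complex.sel(1))
    moreover have "Re (ip (root y) y) \<ge> 0" "Re (ip (S y) y) \<ge> 0"
      using S(1) root_positive y by (auto simp: positive_def)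
    ultimately have "Re (ip (root y) y) = 0" "Re (ip (S y) y) = 0" by linarith+
    then have 0: "root y = 0" "S y = 0" using positive_null S(1) root_positive y by blast+
    have "ip y y = ip (root u) y - ip (S u) y" using ip_diff[of "root u" "S u" y] True y unfolding y_def[symmetric] by simp
    also have "\<dots> = ip u (root y) - ip u (S y)" using True y S(1) root_positive by (simp add: positive_def)
    also have "\<dots> = 0" unfolding 0 by simp
    finally have "N y = 0" using ip_self[OF y] by simp
    then show ?thesis using N_zero_iff[OF y] by (simp add: y_def)
  qed (use S(3) in \<open>simp add: root_def\<close>)
qed

text \<open>Only real multiples are asked of \<open>W\<close>, so that the real square-summable
  sequences qualify besides the complex subspace \<open>L2_even k\<close>.\<close>

lemma root_invariant:
  assumes W: "W \<subseteq> V" "0 \<in> W" "\<And>u v. u \<in> W \<Longrightarrow> v \<in> W \<Longrightarrow> u + v \<in> W"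
    "\<And>r u. u \<in> W \<Longrightarrow> of_real r *\<^sub>C u \<in> W" "\<And>u. u \<in> W \<Longrightarrow> T u \<in> W"
    and closed: "\<And>x v. (\<forall>M. x M \<in> W) \<Longrightarrow> v \<in> V \<Longrightarrow> (\<lambda>M. N (x M - v)) \<longlonglongrightarrow> 0 \<Longrightarrow> v \<in> W"
    and u: "u \<in> W"
  shows "root u \<in> W"
proof -
  have W_diff: "u - v \<in> W" if "u \<in> W" "v \<in> W" for u v
    using W(3)[OF that(1) W(4)[OF that(2), of "- 1"]] by simp
  have X: "X u \<in> W" if "u \<in> W" for u unfolding X_def using that by (intro W_diff W(4) W(5))
  have "iter m u \<in> W" if "u \<in> W" for m u
    using that
  proof (induction m arbitrary: u)
    case (Suc m)
    have "of_real (1 / 2) *\<^sub>C (X u + iter m (iter m u)) \<in> W"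
      using Suc.IH[OF Suc.IH[OF Suc.prems]] X[OF Suc.prems] by (intro W(4) W(3))
    then show ?case by simp
  qed (simp add: W(2))
  then have "Y u \<in> W" using closed[of "\<lambda>M. iter M u" "Y u"] Y_lim[of u] u W(1) by blast
  then show ?thesis using u W(1) unfolding root_def by (auto intro!: W(4) W_diff)
qed

end

section \<open>Ground states\<close>

lemma one_weight: "\<forall>m::int. (1::real) > 0" "\<forall>m::int. (1::real) \<ge> 0" "\<forall>m::int. \<bar>1::real\<bar> \<le> 1 * 1"
  by simp_all

lemma L2_inner_cip: "L2_inner c d = cip (\<lambda>_. 1) c d"
  by (simp add: L2_inner_def cip_def)

lemma inner_space_L2: "inner_space L2 L2_norm L2_inner"
proof -
  interpret nspace L2 L2_norm unfolding L2_wsp by (rule nspace_wsp[OF one_weight(1)])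
  show ?thesis
  proof
    show "L2_inner (u + v) w = L2_inner u w + L2_inner v w" if "u \<in> L2" "v \<in> L2" "w \<in> L2" for u v w
      unfolding L2_inner_cip using cip_add[OF one_weight(2,3)] that unfolding L2_wsp by blast
    show "L2_inner (c *\<^sub>C u) w = c * L2_inner u w" for c u w
      unfolding L2_inner_cip by (rule cip_scale)
    show "L2_inner u w = cnj (L2_inner w u)" for u w
      unfolding L2_inner_cip by (rule cip_commute)
    show "L2_inner u u = of_real ((L2_norm u)\<^sup>2)" if "u \<in> L2" for u
      unfolding L2_inner_cip L2_wsp wn_power2[OF one_weight(2)]
      using cip_self(1)[OF one_weight(2,3), of u] that unfolding L2_wsp by simp
    show "cmod (L2_inner u w) \<le> L2_norm u * L2_norm w" if "u \<in> L2" "w \<in> L2" for u w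
      unfolding L2_inner_cip using cip_bound[OF one_weight(2,3), of u w] that unfolding L2_wsp by simp
  qed
qed

interpretation L2: inner_space L2 L2_norm L2_inner
  by (rule inner_space_L2)

lemma positive_op_iff: "positive_op T \<longleftrightarrow> L2.positive T"
  by (simp add: positive_op_def L2.positive_def)

lemma L2_lim_coord:
  assumes "\<forall>M. x M \<in> L2" "v \<in> L2" "(\<lambda>M. L2_norm (x M - v)) \<longlonglongrightarrow> 0"
  shows "(\<lambda>M. x M m) \<longlonglongrightarrow> v m"
proof (rule L2.dual_tendsto[where \<phi> = "\<lambda>c. c m"])
  show "(\<lambda>c. c m) \<in> dual_space L2_norm L2" unfolding L2_wsp by (rule coord_dual[OF one_weight(1)])
qed (use assms in auto)

lemma shift_L2:
  assumes "c \<in> L2"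
  shows "(\<lambda>m. c (m + e)) \<in> L2" "L2_norm (\<lambda>m. c (m + e)) \<le> L2_norm c"
proof -
  have "inj (\<lambda>m::int. m + e)" by simp
  note t = wsp_transfer[OF one_weight(2,2) this, of 1 "\<lambda>m. c (m + e)" c]
  show "(\<lambda>m. c (m + e)) \<in> L2" "L2_norm (\<lambda>m. c (m + e)) \<le> L2_norm c"
    using t assms unfolding L2_wsp by auto
qed

lemma shift_inner: "L2_inner (\<lambda>m. c (m + e)) d = L2_inner c (\<lambda>m. d (m - e))"
proof -
  have "bij_betw (\<lambda>m. m + e) UNIV UNIV" by (rule bij_betw_byWitness[where f' = "\<lambda>m. m - e"]) auto
  from infsum_reindex_bij_betw[OF this, of "\<lambda>m. c m * cnj (d (m - e))"]
  show ?thesis by (simp add: L2_inner_def)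
qed

lemma cos_mult1_shift: "cos_mult1 k c = (1 / 2) *\<^sub>C ((\<lambda>m. c (m + - int k)) + (\<lambda>m. c (m + int k)))"
  by (simp add: cos_mult1_def fun_eq_iff scaleC_fun_def scaleC_complex_def)

lemma cos_mult1_L2:
  assumes c: "c \<in> L2"
  shows "cos_mult1 k c \<in> L2" "L2_norm (cos_mult1 k c) \<le> L2_norm c"
proof -
  note s = shift_L2[OF c]
  show "cos_mult1 k c \<in> L2" unfolding cos_mult1_shift by (intro L2.V_scale L2.V_add s)
  have "L2_norm (cos_mult1 k c) = L2_norm ((\<lambda>m. c (m + - int k)) + (\<lambda>m. c (m + int k))) / 2"
    unfolding cos_mult1_shift L2.N_scale[OF L2.V_add[OF s(1) s(1)]] by (simp add: norm_divide)
  also have "\<dots> \<le> (L2_norm c + L2_norm c) / 2"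
    using L2.N_triangle[OF s(1) s(1), of "- int k" "int k"] s(2)[of "- int k"] s(2)[of "int k"] by simp
  finally show "L2_norm (cos_mult1 k c) \<le> L2_norm c" by simp
qed

lemma cos_mult1_sa:
  assumes c: "c \<in> L2" and d: "d \<in> L2"
  shows "L2_inner (cos_mult1 k c) d = L2_inner c (cos_mult1 k d)"
proof -
  note s = shift_L2(1)[OF c] shift_L2(1)[OF d]
  have L: "L2_inner (cos_mult1 k c) d = (1 / 2) * (L2_inner (\<lambda>m. c (m + - int k)) d + L2_inner (\<lambda>m. c (m + int k)) d)"
    unfolding cos_mult1_shift L2.ip_scale[OF L2.V_add[OF s(1) s(1)] d] L2.ip_add[OF s(1) s(1) d] ..
  have R: "L2_inner c (cos_mult1 k d) = (1 / 2) * (L2_inner c (\<lambda>m. d (m + - int k)) + L2_inner c (\<lambda>m. d (m + int k)))"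
    unfolding cos_mult1_shift L2.ip_scale_right[OF L2.V_add[OF s(2) s(2)] c] L2.ip_add_right[OF s(2) s(2) c] by simp
  show ?thesis unfolding L R shift_inner[of c] by (simp add: add.commute)
qed

lemma cos_mult1_add: "cos_mult1 k (c + d) = cos_mult1 k c + cos_mult1 k d"
  and cos_mult1_scale: "cos_mult1 k (z *\<^sub>C c) = z *\<^sub>C cos_mult1 k c"
  by (auto simp: cos_mult1_def fun_eq_iff scaleC_fun_def scaleC_complex_def field_simps)

lemma multiplier_add: "multiplier p (c + d) = multiplier p c + multiplier p d"
  and multiplier_scale: "multiplier p (z *\<^sub>C c) = z *\<^sub>C multiplier p c"
  by (auto simp: multiplier_def fun_eq_iff scaleC_fun_def scaleC_complex_def algebra_simps)

lemma multiplier_L2: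
  assumes p: "\<forall>m. \<bar>p m\<bar> \<le> K" and c: "c \<in> L2"
  shows "multiplier (\<lambda>m. of_real (p m)) c \<in> L2"
proof -
  have K: "K \<ge> 0" using p abs_ge_zero order_trans by blast
  show ?thesis
    unfolding L2_wsp
  proof (rule wsp_transfer(1)[OF one_weight(2,2) inj_on_id K])
    show "wabs (\<lambda>_. 1) (multiplier (\<lambda>m. of_real (p m)) c) m \<le> K * wabs (\<lambda>_. 1) c (id m)" for m
      using mult_right_mono[OF p[rule_format, of m], of "cmod (c m)"] by (simp add: multiplier_def norm_mult)
  qed (use c in \<open>simp add: L2_wsp\<close>)
qed

lemma multiplier_inner:
  "L2_inner (multiplier (\<lambda>m. of_real (p m)) c) d = cip p c d"
  "L2_inner c (multiplier (\<lambda>m. of_real (p m)) d) = cip p c d"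
  by (simp_all add: L2_inner_def cip_def multiplier_def mult_ac)

lemma multiplier_quad:
  assumes p: "\<forall>m. 0 \<le> p m \<and> p m \<le> K" and c: "c \<in> L2"
  shows "(L2_norm (multiplier (\<lambda>m. of_real (p m)) c))\<^sup>2 \<le> K * Re (L2_inner (multiplier (\<lambda>m. of_real (p m)) c) c)"
proof -
  have K: "K \<ge> 0" using p order_trans by blast
  have pK: "\<forall>m. \<bar>p m\<bar> \<le> K * 1" using p by simp
  have cw: "c \<in> wsp (\<lambda>_. 1)" using c by (simp add: L2_wsp)
  note cs = cip_self[OF one_weight(2) pK cw]
  have M: "multiplier (\<lambda>m. of_real (p m)) c \<in> L2" using p c by (intro multiplier_L2[where K = K]) auto
  have "(L2_norm (multiplier (\<lambda>m. of_real (p m)) c))\<^sup>2 = (\<Sum>\<^sub>\<infinity>m. 1 * (cmod (multiplier (\<lambda>m. of_real (p m)) c m))\<^sup>2)"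
    unfolding L2_wsp by (rule wn_power2[OF one_weight(2)])
  also have "\<dots> \<le> (\<Sum>\<^sub>\<infinity>m. K * (p m * (cmod (c m))\<^sup>2))"
  proof (rule infsum_mono)
    show "(\<lambda>m. 1 * (cmod (multiplier (\<lambda>m. of_real (p m)) c m))\<^sup>2) summable_on UNIV" using M by (simp add: L2_def)
    show "(\<lambda>m. K * (p m * (cmod (c m))\<^sup>2)) summable_on UNIV" by (rule summable_on_cmult_right[OF cs(2)])
    fix m
    have "p m * (p m * (cmod (c m))\<^sup>2) \<le> K * (p m * (cmod (c m))\<^sup>2)" using p by (intro mult_right_mono) auto
    then show "1 * (cmod (multiplier (\<lambda>m. of_real (p m)) c m))\<^sup>2 \<le> K * (p m * (cmod (c m))\<^sup>2)"
      using p by (simp add: multiplier_def norm_mult power_mult_distrib power2_eq_square mult_ac)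
  qed
  also have "\<dots> = K * (\<Sum>\<^sub>\<infinity>m. p m * (cmod (c m))\<^sup>2)" by (rule infsum_cmult_right')
  also have "\<dots> = K * Re (L2_inner (multiplier (\<lambda>m. of_real (p m)) c) c)" unfolding multiplier_inner cs(1) by simp
  finally show ?thesis .
qed

lemma A1_asym: "A1 k n = multiplier (\<lambda>m. of_real (asym k (m, int n)))"
  by (simp add: A1_def asym_eq msq_def add_ac)

lemma B1_bsym: "B1 k n = multiplier (\<lambda>m. of_real (bsym k (m, int n)))"
  by (simp add: B1_def bsym_def msq_def)

lemma A1_L2: "c \<in> L2 \<Longrightarrow> A1 k n c \<in> L2"
  unfolding A1_asym using asym_bound by (intro multiplier_L2) auto

lemma bsym_line:
  assumes "n \<ge> 1"
  shows "0 \<le> bsym k (m, int n) \<and> bsym k (m, int n) \<le> (1 + (real k)\<^sup>2) / (real n)\<^sup>2"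
  using assms bsym_nonneg by (auto simp: bsym_def msq_def intro!: divide_left_mono mult_pos_pos add_nonneg_pos)

lemma B1_L2: "n \<ge> 1 \<Longrightarrow> c \<in> L2 \<Longrightarrow> B1 k n c \<in> L2"
  unfolding B1_bsym using bsym_line by (intro multiplier_L2[where K = "(1 + (real k)\<^sup>2) / (real n)\<^sup>2"]) auto

text \<open>D = C B C with a self-adjoint contraction C. For v = C u the squared norm of D u is at
  most that of B v, which is at most \<kappa> times (B v, v) = (D u, u).\<close>

lemma sqrt_setting_D1:
  assumes n: "n \<ge> 1"
  shows "sqrt_setting L2 L2_norm L2_inner (D1 k n) ((1 + (real k)\<^sup>2) / (real n)\<^sup>2)"
proof unfold_locales
  note L = B1_L2[OF n] cos_mult1_L2(1)
  show "linear_on L2 (D1 k n)"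
    unfolding linear_on_def D1_def B1_def by (simp add: cos_mult1_add cos_mult1_scale multiplier_add multiplier_scale)
  show "D1 k n u \<in> L2" if "u \<in> L2" for u using that L by (simp add: D1_def)
  have B: "L2_inner (B1 k n u) w = L2_inner u (B1 k n w)" for u w by (simp add: B1_bsym multiplier_inner)
  show "L2_inner (D1 k n u) w = L2_inner u (D1 k n w)" if "u \<in> L2" "w \<in> L2" for u w
    using that L by (simp add: D1_def cos_mult1_sa B)
  show "(1 + (real k)\<^sup>2) / (real n)\<^sup>2 > 0" using n by (intro divide_pos_pos add_pos_nonneg) auto
  show "(L2_norm (D1 k n u))\<^sup>2 \<le> (1 + (real k)\<^sup>2) / (real n)\<^sup>2 * Re (L2_inner (D1 k n u) u)" if u: "u \<in> L2" for u
  proof -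
    define v where "v = cos_mult1 k u"
    have v: "v \<in> L2" using u L by (simp add: v_def)
    have "(L2_norm (D1 k n u))\<^sup>2 \<le> (L2_norm (B1 k n v))\<^sup>2"
      unfolding D1_def using cos_mult1_L2[OF L(1)[OF v]] L2.N_nonneg
      by (intro power_mono) (auto simp: v_def)
    also have "\<dots> \<le> (1 + (real k)\<^sup>2) / (real n)\<^sup>2 * Re (L2_inner (B1 k n v) v)"
      unfolding B1_bsym using bsym_line[OF n] v by (intro multiplier_quad) auto
    also have "L2_inner (B1 k n v) v = L2_inner (D1 k n u) u"
      using cos_mult1_sa[OF L(1)[OF v] u] by (simp add: D1_def v_def)
    finally show ?thesis .
  qed
qed

section \<open>Parity, support and reality under the one-dimensional operators\<close>

abbreviation even_supp :: "nat \<Rightarrow> dist1 \<Rightarrow> bool" where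
  "even_supp k c \<equiv> \<forall>m. c m \<noteq> 0 \<longrightarrow> (\<exists>j. even j \<and> m = int k * j)"

abbreviation odd_supp :: "nat \<Rightarrow> dist1 \<Rightarrow> bool" where
  "odd_supp k c \<equiv> \<forall>m. c m \<noteq> 0 \<longrightarrow> (\<exists>j. odd j \<and> m = int k * j)"

lemma cos_mult1_even:
  assumes "\<forall>m. c (- m) = c m"
  shows "\<forall>m. cos_mult1 k c (- m) = cos_mult1 k c m"
proof
  fix m
  show "cos_mult1 k c (- m) = cos_mult1 k c m"
    using assms[rule_format, of "m + int k"] assms[rule_format, of "m - int k"]
    by (simp add: cos_mult1_def add.commute)
qed

lemma cos_mult1_supp:
  assumes "cos_mult1 k c m \<noteq> 0"
  shows "\<exists>i. c i \<noteq> 0 \<and> (m = i + int k \<or> m = i - int k)"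
proof -
  have "c (m - int k) \<noteq> 0 \<or> c (m + int k) \<noteq> 0" using assms by (auto simp: cos_mult1_def)
  then show ?thesis by (auto intro: exI[of _ "m - int k"] exI[of _ "m + int k"])
qed

lemma cos_mult1_even_supp:
  assumes "even_supp k c"
  shows "odd_supp k (cos_mult1 k c)"
proof (intro allI impI)
  fix m assume "cos_mult1 k c m \<noteq> 0"
  from cos_mult1_supp[OF this] obtain i where i: "c i \<noteq> 0" "m = i + int k \<or> m = i - int k" by (elim exE conjE)
  obtain j where "even j" "i = int k * j" using assms[rule_format, OF i(1)] by (elim exE conjE)
  then have "odd (j + 1) \<and> m = int k * (j + 1) \<or> odd (j - 1) \<and> m = int k * (j - 1)"
    using i(2) by (auto simp: algebra_simps)
  then show "\<exists>j. odd j \<and> m = int k * j" by blast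
qed

lemma cos_mult1_odd_supp:
  assumes "odd_supp k c"
  shows "even_supp k (cos_mult1 k c)"
proof (intro allI impI)
  fix m assume "cos_mult1 k c m \<noteq> 0"
  from cos_mult1_supp[OF this] obtain i where i: "c i \<noteq> 0" "m = i + int k \<or> m = i - int k" by (elim exE conjE)
  obtain j where "odd j" "i = int k * j" using assms[rule_format, OF i(1)] by (elim exE conjE)
  then have "even (j + 1) \<and> m = int k * (j + 1) \<or> even (j - 1) \<and> m = int k * (j - 1)"
    using i(2) by (auto simp: algebra_simps)
  then show "\<exists>j. even j \<and> m = int k * j" by blast
qed

lemma A1_even: "\<forall>m. c (- m) = c m \<Longrightarrow> \<forall>m. A1 k n c (- m) = A1 k n c m"
  and B1_even: "\<forall>m. c (- m) = c m \<Longrightarrow> \<forall>m. B1 k n c (- m) = B1 k n c m"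
  by (simp_all add: A1_def B1_def multiplier_def)

lemma A1_supp: "A1 k n c m \<noteq> 0 \<Longrightarrow> c m \<noteq> 0"
  and B1_supp: "B1 k n c m \<noteq> 0 \<Longrightarrow> c m \<noteq> 0"
  by (auto simp: A1_def B1_def multiplier_def)

lemma A1_L2_even: "c \<in> L2_even k \<Longrightarrow> A1 k n c \<in> L2_even k"
  unfolding L2_even_iff using A1_L2 A1_even[of c k n] by (auto dest!: A1_supp)

lemma D1_L2_even:
  assumes n: "n \<ge> 1" and c: "c \<in> L2_even k"
  shows "D1 k n c \<in> L2_even k"
proof -
  have c': "c \<in> L2" "\<forall>m. c (- m) = c m" "even_supp k c" using c by (auto simp: L2_even_iff)
  have "\<forall>m. D1 k n c (- m) = D1 k n c m"
    unfolding D1_def o_def by (intro cos_mult1_even B1_even c'(2))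
  moreover have "odd_supp k (B1 k n (cos_mult1 k c))"
    using cos_mult1_even_supp[OF c'(3)] by (auto dest!: B1_supp)
  then have "even_supp k (D1 k n c)"
    unfolding D1_def o_def by (rule cos_mult1_odd_supp)
  moreover have "D1 k n c \<in> L2" using c'(1) by (simp add: D1_def cos_mult1_L2 B1_L2[OF n])
  ultimately show ?thesis by (simp add: L2_even_iff)
qed

lemma cos_mult1_real: "c \<in> real_dist1 \<Longrightarrow> cos_mult1 k c \<in> real_dist1"
  unfolding real_dist1_def
proof (intro CollectI allI)
  fix m assume "c \<in> {c. \<forall>m. c (- m) = cnj (c m)}"
  then have "c (- (m + int k)) = cnj (c (m + int k))" "c (- (m - int k)) = cnj (c (m - int k))" by blast+
  then show "cos_mult1 k c (- m) = cnj (cos_mult1 k c m)" by (simp add: cos_mult1_def add.commute)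
qed

lemma A1_real: "c \<in> real_dist1 \<Longrightarrow> A1 k n c \<in> real_dist1"
  and B1_real: "c \<in> real_dist1 \<Longrightarrow> B1 k n c \<in> real_dist1"
  by (simp_all add: real_dist1_def A1_def B1_def multiplier_def)

text \<open>Evenness, support and reality pass from \<open>D1\<close> to its square root through
  \<open>root_invariant\<close>.\<close>

lemma sqrt_D1:
  assumes n: "n \<ge> 1"
  shows "positive_op (sqrt_op (D1 k n))"
    and sqrt_D1_sqrt: "c \<in> L2 \<Longrightarrow> sqrt_op (D1 k n) (sqrt_op (D1 k n) c) = D1 k n c"
    and sqrt_D1_even: "c \<in> L2_even k \<Longrightarrow> sqrt_op (D1 k n) c \<in> L2_even k"
    and sqrt_D1_real: "c \<in> L2 \<Longrightarrow> c \<in> real_dist1 \<Longrightarrow> sqrt_op (D1 k n) c \<in> real_dist1"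
proof -
  interpret sqrt_setting L2 L2_norm L2_inner "D1 k n" "(1 + (real k)\<^sup>2) / (real n)\<^sup>2"
    by (rule sqrt_setting_D1[OF n])
  have eq: "sqrt_op (D1 k n) = root"
    unfolding sqrt_op_def
  proof (rule the_equality)
    show "positive_op root \<and> (\<forall>c\<in>L2. root (root c) = D1 k n c) \<and> (\<forall>c. c \<notin> L2 \<longrightarrow> root c = 0)"
      using root_positive root_root by (simp add: positive_op_iff root_def)
    show "S = root" if "positive_op S \<and> (\<forall>c\<in>L2. S (S c) = D1 k n c) \<and> (\<forall>c. c \<notin> L2 \<longrightarrow> S c = 0)" for S
      using root_unique that by (simp add: positive_op_iff)
  qed
  show "positive_op (sqrt_op (D1 k n))" unfolding eq positive_op_iff by (rule root_positive)
  show "c \<in> L2 \<Longrightarrow> sqrt_op (D1 k n) (sqrt_op (D1 k n) c) = D1 k n c" unfolding eq by (rule root_root)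
  show "sqrt_op (D1 k n) c \<in> L2_even k" if c: "c \<in> L2_even k"
    unfolding eq
  proof (rule root_invariant[OF _ _ _ _ _ _ c])
    show "L2_even k \<subseteq> L2" by (auto simp: L2_even_iff)
    show "0 \<in> L2_even k" by (simp add: L2_even_iff)
    show "u + v \<in> L2_even k" if "u \<in> L2_even k" "v \<in> L2_even k" for u v
    proof -
      have "u m \<noteq> 0 \<or> v m \<noteq> 0" if "(u + v) m \<noteq> 0" for m using that by auto
      then show ?thesis using that unfolding L2_even_iff by (metis L2.V_add plus_fun_apply)
    qed
    show "of_real r *\<^sub>C u \<in> L2_even k" if "u \<in> L2_even k" for r u
    proof -
      have "(of_real r *\<^sub>C u) m = of_real r * u m" for m by (simp add: scaleC_fun_def scaleC_complex_def)
      then show ?thesis using that unfolding L2_even_iff by (metis L2.V_scale mult_zero_right)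
    qed
    show "D1 k n u \<in> L2_even k" if "u \<in> L2_even k" for u by (rule D1_L2_even[OF n that])
    fix x v assume x: "\<forall>M::nat. x M \<in> L2_even k" and v: "v \<in> L2" and lim: "(\<lambda>M. L2_norm (x M - v)) \<longlonglongrightarrow> 0"
    have "\<forall>M. x M \<in> L2" using x by (simp add: L2_even_iff)
    note lc = L2_lim_coord[OF this v lim]
    have "v (- m) = v m" for m
    proof -
      have "x M (- m) = x M m" for M using x by (simp add: L2_even_iff)
      then show ?thesis using LIMSEQ_unique[OF lc[of "- m"]] lc[of m] by simp
    qed
    moreover have "\<exists>j. even j \<and> m = int k * j" if "v m \<noteq> 0" for m
    proof (rule ccontr)
      assume "\<not> ?thesis"
      then have "x M m = 0" for M using x unfolding L2_even_iff by blast
      then have "v m = 0" using LIMSEQ_unique[OF lc[of m]] by simp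
      then show False using that by simp
    qed
    ultimately show "v \<in> L2_even k" using v by (simp add: L2_even_iff)
  qed
  show "sqrt_op (D1 k n) c \<in> real_dist1" if c: "c \<in> L2" "c \<in> real_dist1"
  proof -
    have "c \<in> L2 \<inter> real_dist1" using c by simp
    then have "root c \<in> L2 \<inter> real_dist1"
    proof (rule root_invariant[rotated -1])
      show "D1 k n u \<in> L2 \<inter> real_dist1" if "u \<in> L2 \<inter> real_dist1" for u
        using that maps by (simp add: D1_def cos_mult1_real B1_real)
      show "u + v \<in> L2 \<inter> real_dist1" if "u \<in> L2 \<inter> real_dist1" "v \<in> L2 \<inter> real_dist1" for u v
        using that by (simp add: real_dist1_def)
      show "of_real r *\<^sub>C u \<in> L2 \<inter> real_dist1" if "u \<in> L2 \<inter> real_dist1" for r u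
        using that by (simp add: real_dist1_def) (simp add: scaleC_fun_def scaleC_complex_def)
      fix x v assume x: "\<forall>M::nat. x M \<in> L2 \<inter> real_dist1" and v: "v \<in> L2" and lim: "(\<lambda>M. L2_norm (x M - v)) \<longlonglongrightarrow> 0"
      have "\<forall>M. x M \<in> L2" using x by simp
      note lc = L2_lim_coord[OF this v lim]
      have "v (- m) = cnj (v m)" for m
      proof -
        have "x M (- m) = cnj (x M m)" for M using x by (simp add: real_dist1_def)
        then show ?thesis using LIMSEQ_unique[OF lc[of "- m"]] tendsto_cnj[OF lc[of m]] by simp
      qed
      then show "v \<in> L2 \<inter> real_dist1" using v by (simp add: real_dist1_def)
    qed (auto simp: real_dist1_def)
    then show ?thesis by (simp add: eq)
  qed
qed

section \<open>Real eigenfunctions\<close>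

lemma line_summable:
  assumes c: "c \<in> L2"
  shows "(\<lambda>m. if snd m = l then (cmod (c (fst m)))\<^sup>2 else 0) summable_on (UNIV :: (int \<times> int) set)"
proof -
  have inj: "inj (\<lambda>m1::int. (m1, l))" by (auto simp: inj_on_def)
  have "((\<lambda>m. (cmod (c (fst m)))\<^sup>2) \<circ> (\<lambda>m1. (m1, l))) summable_on UNIV" using c by (simp add: L2_def o_def)
  then have "(\<lambda>m. (cmod (c (fst m)))\<^sup>2) summable_on range (\<lambda>m1. (m1, l))"
    by (simp only: summable_on_reindex[OF inj])
  moreover have "m \<in> range (\<lambda>m1. (m1, l)) \<longleftrightarrow> snd m = l" for m by (cases m) auto
  ultimately show ?thesis
    by (subst summable_on_cong_neutral[where T = "range (\<lambda>m1. (m1, l))" and g = "\<lambda>m. (cmod (c (fst m)))\<^sup>2"]) auto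
qed

text \<open>A ground state is known only to be square summable, which places the resulting state at
  order 0, with exponents -1 and 0; hence \<open>\<sigma> \<le> 0\<close>.\<close>

lemma tensor_wsp:
  assumes c: "c \<in> L2" and g: "\<forall>l. cmod (g l) \<le> 1 \<and> (\<bar>l\<bar> \<noteq> int n \<longrightarrow> g l = 0)" and \<sigma>: "\<sigma> \<le> 0"
  shows "c \<otimes>\<^sub>D g \<in> wsp (sob \<sigma>)"
  unfolding wsp_def mem_Collect_eq
proof (rule summable_on_comparison_test)
  let ?f = "\<lambda>l m. if snd m = l then (cmod (c (fst m)))\<^sup>2 else 0 :: real"
  show "(\<lambda>m. ?f (int n) m + ?f (- int n) m) summable_on UNIV"
    using line_summable[OF c] by (intro summable_on_add)
  fix m :: "int \<times> int"
  show "0 \<le> sob \<sigma> m * (cmod ((c \<otimes>\<^sub>D g) m))\<^sup>2" by (simp add: sob_def)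
  show "sob \<sigma> m * (cmod ((c \<otimes>\<^sub>D g) m))\<^sup>2 \<le> ?f (int n) m + ?f (- int n) m"
  proof (cases "\<bar>snd m\<bar> = int n")
    case False
    then have "(c \<otimes>\<^sub>D g) m = 0" using g by (simp add: tensor_def split_beta)
    then show ?thesis by simp
  next
    case True
    have "(1 + msq m) powr \<sigma> \<le> (1 + msq m) powr 0" using \<sigma> msq_nonneg[of m] by (intro powr_mono) auto
    then have s: "sob \<sigma> m \<le> 1" using msq_nonneg[of m] by (simp add: sob_def)
    have "cmod ((c \<otimes>\<^sub>D g) m) \<le> cmod (c (fst m)) * 1"
      unfolding tensor_def split_beta norm_mult using g by (intro mult_left_mono) auto
    then have "(cmod ((c \<otimes>\<^sub>D g) m))\<^sup>2 \<le> (cmod (c (fst m)))\<^sup>2" by (simp add: power_mono)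
    then have "sob \<sigma> m * (cmod ((c \<otimes>\<^sub>D g) m))\<^sup>2 \<le> 1 * (cmod (c (fst m)))\<^sup>2"
      using s by (intro mult_mono) auto
    moreover have "(cmod (c (fst m)))\<^sup>2 \<le> ?f (int n) m + ?f (- int n) m" using True by (cases "snd m \<ge> 0") auto
    ultimately show ?thesis by simp
  qed
qed

lemma tensor_block:
  assumes k: "k > 0" and n: "n \<ge> 1" and h: "h \<in> L2" "\<forall>m. h (- m) = h m" "odd_supp k h" and f: "f \<in> L2_even k"
  shows "(h \<otimes>\<^sub>D fourier (\<lambda>x. sin (real n * x)), f \<otimes>\<^sub>D fourier (\<lambda>x. cos (real n * x))) \<in> block 0 k n"
proof -
  let ?u = "(h \<otimes>\<^sub>D fourier (\<lambda>x. sin (real n * x)), f \<otimes>\<^sub>D fourier (\<lambda>x. cos (real n * x)))"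
  have f': "f \<in> L2" "\<forall>m. f (- m) = f m" "even_supp k f" using f by (auto simp: L2_even_iff)
  have k0: "int k \<noteq> 0" using k by simp
  have "?u \<in> Xall 0"
    unfolding Xall_def mem_Times_iff fst_conv snd_conv
    using h(1) f'(1) by (intro conjI tensor_wsp[where n = n]) (auto simp: fourier_cos fourier_sin)
  moreover have "sym k ?u"
    unfolding sym_def fst_conv snd_conv tensor_def prod.case split_beta
  proof (intro conjI allI impI)
    show "h 0 * fourier (\<lambda>x. sin (real n * x)) 0 = 0" using n by (simp add: fourier_sin)
  next
    fix m :: "int \<times> int" assume "\<not> int k dvd fst m"
    then have "\<not> (\<exists>j. P j \<and> fst m = int k * j)" for P by auto
    then have "h (fst m) = 0" "f (fst m) = 0" using h(3) f'(3) by blast+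
    then show "h (fst m) * fourier (\<lambda>x. sin (real n * x)) (snd m) = 0"
      "f (fst m) * fourier (\<lambda>x. cos (real n * x)) (snd m) = 0" by simp_all
  next
    fix j l
    have "h (int k * j) = - sg j * h (int k * j)"
    proof (cases "h (int k * j) = 0")
      case False
      then obtain i where "odd i" "int k * j = int k * i" using h(3) by blast
      then have "odd j" using k0 by simp
      then show ?thesis by (simp add: sg_def)
    qed simp
    then have "h (- (int k * j)) = - sg j * h (int k * j)" using h(2) by simp
    then show "h (- (int k * j)) * fourier (\<lambda>x. sin (real n * x)) l
        = - sg j * (h (int k * j) * fourier (\<lambda>x. sin (real n * x)) l)"
      by (simp only: mult.assoc)
    have "f (int k * j) = sg j * f (int k * j)"
    proof (cases "f (int k * j) = 0")
      case False
      then obtain i where "even i" "int k * j = int k * i" using f'(3) by blast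
      then have "even j" using k0 by simp
      then show ?thesis by (simp add: sg_def)
    qed simp
    then have "f (- (int k * j)) = sg j * f (int k * j)" using f'(2) by simp
    then show "f (- (int k * j)) * fourier (\<lambda>x. cos (real n * x)) l
        = sg j * (f (int k * j) * fourier (\<lambda>x. cos (real n * x)) l)"
      by (simp only: mult.assoc)
  next
    fix m l
    show "h m * fourier (\<lambda>x. sin (real n * x)) (- l) = - (h m * fourier (\<lambda>x. sin (real n * x)) l)"
      using n by (auto simp: fourier_sin)
    show "f m * fourier (\<lambda>x. cos (real n * x)) (- l) = f m * fourier (\<lambda>x. cos (real n * x)) l"
      by (auto simp: fourier_cos)
  qed
  ultimately have "?u \<in> Xsym 0 k" by (simp add: Xsym_iff[OF k])
  then show ?thesis by (auto simp: block_def)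
qed

lemma fourier_derivative:
  "- \<i> * of_int l * fourier (\<lambda>x. cos (real n * x)) l = of_nat n * fourier (\<lambda>x. sin (real n * x)) l"
  "- \<i> * of_int l * fourier (\<lambda>x. sin (real n * x)) l = - of_nat n * fourier (\<lambda>x. cos (real n * x)) l"
  by (auto simp: fourier_cos fourier_sin complex_eq_iff)

text \<open>Reduces the operator on a block to \<open>A1\<close>, \<open>B1\<close> and
  \<open>cos_mult1\<close> in the first variable; the derivative in x2 exchanges sine and
  cosine.\<close>

lemma L_op_tensor:
  fixes h f n
  defines "S \<equiv> fourier (\<lambda>x. sin (real n * x))" and "C \<equiv> fourier (\<lambda>x. cos (real n * x))"
  shows "L_op k (h \<otimes>\<^sub>D S, f \<otimes>\<^sub>D C)
    = ((of_real (real n * real k) *\<^sub>C cos_mult1 k (A1 k n f)) \<otimes>\<^sub>D S,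
       (- of_real (real n * real k) *\<^sub>C cos_mult1 k (B1 k n h)) \<otimes>\<^sub>D C)"
proof -
  have supp: "S l = 0" "C l = 0" if "\<bar>l\<bar> \<noteq> int n" for l using that by (auto simp: S_def C_def fourier_cos fourier_sin)
  have ab: "asym k (m, l) = asym k (m, int n) \<and> bsym k (m, l) = bsym k (m, int n)" if "\<bar>l\<bar> = int n" for m l
  proof -
    have "l = int n \<or> l = - int n" using that by linarith
    then show ?thesis using asym_neg(2)[of k m "int n"] bsym_neg(2)[of k m "int n"] by auto
  qed
  show ?thesis
  proof (rule prod_eqI; rule ext)
    fix m :: "int \<times> int"
    obtain m1 l where m: "m = (m1, l)" by (cases m)
    define x where "x = cos_mult1 k (A1 k n f) m1"
    define y where "y = cos_mult1 k (B1 k n h) m1"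
    have "fst (L_op k (h \<otimes>\<^sub>D S, f \<otimes>\<^sub>D C)) (m1, l) = of_nat k * x * (- \<i> * of_int l * C l)"
    proof (cases "\<bar>l\<bar> = int n")
      case True
      show ?thesis
        unfolding L_op_coeff x_def cos_mult1_def A1_asym multiplier_def tensor_def snd_conv prod.case
          conjunct1[OF ab[OF True]]
        by (simp add: field_simps)
    qed (simp add: L_op_coeff tensor_def supp)
    also have "\<dots> = of_nat k * x * (of_nat n * S l)" unfolding C_def S_def fourier_derivative(1) ..
    finally show "fst (L_op k (h \<otimes>\<^sub>D S, f \<otimes>\<^sub>D C)) m = fst ((of_real (real n * real k) *\<^sub>C cos_mult1 k (A1 k n f)) \<otimes>\<^sub>D S,
       (- of_real (real n * real k) *\<^sub>C cos_mult1 k (B1 k n h)) \<otimes>\<^sub>D C) m"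
      by (simp add: m x_def tensor_def scaleC_fun_def scaleC_complex_def mult_ac)
    have "snd (L_op k (h \<otimes>\<^sub>D S, f \<otimes>\<^sub>D C)) (m1, l) = of_nat k * y * (- \<i> * of_int l * S l)"
    proof (cases "\<bar>l\<bar> = int n")
      case True
      show ?thesis
        unfolding L_op_coeff y_def cos_mult1_def B1_bsym multiplier_def tensor_def fst_conv prod.case
          conjunct2[OF ab[OF True]]
        by (simp add: field_simps)
    qed (simp add: L_op_coeff tensor_def supp)
    also have "\<dots> = of_nat k * y * (- of_nat n * C l)" unfolding C_def S_def fourier_derivative(2) ..
    finally show "snd (L_op k (h \<otimes>\<^sub>D S, f \<otimes>\<^sub>D C)) m = snd ((of_real (real n * real k) *\<^sub>C cos_mult1 k (A1 k n f)) \<otimes>\<^sub>D S,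
       (- of_real (real n * real k) *\<^sub>C cos_mult1 k (B1 k n h)) \<otimes>\<^sub>D C) m"
      by (simp add: m y_def tensor_def scaleC_fun_def scaleC_complex_def mult_ac)
  qed
qed

text \<open>\<open>real_eigenfunction\<close> with the rate as a parameter, because the rate
  belonging to a ground state is identified with \<open>lam\<close> only afterwards.\<close>

definition growing_state :: "nat \<Rightarrow> nat \<Rightarrow> real \<Rightarrow> dist1 \<Rightarrow> state" where
  "growing_state k n l f = ((of_real (real n * real k / l) *\<^sub>C cos_mult1 k (A1 k n f))
      \<otimes>\<^sub>D fourier (\<lambda>x. sin (real n * x)), f \<otimes>\<^sub>D fourier (\<lambda>x. cos (real n * x)))"

lemma growing_state_eigen:
  assumes l: "l \<noteq> 0" and f: "D1 k n (A1 k n f) = of_real (- ((l / (real n * real k))\<^sup>2)) *\<^sub>C f" and nk: "n \<ge> 1" "k > 0"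
  shows "L_op k (growing_state k n l f) = of_real l *\<^sub>C growing_state k n l f"
proof -
  let ?S = "fourier (\<lambda>x. sin (real n * x))" and ?C = "fourier (\<lambda>x. cos (real n * x))"
  define h where "h = of_real (real n * real k / l) *\<^sub>C cos_mult1 k (A1 k n f)"
  have scale: "(z *\<^sub>C a) \<otimes>\<^sub>D b = z *\<^sub>C (a \<otimes>\<^sub>D b)" for z a b
    by (auto simp: tensor_def fun_eq_iff scaleC_fun_def scaleC_complex_def)
  have "of_real (real n * real k) *\<^sub>C cos_mult1 k (A1 k n f) = of_real l *\<^sub>C h"
    using l unfolding h_def scaleC_scaleC of_real_mult[symmetric] by simp
  moreover have "- of_real (real n * real k) *\<^sub>C cos_mult1 k (B1 k n h) = of_real l *\<^sub>C f"
  proof -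
    have "cos_mult1 k (B1 k n h) = of_real (real n * real k / l) *\<^sub>C D1 k n (A1 k n f)"
      unfolding h_def D1_def o_def B1_def multiplier_scale cos_mult1_scale ..
    then have "- of_real (real n * real k) *\<^sub>C cos_mult1 k (B1 k n h)
        = of_real (- (real n * real k) * (real n * real k / l) * (- ((l / (real n * real k))\<^sup>2))) *\<^sub>C f"
      by (simp only: f scaleC_scaleC of_real_mult of_real_minus mult.assoc)
    also have "- (real n * real k) * (real n * real k / l) * (- ((l / (real n * real k))\<^sup>2)) = l"
      using l nk by (simp add: power2_eq_square)
    finally show ?thesis .
  qed
  ultimately show ?thesis
    unfolding growing_state_def h_def[symmetric] L_op_tensor by (simp add: scale scaleC_prod_def)
qed

lemma growing_state_neq_0:
  assumes "f \<noteq> 0" "n \<ge> 1"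
  shows "growing_state k n l f \<noteq> 0"
proof -
  obtain m where "f m \<noteq> 0" using assms(1) by (auto simp: fun_eq_iff)
  then have "snd (growing_state k n l f) (m, int n) \<noteq> 0"
    using assms(2) by (simp add: growing_state_def tensor_def fourier_cos)
  then show ?thesis by auto
qed

lemma growing_state_real:
  assumes f: "f \<in> real_dist1"
  shows "growing_state k n l f \<in> real_states"
proof -
  define h where "h = of_real (real n * real k / l) *\<^sub>C cos_mult1 k (A1 k n f)"
  have "cos_mult1 k (A1 k n f) \<in> real_dist1" by (intro cos_mult1_real A1_real f)
  then have h: "h (- m) = cnj (h m)" for m by (simp add: h_def real_dist1_def scaleC_fun_def scaleC_complex_def)
  have f': "f (- m) = cnj (f m)" for m using f by (simp add: real_dist1_def)
  show ?thesis
    unfolding growing_state_def h_def[symmetric]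
    by (auto simp: real_states_def tensor_def h f' fourier_sin fourier_cos)
qed

lemma growing_state_block:
  assumes k: "k > 0" and n: "n \<ge> 1" and f: "f \<in> L2_even k"
  shows "growing_state k n l f \<in> block 0 k n"
proof -
  have A: "A1 k n f \<in> L2" "\<forall>m. A1 k n f (- m) = A1 k n f m" "even_supp k (A1 k n f)"
    using A1_L2_even[OF f] by (auto simp: L2_even_iff)
  show ?thesis
    unfolding growing_state_def
  proof (rule tensor_block[OF k n _ _ _ f])
    show "of_real (real n * real k / l) *\<^sub>C cos_mult1 k (A1 k n f) \<in> L2"
      by (intro L2.V_scale cos_mult1_L2 A)
    show "\<forall>m. (of_real (real n * real k / l) *\<^sub>C cos_mult1 k (A1 k n f)) (- m) = (of_real (real n * real k / l) *\<^sub>C cos_mult1 k (A1 k n f)) m"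
      using cos_mult1_even[OF A(2), of k] by (simp add: scaleC_fun_def)
    show "odd_supp k (of_real (real n * real k / l) *\<^sub>C cos_mult1 k (A1 k n f))"
      using cos_mult1_even_supp[OF A(3)] by (simp add: scaleC_fun_def scaleC_complex_def)
  qed
qed

lemma L2_linear_sqrt:
  assumes "n \<ge> 1"
  shows "linear_on L2 (sqrt_op (D1 k n))" "c \<in> L2 \<Longrightarrow> sqrt_op (D1 k n) c \<in> L2"
  using sqrt_D1(1)[OF assms, of k] by (auto simp: positive_op_def bounded_op_def)

section \<open>Ground states and modes determine each other\<close>

context modes
begin

text \<open>\<open>g\<close> is only square summable, so the growing state is compared with the mode
  in the block of order 0. Being a multiple of the mode, it then lies in the spaces of every
  order.\<close>

lemma ground_data:
  assumes n: "n \<in> {1..<k}" and g: "g \<in> L2_even k" "g \<noteq> 0" and \<nu>: "\<nu> > 0"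
    and Kg: "K1 k n g = of_real (- \<nu>) *\<^sub>C g"
  defines "f \<equiv> sqrt_op (D1 k n) g"
  shows "\<nu> = (lm n / (real n * real k))\<^sup>2" "growing_state k n (lm n) f \<in> cspan {vec n 1}" "f \<noteq> 0"
proof -
  have n1: "n \<ge> 1" using n by simp
  let ?S = "sqrt_op (D1 k n)"
  interpret M0: modes k 0 lm ph ps using k mode by unfold_locales auto
  have gL: "g \<in> L2" using g(1) by (simp add: L2_even_iff)
  have fe: "f \<in> L2_even k" unfolding f_def by (rule sqrt_D1_even[OF n1 g(1)])
  then have fL: "A1 k n f \<in> L2" using A1_L2 by (simp add: L2_even_iff)
  have SAf: "?S (A1 k n f) = of_real (- \<nu>) *\<^sub>C g" using Kg by (simp add: K1_def f_def)
  show f0: "f \<noteq> 0"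
  proof
    assume "f = 0"
    then have "A1 k n f = 0" by (simp add: A1_def multiplier_def fun_eq_iff)
    then have "of_real (- \<nu>) *\<^sub>C g = 0"
      using SAf linear_on_0[OF L2_linear_sqrt(1)[OF n1] L2.subspace, of k] by simp
    then show False using g(2) \<nu> by simp
  qed
  have DAf: "D1 k n (A1 k n f) = of_real (- \<nu>) *\<^sub>C f"
  proof -
    have "D1 k n (A1 k n f) = ?S (of_real (- \<nu>) *\<^sub>C g)" unfolding SAf[symmetric] by (rule sqrt_D1_sqrt[OF n1 fL, symmetric])
    also have "\<dots> = of_real (- \<nu>) *\<^sub>C f"
      using L2_linear_sqrt(1)[OF n1, of k] gL unfolding f_def linear_on_def by blast
    finally show ?thesis .
  qed
  define l where "l = real n * real k * sqrt \<nu>"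
  have l: "l > 0" using n1 k \<nu> by (simp add: l_def)
  have \<nu>l: "\<nu> = (l / (real n * real k))\<^sup>2" using n1 k \<nu> by (simp add: l_def)
  let ?u = "growing_state k n l f"
  have Lu: "L_op k ?u = of_real l *\<^sub>C ?u"
    using growing_state_eigen[of l k n f] l DAf n1 k \<nu>l by simp
  have ub: "?u \<in> block 0 k n" by (rule growing_state_block[OF k n1 fe])
  interpret operator "block 0 k n" "Xnorm 0" "L_op k" using n1 by (intro operator_block[OF k])
  have "eigenvalue (block 0 k n) (L_op k) (of_real l)"
    using Lu ub growing_state_neq_0[OF f0 n1] unfolding eigenvalue_def eigenspace_def by blast
  then have "of_real l \<in> spectrum (Xnorm 0) (block 0 k n) (L_op k)"
    using eigenvalue_not_regular by (simp add: spectrum_regular)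
  then have ll: "l = lm n" using M0.block_spectrum[OF n, of "of_real l"] l by simp
  show "\<nu> = (lm n / (real n * real k))\<^sup>2" using \<nu>l ll by simp
  have "?u \<in> eigenspace (block 0 k n) (L_op k) (of_real (lam k n))"
    using ub Lu ll lam_eq[OF n] by (simp add: eigenspace_def)
  then show "growing_state k n (lm n) f \<in> cspan {vec n 1}"
    unfolding M0.block_eigenspace[OF n] ll .
qed

text \<open>Converse of \<open>ground_data\<close>. From D A f = - \<nu> f the choice g = - (1 /
  \<nu>) D^(1/2) A f satisfies D^(1/2) g = f, which recovers a ground state without inverting the
  square root.\<close>

lemma mode_ground:
  assumes n: "n \<in> {1..<k}"
  defines "\<nu> \<equiv> (lm n / (real n * real k))\<^sup>2"
  shows "\<exists>g. g \<in> L2_even k \<and> g \<noteq> 0 \<and> g \<in> real_dist1 \<and> K1 k n g = of_real (- \<nu>) *\<^sub>C g"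
proof -
  have n1: "n \<ge> 1" using n by simp
  let ?S = "sqrt_op (D1 k n)"
  have \<nu>: "\<nu> > 0" using n1 k lm_pos[OF n] by (simp add: \<nu>_def)
  define f where "f m = complex_of_real (ph n m)" for m
  define h where "h m = complex_of_real (ps n m)" for m
  have "f \<in> sobolev1 0"
  proof (rule sobolev1_line)
    show "(\<lambda>m1. snd (vec n 1) (m1, int n)) = f" by (simp add: vec_def f_def fun_eq_iff)
    show "snd (vec n 1) \<in> wsp (sob 0)" using XallD[OF vec_Xall[OF n]] by blast
  qed
  moreover have "1 + (real_of_int m)\<^sup>2 \<noteq> 0" for m using zero_le_power2[of "real_of_int m"] by linarith
  ultimately have fL: "f \<in> L2" by (simp add: sobolev1_def L2_def)
  then have fe: "f \<in> L2_even k"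
    using mode_even(1)[OF n] ph_supp[OF n] by (simp add: L2_even_iff f_def)
  have fr: "f \<in> real_dist1" by (simp add: real_dist1_def f_def mode_even[OF n])
  have f0: "f \<noteq> 0" using ph_0[OF n] by (auto simp: f_def fun_eq_iff)
  have CA: "cos_mult1 k (A1 k n f) = of_real (lm n / (real n * real k)) *\<^sub>C h"
  proof
    fix m
    have "lm n * ps n m / (real n * real k) = (asym k (m - int k, int n) * ph n (m - int k) + asym k (m + int k, int n) * ph n (m + int k)) / 2"
      unfolding ps_eq[OF n] using n1 k by simp
    from arg_cong[OF this, of complex_of_real]
    show "cos_mult1 k (A1 k n f) m = (of_real (lm n / (real n * real k)) *\<^sub>C h) m"
      by (simp add: cos_mult1_def A1_asym multiplier_def f_def h_def scaleC_fun_def scaleC_complex_def)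
  qed
  have CB: "cos_mult1 k (B1 k n h) = of_real (- (lm n / (real n * real k))) *\<^sub>C f"
  proof
    fix m
    have "- (lm n * ph n m) / (real n * real k) = (bsym k (m - int k, int n) * ps n (m - int k) + bsym k (m + int k, int n) * ps n (m + int k)) / 2"
      unfolding ph_eq[OF n] using n1 k by simp
    from arg_cong[OF this, of complex_of_real]
    show "cos_mult1 k (B1 k n h) m = (of_real (- (lm n / (real n * real k))) *\<^sub>C f) m"
      by (simp add: cos_mult1_def B1_bsym multiplier_def f_def h_def scaleC_fun_def scaleC_complex_def)
  qed
  have "D1 k n (A1 k n f) = of_real (lm n / (real n * real k)) *\<^sub>C cos_mult1 k (B1 k n h)"
    unfolding D1_def o_def CA B1_def multiplier_scale cos_mult1_scale ..
  also have "\<dots> = of_real (- \<nu>) *\<^sub>C f"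
    unfolding CB scaleC_scaleC \<nu>_def by (simp add: power2_eq_square)
  finally have DAf: "D1 k n (A1 k n f) = of_real (- \<nu>) *\<^sub>C f" .
  have Ae: "A1 k n f \<in> L2_even k" by (rule A1_L2_even[OF fe])
  then have AL: "A1 k n f \<in> L2" by (simp add: L2_even_iff)
  define g where "g = of_real (- 1 / \<nu>) *\<^sub>C ?S (A1 k n f)"
  have S_scale: "?S (z *\<^sub>C c) = z *\<^sub>C ?S c" if "c \<in> L2" for z c
    using L2_linear_sqrt(1)[OF n1, of k] that by (simp add: linear_on_def)
  have "?S g = of_real (- 1 / \<nu>) *\<^sub>C D1 k n (A1 k n f)"
    unfolding g_def S_scale[OF L2_linear_sqrt(2)[OF n1 AL]] sqrt_D1_sqrt[OF n1 AL] ..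
  also have "\<dots> = f" using \<nu> unfolding DAf scaleC_scaleC by (simp add: scaleC_one)
  finally have Sg: "?S g = f" .
  have "K1 k n g = of_real (- \<nu>) *\<^sub>C g"
    using \<nu> by (simp add: K1_def Sg) (simp add: g_def scaleC_scaleC scaleC_one)
  moreover have "g \<noteq> 0"
    using Sg f0 linear_on_0[OF L2_linear_sqrt(1)[OF n1] L2.subspace, of k] by auto
  moreover have "g \<in> L2_even k"
  proof -
    have "?S (A1 k n f) \<in> L2_even k" by (rule sqrt_D1_even[OF n1 Ae])
    moreover have "(z *\<^sub>C c) m = z * c m" for z and c :: dist1 and m by (simp add: scaleC_fun_def scaleC_complex_def)
    ultimately show ?thesis unfolding g_def L2_even_iff by (metis L2.V_scale mult_zero_right)
  qed
  moreover have "g \<in> real_dist1"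
    using sqrt_D1_real[OF n1 AL A1_real[OF fr]]
    by (simp add: g_def real_dist1_def scaleC_fun_def scaleC_complex_def)
  ultimately show ?thesis by blast
qed

lemma nu_eq:
  assumes n: "n \<in> {1..<k}"
  shows "nu k n = (lm n / (real n * real k))\<^sup>2"
  unfolding nu_def
proof (rule the_equality)
  obtain g where "g \<in> L2_even k" "g \<noteq> 0" "K1 k n g = of_real (- ((lm n / (real n * real k))\<^sup>2)) *\<^sub>C g"
    using mode_ground[OF n] by blast
  then have "eigenvalue (L2_even k) (K1 k n) (of_real (- ((lm n / (real n * real k))\<^sup>2)))"
    unfolding eigenvalue_def eigenspace_def by blast
  then show "0 < (lm n / (real n * real k))\<^sup>2 \<and> eigenvalue (L2_even k) (K1 k n) (of_real (- ((lm n / (real n * real k))\<^sup>2)))"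
    using n k lm_pos[OF n] by simp
next
  fix \<nu> :: real assume \<nu>: "0 < \<nu> \<and> eigenvalue (L2_even k) (K1 k n) (of_real (- \<nu>))"
  then obtain g where "g \<in> L2_even k" "g \<noteq> 0" "K1 k n g = of_real (- \<nu>) *\<^sub>C g"
    unfolding eigenvalue_def eigenspace_def by blast
  then show "\<nu> = (lm n / (real n * real k))\<^sup>2" using ground_data(1)[OF n] \<nu> by blast
qed

lemma ground_state_ex: "n \<in> {1..<k} \<Longrightarrow> \<exists>g. ground_state k n g"
  unfolding ground_state_def eigenspace_def nu_eq using mode_ground by blast

lemma real_eigenfunction_props:
  assumes n: "n \<in> {1..<k}" and g: "ground_state k n g"
  shows "real_eigenfunction k n g \<in> real_states" "real_eigenfunction k n g \<noteq> 0"
    "real_eigenfunction k n g \<in> cspan {vec n 1}"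
proof -
  let ?f = "sqrt_op (D1 k n) g"
  have n1: "n \<ge> 1" using n by simp
  have eq: "real_eigenfunction k n g = growing_state k n (lm n) ?f"
    by (simp add: real_eigenfunction_def growing_state_def lam_eq[OF n] Let_def)
  have g': "g \<in> L2_even k" "K1 k n g = of_real (- nu k n) *\<^sub>C g" "g \<noteq> 0" "g \<in> real_dist1"
    using g by (auto simp: ground_state_def eigenspace_def)
  have "nu k n > 0" unfolding nu_eq[OF n] using n k lm_pos[OF n] by simp
  note d = ground_data[OF n g'(1,3) this g'(2)]
  show "real_eigenfunction k n g \<in> cspan {vec n 1}" unfolding eq by (rule d(2))
  show "real_eigenfunction k n g \<noteq> 0" unfolding eq by (rule growing_state_neq_0[OF d(3) n1])
  have "g \<in> L2" using g'(1) by (simp add: L2_even_iff)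
  then show "real_eigenfunction k n g \<in> real_states"
    unfolding eq by (intro growing_state_real sqrt_D1_real[OF n1] g')
qed

end

context leading_modes
begin

lemma fastest_growing:
  assumes n: "leading = {n}" and g: "ground_state k n g"
  shows "fastest_growing_eigenfunction (Xsym s k) (L_op k) (of_real (Lam k)) (real_eigenfunction k n g)"
proof -
  have "n \<in> {1..<k}" using n by (auto simp: leading_def)
  note p = real_eigenfunction_props[OF this g]
  have "real_eigenfunction k n g \<in> eigenspace (Xsym s k) (L_op k) (of_real (Lam k))"
    using p(3) by (simp add: n leading_space_eq flip: leading_space_eigenspace)
  then show ?thesis
    using p(2) eigenvalue_le_Lam by (auto simp: fastest_growing_eigenfunction_def)
qed

end

theorem theorem3p11:
  fixes k :: nat and s :: real
  assumes "k \<ge> 2" and "s \<ge> 0"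
  shows
    "spectrum (Xnorm s) (Xsym s k) (L_op k) \<inter> {z. Re z > 0}
        = (\<lambda>n. complex_of_real (lam k n)) ` {1..<k}
     \<and> (\<forall>n\<in>{1..<k}.
          algebraically_simple (Xnorm s) (block s k n) (L_op k) (of_real (lam k n)))
     \<and> (\<exists>B. finite B \<and> cspan B = leading_space s k)
     \<and> gap k > 0
     \<and> (\<exists>r. isolating_radius (Xnorm s) (Xsym s k) (L_op k) (of_real (Lam k)) r)
     \<and> bounded_op (Xnorm s) (Xsym s k) (P_op s k)
     \<and> P_op s k ` Xsym s k = leading_space s k
     \<and> (\<forall>u\<in>Xsym s k. L_op k (P_op s k u) = of_real (Lam k) *\<^sub>C P_op s k u)
     \<and> cdim (leading_space s k) = card {n\<in>{1..k-1}. lam k n = Lam k}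
     \<and> spectrum (Xnorm s) ((\<lambda>u. u - P_op s k u) ` Xsym s k) (L_op k) \<subseteq> {z. Re z \<le> Lam2 k}
     \<and> (\<forall>\<eta>>0. \<exists>C. \<forall>t\<ge>0. \<forall>u\<in>Xsym s k.
          Xnorm s (op_exp (Xnorm s) (Xsym s k) (L_op k) t (u - P_op s k u))
            \<le> C * exp ((Lam2 k + \<eta>) * t) * Xnorm s u)
     \<and> (\<exists>C. \<forall>t\<ge>0. \<forall>u\<in>Xsym s k.
          Xnorm s (op_exp (Xnorm s) (Xsym s k) (L_op k) t u) \<le> C * exp (Lam k * t) * Xnorm s u)
     \<and> (algebraically_simple (Xnorm s) (Xsym s k) (L_op k) (of_real (Lam k))
          \<longleftrightarrow> (\<exists>!n. n \<in> {1..k-1} \<and> lam k n = Lam k))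
     \<and> (\<forall>n\<in>{1..k-1}. lam k n = Lam k \<and> (\<forall>m\<in>{1..k-1}. lam k m = Lam k \<longrightarrow> m = n) \<longrightarrow>
          rdim (leading_space s k \<inter> real_states) = 1
          \<and> (\<exists>g. ground_state k n g)
          \<and> (\<forall>g. ground_state k n g \<longrightarrow>
               real_eigenfunction k n g \<in> real_states
               \<and> fastest_growing_eigenfunction (Xsym s k) (L_op k) (of_real (Lam k))
                   (real_eigenfunction k n g)))"
proof -
  have k: "k > 0" using assms(1) by simp
  have "\<forall>n. \<exists>\<rho> \<phi> \<psi>. n \<in> {1..<k} \<longrightarrow> chain_mode k n \<rho> \<phi> \<psi>"
    using chain_mode_ex by (metis atLeastLessThan_iff)
  then obtain lm ph ps where "\<forall>n. n \<in> {1..<k} \<longrightarrow> chain_mode k n (lm n) (ph n) (ps n)" by metis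
  then interpret leading_modes k s lm ph ps
    using assms k by unfold_locales auto
  have leading_eq: "leading = {n\<in>{1..k-1}. lam k n = Lam k}" by (auto simp: leading_def)
  have "card leading = 1 \<longleftrightarrow> (\<exists>n. leading = {n})" by (simp add: card_1_singleton_iff)
  also have "\<dots> \<longleftrightarrow> (\<exists>!n. n \<in> leading)" by (auto simp: set_eq_iff)
  finally have card_1: "card leading = 1 \<longleftrightarrow> (\<exists>!n. n \<in> {1..k-1} \<and> lam k n = Lam k)"
    unfolding leading_eq by simp
  have eigen: "L_op k (P_op s k u) = of_real (Lam k) *\<^sub>C P_op s k u" if "u \<in> Xsym s k" for u
  proof -
    have "P_op s k u \<in> leading_space s k" using P_op_image that by blast
    then show ?thesis unfolding leading_space_eigenspace eigenspace_def by simp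
  qed
  have unique: "rdim (leading_space s k \<inter> real_states) = 1
      \<and> (\<exists>g. ground_state k n g)
      \<and> (\<forall>g. ground_state k n g \<longrightarrow>
           real_eigenfunction k n g \<in> real_states
           \<and> fastest_growing_eigenfunction (Xsym s k) (L_op k) (of_real (Lam k)) (real_eigenfunction k n g))"
    if n: "n \<in> {1..k-1}" "lam k n = Lam k \<and> (\<forall>m\<in>{1..k-1}. lam k m = Lam k \<longrightarrow> m = n)" for n
  proof -
    have "m \<in> leading \<longleftrightarrow> m = n" for m unfolding leading_eq using n by blast
    then have l: "leading = {n}" by blast
    have nk: "n \<in> {1..<k}" using l by (auto simp: leading_def)
    show ?thesis
    proof (intro conjI allI impI)
      show "rdim (leading_space s k \<inter> real_states) = 1" by (rule leading_space_real[OF l])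
      show "\<exists>g. ground_state k n g" by (rule ground_state_ex[OF nk])
      show "real_eigenfunction k n g \<in> real_states" if "ground_state k n g" for g
        by (rule real_eigenfunction_props(1)[OF nk that])
      show "fastest_growing_eigenfunction (Xsym s k) (L_op k) (of_real (Lam k)) (real_eigenfunction k n g)"
        if "ground_state k n g" for g
        by (rule fastest_growing[OF l that])
    qed
  qed
  have "finite ((\<lambda>n. vec n 1) ` leading)" by (simp add: leading_def)
  then have fin: "\<exists>B. finite B \<and> cspan B = leading_space s k" using leading_space_eq by metis
  have gap: "gap k > 0" using Lam2_less by (simp add: gap_def)
  have simple: "algebraically_simple (Xnorm s) (Xsym s k) (L_op k) (of_real (Lam k))
      \<longleftrightarrow> (\<exists>!n. n \<in> {1..k-1} \<and> lam k n = Lam k)"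
    unfolding leading_simple_iff card_1 ..
  show ?thesis
    by (assumption | rule conjI[OF Xsym_spectrum] conjI[OF fin] conjI[OF gap] conjI[OF leading_isolating]
        conjI[OF P_op_bounded] conjI[OF P_op_image] conjI[OF cdim_leading_space[unfolded leading_eq]]
        conjI[OF rest_spectrum] conjI[OF total_growth] conjI[OF simple] ballI allI impI
        block_simple eigen gap_growth unique conjI)+
qed

end
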